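(* Let $\mathcal L\mathrm{Toda}$ be the Lie algebra spanned by elements $B_{\{p\}},C_{\{p\}}$ ($p\in K$), linear in $p$ (so $\mathcal L\mathrm{Toda}\cong K\oplus K$ as a vector space), with $$[B_{\{p\}},C_{\{q\}}]=-C_{\{\bar\Delta\langle p\rangle q\}},\qquad [B_{\{p\}},B_{\{q\}}]=[C_{\{p\}},C_{\{q\}}]=0,\qquad \bar\Delta=1-T^{-1}.$$ Let $\mathcal L\mathrm{Toda}_{\mathrm{ann}}$ be the span of $B_{\{p\}},C_{\{p\}}$ with $p\in\mathbb C_{\mathbb Z}^{\mathrm{pol}}$, let $\mathbb C_0=\mathbb Cm_0$ be its trivial one-dimensional module, and let $$\mathrm{VToda}=\mathcal U(\mathcal L\mathrm{Toda})\otimes_{\mathcal U(\mathcal L\mathrm{Toda}_{\mathrm{ann}})}\mathbb C_0,\qquad v_0=1\otimes m_0 .$$ Then $\mathrm{VToda}$ is an $H_T$-vertex algebra with vacuum $v_0$, with state-field correspondence such that for $X\in\{B,C\}$ the vertex operator of $X_{\{1/\tau\}}v_0$ is the current $X(\tau)$, i.e. the distribution $F\mapsto X_{\{F\}}$, $F\in K$.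
   Context: $H_T=\mathbb C[T,T^{-1}]$ is the Hopf algebra with $T$ grouplike and antipode $S(T)=T^{-1}$; $\hat H_T=H_T[\partial_\tau]$ with $\partial_\tau$ primitive, $S(\partial_\tau)=-\partial_\tau$. Coproducts are written $\sum h'\otimes h''$; $h\langle p\rangle$ denotes the action of $h$ on $p$. $\mathbb C_{\mathbb Z}^{\mathrm{pol}}=\mathbb C[\tau]$ is the algebra of polynomial functions on $\mathbb Z$ ($\tau$ is the function $n\mapsto n$), $(Tf)(\tau)=f(\tau+1)$, $\partial_\tau=d/d\tau$. $M$ is the multiplicative set generated by $1$ and the elements $\tau+k$, $k\in\mathbb Z$; $K=M^{-1}\mathbb C_{\mathbb Z}^{\mathrm{pol}}$ (rational functions with poles only at integers), an $\hat H_T$-module. $K=\mathbb C_{\mathbb Z}^{\mathrm{pol}}\oplus K_{\mathrm{Sing}}$ where $K_{\mathrm{Sing}}=\bigoplus_{n\in\mathbb Z,k\ge0}\mathbb C\,(\tau+n)^{-k-1}$, and $h\mapsto S(h)\frac1\tau$ is a linear isomorphism $\hat H_T\to K_{\mathrm{Sing}}$. $\mathrm{Tr}\colon K\to\mathbb C$ is the sum of the residues of $F(\tau)d\tau$ at all integers. A $W$-valued distribution on $K$ is a linear map $D\colon K\to W$; $D_{\mathrm{Hol}}$ (resp. $D_{\mathrm{Sing}}$) agrees with $D$ on $K_{\mathrm{Sing}}$ and vanishes on $\mathbb C_{\mathbb Z}^{\mathrm{pol}}$ (resp. agrees with $D$ on $\mathbb C_{\mathbb Z}^{\mathrm{pol}}$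 and vanishes on $K_{\mathrm{Sing}}$). For $h\in\hat H_T$, $(h_KD)(F)=D(S(h)F)$. $D$ has rational singularities with kernel $\sum_iw_i\otimes F_i\in W\otimes K_{\mathrm{Sing}}$ if $D(G)=\sum_iw_i\mathrm{Tr}(F_iG)$ for all $G\in\mathbb C_{\mathbb Z}^{\mathrm{pol}}$. A field on $V$ is an $\mathrm{End}(V)$-valued distribution $f(\tau)$ such that for each $v\in V$ the distribution $G\mapsto f(G)v$ has rational singularities. Fields $f,g$ are mutually rational if there is $F\in M$ such that the commutator distribution on $K\otimes K$, $G\otimes G'\mapsto f(G)g(G')-g(G')f(G)$, vanishes on $F(\tau_1-\tau_2)\cdot(K\otimes K)$. An $H_T$-vertex algebra is a vector space $V$ with $1_V\in V$ and a linear map $f\mapsto Y(f,\tau)$ from $V$ to fields on $V$ such that: (Vacuum) $Y(1_V)(F)=\mathrm{Tr}(F)\,\mathrm{id}_V$; $Y(f)(G)1_V=0$ for $G\in\mathbb C_{\mathbb Z}^{\mathrm{pol}}$; $Y(f)(\frac1\tau)1_V=f$. Put $h_Vf=Y(f)(S(h)\frac1\tau)1_V$ for $h\in\hat H_T$, $f\in V$. ($H_T$-covariance) $h_KY(f,\tau)=Y(h_Vf,\tau)$ for $h\in H_T$. (Skew-symmetry) $Y(f,\tau)g=\mathcal R_V(\tau)Y^S(g,\tau)f$ for $f,g\in V$. Here $Y^S(g,\tau)f$ is obtained by substituting $\tau\mapsto-\tau$ in the kernel: it is the distribution $D(F)=-Y(g)(F(-\tau))f$, and, if $\sum_iv_i\otimes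 F_i$ is the singular kernel of $D$, then $(\mathcal R_V(\tau)D)(G)=\sum_i R(v_i)(F_iG)+(R\cdot D_{\mathrm{Hol}})(G)$ for $G\in K$, where $R(v)\colon K\to V$ vanishes on $\mathbb C_{\mathbb Z}^{\mathrm{pol}}$ with $R(v)(S(h)\frac1\tau)=h_Vv$ for $h\in\hat H_T$, and $R\cdot D_{\mathrm{Hol}}$ vanishes on $\mathbb C_{\mathbb Z}^{\mathrm{pol}}$ with $(R\cdot D_{\mathrm{Hol}})(S(h)\frac1\tau)=\sum h'_VD(S(h'')\frac1\tau)$. (Mutual rationality) $Y(f,\tau)$ and $Y(g,\tau)$ are mutually rational for all $f,g\in V$. *)

theory Defs
  imports
    "HOL-Complex_Analysis.Complex_Residues"
    "HOL-Computational_Algebra.Fraction_Field"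
    "HOL-Computational_Algebra.Polynomial"
    "HOL-Library.Poly_Mapping"
    "HOL-Library.Product_Plus"
begin

section \<open>Complex vector spaces, algebras and Lie algebras\<close>

class scaleC =
  fixes scaleC :: "complex \<Rightarrow> 'a \<Rightarrow> 'a"  (infixr \<open>*\<^sub>C\<close> 75)

class complex_vector = scaleC + ab_group_add +
  assumes scaleC_add_right: "c *\<^sub>C (x + y) = c *\<^sub>C x + c *\<^sub>C y"
    and scaleC_add_left: "(c + d) *\<^sub>C x = c *\<^sub>C x + d *\<^sub>C x"
    and scaleC_scaleC: "c *\<^sub>C d *\<^sub>C x = (c * d) *\<^sub>C x"
    and scaleC_one: "1 *\<^sub>C x = x"

class complex_algebra_1 = complex_vector + ring_1 +
  assumes scaleC_mult_left: "(c *\<^sub>C x) * y = c *\<^sub>C (x * y)"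
    and scaleC_mult_right: "x * (c *\<^sub>C y) = c *\<^sub>C (x * y)"

class complex_lie_algebra = complex_vector +
  fixes lie :: "'a \<Rightarrow> 'a \<Rightarrow> 'a"
  assumes lie_add_left: "lie (x + y) z = lie x z + lie y z"
    and lie_add_right: "lie x (y + z) = lie x y + lie x z"
    and lie_scaleC_left: "lie (c *\<^sub>C x) y = c *\<^sub>C lie x y"
    and lie_scaleC_right: "lie x (c *\<^sub>C y) = c *\<^sub>C lie x y"
    and lie_self: "lie x x = 0"
    and jacobi: "lie x (lie y z) + lie y (lie z x) + lie z (lie x y) = 0"

global_interpretation cvec: vector_space "scaleC :: complex \<Rightarrow> 'a \<Rightarrow> 'a :: complex_vector"
  by unfold_locales (simp_all add: scaleC_add_right scaleC_add_left scaleC_scaleC scaleC_one)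

abbreviation cspan :: "'a::complex_vector set \<Rightarrow> 'a set" where
  "cspan \<equiv> module.span scaleC"

abbreviation clinear :: "('a::complex_vector \<Rightarrow> 'b::complex_vector) \<Rightarrow> bool" where
  "clinear \<equiv> Vector_Spaces.linear scaleC scaleC"

lemma clinear_iff:
  "clinear f \<longleftrightarrow> (\<forall>x y. f (x + y) = f x + f y) \<and> (\<forall>c x. f (c *\<^sub>C x) = c *\<^sub>C f x)"
  by (auto simp: Vector_Spaces.linear_iff cvec.vector_space_axioms)

instantiation complex :: complex_algebra_1
begin
definition scaleC_complex :: "complex \<Rightarrow> complex \<Rightarrow> complex" where
  "scaleC_complex = (*)"
instance by standard (simp_all add: scaleC_complex_def algebra_simps)
end

instantiation poly_mapping :: (type, complex_vector) complex_vector
begin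
lift_definition scaleC_poly_mapping :: "complex \<Rightarrow> ('a \<Rightarrow>\<^sub>0 'b) \<Rightarrow> ('a \<Rightarrow>\<^sub>0 'b)"
  is "\<lambda>c f k. c *\<^sub>C f k"
proof -
  fix c :: complex and f :: "'a \<Rightarrow> 'b" assume "finite {k. f k \<noteq> 0}"
  then show "finite {k. c *\<^sub>C f k \<noteq> 0}" by (rule rev_finite_subset) auto
qed
instance
  by standard (transfer; simp add: fun_eq_iff scaleC_add_right scaleC_add_left scaleC_scaleC scaleC_one)+
end

lemma lookup_scaleC: "Poly_Mapping.lookup (c *\<^sub>C f) k = c *\<^sub>C Poly_Mapping.lookup f k"
  by transfer simp

lemma poly_mapping_single_induct [case_names zero single add]:
  assumes "P 0" "\<And>k v. P (Poly_Mapping.single k v)" "\<And>f g. P f \<Longrightarrow> P g \<Longrightarrow> P (f + g)"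
  shows "P (f :: 'a \<Rightarrow>\<^sub>0 'b::comm_monoid_add)"
proof -
  have "P (\<Sum>k\<in>A. Poly_Mapping.single k (Poly_Mapping.lookup f k))" if "finite A" for A
    using that by (induction A rule: finite_induct) (simp_all add: assms)
  moreover have "(\<Sum>k\<in>Poly_Mapping.keys f. Poly_Mapping.single k (Poly_Mapping.lookup f k)) = f"
    by (rule poly_mapping_eqI) (simp add: lookup_sum lookup_single when_def in_keys_iff)
  ultimately show ?thesis by (metis finite_keys)
qed

lemma scaleC_conv_single_mult:
  fixes f :: "'a::monoid_add \<Rightarrow>\<^sub>0 'b::complex_algebra_1"
  shows "c *\<^sub>C f = Poly_Mapping.single 0 (c *\<^sub>C 1) * f"
proof -
  have "c *\<^sub>C f = Poly_Mapping.map ((*) (c *\<^sub>C 1)) f"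
    by (rule poly_mapping_eqI)
      (simp add: lookup_scaleC map.rep_eq when_def scaleC_mult_left in_keys_iff)
  then show ?thesis by (simp add: mult_map_scale_conv_mult)
qed

lemma single_scalar_central:
  fixes f :: "'a::monoid_add \<Rightarrow>\<^sub>0 'b::complex_algebra_1"
  shows "Poly_Mapping.single 0 (c *\<^sub>C 1) * f = f * Poly_Mapping.single 0 (c *\<^sub>C 1)"
proof -
  have "f * Poly_Mapping.single 0 (c *\<^sub>C 1) = c *\<^sub>C f"
  proof (induction f rule: poly_mapping_single_induct)
    case zero
    then show ?case by (simp add: cvec.scale_zero_right)
  next
    case (single k v)
    then show ?case
      by (auto intro!: poly_mapping_eqI simp: mult_single lookup_scaleC lookup_single when_def scaleC_mult_right)
  next
    case (add f g)
    then show ?case by (simp add: distrib_right scaleC_add_right)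
  qed
  then show ?thesis by (simp add: scaleC_conv_single_mult)
qed

instance poly_mapping :: (monoid_add, complex_algebra_1) complex_algebra_1
proof
  fix c and f g :: "'a \<Rightarrow>\<^sub>0 'b"
  show "(c *\<^sub>C f) * g = c *\<^sub>C (f * g)"
    by (simp add: scaleC_conv_single_mult mult.assoc)
  show "f * (c *\<^sub>C g) = c *\<^sub>C (f * g)"
    by (metis mult.assoc scaleC_conv_single_mult single_scalar_central)
qed

text \<open>A complex-valued finitely supported function on \<open>'a\<close> is an element of the vector space with
  basis \<open>'a\<close>; \<open>lin_ext \<phi>\<close> is the linear map with value \<open>\<phi> k\<close> at the basis vector \<open>k\<close>.\<close>

definition lin_ext :: "('a \<Rightarrow> 'b::complex_vector) \<Rightarrow> ('a \<Rightarrow>\<^sub>0 complex) \<Rightarrow> 'b" where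
  "lin_ext \<phi> f = (\<Sum>k\<in>Poly_Mapping.keys f. Poly_Mapping.lookup f k *\<^sub>C \<phi> k)"

lemma lin_ext_superset:
  assumes "finite S" "Poly_Mapping.keys f \<subseteq> S"
  shows "lin_ext \<phi> f = (\<Sum>k\<in>S. Poly_Mapping.lookup f k *\<^sub>C \<phi> k)"
  unfolding lin_ext_def
  by (rule sum.mono_neutral_left) (use assms in \<open>auto simp: in_keys_iff\<close>)

lemma lin_ext_single [simp]: "lin_ext \<phi> (Poly_Mapping.single k c) = c *\<^sub>C \<phi> k"
  by (simp add: lin_ext_def)

lemma lin_ext_add: "lin_ext \<phi> (f + g) = lin_ext \<phi> f + lin_ext \<phi> g"
proof -
  let ?S = "Poly_Mapping.keys f \<union> Poly_Mapping.keys g"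
  have "lin_ext \<phi> (f + g) = (\<Sum>k\<in>?S. Poly_Mapping.lookup (f + g) k *\<^sub>C \<phi> k)"
    by (rule lin_ext_superset) (auto simp: Poly_Mapping.keys_add)
  also have "\<dots> = (\<Sum>k\<in>?S. Poly_Mapping.lookup f k *\<^sub>C \<phi> k) + (\<Sum>k\<in>?S. Poly_Mapping.lookup g k *\<^sub>C \<phi> k)"
    by (simp add: lookup_add scaleC_add_left sum.distrib)
  also have "\<dots> = lin_ext \<phi> f + lin_ext \<phi> g"
    by (simp add: lin_ext_superset[of ?S])
  finally show ?thesis .
qed

lemma lin_ext_scaleC: "lin_ext \<phi> (c *\<^sub>C f) = c *\<^sub>C lin_ext \<phi> f"
proof -
  have "lin_ext \<phi> (c *\<^sub>C f) = (\<Sum>k\<in>Poly_Mapping.keys f. Poly_Mapping.lookup (c *\<^sub>C f) k *\<^sub>C \<phi> k)"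
    by (rule lin_ext_superset) (auto simp: in_keys_iff lookup_scaleC)
  then show ?thesis
    by (simp add: lin_ext_def lookup_scaleC cvec.scale_sum_right scaleC_complex_def)
qed

lemma clinear_lin_ext: "clinear (lin_ext \<phi>)"
  by (simp add: clinear_iff lin_ext_add lin_ext_scaleC)

lemma lin_ext_diff: "lin_ext \<phi> (f - g) = lin_ext \<phi> f - lin_ext \<phi> g"
  by (metis add_diff_cancel_right' diff_add_cancel lin_ext_add)

lemma lin_ext_zero [simp]: "lin_ext \<phi> 0 = 0"
  by (simp add: lin_ext_def)

lemma single_eq_scaleC: "Poly_Mapping.single k (c::complex) = c *\<^sub>C Poly_Mapping.single k 1"
  by (rule poly_mapping_eqI) (simp add: lookup_scaleC lookup_single when_def scaleC_complex_def)

lemma lin_ext_of_single: "lin_ext (\<lambda>k. Poly_Mapping.single k 1) f = f"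
  by (induction f rule: poly_mapping_single_induct)
    (simp_all add: lin_ext_add flip: single_eq_scaleC)

lemma lin_ext_comp:
  assumes "clinear L"
  shows "L (lin_ext \<phi> f) = lin_ext (\<lambda>k. L (\<phi> k)) f"
proof (induction f rule: poly_mapping_single_induct)
  case zero
  have "L 0 = 0" using assms unfolding clinear_iff by (metis add_cancel_left_left)
  then show ?case by simp
next
  case (single k v)
  then show ?case using assms by (simp add: clinear_iff)
next
  case (add f g)
  then show ?case using assms by (simp add: clinear_iff lin_ext_add)
qed

lemma clinear_span_vanish:
  assumes "clinear L" "\<And>r. r \<in> R \<Longrightarrow> L r = 0" "x \<in> cspan R"
  shows "L x = 0"
  using assms(3)
proof (induction rule: cvec.span_induct_alt)
  case base
  from assms(1) have "L 0 = L 0 + L 0" unfolding clinear_iff by (metis add.right_neutral)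
  then show ?case by simp
next
  case (step c x y)
  then show ?case using assms(1,2) by (simp add: clinear_iff)
qed

section \<open>The algebra K of rational functions with poles at integers\<close>

inductive_set M :: "complex poly set" where
  one: "1 \<in> M"
| lin: "q \<in> M \<Longrightarrow> [:of_int k, 1:] * q \<in> M"

lemma M_nz: "q \<in> M \<Longrightarrow> q \<noteq> 0"
  by (induction rule: M.induct) (auto simp del: mult_pCons_left)

lemma M_mult: "p \<in> M \<Longrightarrow> q \<in> M \<Longrightarrow> p * q \<in> M"
  by (induction p rule: M.induct) (auto simp: mult.assoc intro: M.lin simp del: mult_pCons_left)

lemma M_pcompose_shift: "q \<in> M \<Longrightarrow> pcompose q [:of_int n, 1:] \<in> M"
proof (induction rule: M.induct)
  case one
  then show ?case using M.one by (simp add: pcompose_1)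
next
  case (lin q k)
  have "pcompose [:of_int k, 1:] [:of_int n, 1:] = [:of_int (k + n), 1 :: complex:]"
    by (simp add: pcompose_pCons)
  with lin show ?case by (metis M.lin pcompose_mult)
qed

lemma M_pcompose_neg: "q \<in> M \<Longrightarrow> \<exists>q'\<in>M. \<exists>c. c \<noteq> 0 \<and> pcompose q [:0, -1:] = smult c q'"
proof (induction rule: M.induct)
  case one
  then show ?case by (intro bexI[of _ 1] exI[of _ 1]) (auto simp: pcompose_1 M.one)
next
  case (lin q k)
  then obtain q' c where *: "q' \<in> M" "c \<noteq> 0" "pcompose q [:0, -1:] = smult c q'" by blast
  have "pcompose [:of_int k, 1:] [:0, -1:] = smult (-1) [:of_int (- k), 1 :: complex:]"
    by (simp add: pcompose_pCons)
  then have "pcompose ([:of_int k, 1:] * q) [:0, -1:] = smult (- c) ([:of_int (- k), 1:] * q')"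
    by (simp only: pcompose_mult * mult_smult_left mult_smult_right smult_smult) simp
  with * show ?case by (metis M.lin neg_0_equal_iff_equal equation_minus_iff)
qed

text \<open>Substituting a constant is a junk case, it could annihilate denominators.\<close>

lift_definition fract_subst :: "complex poly \<Rightarrow> complex poly fract \<Rightarrow> complex poly fract"
  is "\<lambda>u x. if degree u = 0 then (0, 1) else (pcompose (fst x) u, pcompose (snd x) u)"
proof -
  fix u :: "complex poly" and x y :: "complex poly \<times> complex poly"
  assume a: "fractrel x y"
  show "fractrel (if degree u = 0 then (0, 1) else (pcompose (fst x) u, pcompose (snd x) u))
          (if degree u = 0 then (0, 1) else (pcompose (fst y) u, pcompose (snd y) u))"
    using a pcompose_eq_0[of "snd x" u] pcompose_eq_0[of "snd y" u]
    by (auto simp flip: pcompose_mult)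
qed

lemma fract_subst_Fract:
  "degree u \<noteq> 0 \<Longrightarrow> q \<noteq> 0 \<Longrightarrow> fract_subst u (Fract p q) = Fract (pcompose p u) (pcompose q u)"
  by transfer (auto dest: pcompose_eq_0)

lift_definition fract_deriv :: "complex poly fract \<Rightarrow> complex poly fract"
  is "\<lambda>x. (pderiv (fst x) * snd x - fst x * pderiv (snd x), snd x * snd x)"
proof -
  fix x y :: "complex poly \<times> complex poly"
  assume "fractrel x y"
  moreover obtain a b where x: "x = (a, b)" by force
  moreover obtain c d where y: "y = (c, d)" by force
  ultimately have nz: "b \<noteq> 0" "d \<noteq> 0" and e: "a * d = c * b" by auto
  from e have "pderiv (a * d) = pderiv (c * b)" by simp
  then have e': "a * pderiv d + d * pderiv a = c * pderiv b + b * pderiv c"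
    by (simp add: pderiv_mult)
  have "(pderiv a * b - a * pderiv b) * (d * d) = (pderiv c * d - c * pderiv d) * (b * b)"
    using e e' by algebra
  with nz show "fractrel (pderiv (fst x) * snd x - fst x * pderiv (snd x), snd x * snd x)
      (pderiv (fst y) * snd y - fst y * pderiv (snd y), snd y * snd y)"
    by (simp add: x y)
qed

lemma fract_deriv_Fract:
  "q \<noteq> 0 \<Longrightarrow> fract_deriv (Fract p q) = Fract (pderiv p * q - p * pderiv q) (q * q)"
  by transfer simp

lemma eventually_poly_nz: "p \<noteq> 0 \<Longrightarrow> eventually (\<lambda>z. poly p z \<noteq> 0) (at (x::complex))"
  using islimpt_finite[OF poly_roots_finite[of p], of x] by (simp add: islimpt_iff_eventually)

lift_definition fract_residue :: "complex poly fract \<Rightarrow> complex \<Rightarrow> complex"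
  is "\<lambda>x a. residue (\<lambda>z. poly (fst x) z / poly (snd x) z) a"
proof (rule ext)
  fix x y :: "complex poly \<times> complex poly" and a
  assume xy: "fractrel x y"
  have e: "poly (fst x) z * poly (snd y) z = poly (fst y) z * poly (snd x) z" for z
    using xy by (metis fractrel_iff poly_mult)
  from xy have "eventually (\<lambda>z. poly (snd x) z \<noteq> 0 \<and> poly (snd y) z \<noteq> 0) (at a)"
    by (auto intro!: eventually_conj eventually_poly_nz)
  then have "eventually (\<lambda>z. poly (fst x) z / poly (snd x) z = poly (fst y) z / poly (snd y) z) (at a)"
    by (rule eventually_mono) (use e in \<open>auto simp: frac_eq_eq\<close>)
  then show "residue (\<lambda>z. poly (fst x) z / poly (snd x) z) a
      = residue (\<lambda>z. poly (fst y) z / poly (snd y) z) a"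
    by (rule residue_cong) simp
qed

text \<open>The algebra of polynomial functions on the integers is identified with \<^typ>\<open>complex poly\<close>;
  \<open>ratK\<close> is its localization at \<^const>\<open>M\<close>, realized inside the field of fractions.\<close>

typedef ratK = "{Fract p q | p q. q \<in> M}"
  using M.one by blast

lifting_forget poly.lifting
setup_lifting type_definition_ratK

lemma ratK_I: "q \<in> M \<Longrightarrow> \<exists>p' q'. Fract p q = Fract p' q' \<and> q' \<in> M"
  by blast

instantiation ratK :: comm_ring_1
begin
lift_definition zero_ratK :: ratK is 0
  unfolding Zero_fract_def by (rule ratK_I, rule M.one)
lift_definition one_ratK :: ratK is 1
  unfolding One_fract_def by (rule ratK_I, rule M.one)
lift_definition plus_ratK :: "ratK \<Rightarrow> ratK \<Rightarrow> ratK" is "(+)"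
  by (auto simp: M_nz intro!: ratK_I M_mult)
lift_definition minus_ratK :: "ratK \<Rightarrow> ratK \<Rightarrow> ratK" is "(-)"
  by (auto simp: M_nz intro!: ratK_I M_mult)
lift_definition uminus_ratK :: "ratK \<Rightarrow> ratK" is "uminus"
  by (auto simp: M_nz intro!: ratK_I M_mult)
lift_definition times_ratK :: "ratK \<Rightarrow> ratK \<Rightarrow> ratK" is "(*)"
  by (auto simp: M_nz intro!: ratK_I M_mult)
instance by standard (transfer; simp add: algebra_simps)+
end

lift_definition of_pol :: "complex poly \<Rightarrow> ratK" is "\<lambda>p. Fract p 1"
  by (rule ratK_I, rule M.one)

instantiation ratK :: complex_algebra_1
begin
definition scaleC_ratK :: "complex \<Rightarrow> ratK \<Rightarrow> ratK" where
  "c *\<^sub>C F = of_pol [:c:] * F"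
instance
proof
  fix c d :: complex and x y :: ratK
  have a: "of_pol [:c + d:] = of_pol [:c:] + of_pol [:d:]"
    by transfer simp
  have m: "of_pol [:c * d:] = of_pol [:c:] * of_pol [:d:]"
    by transfer (simp add: mult.commute)
  have o: "of_pol [:1:] = 1"
    by transfer (simp add: One_fract_def flip: one_pCons)
  show "c *\<^sub>C (x + y) = c *\<^sub>C x + c *\<^sub>C y" "(c + d) *\<^sub>C x = c *\<^sub>C x + d *\<^sub>C x"
    "c *\<^sub>C d *\<^sub>C x = (c * d) *\<^sub>C x" "1 *\<^sub>C x = x" "(c *\<^sub>C x) * y = c *\<^sub>C (x * y)"
    "x * (c *\<^sub>C y) = c *\<^sub>C (x * y)"
    by (simp_all add: scaleC_ratK_def a m o algebra_simps)
qed
end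

lift_definition inv_lin :: "int \<Rightarrow> ratK" is "\<lambda>n. Fract 1 [:of_int n, 1:]"
  by (rule ratK_I) (use M.lin[OF M.one] in simp)

abbreviation inv_tau :: ratK where "inv_tau \<equiv> inv_lin 0"

abbreviation Kpol :: "ratK set" where "Kpol \<equiv> range of_pol"

definition Ksing :: "ratK set" where
  "Ksing = cspan {inv_lin n ^ (k + 1) | n k. True}"

lift_definition shift :: "int \<Rightarrow> ratK \<Rightarrow> ratK" is "\<lambda>n. fract_subst [:of_int n, 1:]"
  by (auto simp: fract_subst_Fract M_nz intro!: ratK_I M_pcompose_shift)

lift_definition derivK :: "ratK \<Rightarrow> ratK" is fract_deriv
  by (auto simp: fract_deriv_Fract M_nz intro!: ratK_I M_mult)

lift_definition reflect :: "ratK \<Rightarrow> ratK" is "fract_subst [:0, -1:]"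
proof -
  fix F :: "complex poly fract"
  assume "\<exists>p q. F = Fract p q \<and> q \<in> M"
  then obtain p q where F: "F = Fract p q" "q \<in> M" by blast
  obtain q' c where q': "q' \<in> M" "c \<noteq> 0" "pcompose q [:0, -1:] = smult c q'"
    using M_pcompose_neg[OF F(2)] by blast
  have "fract_subst [:0, -1:] F = Fract (pcompose p [:0, -1:]) (smult c q')"
    by (simp add: F fract_subst_Fract M_nz q')
  also have "\<dots> = Fract (smult (inverse c) (pcompose p [:0, -1:])) q'"
    using q' by (subst eq_fract) (auto simp: M_nz)
  finally show "\<exists>p q. fract_subst [:0, -1:] F = Fract p q \<and> q \<in> M"
    using q'(1) by blast
qed

lift_definition residueK :: "ratK \<Rightarrow> int \<Rightarrow> complex" is "\<lambda>F n. fract_residue F (of_int n)" .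

text \<open>The sum has only finitely many nonzero terms.\<close>

definition Tr :: "ratK \<Rightarrow> complex" where
  "Tr F = (\<Sum>n | residueK F n \<noteq> 0. residueK F n)"

lemma shift_add: "shift n (F + G) = shift n F + shift n G"
  by transfer
    (auto simp: fract_subst_Fract M_nz M_pcompose_shift pcompose_add pcompose_mult)

lemma shift_mult: "shift n (F * G) = shift n F * shift n G"
  apply transfer
  apply (auto simp: fract_subst_Fract M_nz pcompose_add pcompose_mult)
  done

lemma shift_zero [simp]: "shift n 0 = 0"
  using shift_add[of n 0 0] by simp

lemma shift_of_pol: "shift n (of_pol p) = of_pol (pcompose p [:of_int n, 1:])"
  by transfer (simp add: fract_subst_Fract pcompose_1)

lemma shift_scaleC: "shift n (c *\<^sub>C F) = c *\<^sub>C shift n F"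
  by (simp add: scaleC_ratK_def shift_mult shift_of_pol)


section \<open>The Hopf algebras\<close>

text \<open>The basis vector \<open>(n, k)\<close> stands for \<open>T^n \<partial>^k\<close>; the convolution product of \<^typ>\<open>'a \<Rightarrow>\<^sub>0 complex\<close>
  gives the commutative algebra \<open>\<complex>[T, 1/T][\<partial>]\<close>. Its tensor square is the algebra with basis
  \<^typ>\<open>(int \<times> nat) \<times> (int \<times> nat)\<close>.\<close>

type_synonym hopf = "(int \<times> nat) \<Rightarrow>\<^sub>0 complex"

definition H_T :: "hopf set" where
  "H_T = {h. \<forall>(n, k)\<in>Poly_Mapping.keys h. k = 0}"

definition antipode :: "hopf \<Rightarrow> hopf" where
  "antipode = lin_ext (\<lambda>(n, k). Poly_Mapping.single (- n, k) ((-1) ^ k))"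

text \<open>The algebra homomorphism with \<open>T \<mapsto> T \<otimes> T\<close> and \<open>\<partial> \<mapsto> \<partial> \<otimes> 1 + 1 \<otimes> \<partial>\<close>.\<close>

definition coproduct :: "hopf \<Rightarrow> ((int \<times> nat) \<times> (int \<times> nat)) \<Rightarrow>\<^sub>0 complex" where
  "coproduct = lin_ext (\<lambda>(n, k). Poly_Mapping.single ((n, 0), (n, 0)) 1 *
     (Poly_Mapping.single ((0, 1), (0, 0)) 1 + Poly_Mapping.single ((0, 0), (0, 1)) 1) ^ k)"

definition hact :: "hopf \<Rightarrow> ratK \<Rightarrow> ratK" where
  "hact h F = lin_ext (\<lambda>(n, k). shift n ((derivK ^^ k) F)) h"

text \<open>\<open>F\<close> is congruent to \<open>S(h)(1/\<tau>)\<close> modulo polynomials for exactly one \<open>h\<close>, because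
  \<open>h \<mapsto> S(h)(1/\<tau>)\<close> is an isomorphism onto the complement \<^const>\<open>Ksing\<close> of \<^const>\<open>Kpol\<close>.\<close>

definition sing_coord :: "ratK \<Rightarrow> hopf" where
  "sing_coord F = (THE h. F - hact (antipode h) inv_tau \<in> Kpol)"

section \<open>\<open>H_T\<close>-vertex algebras\<close>

definition is_sing_kernel :: "('v::complex_vector \<times> ratK) list \<Rightarrow> (ratK \<Rightarrow> 'v) \<Rightarrow> bool" where
  "is_sing_kernel ks D \<longleftrightarrow> (\<forall>(w, F)\<in>set ks. F \<in> Ksing) \<and>
     (\<forall>G\<in>Kpol. D G = (\<Sum>(w, F)\<leftarrow>ks. Tr (F * G) *\<^sub>C w))"

text \<open>An \<open>End(V)\<close>-valued distribution is a family of endomorphisms depending linearly on \<^typ>\<open>ratK\<close>.\<close>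

definition is_field :: "(ratK \<Rightarrow> 'v::complex_vector \<Rightarrow> 'v) \<Rightarrow> bool" where
  "is_field \<phi> \<longleftrightarrow> (\<forall>F. clinear (\<phi> F)) \<and> (\<forall>v. clinear (\<lambda>F. \<phi> F v)) \<and>
     (\<forall>v. \<exists>ks. is_sing_kernel ks (\<lambda>F. \<phi> F v))"

text \<open>Bivariate polynomials are elements of \<^typ>\<open>complex poly poly\<close> whose outer variable is \<open>\<tau>\<^sub>1\<close>.
  For bilinear \<open>\<Phi>\<close>, \<open>apply_bipoly P \<Phi> G G'\<close> is the value at \<open>P \<cdot> (G \<otimes> G')\<close> of the linear map
  on \<open>K \<otimes> K\<close> induced by \<open>\<Phi>\<close>; such elements span the submodule generated by \<open>P\<close>.\<close>

definition apply_bipoly ::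
    "complex poly poly \<Rightarrow> (ratK \<Rightarrow> ratK \<Rightarrow> 'v::complex_vector) \<Rightarrow> ratK \<Rightarrow> ratK \<Rightarrow> 'v" where
  "apply_bipoly P \<Phi> G G' = (\<Sum>i\<le>degree P. \<Sum>j\<le>degree (coeff P i).
     coeff (coeff P i) j *\<^sub>C \<Phi> (of_pol (monom 1 i) * G) (of_pol (monom 1 j) * G'))"

definition at_difference :: "complex poly \<Rightarrow> complex poly poly" where
  "at_difference p = pcompose (map_poly (\<lambda>c. [:c:]) p) [:- [:0, 1:], 1:]"

definition mutually_rational ::
    "(ratK \<Rightarrow> 'v::complex_vector \<Rightarrow> 'v) \<Rightarrow> (ratK \<Rightarrow> 'v \<Rightarrow> 'v) \<Rightarrow> bool" where
  "mutually_rational \<phi> \<psi> \<longleftrightarrow> (\<exists>p\<in>M. \<forall>G G' v.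
     apply_bipoly (at_difference p) (\<lambda>G G'. \<phi> G (\<psi> G' v) - \<psi> G' (\<phi> G v)) G G' = 0)"

definition hV :: "'v::complex_vector \<Rightarrow> ('v \<Rightarrow> ratK \<Rightarrow> 'v \<Rightarrow> 'v) \<Rightarrow> hopf \<Rightarrow> 'v \<Rightarrow> 'v" where
  "hV vac Y h f = Y f (hact (antipode h) inv_tau) vac"

definition R_dist ::
    "'v::complex_vector \<Rightarrow> ('v \<Rightarrow> ratK \<Rightarrow> 'v \<Rightarrow> 'v) \<Rightarrow> 'v \<Rightarrow> ratK \<Rightarrow> 'v" where
  "R_dist vac Y v F = hV vac Y (sing_coord F) v"

definition R_hol ::
    "'v::complex_vector \<Rightarrow> ('v \<Rightarrow> ratK \<Rightarrow> 'v \<Rightarrow> 'v) \<Rightarrow> (ratK \<Rightarrow> 'v) \<Rightarrow> ratK \<Rightarrow> 'v" where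
  "R_hol vac Y D F = lin_ext (\<lambda>(a, b). hV vac Y (Poly_Mapping.single a 1)
      (D (hact (antipode (Poly_Mapping.single b 1)) inv_tau))) (coproduct (sing_coord F))"

text \<open>The kernel is unique as an element of \<open>V \<otimes> Ksing\<close> (the trace pairing between \<^const>\<open>Ksing\<close> and
  \<^const>\<open>Kpol\<close> is nondegenerate), and the first summand depends on nothing else.\<close>

definition R_op ::
    "'v::complex_vector \<Rightarrow> ('v \<Rightarrow> ratK \<Rightarrow> 'v \<Rightarrow> 'v) \<Rightarrow> (ratK \<Rightarrow> 'v) \<Rightarrow> ratK \<Rightarrow> 'v" where
  "R_op vac Y D G =
     (\<Sum>(v, F)\<leftarrow>(SOME ks. is_sing_kernel ks D). R_dist vac Y v (F * G)) + R_hol vac Y D G"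

definition Y_S :: "('v::complex_vector \<Rightarrow> ratK \<Rightarrow> 'v \<Rightarrow> 'v) \<Rightarrow> 'v \<Rightarrow> 'v \<Rightarrow> ratK \<Rightarrow> 'v" where
  "Y_S Y g f F = - Y g (reflect F) f"

locale HT_vertex_algebra =
  fixes vac :: "'v::complex_vector" and Y :: "'v \<Rightarrow> ratK \<Rightarrow> 'v \<Rightarrow> 'v"
  assumes Y_field: "is_field (Y f)"
    and Y_linear: "clinear (\<lambda>f. Y f F v)"
    and vacuum: "Y vac F v = Tr F *\<^sub>C v"
    and creation_hol: "G \<in> Kpol \<Longrightarrow> Y f G vac = 0"
    and creation: "Y f inv_tau vac = f"
    and covariance: "h \<in> H_T \<Longrightarrow> Y f (hact (antipode h) F) v = Y (hV vac Y h f) F v"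
    and skew_symmetry: "Y f G g = R_op vac Y (Y_S Y g f) G"
    and mutual_rationality: "mutually_rational (Y f) (Y g)"

section \<open>Universal enveloping algebras\<close>

datatype 'g fword = FWord (letters: "'g list")

instantiation fword :: (type) monoid_add
begin
definition zero_fword :: "'a fword" where "0 = FWord []"
definition plus_fword :: "'a fword \<Rightarrow> 'a fword \<Rightarrow> 'a fword" where
  "v + w = FWord (letters v @ letters w)"
instance by standard (simp_all add: zero_fword_def plus_fword_def)
end

text \<open>Words under concatenation: \<^typ>\<open>'g fword \<Rightarrow>\<^sub>0 complex\<close> is the free associative algebra on the
  set \<^typ>\<open>'g\<close>. The first two families of relations make the generators linear, i.e. cut it down
  to the tensor algebra.\<close>

abbreviation gen :: "'g \<Rightarrow> 'g fword \<Rightarrow>\<^sub>0 complex" where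
  "gen x \<equiv> Poly_Mapping.single (FWord [x]) 1"

definition uea_rels :: "('g::complex_lie_algebra fword \<Rightarrow>\<^sub>0 complex) set" where
  "uea_rels = {gen (x + y) - gen x - gen y | x y. True} \<union> {gen (c *\<^sub>C x) - c *\<^sub>C gen x | c x. True}
     \<union> {gen x * gen y - gen y * gen x - gen (lie x y) | x y. True}"

definition uea_ideal :: "('g::complex_lie_algebra fword \<Rightarrow>\<^sub>0 complex) set" where
  "uea_ideal = cspan {a * r * b | a r b. r \<in> uea_rels}"

definition free_lift :: "('g \<Rightarrow> 'a::complex_algebra_1) \<Rightarrow> ('g fword \<Rightarrow>\<^sub>0 complex) \<Rightarrow> 'a" where
  "free_lift \<phi> = lin_ext (\<lambda>w. prod_list (map \<phi> (letters w)))"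

lemma free_lift_add: "free_lift \<phi> (f + g) = free_lift \<phi> f + free_lift \<phi> g"
  and free_lift_diff: "free_lift \<phi> (f - g) = free_lift \<phi> f - free_lift \<phi> g"
  and free_lift_scaleC: "free_lift \<phi> (c *\<^sub>C f) = c *\<^sub>C free_lift \<phi> f"
  and free_lift_gen [simp]: "free_lift \<phi> (gen x) = \<phi> x"
  and free_lift_one [simp]: "free_lift \<phi> 1 = 1"
  by (simp_all add: free_lift_def lin_ext_add lin_ext_diff lin_ext_scaleC scaleC_one zero_fword_def
      flip: single_one)

lemma free_lift_mult: "free_lift \<phi> (f * g) = free_lift \<phi> f * free_lift \<phi> g"
proof (induction f rule: poly_mapping_single_induct)
  case zero
  show ?case by (simp add: free_lift_def)
next
  case (single k v)
  show ?case
    by (induction g rule: poly_mapping_single_induct)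
      (simp_all add: free_lift_def mult_single plus_fword_def lin_ext_add distrib_left
        scaleC_mult_left scaleC_mult_right scaleC_scaleC)
next
  case (add f g)
  then show ?case by (simp add: distrib_right free_lift_add)
qed

definition lie_hom :: "('g::complex_lie_algebra \<Rightarrow> 'a::complex_algebra_1) \<Rightarrow> bool" where
  "lie_hom \<phi> \<longleftrightarrow> clinear \<phi> \<and> (\<forall>x y. \<phi> (lie x y) = \<phi> x * \<phi> y - \<phi> y * \<phi> x)"

lemma free_lift_ideal:
  assumes "lie_hom \<phi>" "f \<in> uea_ideal"
  shows "free_lift \<phi> f = 0"
proof (rule clinear_span_vanish[of "free_lift \<phi>" "{a * r * b | a r b. r \<in> uea_rels}"])
  show "clinear (free_lift \<phi>)" by (simp add: free_lift_def clinear_lin_ext)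
  show "f \<in> cspan {a * r * b | a r b. r \<in> uea_rels}" using assms(2) by (simp add: uea_ideal_def)
  fix s :: "'a fword \<Rightarrow>\<^sub>0 complex"
  assume "s \<in> {a * r * b | a r b. r \<in> uea_rels}"
  then obtain a r b where s: "s = a * r * b" and r: "r \<in> uea_rels" by blast
  have "free_lift \<phi> r = 0"
    using r assms(1) unfolding uea_rels_def lie_hom_def clinear_iff
    by (auto simp: free_lift_diff free_lift_mult free_lift_scaleC)
  then show "free_lift \<phi> s = 0" by (simp add: s free_lift_mult)
qed

lemma clinear_span_closed:
  assumes "clinear L" "\<And>r. r \<in> R \<Longrightarrow> L r \<in> cspan S" "x \<in> cspan R"
  shows "L x \<in> cspan S"
  using assms(3)
proof (induction rule: cvec.span_induct_alt)
  case base
  from assms(1) have "L 0 = L 0 + L 0" unfolding clinear_iff by (metis add.right_neutral)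
  then show ?case by (simp add: cvec.span_zero)
next
  case (step c x y)
  then show ?case using assms(1,2)
    by (simp add: clinear_iff cvec.span_add cvec.span_scale)
qed

lemma uea_ideal_mult:
  assumes "f \<in> uea_ideal"
  shows "g * f \<in> uea_ideal" "f * g \<in> uea_ideal"
proof -
  let ?R = "{a * r * b | a r b. r \<in> (uea_rels :: ('a fword \<Rightarrow>\<^sub>0 complex) set)}"
  have "g * f \<in> cspan ?R"
  proof (rule clinear_span_closed[of "\<lambda>x. g * x" ?R])
    fix s assume "s \<in> ?R"
    then obtain a r b where "s = a * r * b" "r \<in> uea_rels" by blast
    then have "g * s = (g * a) * r * b" by (simp add: mult.assoc)
    with \<open>r \<in> uea_rels\<close> have "g * s \<in> ?R" by blast
    then show "g * s \<in> cspan ?R" by (rule cvec.span_base)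
  qed (use assms in \<open>auto simp: clinear_iff uea_ideal_def distrib_left scaleC_mult_right\<close>)
  then show "g * f \<in> uea_ideal" by (simp add: uea_ideal_def)
  have "f * g \<in> cspan ?R"
  proof (rule clinear_span_closed[of "\<lambda>x. x * g" ?R])
    fix s assume "s \<in> ?R"
    then obtain a r b where "s = a * r * b" "r \<in> uea_rels" by blast
    then have "s * g = a * r * (b * g)" by (simp add: mult.assoc)
    with \<open>r \<in> uea_rels\<close> have "s * g \<in> ?R" by blast
    then show "s * g \<in> cspan ?R" by (rule cvec.span_base)
  qed (use assms in \<open>auto simp: clinear_iff uea_ideal_def distrib_right scaleC_mult_left\<close>)
  then show "f * g \<in> uea_ideal" by (simp add: uea_ideal_def)
qed

lemma equivp_diff_cspan: "equivp (\<lambda>x y. x - y \<in> cspan S)"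
proof (rule equivpI)
  show "reflp (\<lambda>x y. x - y \<in> cspan S)"
    by (simp add: reflp_def cvec.span_zero)
  show "symp (\<lambda>x y. x - y \<in> cspan S)"
    by (rule sympI) (use cvec.span_neg in fastforce)
  show "transp (\<lambda>x y. x - y \<in> cspan S)"
    by (rule transpI) (use cvec.span_add in fastforce)
qed

lemma diff_cspan_add:
  assumes "x - x' \<in> cspan S" "y - y' \<in> cspan S"
  shows "x + y - (x' + y') \<in> cspan S"
  using cvec.span_add[OF assms] by (simp add: add_diff_add)

lemma diff_cspan_uminus: "x - x' \<in> cspan S \<Longrightarrow> - x - - x' \<in> cspan S"
  using cvec.span_neg[of "x - x'" S] by (simp add: algebra_simps)

lemma diff_cspan_diff:
  assumes "x - x' \<in> cspan S" "y - y' \<in> cspan S"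
  shows "x - y - (x' - y') \<in> cspan S"
  using cvec.span_diff[OF assms] by (simp add: algebra_simps)

lemma diff_cspan_scaleC: "x - x' \<in> cspan S \<Longrightarrow> c *\<^sub>C x - c *\<^sub>C x' \<in> cspan S"
  using cvec.span_scale[of "x - x'" S c] by (simp add: cvec.scale_right_diff_distrib)

lifting_forget poly_mapping.lifting

quotient_type (overloaded) 'g uea = "'g::complex_lie_algebra fword \<Rightarrow>\<^sub>0 complex" /
  "\<lambda>x y. x - y \<in> uea_ideal"
  unfolding uea_ideal_def by (rule equivp_diff_cspan)

lemma zero_rel_one_uea: "(0 :: 'g::complex_lie_algebra fword \<Rightarrow>\<^sub>0 complex) - 1 \<notin> uea_ideal"
proof
  assume a: "(0 :: 'g fword \<Rightarrow>\<^sub>0 complex) - 1 \<in> uea_ideal"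
  have "lie_hom (\<lambda>_::'g. 0::complex)" unfolding lie_hom_def clinear_iff by (simp add: scaleC_complex_def)
  from free_lift_ideal[OF this a] show False by (simp add: free_lift_diff del: diff_0)
      (simp add: free_lift_def)
qed

instantiation uea :: (complex_lie_algebra) complex_algebra_1
begin
lift_definition zero_uea :: "'a uea" is 0 .
lift_definition one_uea :: "'a uea" is 1 .
lift_definition plus_uea :: "'a uea \<Rightarrow> 'a uea \<Rightarrow> 'a uea" is "(+)"
  unfolding uea_ideal_def by (rule diff_cspan_add)
lift_definition uminus_uea :: "'a uea \<Rightarrow> 'a uea" is uminus
  unfolding uea_ideal_def by (rule diff_cspan_uminus)
lift_definition minus_uea :: "'a uea \<Rightarrow> 'a uea \<Rightarrow> 'a uea" is "(-)"
  unfolding uea_ideal_def by (rule diff_cspan_diff)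
lift_definition times_uea :: "'a uea \<Rightarrow> 'a uea \<Rightarrow> 'a uea" is "(*)"
proof -
  fix x x' y y' :: "'a fword \<Rightarrow>\<^sub>0 complex"
  assume *: "x - x' \<in> uea_ideal" "y - y' \<in> uea_ideal"
  have "x * y - x' * y' = (x - x') * y + x' * (y - y')" by (simp add: algebra_simps)
  moreover have "\<dots> \<in> uea_ideal"
    using uea_ideal_mult(2)[OF *(1), of y] uea_ideal_mult(1)[OF *(2), of x']
    unfolding uea_ideal_def by (rule cvec.span_add)
  ultimately show "x * y - x' * y' \<in> uea_ideal" by simp
qed
lift_definition scaleC_uea :: "complex \<Rightarrow> 'a uea \<Rightarrow> 'a uea" is "(*\<^sub>C)"
  unfolding uea_ideal_def by (rule diff_cspan_scaleC)
instance
proof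
  fix a b c :: "'a uea" and s t :: complex
  have e: "x = y \<Longrightarrow> x - y \<in> uea_ideal" for x y :: "'a fword \<Rightarrow>\<^sub>0 complex"
    by (simp add: uea_ideal_def cvec.span_zero)
  show "a + b + c = a + (b + c)" "a + b = b + a" "0 + a = a" "- a + a = 0" "a - b = a + - b"
    "a * b * c = a * (b * c)" "1 * a = a" "a * 1 = a"
    "(a + b) * c = a * c + b * c" "a * (b + c) = a * b + a * c"
    "s *\<^sub>C (a + b) = s *\<^sub>C a + s *\<^sub>C b" "(s + t) *\<^sub>C a = s *\<^sub>C a + t *\<^sub>C a"
    "s *\<^sub>C t *\<^sub>C a = (s * t) *\<^sub>C a" "1 *\<^sub>C a = a"
    "(s *\<^sub>C a) * b = s *\<^sub>C (a * b)" "a * (s *\<^sub>C b) = s *\<^sub>C (a * b)"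
    by (transfer; rule e; simp add: algebra_simps scaleC_add_left scaleC_add_right scaleC_scaleC
        scaleC_one scaleC_mult_left scaleC_mult_right)+
  show "(0 :: 'a uea) \<noteq> 1" by transfer (rule zero_rel_one_uea)
qed
end

lift_definition uea_incl :: "'g::complex_lie_algebra \<Rightarrow> 'g uea" is gen .

text \<open>The algebra homomorphism extending a Lie algebra homomorphism \<open>\<phi>\<close> into an associative algebra.\<close>

definition uea_lift :: "('g::complex_lie_algebra \<Rightarrow> 'a::complex_algebra_1) \<Rightarrow> 'g uea \<Rightarrow> 'a" where
  "uea_lift \<phi> u = free_lift \<phi> (rep_uea u)"

lemma rep_abs_uea: "rep_uea (abs_uea f) - f \<in> uea_ideal"
  by (rule Quotient3_rep_abs[OF Quotient3_uea]) (simp add: uea_ideal_def cvec.span_zero)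

lemma uea_lift_abs: "lie_hom \<phi> \<Longrightarrow> uea_lift \<phi> (abs_uea f) = free_lift \<phi> f"
  using free_lift_ideal[OF _ rep_abs_uea, of \<phi> f] by (simp add: uea_lift_def free_lift_diff)

lemma uea_lift_hom:
  assumes "lie_hom \<phi>"
  shows "uea_lift \<phi> (uea_incl x) = \<phi> x" "uea_lift \<phi> 1 = 1"
    "uea_lift \<phi> (u + v) = uea_lift \<phi> u + uea_lift \<phi> v"
    "uea_lift \<phi> (u * v) = uea_lift \<phi> u * uea_lift \<phi> v"
    "uea_lift \<phi> (c *\<^sub>C u) = c *\<^sub>C uea_lift \<phi> u"
proof -
  show "uea_lift \<phi> (uea_incl x) = \<phi> x" "uea_lift \<phi> 1 = 1"
    by (simp_all add: uea_incl_def one_uea_def uea_lift_abs assms)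
  obtain f g where "u = abs_uea f" "v = abs_uea g"
    by (metis Quotient3_abs_rep[OF Quotient3_uea])
  then show "uea_lift \<phi> (u + v) = uea_lift \<phi> u + uea_lift \<phi> v"
    "uea_lift \<phi> (u * v) = uea_lift \<phi> u * uea_lift \<phi> v"
    "uea_lift \<phi> (c *\<^sub>C u) = c *\<^sub>C uea_lift \<phi> u"
    by (simp_all add: plus_uea.abs_eq times_uea.abs_eq scaleC_uea.abs_eq uea_lift_abs assms
        free_lift_add free_lift_mult free_lift_scaleC)
qed

lemma uea_incl_lie_hom: "lie_hom uea_incl"
  unfolding lie_hom_def clinear_iff
proof (intro conjI allI)
  have i: "r \<in> uea_rels \<Longrightarrow> r \<in> uea_ideal" for r :: "'a fword \<Rightarrow>\<^sub>0 complex"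
    unfolding uea_ideal_def by (rule cvec.span_base) (force intro: exI[of _ 1])
  show "uea_incl (x + y) = uea_incl x + uea_incl y" for x y :: 'a
    by transfer (rule i, auto simp: uea_rels_def diff_diff_eq[symmetric])
  show "uea_incl (c *\<^sub>C x) = c *\<^sub>C uea_incl x" for c and x :: 'a
    by transfer (rule i, auto simp: uea_rels_def)
  show "uea_incl (lie x y) = uea_incl x * uea_incl y - uea_incl y * uea_incl x" for x y :: 'a
  proof transfer
    fix x y :: 'a
    have "gen x * gen y - gen y * gen x - gen (lie x y) \<in> uea_ideal"
      by (rule i) (auto simp: uea_rels_def)
    then show "gen (lie x y) - (gen x * gen y - gen y * gen x) \<in> uea_ideal"
      unfolding uea_ideal_def using cvec.span_neg by fastforce
  qed
qed

section \<open>The Lie algebra and its induced module\<close>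

text \<open>\<open>LToda p q\<close> is \<open>B_{p} + C_{q}\<close>.\<close>

datatype ltoda = LToda (Bpart: ratK) (Cpart: ratK)

definition cur_B :: "ratK \<Rightarrow> ltoda" where "cur_B p = LToda p 0"
definition cur_C :: "ratK \<Rightarrow> ltoda" where "cur_C p = LToda 0 p"

definition Delta_bar :: hopf where
  "Delta_bar = 1 - Poly_Mapping.single (-1, 0) 1"

lemma hact_Delta_bar: "hact Delta_bar p = p - shift (-1) p"
proof -
  have "shift 0 p = p"
    by transfer (auto simp: fract_subst_Fract M_nz pcompose_idR)
  then show ?thesis
    by (simp add: hact_def Delta_bar_def lin_ext_diff scaleC_one zero_prod_def flip: single_one)
qed

instantiation ltoda :: complex_lie_algebra
begin
definition zero_ltoda :: ltoda where "0 = LToda 0 0"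
definition plus_ltoda :: "ltoda \<Rightarrow> ltoda \<Rightarrow> ltoda" where
  "x + y = LToda (Bpart x + Bpart y) (Cpart x + Cpart y)"
definition minus_ltoda :: "ltoda \<Rightarrow> ltoda \<Rightarrow> ltoda" where
  "x - y = LToda (Bpart x - Bpart y) (Cpart x - Cpart y)"
definition uminus_ltoda :: "ltoda \<Rightarrow> ltoda" where
  "- x = LToda (- Bpart x) (- Cpart x)"
definition scaleC_ltoda :: "complex \<Rightarrow> ltoda \<Rightarrow> ltoda" where
  "c *\<^sub>C x = LToda (c *\<^sub>C Bpart x) (c *\<^sub>C Cpart x)"
definition lie_ltoda :: "ltoda \<Rightarrow> ltoda \<Rightarrow> ltoda" where
  "lie x y = cur_C (hact Delta_bar (Bpart y) * Cpart x - hact Delta_bar (Bpart x) * Cpart y)"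
instance
  by standard (simp_all add: zero_ltoda_def plus_ltoda_def minus_ltoda_def uminus_ltoda_def
      scaleC_ltoda_def lie_ltoda_def cur_C_def hact_Delta_bar shift_add shift_scaleC
      scaleC_add_left scaleC_add_right scaleC_scaleC scaleC_one scaleC_mult_left scaleC_mult_right
      cvec.scale_right_diff_distrib algebra_simps)
end

lemma lie_cur:
  "lie (cur_B p) (cur_C q) = - cur_C (hact Delta_bar p * q)"
  "lie (cur_B p) (cur_B q) = 0"
  "lie (cur_C p) (cur_C q) = 0"
  by (simp_all add: lie_ltoda_def cur_B_def cur_C_def uminus_ltoda_def zero_ltoda_def
      hact_Delta_bar shift_zero)

definition ann :: "ltoda set" where
  "ann = cspan (cur_B ` Kpol \<union> cur_C ` Kpol)"

typedef ltoda_ann = ann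
  unfolding ann_def using cvec.span_zero by blast

setup_lifting type_definition_ltoda_ann

lemma Kpol_zero [simp]: "0 \<in> Kpol"
proof -
  have "(0::ratK) = of_pol 0" by transfer (simp add: Zero_fract_def)
  then show ?thesis by (rule range_eqI)
qed

lemma Kpol_add: "p \<in> Kpol \<Longrightarrow> q \<in> Kpol \<Longrightarrow> p + q \<in> Kpol"
proof -
  have "of_pol a + of_pol b = of_pol (a + b)" for a b by transfer simp
  then show "p \<in> Kpol \<Longrightarrow> q \<in> Kpol \<Longrightarrow> p + q \<in> Kpol" by auto
qed

lemma Kpol_diff: "p \<in> Kpol \<Longrightarrow> q \<in> Kpol \<Longrightarrow> p - q \<in> Kpol"
proof -
  have "of_pol a - of_pol b = of_pol (a - b)" for a b by transfer simp
  then show "p \<in> Kpol \<Longrightarrow> q \<in> Kpol \<Longrightarrow> p - q \<in> Kpol" by auto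
qed

lemma Kpol_mult: "p \<in> Kpol \<Longrightarrow> q \<in> Kpol \<Longrightarrow> p * q \<in> Kpol"
proof -
  have "of_pol a * of_pol b = of_pol (a * b)" for a b by transfer simp
  then show "p \<in> Kpol \<Longrightarrow> q \<in> Kpol \<Longrightarrow> p * q \<in> Kpol" by auto
qed

lemma Kpol_scaleC: "p \<in> Kpol \<Longrightarrow> c *\<^sub>C p \<in> Kpol"
  unfolding scaleC_ratK_def by (rule Kpol_mult) auto

lemma Kpol_shift: "p \<in> Kpol \<Longrightarrow> shift n p \<in> Kpol"
  by (auto simp: shift_of_pol)

lemmas Kpol_closed = Kpol_zero Kpol_add Kpol_diff Kpol_mult Kpol_scaleC Kpol_shift

lemma ann_iff: "x \<in> ann \<longleftrightarrow> Bpart x \<in> Kpol \<and> Cpart x \<in> Kpol"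
proof
  assume "x \<in> ann"
  then show "Bpart x \<in> Kpol \<and> Cpart x \<in> Kpol"
    unfolding ann_def
  proof (induction rule: cvec.span_induct_alt)
    case base
    then show ?case by (simp add: zero_ltoda_def Kpol_closed)
  next
    case (step c x y)
    then have "Bpart x \<in> Kpol \<and> Cpart x \<in> Kpol"
      by (auto simp: cur_B_def cur_C_def Kpol_closed simp del: image_iff)
    with step show ?case by (simp add: plus_ltoda_def scaleC_ltoda_def Kpol_closed)
  qed
next
  assume *: "Bpart x \<in> Kpol \<and> Cpart x \<in> Kpol"
  have "x = cur_B (Bpart x) + cur_C (Cpart x)"
    by (cases x) (simp add: cur_B_def cur_C_def plus_ltoda_def)
  also have "\<dots> \<in> ann"
    unfolding ann_def using * by (intro cvec.span_add cvec.span_base) blast+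
  finally show "x \<in> ann" .
qed

instantiation ltoda_ann :: complex_lie_algebra
begin
lift_definition zero_ltoda_ann :: ltoda_ann is 0
  unfolding ann_def by (rule cvec.span_zero)
lift_definition plus_ltoda_ann :: "ltoda_ann \<Rightarrow> ltoda_ann \<Rightarrow> ltoda_ann" is "(+)"
  unfolding ann_def by (rule cvec.span_add)
lift_definition minus_ltoda_ann :: "ltoda_ann \<Rightarrow> ltoda_ann \<Rightarrow> ltoda_ann" is "(-)"
  unfolding ann_def by (rule cvec.span_diff)
lift_definition uminus_ltoda_ann :: "ltoda_ann \<Rightarrow> ltoda_ann" is uminus
  unfolding ann_def by (rule cvec.span_neg)
lift_definition scaleC_ltoda_ann :: "complex \<Rightarrow> ltoda_ann \<Rightarrow> ltoda_ann" is "(*\<^sub>C)"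
  unfolding ann_def by (rule cvec.span_scale)
lift_definition lie_ltoda_ann :: "ltoda_ann \<Rightarrow> ltoda_ann \<Rightarrow> ltoda_ann" is lie
  by (simp add: ann_iff lie_ltoda_def cur_C_def hact_Delta_bar Kpol_closed)
instance
proof
  fix x y z :: ltoda_ann and c d :: complex
  show "x + y + z = x + (y + z)" "x + y = y + x" "0 + x = x" "- x + x = 0" "x - y = x + - y"
    by (transfer; simp add: add_ac)+
  show "c *\<^sub>C (x + y) = c *\<^sub>C x + c *\<^sub>C y" "(c + d) *\<^sub>C x = c *\<^sub>C x + d *\<^sub>C x"
    "c *\<^sub>C d *\<^sub>C x = (c * d) *\<^sub>C x" "1 *\<^sub>C x = x"
    by (transfer; simp only: scaleC_add_left scaleC_add_right scaleC_scaleC scaleC_one)+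
  show "lie (x + y) z = lie x z + lie y z" "lie x (y + z) = lie x y + lie x z"
    "lie (c *\<^sub>C x) y = c *\<^sub>C lie x y" "lie x (c *\<^sub>C y) = c *\<^sub>C lie x y" "lie x x = 0"
    by (transfer; simp only: lie_add_left lie_add_right lie_scaleC_left lie_scaleC_right lie_self)+
  show "lie x (lie y z) + lie y (lie z x) + lie z (lie x y) = 0"
    by transfer (rule jacobi)
qed
end

text \<open>The ring homomorphism \<open>U(ann) \<rightarrow> U(ltoda)\<close> induced by the inclusion, and the one giving the
  trivial one-dimensional module.\<close>

definition uann_incl :: "ltoda_ann uea \<Rightarrow> ltoda uea" where
  "uann_incl = uea_lift (\<lambda>x. uea_incl (Rep_ltoda_ann x))"

definition uann_triv :: "ltoda_ann uea \<Rightarrow> complex" where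
  "uann_triv = uea_lift (\<lambda>_. 0)"

lemma lie_hom_uann_incl: "lie_hom (\<lambda>x. uea_incl (Rep_ltoda_ann x))"
  using uea_incl_lie_hom[where 'a = ltoda] unfolding lie_hom_def clinear_iff
  by (simp add: plus_ltoda_ann.rep_eq scaleC_ltoda_ann.rep_eq lie_ltoda_ann.rep_eq)

lemma lie_hom_uann_triv: "lie_hom (\<lambda>_::ltoda_ann. 0::complex)"
  unfolding lie_hom_def clinear_iff by (simp add: scaleC_complex_def)

text \<open>Relations defining \<open>A \<otimes>\<^bsub>R\<^esub> N\<close> for a right action of \<open>R\<close> on \<open>A\<close> and a left action on \<open>N\<close>, as a
  quotient of the vector space with basis \<open>A \<times> N\<close>.\<close>

definition balanced_rels :: "('a::complex_vector \<Rightarrow> 'r \<Rightarrow> 'a) \<Rightarrow> ('r \<Rightarrow> 'n::complex_vector \<Rightarrow> 'n)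
    \<Rightarrow> (('a \<times> 'n) \<Rightarrow>\<^sub>0 complex) set" where
  "balanced_rels ract lact = (let e = (\<lambda>a n. Poly_Mapping.single (a, n) 1) in
     {e (a + a') n - e a n - e a' n | a a' n. True} \<union>
     {e a (n + n') - e a n - e a n' | a n n'. True} \<union>
     {e (c *\<^sub>C a) n - c *\<^sub>C e a n | c a n. True} \<union>
     {e a (c *\<^sub>C n) - c *\<^sub>C e a n | c a n. True} \<union>
     {e (ract a r) n - e a (lact r n) | a r n. True})"

lemma balanced_relsI:
  "Poly_Mapping.single (a + a', n) 1 - Poly_Mapping.single (a, n) 1 - Poly_Mapping.single (a', n) 1
    \<in> balanced_rels ract lact"
  "Poly_Mapping.single (a, n + n') 1 - Poly_Mapping.single (a, n) 1 - Poly_Mapping.single (a, n') 1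
    \<in> balanced_rels ract lact"
  "Poly_Mapping.single (c *\<^sub>C a, n) 1 - c *\<^sub>C Poly_Mapping.single (a, n) 1 \<in> balanced_rels ract lact"
  "Poly_Mapping.single (a, c *\<^sub>C n) 1 - c *\<^sub>C Poly_Mapping.single (a, n) 1 \<in> balanced_rels ract lact"
  "Poly_Mapping.single (ract a r, n) 1 - Poly_Mapping.single (a, lact r n) 1 \<in> balanced_rels ract lact"
  unfolding balanced_rels_def Let_def by blast+

lemma balanced_rels_cases:
  assumes "x \<in> balanced_rels ract lact"
  obtains (1) a a' n where "x = Poly_Mapping.single (a + a', n) 1 - Poly_Mapping.single (a, n) 1
      - Poly_Mapping.single (a', n) 1"
  | (2) a n n' where "x = Poly_Mapping.single (a, n + n') 1 - Poly_Mapping.single (a, n) 1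
      - Poly_Mapping.single (a, n') 1"
  | (3) c a n where "x = Poly_Mapping.single (c *\<^sub>C a, n) 1 - c *\<^sub>C Poly_Mapping.single (a, n) 1"
  | (4) c a n where "x = Poly_Mapping.single (a, c *\<^sub>C n) 1 - c *\<^sub>C Poly_Mapping.single (a, n) 1"
  | (5) a r n where "x = Poly_Mapping.single (ract a r, n) 1 - Poly_Mapping.single (a, lact r n) 1"
  using assms unfolding balanced_rels_def Let_def by blast

abbreviation vtoda_rels :: "((ltoda uea \<times> complex) \<Rightarrow>\<^sub>0 complex) set" where
  "vtoda_rels \<equiv> balanced_rels (\<lambda>a r. a * uann_incl r) (\<lambda>r n. uann_triv r * n)"

lifting_forget uea.lifting

quotient_type vtoda = "(ltoda uea \<times> complex) \<Rightarrow>\<^sub>0 complex" /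
  "\<lambda>x y. x - y \<in> cspan vtoda_rels"
  by (rule equivp_diff_cspan)

instantiation vtoda :: complex_vector
begin
lift_definition zero_vtoda :: vtoda is 0 .
lift_definition plus_vtoda :: "vtoda \<Rightarrow> vtoda \<Rightarrow> vtoda" is "(+)"
  by (rule diff_cspan_add)
lift_definition uminus_vtoda :: "vtoda \<Rightarrow> vtoda" is uminus
  by (rule diff_cspan_uminus)
lift_definition minus_vtoda :: "vtoda \<Rightarrow> vtoda \<Rightarrow> vtoda" is "(-)"
  by (rule diff_cspan_diff)
lift_definition scaleC_vtoda :: "complex \<Rightarrow> vtoda \<Rightarrow> vtoda" is "(*\<^sub>C)"
  by (rule diff_cspan_scaleC)
instance
proof
  fix a b c :: vtoda and s t :: complex
  have e: "x = y \<Longrightarrow> x - y \<in> cspan vtoda_rels" for x y :: "(ltoda uea \<times> complex) \<Rightarrow>\<^sub>0 complex"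
    by (simp add: cvec.span_zero)
  show "a + b + c = a + (b + c)" "a + b = b + a" "0 + a = a" "- a + a = 0" "a - b = a + - b"
    "s *\<^sub>C (a + b) = s *\<^sub>C a + s *\<^sub>C b" "(s + t) *\<^sub>C a = s *\<^sub>C a + t *\<^sub>C a"
    "s *\<^sub>C t *\<^sub>C a = (s * t) *\<^sub>C a" "1 *\<^sub>C a = a"
    by (transfer; rule e; simp add: algebra_simps scaleC_add_left scaleC_add_right scaleC_scaleC
        scaleC_one)+
qed
end

lift_definition vtensor :: "ltoda uea \<Rightarrow> complex \<Rightarrow> vtoda" is
  "\<lambda>a n. Poly_Mapping.single (a, n) 1" .

definition v0 :: vtoda where "v0 = vtensor 1 1"

lift_definition uact :: "ltoda uea \<Rightarrow> vtoda \<Rightarrow> vtoda" is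
  "\<lambda>u. lin_ext (\<lambda>(a, n). Poly_Mapping.single (u * a, n) 1)"
proof -
  fix u :: "ltoda uea" and x y :: "(ltoda uea \<times> complex) \<Rightarrow>\<^sub>0 complex"
  let ?L = "lin_ext (\<lambda>(a, n). Poly_Mapping.single (u * a, n) (1::complex))"
  assume xy: "x - y \<in> cspan vtoda_rels"
  have "?L (x - y) \<in> cspan vtoda_rels"
  proof (rule clinear_span_closed[OF clinear_lin_ext _ xy])
    fix r :: "(ltoda uea \<times> complex) \<Rightarrow>\<^sub>0 complex"
    assume "r \<in> vtoda_rels"
    then have "?L r \<in> vtoda_rels"
    proof (cases rule: balanced_rels_cases)
      case (1 a a' n)
      then have "?L r = Poly_Mapping.single (u * a + u * a', n) 1 - Poly_Mapping.single (u * a, n) 1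
          - Poly_Mapping.single (u * a', n) 1"
        by (simp add: lin_ext_diff scaleC_one distrib_left)
      then show ?thesis by (auto intro: balanced_relsI)
    next
      case (2 a n n')
      then have "?L r = Poly_Mapping.single (u * a, n + n') 1 - Poly_Mapping.single (u * a, n) 1
          - Poly_Mapping.single (u * a, n') 1"
        by (simp add: lin_ext_diff scaleC_one)
      then show ?thesis by (auto intro: balanced_relsI)
    next
      case (3 c a n)
      then have "?L r = Poly_Mapping.single (c *\<^sub>C (u * a), n) 1 - c *\<^sub>C Poly_Mapping.single (u * a, n) 1"
        by (simp add: lin_ext_diff lin_ext_scaleC scaleC_one scaleC_mult_right)
      then show ?thesis by (auto intro: balanced_relsI)
    next
      case (4 c a n)
      then have "?L r = Poly_Mapping.single (u * a, c *\<^sub>C n) 1 - c *\<^sub>C Poly_Mapping.single (u * a, n) 1"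
        by (simp add: lin_ext_diff lin_ext_scaleC scaleC_one)
      then show ?thesis by (auto intro: balanced_relsI)
    next
      case (5 a b n)
      then have "?L r = Poly_Mapping.single ((u * a) * uann_incl b, n) 1
          - Poly_Mapping.single (u * a, uann_triv b * n) 1"
        by (simp add: lin_ext_diff scaleC_one mult.assoc)
      moreover have "\<dots> \<in> vtoda_rels"
        by (rule balanced_relsI(5)[where ract = "\<lambda>a r. a * uann_incl r" and lact = "\<lambda>r n. uann_triv r * n"])
      ultimately show ?thesis by simp
    qed
    then show "?L r \<in> cspan vtoda_rels" by (rule cvec.span_base)
  qed
  then show "?L x - ?L y \<in> cspan vtoda_rels" by (simp add: lin_ext_diff)
qed

lemma uact_vtensor: "uact u (vtensor a n) = vtensor (u * a) n"
  by transfer (simp add: scaleC_one cvec.span_zero)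

definition vact :: "ltoda \<Rightarrow> vtoda \<Rightarrow> vtoda" where
  "vact x = uact (uea_incl x)"

end

theory Submission
  imports Defs "HOL-Complex_Analysis.Laurent_Convergence" "HOL-Library.Function_Algebras"
begin

text \<open>Expanding a rational function at every integer turns a current \<open>F \<mapsto> X_{F}\<close> into modes
  \<open>X_{n,k}\<close>, its values on \<open>(\<tau> - n)^k\<close> localized at \<open>n\<close>; on each vector of \<open>VToda\<close> only finitely
  many of them contribute. Since \<open>[B_{n,k}, C_{m,l}] = (\<delta>_{n,m-1} - \<delta>_{n,m}) C_{m,k+l}\<close>, the space
  \<open>VToda\<close> is the level zero vacuum module of a loop algebra and as such an ordinary vertex algebra:
  the universal property yields operators \<open>Y0\<close> having the commutator formula with the currents;
  the Borcherds identity for a current, by induction on the vector acted upon, gives the iterate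
  formula, from it follows skew-symmetry, and from this the commutator formula for all pairs of
  states. With the automorphisms \<open>T_n\<close> moving the points, \<open>Y(f, \<tau>)\<close> near \<open>\<tau> = n\<close> is \<open>Y0(T_n f)\<close>,
  and the axioms over the integers are sums of local statements. The one global input is that the
  residues of a product of two elements of \<open>Ksing\<close> add up to zero.\<close>

section \<open>Laurent coefficients of rational functions\<close>

text \<open>The state space is accessible in two ways: by its universal property, and by induction
  over words of modes applied to \<open>v0\<close>. So an operator is built by prescribing its
  commutators with the modes and its value at \<open>v0\<close>, and an identity among vertex
  operators is proved by checking that both sides obey the same recursion under one more mode and
  agree at \<open>v0\<close>, where translation covariance decides. Two obstacles separate K from
  local modes. A polynomial is nonzero near almost every integer, so pairing it with modes makes
  sense only if finitely many nonnegative modes survive on each vector. And a distribution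
  determines its modes only because there are functions in K with prescribed expansions at finitely
  many integers. Once both are settled, the bracket of two currents, an identity in the functions F
  and G, can be compared coefficient by coefficient. The bracket has no central term and couples
  only equal or neighbouring points. A commutator of two modes is thus a multiple of a single mode,
  which is why the recursions close up with plain binomial coefficients.\<close>

unbundle fps_syntax

definition poly_fls :: "complex poly \<Rightarrow> complex \<Rightarrow> complex fls" where
  "poly_fls p a = fps_to_fls (fps_of_poly (pcompose p [:a, 1:]))"

lemma poly_fls_hom:
  "poly_fls (p + q) a = poly_fls p a + poly_fls q a"
  "poly_fls (p * q) a = poly_fls p a * poly_fls q a"
  "poly_fls (- p) a = - poly_fls p a"
  "poly_fls (p - q) a = poly_fls p a - poly_fls q a"
  "poly_fls 0 a = 0"
  "poly_fls 1 a = 1"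
  by (simp_all add: poly_fls_def pcompose_add pcompose_mult pcompose_uminus pcompose_diff
      fps_of_poly_add fps_of_poly_mult fps_of_poly_uminus fps_of_poly_diff
      fls_times_fps_to_fls pcompose_1)

lemma poly_fls_eq_0_iff [simp]: "poly_fls p a = 0 \<longleftrightarrow> p = 0"
proof -
  have "pcompose p [:a, 1:] = 0 \<longleftrightarrow> p = 0" by (auto dest: pcompose_eq_0)
  then show ?thesis by (simp add: poly_fls_def)
qed

lemma poly_fls_nth_neg: "k < 0 \<Longrightarrow> poly_fls p a $$ k = 0"
  by (simp add: poly_fls_def)

lift_definition fract_fls :: "complex poly fract \<Rightarrow> complex \<Rightarrow> complex fls"
  is "\<lambda>x a. poly_fls (fst x) a / poly_fls (snd x) a"
  by (auto simp: fun_eq_iff frac_eq_eq simp flip: poly_fls_hom)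

lemma fract_fls_Fract: "q \<noteq> 0 \<Longrightarrow> fract_fls (Fract p q) a = poly_fls p a / poly_fls q a"
  by transfer simp

lift_definition laurent :: "ratK \<Rightarrow> int \<Rightarrow> complex fls" is "\<lambda>F n. fract_fls F (of_int n)" .

lemma laurent_hom:
  "laurent (F + G) n = laurent F n + laurent G n"
  "laurent (F * G) n = laurent F n * laurent G n"
  "laurent 0 n = 0"
  "laurent 1 n = 1"
  by (transfer; auto simp: fract_fls_Fract M_nz poly_fls_hom add_frac_eq Zero_fract_def One_fract_def)+

lemma laurent_of_pol: "laurent (of_pol p) n = poly_fls p (of_int n)"
  by transfer (simp add: fract_fls_Fract poly_fls_hom)

lemma poly_fls_lin: "poly_fls [:b, 1:] a = fls_X + fls_const (a + b)"
  by (rule fls_eqI) (auto simp: poly_fls_def pcompose_pCons nat_eq_iff coeff_pCons split: nat.split)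

lemma poly_fls_const: "poly_fls [:b:] a = fls_const b"
  by (rule fls_eqI) (auto simp: poly_fls_def pcompose_pCons nat_eq_iff coeff_pCons split: nat.split)

lemma laurent_scaleC: "laurent (c *\<^sub>C F) n = fls_const c * laurent F n"
  by (simp add: scaleC_ratK_def laurent_hom laurent_of_pol poly_fls_const)

lemma laurent_power: "laurent (F ^ k) n = laurent F n ^ k"
  by (induction k) (simp_all add: laurent_hom)

lemma laurent_inv_lin: "laurent (inv_lin m) n = inverse (fls_X + fls_const (of_int (n + m)))"
  by transfer (simp add: fract_fls_Fract poly_fls_lin poly_fls_hom field_simps)

text \<open>\<open>laurent F n\<close> is a series in \<open>\<tau> - n\<close>. The function with
  its pole at \<open>n\<close> is \<open>inv_lin (- n)\<close>, whence the sign in the statements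
  below.\<close>

definition cc :: "ratK \<Rightarrow> int \<Rightarrow> int \<Rightarrow> complex" where "cc F n k = laurent F n $$ k"

lemma cc_add: "cc (F + G) n k = cc F n k + cc G n k"
  and cc_zero [simp]: "cc 0 n k = 0"
  and cc_scaleC: "cc (c *\<^sub>C F) n k = c * cc F n k"
  by (simp_all add: cc_def laurent_hom laurent_scaleC)

lemma cc_minus: "cc (- F) n k = - cc F n k"
  using cc_add[of F "- F" n k] by (simp add: eq_neg_iff_add_eq_0 add.commute)

lemma cc_diff: "cc (F - G) n k = cc F n k - cc G n k"
  using cc_add[of F "- G" n k] by (simp add: cc_minus)

lemma cc_of_pol_neg: "k < 0 \<Longrightarrow> cc (of_pol p) n k = 0"
  by (simp add: cc_def laurent_of_pol poly_fls_nth_neg)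

text \<open>The usual product formula sums over an interval depending on both subdegrees. A sum over
  all integers has no such bounds and can be shifted and interchanged without tracking them.\<close>

lemma fls_mult_nth_Sum_any:
  fixes f g :: "'a::comm_semiring_0 fls"
  shows "finite {l. f $$ l * g $$ (k - l) \<noteq> 0}"
    and "(f * g) $$ k = Sum_any (\<lambda>l. f $$ l * g $$ (k - l))"
proof -
  let ?A = "{fls_subdegree f..k - fls_subdegree g}"
  have sub: "{l. f $$ l * g $$ (k - l) \<noteq> 0} \<subseteq> ?A"
  proof
    fix l assume "l \<in> {l. f $$ l * g $$ (k - l) \<noteq> 0}"
    then have "f $$ l \<noteq> 0" "g $$ (k - l) \<noteq> 0" by auto
    then have "\<not> l < fls_subdegree f" "\<not> k - l < fls_subdegree g"
      using fls_eq0_below_subdegree by blast+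
    then show "l \<in> ?A" by simp
  qed
  then show "finite {l. f $$ l * g $$ (k - l) \<noteq> 0}" by (rule finite_subset) simp
  have "(f * g) $$ k = (\<Sum>i=fls_subdegree f + fls_subdegree g..k. f $$ (i - fls_subdegree g) * g $$ (fls_subdegree g + k - i))"
    by (rule fls_times_nth)
  also have "\<dots> = (\<Sum>l\<in>?A. f $$ l * g $$ (k - l))"
    by (rule sum.reindex_bij_witness[of _ "\<lambda>l. l + fls_subdegree g" "\<lambda>i. i - fls_subdegree g"])
      (auto simp: algebra_simps)
  also have "\<dots> = Sum_any (\<lambda>l. f $$ l * g $$ (k - l))"
    by (rule Sum_any.expand_superset[symmetric]) (use sub in auto)
  finally show "(f * g) $$ k = Sum_any (\<lambda>l. f $$ l * g $$ (k - l))" .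
qed

lemma cc_mult: "cc (F * G) n k = Sum_any (\<lambda>l. cc F n l * cc G n (k - l))"
  by (simp add: cc_def laurent_hom fls_mult_nth_Sum_any(2))

lemma finite_cc_mult: "finite {l. cc F n l * cc G n (k - l) \<noteq> 0}"
  unfolding cc_def by (rule fls_mult_nth_Sum_any)

lemma laurent_inv_lin_self: "laurent (inv_lin (- n) ^ j) n = fls_X_inv ^ j"
  by (simp add: laurent_power laurent_inv_lin fls_inverse_X)

lemma cc_inv_lin_self: "cc (inv_lin (- n) ^ j) n k = (if k = - int j then 1 else 0)"
  by (simp add: cc_def laurent_inv_lin_self)

lemma cc_inv_lin_other:
  assumes "m \<noteq> n" "k < 0"
  shows "cc (inv_lin (- m) ^ j) n k = 0"
proof -
  have "of_int (n - m) \<noteq> (0::complex)" using assms by simp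
  then have "laurent (inv_lin (- m)) n = fps_to_fls (inverse (fps_X + fps_const (of_int (n - m))))"
    by (subst fls_inverse_fps_to_fls[symmetric])
      (simp_all add: laurent_inv_lin subdegree_eq_0_iff fls_X_def[symmetric])
  then have "laurent (inv_lin (- m) ^ j) n = fps_to_fls (inverse (fps_X + fps_const (of_int (n - m))) ^ j)"
    by (simp add: laurent_power fps_to_fls_power)
  with assms show ?thesis by (simp add: cc_def)
qed

lemma cc_shift: "cc (shift a F) n k = cc F (n + a) k"
proof -
  have "pcompose (pcompose p [:of_int a, 1:]) [:of_int n, 1:] = pcompose p [:of_int (n + a), 1:]"
    for p :: "complex poly"
    by (simp add: pcompose_assoc[symmetric] pcompose_pCons add.commute)
  moreover obtain p q where "Rep_ratK F = Fract p q" "q \<in> M" using Rep_ratK[of F] by blast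
  ultimately have "laurent (shift a F) n = laurent F (n + a)"
    by (simp add: laurent.rep_eq shift.rep_eq fract_subst_Fract fract_fls_Fract M_nz
        M_pcompose_shift poly_fls_def)
  then show ?thesis by (simp add: cc_def)
qed

subsection \<open>Partial fractions\<close>

lemma of_pol_hom: "of_pol (p + q) = of_pol p + of_pol q" "of_pol (p * q) = of_pol p * of_pol q"
  "of_pol 1 = 1" "of_pol 0 = 0" "of_pol (p - q) = of_pol p - of_pol q"
  by (transfer; simp add: One_fract_def Zero_fract_def)+

lemma of_pol_const: "of_pol [:c:] = c *\<^sub>C 1"
  by (simp add: scaleC_ratK_def)

lemma inv_lin_mult: "inv_lin a * of_pol [:of_int a, 1:] = 1"
  by transfer (simp add: One_fract_def eq_fract)

lemma inv_lin_diff: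
  assumes "a \<noteq> b"
  shows "inv_lin a * inv_lin b = (1 / of_int (b - a)) *\<^sub>C (inv_lin a - inv_lin b)"
proof -
  have e: "of_pol [:of_int b, 1:] - of_pol [:of_int a, 1:] = of_int (b - a) *\<^sub>C 1"
    by (simp only: of_pol_const[symmetric] of_pol_hom(5)[symmetric]) simp
  have "inv_lin a - inv_lin b = inv_lin a * inv_lin b * (of_pol [:of_int b, 1:] - of_pol [:of_int a, 1:])"
  proof -
    have "inv_lin a * inv_lin b * of_pol [:of_int b, 1:] = inv_lin a"
      by (simp only: mult.assoc inv_lin_mult mult_1_right)
    moreover have "inv_lin a * inv_lin b * of_pol [:of_int a, 1:] = inv_lin b * (inv_lin a * of_pol [:of_int a, 1:])"
      by (simp only: mult_ac)
    ultimately show ?thesis by (simp add: right_diff_distrib inv_lin_mult del: of_pol_hom)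
  qed
  also have "\<dots> = of_int (b - a) *\<^sub>C (inv_lin a * inv_lin b)"
    by (simp only: e scaleC_mult_right mult_1_right)
  finally show ?thesis using assms by (simp add: scaleC_scaleC scaleC_one)
qed

definition pf_gens :: "ratK set" where
  "pf_gens = Kpol \<union> {inv_lin n ^ Suc k | n k. True}"

lemma inv_lin_power_in_span: "inv_lin a * inv_lin n ^ Suc k \<in> cspan pf_gens"
proof (cases "a = n")
  case True
  then have "inv_lin a * inv_lin n ^ Suc k = inv_lin n ^ Suc (Suc k)" by simp
  then show ?thesis unfolding pf_gens_def by (intro cvec.span_base) blast
next
  case False
  have g: "inv_lin b ^ Suc i \<in> cspan pf_gens" for b i
    unfolding pf_gens_def by (intro cvec.span_base) blast
  show ?thesis
  proof (induction k)
    case 0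
    then show ?case using g[of a 0] g[of n 0] False
      by (simp add: inv_lin_diff cvec.span_scale cvec.span_diff)
  next
    case (Suc k)
    have "inv_lin a * inv_lin n ^ Suc (Suc k)
        = (1 / of_int (n - a)) *\<^sub>C (inv_lin a * inv_lin n ^ Suc k - inv_lin n ^ Suc (Suc k))"
    proof -
      have "inv_lin a * inv_lin n ^ Suc (Suc k) = (inv_lin a * inv_lin n) * inv_lin n ^ Suc k"
        by (simp add: mult_ac)
      then show ?thesis
        by (simp only: inv_lin_diff[OF False] scaleC_mult_left left_diff_distrib power_Suc)
    qed
    then show ?case using g[of n "Suc k"] Suc by (simp add: cvec.span_scale cvec.span_diff del: power_Suc)
  qed
qed

lemma inv_lin_times_span:
  assumes "F \<in> cspan pf_gens"
  shows "inv_lin a * F \<in> cspan pf_gens"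
proof (rule clinear_span_closed[OF _ _ assms])
  show "clinear ((*) (inv_lin a))" by (simp add: clinear_iff distrib_left scaleC_mult_right)
  fix r assume "r \<in> pf_gens"
  then consider p where "r = of_pol p" | n k where "r = inv_lin n ^ Suc k"
    unfolding pf_gens_def by blast
  then show "inv_lin a * r \<in> cspan pf_gens"
  proof cases
    case 1
    \<comment> \<open>Division with remainder by \<open>\<tau> + a\<close>: only the constant
      remainder keeps the pole.\<close>
    define s c where "s = synthetic_div p (- of_int a)" and "c = poly p (- of_int a)"
    have "p = [:of_int a, 1:] * s + [:c:]"
      using synthetic_div_correct'[of "- of_int a" p] by (simp add: s_def c_def)
    then have "inv_lin a * r = (inv_lin a * of_pol [:of_int a, 1:]) * of_pol s + c *\<^sub>C inv_lin a"
      by (simp only: 1 of_pol_hom of_pol_const distrib_left mult.assoc scaleC_mult_right mult_1_right)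
    also have "\<dots> = of_pol s + c *\<^sub>C inv_lin a ^ Suc 0" by (simp add: inv_lin_mult)
    also have "\<dots> \<in> cspan pf_gens"
    proof (intro cvec.span_add cvec.span_scale cvec.span_base)
      show "of_pol s \<in> pf_gens" by (simp add: pf_gens_def)
      show "inv_lin a ^ Suc 0 \<in> pf_gens" unfolding pf_gens_def by blast
    qed
    finally show ?thesis .
  next
    case 2
    then show ?thesis by (simp only: inv_lin_power_in_span)
  qed
qed

text \<open>A denominator in \<open>M\<close> is a product of linear factors. They are removed one
  at a time: \<open>inv_lin k\<close> undoes the factor \<open>\<tau> + k\<close> and preserves the
  span.\<close>

lemma pf_span_UNIV: "F \<in> cspan pf_gens"
proof -
  have "F * of_pol q = of_pol p \<Longrightarrow> F \<in> cspan pf_gens" if "q \<in> M" for p q F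
    using that
  proof (induction arbitrary: F rule: M.induct)
    case one
    then show ?case by (auto simp: of_pol_hom pf_gens_def intro: cvec.span_base)
  next
    case (lin q k)
    then have "(F * of_pol [:of_int k, 1:]) * of_pol q = of_pol p"
      by (simp only: of_pol_hom mult.assoc)
    then have "F * of_pol [:of_int k, 1:] \<in> cspan pf_gens" by (rule lin)
    then have "inv_lin k * (F * of_pol [:of_int k, 1:]) \<in> cspan pf_gens" by (rule inv_lin_times_span)
    also have "inv_lin k * (F * of_pol [:of_int k, 1:]) = F * (inv_lin k * of_pol [:of_int k, 1:])"
      by (simp only: mult_ac)
    also have "\<dots> = F" by (simp add: inv_lin_mult)
    finally show ?case .
  qed
  moreover have "\<exists>p q. q \<in> M \<and> F * of_pol q = of_pol p"
  proof -
    obtain p q where pq: "Rep_ratK F = Fract p q" "q \<in> M" using Rep_ratK[of F] by blast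
    then have "F * of_pol q = of_pol p"
      by (simp add: Rep_ratK_inject[symmetric] times_ratK.rep_eq of_pol.rep_eq eq_fract M_nz)
    with pq show ?thesis by blast
  qed
  ultimately show ?thesis by blast
qed

lemma ratK_induct [case_names poly sing add scale]:
  assumes "\<And>p. P (of_pol p)" "\<And>n k. P (inv_lin (- n) ^ Suc k)"
    and "\<And>F G. P F \<Longrightarrow> P G \<Longrightarrow> P (F + G)" "\<And>c F. P F \<Longrightarrow> P (c *\<^sub>C F)"
  shows "P F"
  using pf_span_UNIV[of F]
proof (induction rule: cvec.span_induct_alt)
  case base
  then show ?case using assms(1)[of 0] by (simp add: of_pol_hom)
next
  case (step c x y)
  then have "P x" using assms(1) assms(2)[of "- n" for n] unfolding pf_gens_def by auto
  with step assms(3,4) show ?case by blast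
qed

lemma finite_cc_neg: "finite {(n, k). k < 0 \<and> cc F n k \<noteq> 0}"
proof (induction F rule: ratK_induct)
  case (poly p)
  have "{(n, k). k < 0 \<and> cc (of_pol p) n k \<noteq> 0} = {}" by (auto simp: cc_of_pol_neg)
  then show ?case by (simp only: finite.emptyI)
next
  case (sing n k)
  have "{(m, l). l < 0 \<and> cc (inv_lin (- n) ^ Suc k) m l \<noteq> 0} \<subseteq> {(n, - int (Suc k))}"
  proof clarify
    fix m l :: int assume "l < 0" "cc (inv_lin (- n) ^ Suc k) m l \<noteq> 0"
    moreover have "m = n" using calculation cc_inv_lin_other by metis
    ultimately show "m = n \<and> l = - int (Suc k)"
      by (metis cc_inv_lin_self)
  qed
  then show ?case by (rule finite_subset) simp
next
  case (add F G)
  have "{(n, k). k < 0 \<and> cc (F + G) n k \<noteq> 0}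
    \<subseteq> {(n, k). k < 0 \<and> cc F n k \<noteq> 0} \<union> {(n, k). k < 0 \<and> cc G n k \<noteq> 0}"
    by (auto simp: cc_add)
  then show ?case by (rule finite_subset) (use add in simp)
next
  case (scale c F)
  have "{(n, k). k < 0 \<and> cc (c *\<^sub>C F) n k \<noteq> 0} \<subseteq> {(n, k). k < 0 \<and> cc F n k \<noteq> 0}"
    by (auto simp: cc_scaleC)
  then show ?case by (rule finite_subset) (use scale in simp)
qed

subsection \<open>Distributions given by families of modes\<close>

text \<open>The distributions with rational singularities are those of the form \<open>Lsum d\<close> with \<open>trunc d\<close>:
  the vector \<open>d n k\<close> is the value on \<open>(\<tau> - n)^k\<close> localized at \<open>n\<close>. Without \<open>trunc d\<close> the sum may
  have infinite support, in which case \<^const>\<open>Sum_any\<close> is zero.\<close>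

definition trunc :: "(int \<Rightarrow> int \<Rightarrow> 'v::complex_vector) \<Rightarrow> bool" where
  "trunc d \<longleftrightarrow> finite {(n, k). k \<ge> 0 \<and> d n k \<noteq> 0}"

definition Lsum :: "(int \<Rightarrow> int \<Rightarrow> 'v::complex_vector) \<Rightarrow> ratK \<Rightarrow> 'v" where
  "Lsum d F = Sum_any (\<lambda>(n, k). cc F n k *\<^sub>C d n k)"

lemma finite_Lsum:
  assumes "trunc d"
  shows "finite {(n, k). cc F n k \<noteq> 0 \<and> d n k \<noteq> 0}"
proof (rule finite_subset)
  show "{(n, k). cc F n k \<noteq> 0 \<and> d n k \<noteq> 0}
      \<subseteq> {(n, k). k < 0 \<and> cc F n k \<noteq> 0} \<union> {(n, k). k \<ge> 0 \<and> d n k \<noteq> 0}" by auto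
  show "finite ({(n, k). k < 0 \<and> cc F n k \<noteq> 0} \<union> {(n, k). k \<ge> 0 \<and> d n k \<noteq> 0})"
    using assms finite_cc_neg by (simp add: trunc_def)
qed

lemma finite_Lsum': "trunc d \<Longrightarrow> finite {x. (case x of (n, k) \<Rightarrow> cc F n k *\<^sub>C d n k) \<noteq> 0}"
  by (rule finite_subset[OF _ finite_Lsum[of d F]]) auto

lemma Lsum_superset:
  assumes "finite A" "{(n, k). cc F n k \<noteq> 0 \<and> d n k \<noteq> 0} \<subseteq> A"
  shows "Lsum d F = (\<Sum>(n, k)\<in>A. cc F n k *\<^sub>C d n k)"
  unfolding Lsum_def by (rule Sum_any.expand_superset) (use assms in auto)

lemma Lsum_add: "trunc d \<Longrightarrow> Lsum d (F + G) = Lsum d F + Lsum d G"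
  using Sum_any.distrib[OF finite_Lsum'[of d F] finite_Lsum'[of d G]]
  by (simp add: Lsum_def cc_add scaleC_add_left case_prod_unfold)

lemma Lsum_scaleC:
  assumes "trunc d"
  shows "Lsum d (c *\<^sub>C F) = c *\<^sub>C Lsum d F"
proof -
  let ?A = "{(n, k). cc F n k \<noteq> 0 \<and> d n k \<noteq> 0}"
  have "Lsum d (c *\<^sub>C F) = (\<Sum>(n, k)\<in>?A. cc (c *\<^sub>C F) n k *\<^sub>C d n k)"
    by (rule Lsum_superset) (auto simp: finite_Lsum assms cc_scaleC)
  also have "\<dots> = c *\<^sub>C (\<Sum>(n, k)\<in>?A. cc F n k *\<^sub>C d n k)"
    by (simp add: cc_scaleC cvec.scale_sum_right scaleC_scaleC case_prod_unfold)
  also have "\<dots> = c *\<^sub>C Lsum d F"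
    by (subst Lsum_superset[of ?A]) (auto simp: finite_Lsum assms)
  finally show ?thesis .
qed

lemma clinear_Lsum: "trunc d \<Longrightarrow> clinear (Lsum d)"
  by (simp add: clinear_iff Lsum_add Lsum_scaleC)

lemma trunc_zero [simp]: "trunc (\<lambda>n k. 0)" by (simp add: trunc_def)

lemma trunc_add: "trunc d \<Longrightarrow> trunc e \<Longrightarrow> trunc (\<lambda>n k. d n k + e n k)"
  unfolding trunc_def
  by (rule finite_subset[of _ "{(n, k). k \<ge> 0 \<and> d n k \<noteq> 0} \<union> {(n, k). k \<ge> 0 \<and> e n k \<noteq> 0}"]) auto

lemma trunc_comp: "trunc d \<Longrightarrow> L 0 = 0 \<Longrightarrow> trunc (\<lambda>n k. L (d n k))"
  unfolding trunc_def
  by (rule finite_subset[of _ "{(n, k). k \<ge> 0 \<and> d n k \<noteq> 0}"]) auto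

lemma Lsum_fun_add:
  assumes "trunc d" "trunc e"
  shows "Lsum (\<lambda>n k. d n k + e n k) F = Lsum d F + Lsum e F"
  using Sum_any.distrib[OF finite_Lsum'[of d F] finite_Lsum'[of e F]] assms
  by (simp add: Lsum_def scaleC_add_right case_prod_unfold)

lemma clinear_0: "clinear L \<Longrightarrow> L 0 = 0"
  unfolding clinear_iff by (metis add_cancel_left_left)

lemma clinear_add: "clinear L \<Longrightarrow> L (x + y) = L x + L y"
  and clinear_scaleC: "clinear L \<Longrightarrow> L (c *\<^sub>C x) = c *\<^sub>C L x"
  by (simp_all add: clinear_iff)

lemma clinear_sum: "clinear L \<Longrightarrow> L (sum f A) = (\<Sum>a\<in>A. L (f a))"
  by (induction A rule: infinite_finite_induct) (simp_all add: clinear_0 clinear_add)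

lemma clinear_uminus: "clinear L \<Longrightarrow> L (- x) = - L x"
  using clinear_add[of L x "- x"] by (simp add: clinear_0 eq_neg_iff_add_eq_0 add.commute)

lemma clinear_diff: "clinear L \<Longrightarrow> L (x - y) = L x - L y"
  using clinear_add[of L x "- y"] by (simp add: clinear_uminus)

lemma clinearI: "(\<And>x y. L (x + y) = L x + L y) \<Longrightarrow> (\<And>c x. L (c *\<^sub>C x) = c *\<^sub>C L x) \<Longrightarrow> clinear L"
  by (simp add: clinear_iff)

lemma Lsum_comp:
  assumes "clinear L" "trunc d"
  shows "L (Lsum d F) = Lsum (\<lambda>n k. L (d n k)) F"
proof -
  let ?A = "{(n, k). cc F n k \<noteq> 0 \<and> d n k \<noteq> 0}"
  have "L (Lsum d F) = L (\<Sum>(n, k)\<in>?A. cc F n k *\<^sub>C d n k)"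
    by (subst Lsum_superset[of ?A]) (auto simp: finite_Lsum assms)
  also have "\<dots> = (\<Sum>(n, k)\<in>?A. cc F n k *\<^sub>C L (d n k))"
    using assms(1) by (auto simp: clinear_sum clinear_iff case_prod_unfold)
  also have "\<dots> = Lsum (\<lambda>n k. L (d n k)) F"
    by (rule Lsum_superset[symmetric]) (auto simp: finite_Lsum assms clinear_0)
  finally show ?thesis .
qed

subsection \<open>Closure properties\<close>

lemma scaleC_Sum_any:
  fixes g :: "'a \<Rightarrow> complex"
  assumes "finite {a. g a \<noteq> 0}"
  shows "Sum_any g *\<^sub>C v = Sum_any (\<lambda>a. g a *\<^sub>C (v :: 'v::complex_vector))"
proof -
  have "Sum_any g *\<^sub>C v = (\<Sum>a | g a \<noteq> 0. g a *\<^sub>C v)"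
    by (simp add: Sum_any.expand_set cvec.scale_sum_left)
  also have "\<dots> = Sum_any (\<lambda>a. g a *\<^sub>C v)"
    by (rule Sum_any.expand_superset[symmetric]) (use assms in auto)
  finally show ?thesis .
qed

text \<open>The transpose of multiplication by \<open>H\<close>: the function
  \<open>(\<tau> - n)^k H\<close> is expanded at \<open>n\<close>. The sum is finite for truncated
  \<open>d\<close>, since the poles of \<open>H\<close> bound \<open>l\<close> from below and
  truncation bounds \<open>k + l\<close> from above.\<close>

definition mode_mult :: "ratK \<Rightarrow> (int \<Rightarrow> int \<Rightarrow> 'v::complex_vector) \<Rightarrow> int \<Rightarrow> int \<Rightarrow> 'v" where
  "mode_mult H d n k = Sum_any (\<lambda>l. cc H n l *\<^sub>C d n (k + l))"

lemma finite_mode_mult: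
  assumes "trunc d"
  shows "finite {l. cc H n l *\<^sub>C d n (k + l) \<noteq> 0}"
proof -
  have "{l. cc H n l *\<^sub>C d n (k + l) \<noteq> 0}
    \<subseteq> snd ` {(n, l). l < 0 \<and> cc H n l \<noteq> 0} \<union> (\<lambda>(n, l). l - k) ` {(n, l). l \<ge> 0 \<and> d n l \<noteq> 0} \<union> {0..-k}"
  proof
    fix l assume l: "l \<in> {l. cc H n l *\<^sub>C d n (k + l) \<noteq> 0}"
    then have nz: "cc H n l \<noteq> 0" "d n (k + l) \<noteq> 0" by auto
    consider "l < 0" | "k + l \<ge> 0" | "0 \<le> l" "k + l < 0" by linarith
    then show "l \<in> snd ` {(n, l). l < 0 \<and> cc H n l \<noteq> 0} \<union> (\<lambda>(n, l). l - k) ` {(n, l). l \<ge> 0 \<and> d n l \<noteq> 0} \<union> {0..-k}"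
    proof cases
      case 1 then show ?thesis using nz by force
    next
      case 2
      then have "l = (\<lambda>(n, l). l - k) (n, k + l)" "(n, k + l) \<in> {(n, l). l \<ge> 0 \<and> d n l \<noteq> 0}"
        using nz by auto
      then show ?thesis by blast
    next
      case 3 then show ?thesis by simp
    qed
  qed
  moreover have "finite (snd ` {(n, l). l < 0 \<and> cc H n l \<noteq> 0} \<union> (\<lambda>(n, l). l - k) ` {(n, l). l \<ge> 0 \<and> d n l \<noteq> 0} \<union> {0..-k})"
    using assms finite_cc_neg by (intro finite_UnI finite_imageI) (auto simp: trunc_def)
  ultimately show ?thesis by (rule finite_subset)
qed

lemma trunc_mode_mult:
  assumes "trunc d"
  shows "trunc (mode_mult H d)"
  unfolding trunc_def
proof (rule finite_subset)
  define A where "A = {(n, k). k \<ge> 0 \<and> d n k \<noteq> 0}"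
  define B where "B = {(n, l). l < 0 \<and> cc H n l \<noteq> 0}"
  \<comment> \<open>A nonzero term has \<open>k + l \<le> L\<close> by truncation and
    \<open>m \<le> l\<close> by the order of the poles, hence \<open>k \<le> L - m\<close>; its
    point carries a pole of \<open>H\<close> or a nonnegative mode of \<open>d\<close>.\<close>
  define L where "L = Max (insert 0 (snd ` A))"
  define m where "m = Min (insert 0 (snd ` B))"
  have fin: "finite A" "finite B" using assms finite_cc_neg by (simp_all add: trunc_def A_def B_def)
  show "finite ((fst ` A \<union> fst ` B) \<times> {0..L - m})" using fin by simp
  show "{(n, k). 0 \<le> k \<and> mode_mult H d n k \<noteq> 0} \<subseteq> (fst ` A \<union> fst ` B) \<times> {0..L - m}"
  proof clarify
    fix n k assume k: "0 \<le> k" and "mode_mult H d n k \<noteq> 0"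
    then have "Sum_any (\<lambda>l. cc H n l *\<^sub>C d n (k + l)) \<noteq> 0" by (simp add: mode_mult_def)
    then obtain l where l: "cc H n l *\<^sub>C d n (k + l) \<noteq> 0"
      by (rule Sum_any.not_neutral_obtains_not_neutral)
    then have nz: "cc H n l \<noteq> 0" "d n (k + l) \<noteq> 0" by auto
    have AL: "snd x \<le> L" if "x \<in> A" for x unfolding L_def using fin that by (intro Max_ge) auto
    have L0: "0 \<le> L" unfolding L_def using fin by (intro Max_ge) auto
    have Bm: "m \<le> snd x" if "x \<in> B" for x unfolding m_def using fin that by (intro Min_le) auto
    have m0: "m \<le> 0" unfolding m_def using fin by (intro Min_le) auto
    have "n \<in> fst ` A \<union> fst ` B"
    proof (cases "l < 0")
      case True then have "(n, l) \<in> B" using nz by (simp add: B_def)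
      then show ?thesis by force
    next
      case False then have "(n, k + l) \<in> A" using nz k by (simp add: A_def)
      then show ?thesis by force
    qed
    moreover have "k + l \<le> L"
    proof (cases "k + l \<ge> 0")
      case True then have "(n, k + l) \<in> A" using nz by (simp add: A_def)
      then show ?thesis using AL by force
    next
      case False then show ?thesis using L0 by simp
    qed
    moreover have "m \<le> l"
    proof (cases "l < 0")
      case True then have "(n, l) \<in> B" using nz by (simp add: B_def)
      then show ?thesis using Bm by force
    next
      case False then show ?thesis using m0 by simp
    qed
    ultimately show "n \<in> fst ` A \<union> fst ` B \<and> k \<in> {0..L - m}" using k by auto
  qed
qed

text \<open>Both sides are rearrangements of one triple sum over \<open>n\<close>, \<open>k\<close>,
  \<open>l\<close>, the degrees coming from \<open>F\<close> and from \<open>H\<close>. The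
  constants \<open>a\<close> and \<open>b\<close> bound its support: \<open>a \<le> k\<close>,
  \<open>a \<le> l\<close> and \<open>k + l \<le> b\<close>, so that \<open>k\<close> and
  \<open>l\<close> are at most \<open>b - a\<close>.\<close>

lemma Lsum_mult:
  assumes d: "trunc d"
  shows "Lsum d (H * F) = Lsum (mode_mult H d) F"
proof -
  let ?g = "\<lambda>(n, k, l). (cc F n k * cc H n l) *\<^sub>C d n (k + l)"
  define A where "A = {(n, k). k \<ge> 0 \<and> d n k \<noteq> 0}"
  define B where "B = {(n, l). l < 0 \<and> cc H n l \<noteq> 0}"
  define C where "C = {(n, k). k < 0 \<and> cc F n k \<noteq> 0}"
  define N where "N = fst ` A \<union> fst ` B \<union> fst ` C"
  define b where "b = Max (insert 0 (snd ` A))"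
  define a where "a = min (Min (insert 0 (snd ` B))) (Min (insert 0 (snd ` C)))"
  have fin: "finite A" "finite B" "finite C"
    using d finite_cc_neg by (simp_all add: trunc_def A_def B_def C_def)
  define S where "S = N \<times> {2 * a..b - 2 * a} \<times> {2 * a..b - 2 * a}"
  have finS: "finite S" using fin by (simp add: S_def N_def)
  have bound: "a \<le> k \<and> a \<le> l \<and> k + l \<le> b \<and> a \<le> 0 \<and> 0 \<le> b \<and> n \<in> N"
    if nz: "cc F n k \<noteq> 0" "cc H n l \<noteq> 0" "d n (k + l) \<noteq> 0" for n k l
  proof -
    have AL: "snd x \<le> b" if "x \<in> A" for x unfolding b_def using fin that by (intro Max_ge) auto
    have b0: "0 \<le> b" unfolding b_def using fin by (intro Max_ge) auto
    have Ba: "a \<le> snd x" if "x \<in> B" for x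
      unfolding a_def using fin that by (intro min.coboundedI1 Min_le) auto
    have Ca: "a \<le> snd x" if "x \<in> C" for x
      unfolding a_def using fin that by (intro min.coboundedI2 Min_le) auto
    have a0: "a \<le> 0" unfolding a_def using fin by (intro min.coboundedI1 Min_le) auto
    have "a \<le> k" using Ca[of "(n, k)"] nz a0 by (cases "k < 0") (auto simp: C_def)
    moreover have "a \<le> l" using Ba[of "(n, l)"] nz a0 by (cases "l < 0") (auto simp: B_def)
    moreover have "k + l \<le> b" using AL[of "(n, k + l)"] nz b0 by (cases "k + l < 0") (auto simp: A_def)
    moreover have "n \<in> N"
    proof -
      consider "k < 0" | "l < 0" | "k + l \<ge> 0" by linarith
      then have "(n, k) \<in> C \<or> (n, l) \<in> B \<or> (n, k + l) \<in> A"
        by cases (use nz in \<open>auto simp: A_def B_def C_def\<close>)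
      then show ?thesis by (force simp: N_def)
    qed
    ultimately show ?thesis using a0 b0 by simp
  qed
  have L: "Lsum d (H * F) = Sum_any ?g"
  proof -
    have "cc (H * F) n k *\<^sub>C d n k = Sum_any (\<lambda>l. (cc F n (k - l) * cc H n l) *\<^sub>C d n k)" for n k
      unfolding cc_mult by (subst scaleC_Sum_any[OF finite_cc_mult]) (simp add: mult.commute)
    then have "Lsum d (H * F) = Sum_any (\<lambda>(n, k). Sum_any (\<lambda>l. (cc F n (k - l) * cc H n l) *\<^sub>C d n k))"
      by (simp add: Lsum_def)
    also have "\<dots> = Sum_any (\<lambda>(n, k, l). (cc F n (k - l) * cc H n l) *\<^sub>C d n k)"
    proof (rule Sum_any.cartesian_product2)
      show "finite ((N \<times> {2 * a..b}) \<times> {a..b - a})" using fin by (simp add: N_def)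
      show "{(n, k). \<exists>l. (cc F n (k - l) * cc H n l) *\<^sub>C d n k \<noteq> 0} \<times>
          {l. \<exists>n k. (cc F n (k - l) * cc H n l) *\<^sub>C d n k \<noteq> 0} \<subseteq> (N \<times> {2 * a..b}) \<times> {a..b - a}"
        using bound[of n "k - l" l for n k l] by fastforce
    qed
    also have "\<dots> = Sum_any ?g"
    proof (rule Sum_any.reindex_cong[symmetric])
      show "bij (\<lambda>(n::int, k::int, l). (n, k - l, l))"
        by (rule bij_betwI[where g = "\<lambda>(n, k, l). (n, k + l, l)"]) auto
    qed auto
    finally show ?thesis .
  qed
  have "Lsum (mode_mult H d) F = Sum_any ?g"
  proof -
    have "cc F n k *\<^sub>C mode_mult H d n k = Sum_any (\<lambda>l. (cc F n k * cc H n l) *\<^sub>C d n (k + l))" for n k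
    proof -
      let ?S = "{l. cc H n l *\<^sub>C d n (k + l) \<noteq> 0}"
      have "cc F n k *\<^sub>C mode_mult H d n k = cc F n k *\<^sub>C (\<Sum>l\<in>?S. cc H n l *\<^sub>C d n (k + l))"
        unfolding mode_mult_def by (simp only: Sum_any.expand_set)
      also have "\<dots> = (\<Sum>l\<in>?S. (cc F n k * cc H n l) *\<^sub>C d n (k + l))"
        by (simp only: cvec.scale_sum_right scaleC_scaleC)
      also have "\<dots> = Sum_any (\<lambda>l. (cc F n k * cc H n l) *\<^sub>C d n (k + l))"
        by (rule Sum_any.expand_superset[symmetric, OF finite_mode_mult[OF d]]) auto
      finally show ?thesis .
    qed
    then have "Lsum (mode_mult H d) F = Sum_any (\<lambda>(n, k). Sum_any (\<lambda>l. (cc F n k * cc H n l) *\<^sub>C d n (k + l)))"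
      by (simp add: Lsum_def)
    also have "\<dots> = Sum_any ?g"
    proof (rule Sum_any.cartesian_product2)
      show "finite ((N \<times> {a..b - a}) \<times> {a..b - a})" using fin by (simp add: N_def)
      show "{(n, k). \<exists>l. (cc F n k * cc H n l) *\<^sub>C d n (k + l) \<noteq> 0} \<times>
          {l. \<exists>n k. (cc F n k * cc H n l) *\<^sub>C d n (k + l) \<noteq> 0} \<subseteq> (N \<times> {a..b - a}) \<times> {a..b - a}"
        using bound by fastforce
    qed
    finally show ?thesis .
  qed
  with L show ?thesis by simp
qed

lemma trunc_shift: "trunc d \<Longrightarrow> trunc (\<lambda>n k. d (n - a) k)"
  unfolding trunc_def
proof (rule finite_subset)
  show "{(n, k). 0 \<le> k \<and> d (n - a) k \<noteq> 0} \<subseteq> (\<lambda>(n, k). (n + a, k)) ` {(n, k). k \<ge> 0 \<and> d n k \<noteq> 0}"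
    by (force simp: image_def)
qed simp

lemma Lsum_shift: "Lsum d (shift a F) = Lsum (\<lambda>n k. d (n - a) k) F"
  unfolding Lsum_def cc_shift
  by (rule Sum_any.reindex_cong[where l = "\<lambda>(n, k). (n + a, k)", symmetric])
    (auto intro!: bij_betwI[where g = "\<lambda>(n, k). (n - a, k)"])

text \<open>Away from its pole the function has only nonnegative coefficients, which
  \<open>d\<close> does not see; at the pole it is a single power.\<close>

lemma Lsum_inv_lin:
  assumes "trunc d" "\<And>n k. k \<ge> 0 \<Longrightarrow> d n k = 0"
  shows "Lsum d (inv_lin (- n) ^ Suc k) = d n (- int (Suc k))"
proof -
  have "Lsum d (inv_lin (- n) ^ Suc k)
      = (\<Sum>(m, l)\<in>{(n, - int (Suc k))}. cc (inv_lin (- n) ^ Suc k) m l *\<^sub>C d m l)"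
  proof (rule Lsum_superset)
    show "{(m, l). cc (inv_lin (- n) ^ Suc k) m l \<noteq> 0 \<and> d m l \<noteq> 0} \<subseteq> {(n, - int (Suc k))}"
    proof clarify
      fix m l assume a: "cc (inv_lin (- n) ^ Suc k) m l \<noteq> 0" "d m l \<noteq> 0"
      then have "l < 0" using assms(2)[of l m] by (cases "l < 0") auto
      with a have "m = n" using cc_inv_lin_other by metis
      with a show "m = n \<and> l = - int (Suc k)" by (metis cc_inv_lin_self)
    qed
  qed simp
  then show ?thesis by (simp add: cc_inv_lin_self scaleC_one del: power_Suc)
qed

lemma Lsum_of_pol: "(\<And>n k. k \<ge> 0 \<Longrightarrow> d n k = 0) \<Longrightarrow> Lsum d (of_pol p) = 0"
proof -
  assume "\<And>n k. k \<ge> 0 \<Longrightarrow> d n k = 0"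
  then have "Lsum d (of_pol p) = (\<Sum>(n, k)\<in>{}. cc (of_pol p) n k *\<^sub>C d n k)"
    by (intro Lsum_superset) (auto, metis cc_of_pol_neg not_le)
  then show ?thesis by simp
qed

lemma clinear_ratK_eqI:
  assumes "clinear D" "clinear E" "\<And>p. D (of_pol p) = E (of_pol p)"
    and "\<And>n k. D (inv_lin (- n) ^ Suc k) = E (inv_lin (- n) ^ Suc k)"
  shows "D F = E F"
  by (induction F rule: ratK_induct) (use assms in \<open>auto simp: clinear_iff simp del: power_Suc\<close>)

text \<open>Truncation restricts only the nonnegative modes, so the negative ones can be prescribed
  freely on the basis of the singular part.\<close>

lemma Lsum_of_vanishing:
  assumes "clinear D" "\<And>p. D (of_pol p) = 0"
  defines "d \<equiv> \<lambda>n k. if k < 0 then D (inv_lin (- n) ^ nat (- k)) else 0"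
  shows "trunc d" "D F = Lsum d F"
proof -
  show t: "trunc d" by (simp add: trunc_def d_def)
  show "D F = Lsum d F"
  proof (rule clinear_ratK_eqI[OF assms(1) clinear_Lsum[OF t]])
    show "D (of_pol p) = Lsum d (of_pol p)" for p
      by (subst Lsum_of_pol) (auto simp: assms(2) d_def)
    show "D (inv_lin (- n) ^ Suc k) = Lsum d (inv_lin (- n) ^ Suc k)" for n k
      by (subst Lsum_inv_lin[OF t]) (auto simp: d_def nat_add_distrib simp del: power_Suc)
  qed
qed

lemma Kpol_iff: "F \<in> Kpol \<longleftrightarrow> (\<forall>n k. k < 0 \<longrightarrow> cc F n k = 0)"
proof
  assume "F \<in> Kpol"
  then show "\<forall>n k. k < 0 \<longrightarrow> cc F n k = 0" by (auto simp: cc_of_pol_neg)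
next
  \<comment> \<open>With these modes \<open>Lsum e F\<close> is the sum of the principal parts of
    \<open>F\<close>.\<close>
  define e where "e = (\<lambda>n k. if k < 0 then inv_lin (- n) ^ nat (- k) else 0)"
  have t: "trunc e" by (simp add: trunc_def e_def)
  have "F - Lsum e F \<in> Kpol"
  proof (induction F rule: ratK_induct)
    case (poly p)
    have "Lsum e (of_pol p) = 0" by (rule Lsum_of_pol) (simp add: e_def)
    then show ?case by simp
  next
    case (sing n k)
    have "Lsum e (inv_lin (- n) ^ Suc k) = inv_lin (- n) ^ Suc k"
      by (subst Lsum_inv_lin[OF t]) (auto simp: e_def nat_add_distrib simp del: power_Suc)
    then show ?case by (simp del: power_Suc add: Kpol_zero del: image_iff)
  next
    case (add F G)
    have "F + G - Lsum e (F + G) = (F - Lsum e F) + (G - Lsum e G)" by (simp add: Lsum_add t)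
    with add show ?case by (simp only: Kpol_add)
  next
    case (scale c F)
    have "c *\<^sub>C F - Lsum e (c *\<^sub>C F) = c *\<^sub>C (F - Lsum e F)"
      by (simp add: Lsum_scaleC t cvec.scale_right_diff_distrib)
    with scale show ?case by (simp only: Kpol_scaleC)
  qed
  moreover assume "\<forall>n k. k < 0 \<longrightarrow> cc F n k = 0"
  then have "Lsum e F = (\<Sum>(n, k)\<in>{}. cc F n k *\<^sub>C e n k)"
    by (intro Lsum_superset) (auto simp: e_def)
  ultimately show "F \<in> Kpol" by simp
qed

subsection \<open>Uniqueness of modes\<close>

text \<open>Modes are recovered by evaluating at functions that agree with \<open>(\<tau> - n)^k\<close> to high order at
  \<open>n\<close> and vanish to high order at the finitely many other relevant points.\<close>

definition vanish_poly :: "int set \<Rightarrow> nat \<Rightarrow> complex poly" where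
  "vanish_poly A N = (\<Prod>a\<in>A. [:- of_int a, 1:] ^ N)"

lemma M_prod: "finite A \<Longrightarrow> (\<And>a. a \<in> A \<Longrightarrow> f a \<in> M) \<Longrightarrow> prod f A \<in> M"
  by (induction A rule: finite_induct) (auto intro: M.one M_mult)

lemma M_power: "p \<in> M \<Longrightarrow> p ^ k \<in> M"
  by (induction k) (auto intro: M.one M_mult)

lemma lin_in_M: "[:- of_int a, 1:] \<in> M"
  using M.lin[OF M.one, of "- a"] by simp

lemma vanish_poly_M: "finite A \<Longrightarrow> vanish_poly A N \<in> M"
  unfolding vanish_poly_def by (intro M_prod M_power lin_in_M)

lemma poly_fls_lin_power: "poly_fls ([:- a, 1:] ^ N) a = fls_X ^ N"
proof (induction N)
  case (Suc N)
  have "poly_fls ([:- a, 1:] ^ Suc N) a = poly_fls [:- a, 1:] a * poly_fls ([:- a, 1:] ^ N) a"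
    by (simp only: power_Suc poly_fls_hom)
  with Suc show ?case by (simp only: poly_fls_lin) simp
qed (simp add: poly_fls_hom)

lemma Sum_any_0I: "(\<And>a. g a = 0) \<Longrightarrow> Sum_any g = 0"
  by simp

lemma cc_vanish_poly_mult:
  assumes A: "finite A" "m \<in> A" and reg: "\<And>k. k < 0 \<Longrightarrow> cc F m k = 0" and l: "l < int N"
  shows "cc (of_pol (vanish_poly A N) * F) m l = 0"
proof -
  have "vanish_poly A N = [:- of_int m, 1:] ^ N * vanish_poly (A - {m}) N"
    unfolding vanish_poly_def using A by (simp add: prod.remove)
  then have "laurent (of_pol (vanish_poly A N) * F) m
      = fls_X ^ N * (poly_fls (vanish_poly (A - {m}) N) (of_int m) * laurent F m)"
    by (simp add: laurent_hom laurent_of_pol poly_fls_hom poly_fls_lin_power mult_ac)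
  moreover have "(poly_fls (vanish_poly (A - {m}) N) (of_int m) * laurent F m) $$ k = 0" if "k < 0" for k
  proof -
    have "cc (of_pol (vanish_poly (A - {m}) N) * F) m k = 0"
      unfolding cc_mult
      by (rule trans[OF Sum_any.cong[of _ "\<lambda>_. 0"]])
        (use that in \<open>auto, metis cc_of_pol_neg reg diff_less_0_iff_less less_trans not_less_iff_gr_or_eq\<close>)
    then show ?thesis by (simp add: cc_def laurent_hom laurent_of_pol)
  qed
  ultimately show ?thesis using l
    by (simp add: cc_def fls_X_power_times_conv_shift)
qed

text \<open>Divide \<open>(\<tau> - n)^k\<close> by the vanishing polynomial, keep the principal
  part \<open>S\<close> of the quotient at \<open>n\<close>, and multiply back. At \<open>n\<close>
  the error is the polynomial times a power series, hence of order at least \<open>N\<close>; at the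
  other points of \<open>A\<close> the polynomial vanishes to order \<open>N\<close> and
  \<open>S\<close> is regular; elsewhere both factors are regular.\<close>

lemma approximant:
  assumes A: "finite A" "n \<in> A"
  obtains P where "\<And>m l. m \<in> A \<Longrightarrow> l < int N \<Longrightarrow> cc P m l = (if m = n \<and> l = k then 1 else 0)"
    "\<And>m l. m \<notin> A \<Longrightarrow> l < 0 \<Longrightarrow> cc P m l = 0"
    "k \<ge> 0 \<Longrightarrow> P \<in> Kpol"
proof -
  let ?p = "of_pol (vanish_poly A N)"
  define g where "g = fls_X_intpow k / laurent ?p n"
  define J where "J = nat (- fls_subdegree g)"
  define S where "S = (\<Sum>j<J. (g $$ (- int (Suc j))) *\<^sub>C inv_lin (- n) ^ Suc j)"
  have cS: "cc S m l = (\<Sum>j<J. g $$ (- int (Suc j)) * cc (inv_lin (- n) ^ Suc j) m l)" for m l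
    unfolding S_def by (induction J) (simp_all add: cc_add cc_scaleC del: power_Suc)
  have S1: "cc S m l = 0" if "m \<noteq> n" "l < 0" for m l
    unfolding cS using that by (intro sum.neutral) (metis cc_inv_lin_other mult_zero_right)
  have S2: "cc S n l = g $$ l" if l: "l < 0" for l
  proof (cases "nat (- l - 1) < J")
    case True
    have "cc S n l = (\<Sum>j<J. if j = nat (- l - 1) then g $$ l else 0)"
      unfolding cS cc_inv_lin_self using l by (intro sum.cong) auto
    then show ?thesis using True by simp
  next
    case False
    then have "g $$ l = 0" using l by (intro fls_eq0_below_subdegree) (auto simp: J_def)
    moreover have "cc S n l = 0"
      unfolding cS cc_inv_lin_self using False l by (intro sum.neutral) auto
    ultimately show ?thesis by simp
  qed
  have pnz: "laurent ?p n \<noteq> 0" using vanish_poly_M[OF A(1)] by (simp add: laurent_of_pol M_nz)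
  define P where "P = ?p * S"
  have Pm: "cc P m l = 0" if "m \<in> A" "m \<noteq> n" "l < int N" for m l
    unfolding P_def by (rule cc_vanish_poly_mult) (use A that S1 in auto)
  have Pn: "cc P n l = (if l = k then 1 else 0)" if l: "l < int N" for l
  proof -
    have "vanish_poly A N = [:- of_int n, 1:] ^ N * vanish_poly (A - {n}) N"
      unfolding vanish_poly_def using A by (simp add: prod.remove)
    then have e: "laurent ?p n = fls_X ^ N * poly_fls (vanish_poly (A - {n}) N) (of_int n)"
      by (simp add: laurent_of_pol poly_fls_hom poly_fls_lin_power)
    have "laurent P n = laurent ?p n * g + laurent ?p n * (laurent S n - g)"
      by (simp add: P_def laurent_hom algebra_simps)
    also have "laurent ?p n * g = fls_X_intpow k" using pnz by (simp add: g_def)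
    finally have "cc P n l = (fls_X_intpow k :: complex fls) $$ l + (laurent ?p n * (laurent S n - g)) $$ l"
      by (simp add: cc_def)
    moreover have "(laurent ?p n * (laurent S n - g)) $$ l = 0"
    proof -
      define h where "h = poly_fls (vanish_poly (A - {n}) N) (of_int n) * (laurent S n - g)"
      have "h $$ i = 0" if "i < 0" for i
      proof -
        have "poly_fls (vanish_poly (A - {n}) N) (of_int n) $$ j * (laurent S n - g) $$ (i - j) = 0" for j
          using that S2[of "i - j"] by (cases "j < 0") (auto simp: poly_fls_nth_neg cc_def)
        then show ?thesis unfolding h_def fls_mult_nth_Sum_any by (rule Sum_any_0I)
      qed
      moreover have "laurent ?p n * (laurent S n - g) = fls_X ^ N * h" by (simp add: e h_def mult.assoc)
      ultimately show ?thesis using l by (simp add: fls_X_power_times_conv_shift)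
    qed
    ultimately show ?thesis by simp
  qed
  have Po: "cc P m l = 0" if "m \<noteq> n" "l < 0" for m l
  proof -
    have "cc ?p m j * cc S m (l - j) = 0" for j
      using that S1[of m "l - j"] by (cases "j < 0") (auto simp: cc_of_pol_neg)
    then show ?thesis unfolding P_def cc_mult by (rule Sum_any_0I)
  qed
  have "P \<in> Kpol" if "k \<ge> 0"
    unfolding Kpol_iff
  proof clarify
    fix m l :: int assume l: "l < 0"
    show "cc P m l = 0"
    proof (cases "m = n")
      case True then show ?thesis using Pn[of l] l that by simp
    next
      case False then show ?thesis using Po l by simp
    qed
  qed
  moreover have "cc P m l = (if m = n \<and> l = k then 1 else 0)" if "m \<in> A" "l < int N" for m l
    using Pm[OF that(1) _ that(2)] Pn[OF that(2)] by (cases "m = n") auto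
  moreover have "cc P m l = 0" if "m \<notin> A" "l < 0" for m l using Po that A(2) by metis
  ultimately show ?thesis by (intro that[of P])
qed

lemma Lsum_approximant:
  assumes "trunc d"
  obtains P where "Lsum d P = d n k" "k \<ge> 0 \<Longrightarrow> P \<in> Kpol"
proof -
  define B where "B = {(n, k). k \<ge> 0 \<and> d n k \<noteq> 0}"
  \<comment> \<open>All nonnegative modes of \<open>d\<close> lie at points of \<open>A\<close> and
    in degrees below \<open>N\<close>. So neither the regular part of \<open>P\<close> outside
    \<open>A\<close> nor its coefficients of degree at least \<open>N\<close> are seen by
    \<open>d\<close>.\<close>
  define A where "A = insert n (fst ` B)"
  define N where "N = nat (Max (insert k (insert 0 (snd ` B))) + 1)"
  have fB: "finite B" using assms by (simp add: trunc_def B_def)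
  have N: "k < int N" "\<And>x. x \<in> B \<Longrightarrow> snd x < int N"
  proof -
    have *: "y \<le> Max (insert k (insert 0 (snd ` B)))" if "y \<in> insert k (insert 0 (snd ` B))" for y
      using fB that by (intro Max_ge) auto
    show "k < int N" using *[of k] by (simp add: N_def)
    show "snd x < int N" if "x \<in> B" for x using *[of "snd x"] that by (simp add: N_def)
  qed
  have "finite A" "n \<in> A" using fB by (simp_all add: A_def)
  then obtain P where P: "\<And>m l. m \<in> A \<Longrightarrow> l < int N \<Longrightarrow> cc P m l = (if m = n \<and> l = k then 1 else 0)"
    "\<And>m l. m \<notin> A \<Longrightarrow> l < 0 \<Longrightarrow> cc P m l = 0" "k \<ge> 0 \<Longrightarrow> P \<in> Kpol"
    using approximant[of A n N k] by blast
  have "Lsum d P = (\<Sum>(m, l)\<in>{(n, k)}. cc P m l *\<^sub>C d m l)"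
  proof (rule Lsum_superset)
    show "{(m, l). cc P m l \<noteq> 0 \<and> d m l \<noteq> 0} \<subseteq> {(n, k)}"
    proof clarify
      fix m l assume a: "cc P m l \<noteq> 0" "d m l \<noteq> 0"
      have "m \<in> A"
      proof (rule ccontr)
        assume "m \<notin> A"
        then have "l \<ge> 0" using P(2)[of m l] a by force
        then have "(m, l) \<in> B" using a by (simp add: B_def)
        then show False using \<open>m \<notin> A\<close> by (force simp: A_def)
      qed
      moreover have "l < int N"
        using N(2)[of "(m, l)"] a by (cases "l \<ge> 0") (auto simp: B_def)
      ultimately show "m = n \<and> l = k" using P(1)[of m l] a by (auto split: if_splits)
    qed
  qed simp
  also have "\<dots> = d n k"
    using P(1)[of n k] N(1) \<open>n \<in> A\<close> by (simp add: scaleC_one)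
  finally show ?thesis using P(3) by (rule that)
qed

lemma Lsum_inject:
  assumes "trunc d" "trunc e" "\<And>F. Lsum d F = Lsum e F"
  shows "d = e"
proof (intro ext)
  fix n k
  let ?f = "\<lambda>n k. d n k + (- e n k)"
  have t: "trunc (\<lambda>n k. - e n k)" by (rule trunc_comp[OF assms(2), of uminus]) simp
  have "clinear (uminus :: 'a \<Rightarrow> 'a)" by (rule clinearI) (auto simp: cvec.scale_minus_right)
  then have "Lsum ?f F = 0" for F
    by (simp add: Lsum_fun_add[OF assms(1) t] assms(3) Lsum_comp[OF _ assms(2), symmetric] del: add_uminus_conv_diff)
  moreover obtain P where "Lsum ?f P = ?f n k"
    using Lsum_approximant[OF trunc_add[OF assms(1) t], of n k] by blast
  ultimately show "d n k = e n k" by simp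
qed

text \<open>For \<open>k \<ge> 0\<close> the approximant is itself a polynomial, so the restriction
  to polynomials determines the modes that a singular kernel records.\<close>

lemma Lsum_inject_Kpol:
  assumes "trunc d" "trunc e" "\<And>F. F \<in> Kpol \<Longrightarrow> Lsum d F = Lsum e F" "k \<ge> 0"
  shows "d n k = e n k"
proof -
  let ?f = "\<lambda>n k. d n k + (- e n k)"
  have t: "trunc (\<lambda>n k. - e n k)" by (rule trunc_comp[OF assms(2), of uminus]) simp
  have "clinear (uminus :: 'a \<Rightarrow> 'a)" by (rule clinearI) (auto simp: cvec.scale_minus_right)
  then have "Lsum ?f F = 0" if "F \<in> Kpol" for F
    by (simp add: Lsum_fun_add[OF assms(1) t] assms(3)[OF that] Lsum_comp[OF _ assms(2), symmetric] del: add_uminus_conv_diff)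
  moreover obtain P where "Lsum ?f P = ?f n k" "P \<in> Kpol"
    using Lsum_approximant[OF trunc_add[OF assms(1) t], of n k] assms(4) by blast
  ultimately show ?thesis by simp
qed

definition modal :: "(ratK \<Rightarrow> 'v::complex_vector) \<Rightarrow> bool" where
  "modal D \<longleftrightarrow> (\<exists>d. trunc d \<and> D = Lsum d)"

definition modes :: "(ratK \<Rightarrow> 'v::complex_vector) \<Rightarrow> int \<Rightarrow> int \<Rightarrow> 'v" where
  "modes D = (THE d. trunc d \<and> D = Lsum d)"

lemma modes_Lsum: "trunc d \<Longrightarrow> modes (Lsum d) = d"
  unfolding modes_def by (rule the_equality) (auto intro: Lsum_inject dest: fun_cong)

lemma modal_modes:
  assumes "modal D"
  shows "trunc (modes D)" "D = Lsum (modes D)"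
  using assms modes_Lsum unfolding modal_def by metis+

lemma modesI: "trunc d \<Longrightarrow> (\<And>F. D F = Lsum d F) \<Longrightarrow> modal D \<and> modes D = d"
  using modes_Lsum[of d] unfolding modal_def by (metis ext)

section \<open>The universal property of the induced module\<close>

text \<open>The targets of the universal property are subspaces of larger types, such as
  \<open>Yspace\<close>, and linearity of the operators is asserted only there.\<close>

definition clin_on :: "'a::complex_vector set \<Rightarrow> ('a \<Rightarrow> 'b::complex_vector) \<Rightarrow> bool" where
  "clin_on S L \<longleftrightarrow> (\<forall>x\<in>S. \<forall>y\<in>S. L (x + y) = L x + L y) \<and> (\<forall>c. \<forall>x\<in>S. L (c *\<^sub>C x) = c *\<^sub>C L x)"

abbreviation csubspace :: "'a::complex_vector set \<Rightarrow> bool" where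
  "csubspace \<equiv> module.subspace scaleC"

lemma clin_on_0: "clin_on S L \<Longrightarrow> csubspace S \<Longrightarrow> L 0 = 0"
  unfolding clin_on_def by (metis cvec.subspace_0 cvec.scale_zero_left)

lemma clin_on_sum:
  assumes "clin_on S L" "csubspace S" "\<And>a. a \<in> A \<Longrightarrow> f a \<in> S"
  shows "L (sum f A) = (\<Sum>a\<in>A. L (f a))"
  using assms(3)
proof (induction A rule: infinite_finite_induct)
  case (insert a A)
  then have "sum f A \<in> S" using assms(2) by (intro cvec.subspace_sum) auto
  then show ?case using insert assms(1) by (simp add: clin_on_def)
qed (simp_all add: clin_on_0[OF assms(1,2)])

lemma Lsum_in_subspace:
  assumes "csubspace S" "\<And>n k. d n k \<in> S"
  shows "Lsum d F \<in> S"
  unfolding Lsum_def Sum_any.expand_set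
  by (intro cvec.subspace_sum assms) (auto intro: cvec.subspace_scale assms)

lemma Lsum_comp_on:
  assumes "csubspace S" "clin_on S L" "trunc d" "\<And>n k. d n k \<in> S"
  shows "L (Lsum d F) = Lsum (\<lambda>n k. L (d n k)) F"
proof -
  let ?A = "{(n, k). cc F n k \<noteq> 0 \<and> d n k \<noteq> 0}"
  have "L (Lsum d F) = L (\<Sum>(n, k)\<in>?A. cc F n k *\<^sub>C d n k)"
    by (subst Lsum_superset[of ?A]) (auto simp: finite_Lsum assms)
  also have "\<dots> = (\<Sum>(n, k)\<in>?A. L (cc F n k *\<^sub>C d n k))"
    by (subst clin_on_sum[OF assms(2,1)]) (auto intro!: cvec.subspace_scale assms sum.cong)
  also have "\<dots> = (\<Sum>(n, k)\<in>?A. cc F n k *\<^sub>C L (d n k))"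
    using assms(2,4) by (intro sum.cong) (auto simp: clin_on_def)
  also have "\<dots> = Lsum (\<lambda>n k. L (d n k)) F"
    by (rule Lsum_superset[symmetric]) (auto simp: finite_Lsum assms clin_on_0[OF assms(2,1)])
  finally show ?thesis .
qed

lemma Lsum_fun_scaleC:
  assumes "trunc d"
  shows "Lsum (\<lambda>n k. c *\<^sub>C d n k) F = c *\<^sub>C Lsum d F"
  by (rule Lsum_comp[symmetric, OF _ assms]) (auto intro!: clinearI simp: scaleC_add_right scaleC_scaleC mult.commute)

lemma Lsum_fun_uminus: "trunc d \<Longrightarrow> Lsum (\<lambda>n k. - d n k) F = - Lsum d F"
  by (rule Lsum_comp[symmetric]) (auto intro!: clinearI simp: cvec.scale_minus_right)

lemma trunc_uminus: "trunc d \<Longrightarrow> trunc (\<lambda>n k. - d n k)"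
  by (rule trunc_comp[of d uminus]) simp_all

lemma trunc_diff: "trunc d \<Longrightarrow> trunc e \<Longrightarrow> trunc (\<lambda>n k. d n k - e n k)"
  using trunc_add[OF _ trunc_uminus, of d e] by simp

lemma Lsum_fun_diff:
  "trunc d \<Longrightarrow> trunc e \<Longrightarrow> Lsum (\<lambda>n k. d n k - e n k) F = Lsum d F - Lsum e F"
  using Lsum_fun_add[OF _ trunc_uminus, of d e F] by (simp add: Lsum_fun_uminus)

lemma Lsum_diff: "trunc d \<Longrightarrow> Lsum d (F - G) = Lsum d F - Lsum d G"
  by (rule clinear_diff[OF clinear_Lsum])

lemma Lsum_uminus: "trunc d \<Longrightarrow> Lsum d (- F) = - Lsum d F"
  by (rule clinear_uminus[OF clinear_Lsum])

lemma Lsum_arg_zero [simp]: "Lsum d 0 = 0"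
  by (simp add: Lsum_def)

lemma Lsum_fun_zero [simp]: "Lsum (\<lambda>n k. 0) F = 0"
  by (simp add: Lsum_def)

lemma abs_uea_hom:
  "abs_uea (f + g) = abs_uea f + abs_uea g" "abs_uea (c *\<^sub>C f) = c *\<^sub>C abs_uea f"
  "abs_uea (f * g) = abs_uea f * abs_uea g" "abs_uea 1 = 1" "abs_uea 0 = 0"
  "abs_uea (gen x) = uea_incl x"
  by (simp_all add: plus_uea.abs_eq scaleC_uea.abs_eq times_uea.abs_eq one_uea_def zero_uea_def uea_incl_def)

lemma uea_induct [case_names one mult add scale]:
  assumes "P 1" "\<And>x u. P u \<Longrightarrow> P (uea_incl x * u)"
    "\<And>u v. P u \<Longrightarrow> P v \<Longrightarrow> P (u + v)" "\<And>c u. P u \<Longrightarrow> P (c *\<^sub>C u)"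
  shows "P (u :: 'g::complex_lie_algebra uea)"
proof -
  have w: "P (abs_uea (Poly_Mapping.single (FWord xs) 1))" for xs :: "'g list"
  proof (induction xs)
    case Nil
    have "Poly_Mapping.single (FWord []) (1::complex) = (1 :: 'g fword \<Rightarrow>\<^sub>0 complex)"
      by (simp flip: single_one add: zero_fword_def)
    then show ?case using assms(1) by (simp add: abs_uea_hom)
  next
    case (Cons x xs)
    have "Poly_Mapping.single (FWord (x # xs)) (1::complex) = gen x * Poly_Mapping.single (FWord xs) 1"
      by (simp add: mult_single plus_fword_def)
    then show ?case using assms(2)[OF Cons] by (simp add: abs_uea_hom)
  qed
  obtain f where "u = abs_uea f" by (metis Quotient3_abs_rep[OF Quotient3_uea])
  moreover have "P (abs_uea f)"
  proof (induction f rule: poly_mapping_single_induct)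
    case zero
    then show ?case using assms(4)[OF assms(1), of 0] by (simp add: abs_uea_hom)
  next
    case (single k v)
    have "abs_uea (Poly_Mapping.single k v) = v *\<^sub>C abs_uea (Poly_Mapping.single (FWord (letters k)) 1)"
      by (metis abs_uea_hom(2) single_eq_scaleC fword.collapse)
    then show ?case by (metis assms(4) w fword.collapse)
  next
    case (add f g)
    then show ?case using assms(3) by (simp add: abs_uea_hom)
  qed
  ultimately show ?thesis by simp
qed

lemma vtensor_rel:
  assumes "x - y \<in> vtoda_rels"
  shows "abs_vtoda x = abs_vtoda y"
  using assms by (simp add: vtoda.abs_eq_iff cvec.span_base)

lemma vtensor_add_left: "vtensor (a + a') n = vtensor a n + vtensor a' n"
  unfolding vtensor_def plus_vtoda.abs_eq map_fun_apply id_apply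
  by (rule vtensor_rel) (use balanced_relsI(1) in \<open>simp add: diff_diff_eq\<close>)

lemma vtensor_scale_left: "vtensor (c *\<^sub>C a) n = c *\<^sub>C vtensor a n"
  unfolding vtensor_def scaleC_vtoda.abs_eq map_fun_apply id_apply
  by (rule vtensor_rel) (rule balanced_relsI(3))

lemma vtensor_scale_right: "vtensor a (c * n) = c *\<^sub>C vtensor a n"
  unfolding vtensor_def scaleC_vtoda.abs_eq map_fun_apply id_apply
  by (rule vtensor_rel) (metis balanced_relsI(4) scaleC_complex_def)

lemma vtensor_balanced: "vtensor (a * uann_incl r) n = vtensor a (uann_triv r * n)"
  unfolding vtensor_def map_fun_apply id_apply
  by (rule vtensor_rel) (rule balanced_relsI(5)[where ract = "\<lambda>a r. a * uann_incl r" and lact = "\<lambda>r n. uann_triv r * n"])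

lemma vtoda_tensor_induct:
  assumes "\<And>u. P (vtensor u 1)" "\<And>v w. P v \<Longrightarrow> P w \<Longrightarrow> P (v + w)" "\<And>c v. P v \<Longrightarrow> P (c *\<^sub>C v)"
  shows "P v"
proof -
  have abs: "abs_vtoda (f + g) = abs_vtoda f + abs_vtoda g" "abs_vtoda (c *\<^sub>C f) = c *\<^sub>C abs_vtoda f"
    "abs_vtoda 0 = 0" for f g c
    by (simp_all add: plus_vtoda.abs_eq scaleC_vtoda.abs_eq zero_vtoda_def)
  obtain f where "v = abs_vtoda f" by (metis Quotient3_abs_rep[OF Quotient3_vtoda])
  moreover have "P (abs_vtoda f)"
  proof (induction f rule: poly_mapping_single_induct)
    case zero
    then show ?case using assms(3)[OF assms(1), of 0] by (simp add: abs)
  next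
    case (single k c)
    obtain u n where k: "k = (u, n)" by force
    have "abs_vtoda (Poly_Mapping.single k c) = c *\<^sub>C vtensor u n"
      by (subst single_eq_scaleC) (simp add: abs k vtensor_def)
    also have "vtensor u n = n *\<^sub>C vtensor u 1" using vtensor_scale_right[of u n 1] by simp
    finally show ?case using assms(1,3) by simp
  next
    case (add f g)
    then show ?case using assms(2) by (simp add: abs)
  qed
  ultimately show ?thesis by simp
qed

lemma clinear_uact: "clinear (uact u)"
proof (rule clinearI)
  show "uact u (x + y) = uact u x + uact u y" for x y
    by transfer (simp add: lin_ext_add cvec.span_zero)
  show "uact u (c *\<^sub>C x) = c *\<^sub>C uact u x" for c x
    by transfer (simp add: lin_ext_scaleC cvec.span_zero)
qed

lemma uact_add_left: "uact (u + u') v = uact u v + uact u' v"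
  by (induction v rule: vtoda_tensor_induct)
    (simp_all add: uact_vtensor distrib_right vtensor_add_left clinear_add[OF clinear_uact]
      clinear_scaleC[OF clinear_uact] scaleC_add_right add_ac)

lemma uact_scale_left: "uact (c *\<^sub>C u) v = c *\<^sub>C uact u v"
  by (induction v rule: vtoda_tensor_induct)
    (simp_all add: uact_vtensor scaleC_mult_left vtensor_scale_left clinear_add[OF clinear_uact]
      clinear_scaleC[OF clinear_uact] scaleC_add_right scaleC_scaleC mult.commute)

lemma uact_mult: "uact (u * u') v = uact u (uact u' v)"
  by (induction v rule: vtoda_tensor_induct)
    (simp_all add: uact_vtensor mult.assoc clinear_add[OF clinear_uact] clinear_scaleC[OF clinear_uact])

lemma uact_diff_left: "uact (u - u') v = uact u v - uact u' v"
  using uact_add_left[of "u - u'" u' v] by simp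

lemma uea_incl_hom: "uea_incl (x + y) = uea_incl x + uea_incl y" "uea_incl (c *\<^sub>C x) = c *\<^sub>C uea_incl x"
  "uea_incl (lie x y) = uea_incl x * uea_incl y - uea_incl y * uea_incl x"
  using uea_incl_lie_hom unfolding lie_hom_def clinear_iff by blast+

lemma clinear_vact: "clinear (vact x)"
  by (simp add: vact_def clinear_uact)

lemma vact_add_left: "vact (x + y) v = vact x v + vact y v"
  and vact_scale_left: "vact (c *\<^sub>C x) v = c *\<^sub>C vact x v"
  and vact_lie: "vact (lie x y) v = vact x (vact y v) - vact y (vact x v)"
  by (simp_all add: vact_def uea_incl_hom uact_add_left uact_scale_left uact_mult uact_diff_left)

lemma vact_ann: "x \<in> ann \<Longrightarrow> vact x v0 = 0"
proof -
  assume "x \<in> ann"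
  then obtain y where x: "x = Rep_ltoda_ann y" by (metis Abs_ltoda_ann_inverse)
  have "vact x v0 = vtensor (1 * uann_incl (uea_incl y)) 1"
    by (simp add: vact_def v0_def uact_vtensor uann_incl_def uea_lift_hom lie_hom_uann_incl x)
  also have "\<dots> = vtensor 1 (0 * 1)"
    by (simp only: vtensor_balanced) (simp add: uann_triv_def uea_lift_hom lie_hom_uann_triv)
  also have "\<dots> = 0" by (simp only: vtensor_scale_right cvec.scale_zero_left)
  finally show ?thesis .
qed

lemma vtoda_induct [case_names vac act add scale]:
  assumes "P v0" "\<And>x v. P v \<Longrightarrow> P (vact x v)"
    "\<And>v w. P v \<Longrightarrow> P w \<Longrightarrow> P (v + w)" "\<And>c v. P v \<Longrightarrow> P (c *\<^sub>C v)"
  shows "P v"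
proof (rule vtoda_tensor_induct[where P = P])
  show "P (vtensor u 1)" for u
  proof (induction u rule: uea_induct)
    case (mult x u)
    then show ?case using assms(2)[OF mult, of x] by (simp add: vact_def uact_vtensor)
  qed (use assms in \<open>simp_all add: vtensor_add_left vtensor_scale_left v0_def\<close>)
qed (use assms in auto)

text \<open>Words act on \<open>w0\<close>, which defines \<open>L\<close> on the free algebra. It
  is then factored through the enveloping algebra and through the tensor product over the
  subalgebra.\<close>

lemma vtoda_universal:
  fixes \<rho> :: "ltoda \<Rightarrow> 'w \<Rightarrow> 'w::complex_vector"
  assumes S: "csubspace S" and \<rho>S: "\<And>x s. s \<in> S \<Longrightarrow> \<rho> x s \<in> S" and lin: "\<And>x. clin_on S (\<rho> x)"
    and \<rho>_add: "\<And>x y s. s \<in> S \<Longrightarrow> \<rho> (x + y) s = \<rho> x s + \<rho> y s"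
    and \<rho>_scale: "\<And>c x s. s \<in> S \<Longrightarrow> \<rho> (c *\<^sub>C x) s = c *\<^sub>C \<rho> x s"
    and \<rho>_lie: "\<And>x y s. s \<in> S \<Longrightarrow> \<rho> (lie x y) s = \<rho> x (\<rho> y s) - \<rho> y (\<rho> x s)"
    and w0: "w0 \<in> S" and ann: "\<And>x. x \<in> ann \<Longrightarrow> \<rho> x w0 = 0"
  obtains \<Phi> where "clinear \<Phi>" "\<Phi> v0 = w0" "\<And>x v. \<Phi> (vact x v) = \<rho> x (\<Phi> v)" "\<And>v. \<Phi> v \<in> S"
proof -
  define L where "L = lin_ext (\<lambda>w. foldr \<rho> (letters w) w0)"
  have L: "clinear L" by (simp add: L_def clinear_lin_ext)
  have fS: "foldr \<rho> xs w0 \<in> S" for xs by (induction xs) (auto intro: \<rho>S w0)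
  have LS: "L f \<in> S" for f
    unfolding L_def lin_ext_def by (intro cvec.subspace_sum S cvec.subspace_scale fS)
  note \<rho>lin = lin[unfolded clin_on_def]
  have \<rho>0: "\<rho> x 0 = 0" for x by (rule clin_on_0[OF lin S])
  have \<rho>0': "\<rho> 0 s = 0" if "s \<in> S" for s using \<rho>_scale[OF that, of 0 0] by simp
  have gen: "L (gen x * f) = \<rho> x (L f)" for x f
  proof (induction f rule: poly_mapping_single_induct)
    case zero
    then show ?case by (simp add: clinear_0[OF L] \<rho>0)
  next
    case (single k v)
    then show ?case using \<rho>lin fS by (simp add: L_def mult_single plus_fword_def)
  next
    case (add f g)
    then show ?case using \<rho>lin LS by (simp add: distrib_left clinear_add[OF L])
  qed
  have scal: "L ((c *\<^sub>C f) * g) = c *\<^sub>C L (f * g)" for c f g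
    by (simp add: scaleC_mult_left clinear_scaleC[OF L])
  \<comment> \<open>The kernel of \<open>L\<close> is a left ideal. Together with the relations
    evaluated on the vector \<open>L b\<close> this disposes of the two-sided ideal.\<close>
  have wd: "L (a * f) = 0" if f: "L f = 0" for a f
  proof -
    have "L (Poly_Mapping.single (FWord xs) 1 * f) = 0" for xs
    proof (induction xs)
      case Nil
      have "Poly_Mapping.single (FWord []) (1::complex) = (1 :: ltoda fword \<Rightarrow>\<^sub>0 complex)"
        by (simp flip: single_one add: zero_fword_def)
      then show ?case using f by simp
    next
      case (Cons x xs)
      have "Poly_Mapping.single (FWord (x # xs)) (1::complex) = gen x * Poly_Mapping.single (FWord xs) 1"
        by (simp add: mult_single plus_fword_def)
      then show ?case by (simp only: mult.assoc gen Cons \<rho>0)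
    qed
    then have s1: "L (Poly_Mapping.single k 1 * f) = 0" for k by (metis fword.collapse)
    show ?thesis
    proof (induction a rule: poly_mapping_single_induct)
      case zero
      then show ?case by (simp add: clinear_0[OF L])
    next
      case (single k v)
      have "L (Poly_Mapping.single k v * f) = v *\<^sub>C L (Poly_Mapping.single k 1 * f)"
        by (metis scal single_eq_scaleC)
      then show ?case by (simp add: s1)
    next
      case (add a b)
      then show ?case by (simp add: distrib_right clinear_add[OF L])
    qed
  qed
  have ideal: "L f = 0" if "f \<in> uea_ideal" for f
  proof (rule clinear_span_vanish[OF L])
    show "f \<in> cspan {a * r * b | a r b. r \<in> uea_rels}" using that by (simp add: uea_ideal_def)
    fix s :: "ltoda fword \<Rightarrow>\<^sub>0 complex" assume "s \<in> {a * r * b | a r b. r \<in> uea_rels}"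
    then obtain a r b where s: "s = a * (r * b)" and r: "r \<in> uea_rels" by (auto simp: mult.assoc)
    have "L (r * b) = 0"
      using r unfolding uea_rels_def
    proof (elim UnE CollectE exE conjE)
      fix x y assume "r = gen (x + y) - gen x - gen y"
      then show ?thesis by (simp add: left_diff_distrib clinear_diff[OF L] gen \<rho>_add LS)
    next
      fix c x assume "r = gen (c *\<^sub>C x) - c *\<^sub>C gen x"
      then show ?thesis by (simp add: left_diff_distrib clinear_diff[OF L] gen \<rho>_scale LS scal)
    next
      fix x y assume "r = gen x * gen y - gen y * gen x - gen (lie x y)"
      then show ?thesis
        by (simp add: left_diff_distrib clinear_diff[OF L] mult.assoc gen \<rho>_lie LS)
    qed
    then show "L s = 0" unfolding s by (rule wd)
  qed
  define Lu where "Lu u = L (rep_uea u)" for u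
  have Lu_abs: "Lu (abs_uea f) = L f" for f
    using ideal[OF rep_abs_uea, of f] by (simp add: Lu_def clinear_diff[OF L])
  have Lu_add: "Lu (u + v) = Lu u + Lu v" and Lu_scale: "Lu (c *\<^sub>C u) = c *\<^sub>C Lu u"
    and Lu_mult: "Lu (uea_incl x * u) = \<rho> x (Lu u)" for u v c x
  proof -
    obtain f g where "u = abs_uea f" "v = abs_uea g"
      by (metis Quotient3_abs_rep[OF Quotient3_uea])
    then show "Lu (u + v) = Lu u + Lu v" "Lu (c *\<^sub>C u) = c *\<^sub>C Lu u" "Lu (uea_incl x * u) = \<rho> x (Lu u)"
      by (simp_all add: Lu_abs clinear_add[OF L] clinear_scaleC[OF L] gen
          flip: abs_uea_hom)
  qed
  have Lu_1: "Lu 1 = w0"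
  proof -
    have "Lu 1 = L 1" using Lu_abs[of 1] by (simp only: abs_uea_hom)
    also have "\<dots> = w0" by (simp add: L_def zero_fword_def scaleC_one flip: single_one)
    finally show ?thesis .
  qed
  have LuS: "Lu u \<in> S" for u by (simp add: Lu_def LS)
  have Lu_ann: "Lu (a * uea_incl (Rep_ltoda_ann y)) = 0" for a y
  proof (induction a rule: uea_induct)
    case one
    have "Lu (uea_incl (Rep_ltoda_ann y) * 1) = 0"
      unfolding Lu_mult Lu_1 by (rule ann) (rule Rep_ltoda_ann)
    then show ?case by simp
  qed (simp_all add: mult.assoc Lu_mult \<rho>0 distrib_right Lu_add scaleC_mult_left Lu_scale)
  \<comment> \<open>The statement is for all \<open>a\<close>, because a letter of \<open>r\<close>
    is moved into \<open>a\<close>, where \<open>Lu_ann\<close> applies.\<close>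
  have Lu_bal: "Lu (a * uann_incl r) = uann_triv r *\<^sub>C Lu a" for a r
  proof (induction r arbitrary: a rule: uea_induct)
    case one
    then show ?case by (simp add: uann_incl_def uann_triv_def uea_lift_hom lie_hom_uann_incl lie_hom_uann_triv scaleC_one)
  next
    case (mult x u)
    have "Lu (a * uann_incl (uea_incl x * u)) = Lu ((a * uea_incl (Rep_ltoda_ann x)) * uann_incl u)"
      by (simp add: uann_incl_def uea_lift_hom lie_hom_uann_incl mult.assoc)
    then show ?case
      by (simp add: mult Lu_ann uann_triv_def uea_lift_hom lie_hom_uann_triv)
  next
    case (add u v)
    then show ?case
      by (simp add: uann_incl_def uann_triv_def uea_lift_hom lie_hom_uann_incl lie_hom_uann_triv
          distrib_left Lu_add scaleC_add_left)
  next
    case (scale c u)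
    then show ?case
      by (simp add: uann_incl_def uann_triv_def uea_lift_hom lie_hom_uann_incl lie_hom_uann_triv
          scaleC_mult_right Lu_scale scaleC_scaleC scaleC_complex_def)
  qed
  define Q where "Q = lin_ext (\<lambda>(u, n). n *\<^sub>C Lu u)"
  have Q: "clinear Q" by (simp add: Q_def clinear_lin_ext)
  have Qs: "Q (Poly_Mapping.single (u, n) 1) = n *\<^sub>C Lu u" for u n by (simp add: Q_def scaleC_one)
  have Qrel: "Q x = 0" if "x \<in> cspan vtoda_rels" for x
  proof (rule clinear_span_vanish[OF Q _ that])
    fix r :: "(ltoda uea \<times> complex) \<Rightarrow>\<^sub>0 complex" assume "r \<in> vtoda_rels"
    then show "Q r = 0"
      by (cases rule: balanced_rels_cases)
        (simp_all add: clinear_diff[OF Q] clinear_scaleC[OF Q] Qs Lu_add Lu_scale Lu_bal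
          scaleC_add_right scaleC_add_left scaleC_scaleC scaleC_complex_def mult_ac)
  qed
  define \<Phi> where "\<Phi> v = Q (rep_vtoda v)" for v
  have \<Phi>_abs: "\<Phi> (abs_vtoda f) = Q f" for f
  proof -
    have "rep_vtoda (abs_vtoda f) - f \<in> cspan vtoda_rels"
      by (rule Quotient3_rep_abs[OF Quotient3_vtoda]) (simp add: cvec.span_zero)
    from Qrel[OF this] show ?thesis by (simp add: \<Phi>_def clinear_diff[OF Q])
  qed
  have \<Phi>: "clinear \<Phi>"
  proof (rule clinearI)
    fix x y c
    obtain f g where "x = abs_vtoda f" "y = abs_vtoda g" by (metis Quotient3_abs_rep[OF Quotient3_vtoda])
    then show "\<Phi> (x + y) = \<Phi> x + \<Phi> y" "\<Phi> (c *\<^sub>C x) = c *\<^sub>C \<Phi> x"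
      by (simp_all add: plus_vtoda.abs_eq scaleC_vtoda.abs_eq \<Phi>_abs clinear_add[OF Q] clinear_scaleC[OF Q])
  qed
  have t: "\<Phi> (vtensor u n) = n *\<^sub>C Lu u" for u n by (simp add: vtensor_def \<Phi>_abs Qs)
  have "\<Phi> v0 = w0" by (simp add: v0_def t Lu_1 scaleC_one)
  moreover have PS: "\<Phi> v \<in> S" for v
    by (induction v rule: vtoda_tensor_induct)
      (simp_all add: t scaleC_one LuS clinear_add[OF \<Phi>] clinear_scaleC[OF \<Phi>] cvec.subspace_add[OF S] cvec.subspace_scale[OF S])
  moreover have "\<Phi> (vact x v) = \<rho> x (\<Phi> v)" for x v
  proof (induction v rule: vtoda_tensor_induct)
    case (1 u)
    then show ?case by (simp add: vact_def uact_vtensor t scaleC_one Lu_mult)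
  next
    case (2 v w)
    then show ?case using \<rho>lin PS by (simp add: clinear_add[OF \<Phi>] clinear_add[OF clinear_vact])
  next
    case (3 c v)
    then show ?case using \<rho>lin PS by (simp add: clinear_scaleC[OF \<Phi>] clinear_scaleC[OF clinear_vact])
  qed
  ultimately show ?thesis using \<Phi> that by blast
qed

section \<open>Modes of the currents\<close>

definition cur :: "bool \<Rightarrow> ratK \<Rightarrow> ltoda" where
  "cur b F = (if b then cur_B F else cur_C F)"

lemma cur_add: "cur b (F + G) = cur b F + cur b G"
  and cur_scaleC: "cur b (c *\<^sub>C F) = c *\<^sub>C cur b F"
  by (simp_all add: cur_def cur_B_def cur_C_def plus_ltoda_def scaleC_ltoda_def)

lemma ltoda_split: "x = cur True (Bpart x) + cur False (Cpart x)"
  by (cases x) (simp add: cur_def cur_B_def cur_C_def plus_ltoda_def)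

lemma clinear_vact_cur: "clinear (\<lambda>F. vact (cur b F) v)"
  by (rule clinearI) (simp_all add: cur_add cur_scaleC vact_add_left vact_scale_left)

lemma modal_add: "modal D \<Longrightarrow> modal E \<Longrightarrow> modal (\<lambda>F. D F + E F)"
  unfolding modal_def using Lsum_fun_add trunc_add by (metis (no_types, lifting) ext)

lemma modal_comp: "clinear L \<Longrightarrow> modal D \<Longrightarrow> modal (\<lambda>F. L (D F))"
  unfolding modal_def using Lsum_comp trunc_comp clinear_0 by (metis (no_types, lifting) ext)

lemma modal_mult: "modal D \<Longrightarrow> modal (\<lambda>F. D (H * F))"
  unfolding modal_def using Lsum_mult trunc_mode_mult by (metis (no_types, lifting) ext)

lemma modal_shift: "modal D \<Longrightarrow> modal (\<lambda>F. D (shift a F))"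
  unfolding modal_def using Lsum_shift trunc_shift by (metis (no_types, lifting) ext)

lemma clinear_scaleC_fun: "clinear (\<lambda>v::'v::complex_vector. c *\<^sub>C v)"
  by (rule clinearI) (simp_all add: scaleC_add_right scaleC_scaleC mult.commute)

lemma clinear_uminus_fun: "clinear (\<lambda>v::'v::complex_vector. - v)"
  by (rule clinearI) (simp_all add: cvec.scale_minus_right)

text \<open>Moving the current past a further factor \<open>x\<close> costs the current of the
  bracket, whose argument depends on \<open>F\<close> through multiplications and a shift; both
  preserve modal distributions.\<close>

lemma modal_vact: "modal (\<lambda>F. vact (cur b F) v)"
proof (induction v arbitrary: b rule: vtoda_induct)
  case vac
  have "vact (cur b (of_pol p)) v0 = 0" for p
    by (rule vact_ann) (auto simp: ann_iff cur_def cur_B_def cur_C_def)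
  from Lsum_of_vanishing[OF clinear_vact_cur this] show ?case
    unfolding modal_def by blast
next
  case (act x v)
  \<comment> \<open>Moves the shift outside, so that \<open>F\<close> is first multiplied and then
    shifted.\<close>
  have s: "shift (-1) F * G = shift (-1) (shift 1 G * F)" for F G
  proof -
    have "shift (-1) (shift 1 G) = G"
    proof -
      obtain p q where "Rep_ratK G = Fract p q" "q \<in> M" using Rep_ratK[of G] by blast
      then have "Rep_ratK (shift (-1) (shift 1 G)) = Rep_ratK G"
        by (simp add: shift.rep_eq fract_subst_Fract M_nz M_pcompose_shift[of q 1, simplified]
            pcompose_assoc[symmetric] pcompose_pCons pcompose_idR)
      then show ?thesis by (simp add: Rep_ratK_inject)
    qed
    then show ?thesis by (simp add: shift_mult mult.commute)
  qed
  have "modal (\<lambda>F. vact (lie (cur b F) x) v)"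
  proof (cases b)
    case True
    have "lie (cur b F) x = cur False (- (Cpart x * F) + shift (-1) (shift 1 (Cpart x) * F))" for F
    proof -
      have "- (Cpart x * F) + shift (-1) (shift 1 (Cpart x) * F) = - ((F - shift (-1) F) * Cpart x)"
        by (subst s[symmetric]) (simp add: algebra_simps)
      then show ?thesis
        by (simp add: True cur_def cur_B_def lie_ltoda_def hact_Delta_bar)
    qed
    then have e: "vact (lie (cur b F) x) v = - vact (cur False (Cpart x * F)) v
        + vact (cur False (shift (-1) (shift 1 (Cpart x) * F))) v" for F
      by (simp add: clinear_diff[OF clinear_vact_cur])
    show ?thesis unfolding e
      by (intro modal_add modal_comp[OF clinear_uminus_fun] modal_mult[OF act]
          modal_mult[OF modal_shift[OF act]])
  next
    case False
    have "lie (cur b F) x = cur False ((Bpart x - shift (-1) (Bpart x)) * F)" for F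
      by (simp add: False cur_def cur_C_def lie_ltoda_def hact_Delta_bar)
    then show ?thesis using modal_mult[OF act] by simp
  qed
  moreover have "vact (cur b F) (vact x v) = vact x (vact (cur b F) v) + vact (lie (cur b F) x) v" for F
    by (simp add: vact_lie)
  ultimately show ?case
    using modal_add[OF modal_comp[OF clinear_vact act]] by (simp del: add_diff_cancel_left')
next
  case (add v w)
  then show ?case using modal_add[OF add(1)[of b] add(2)[of b]] by (simp add: clinear_add[OF clinear_vact])
next
  case (scale c v)
  then show ?case using modal_comp[OF clinear_scaleC_fun scale[of b], of c] by (simp add: clinear_scaleC[OF clinear_vact])
qed

text \<open>\<open>X (True, n)\<close> and \<open>X (False, n)\<close> are the currents \<open>B(\<tau>)\<close> and \<open>C(\<tau>)\<close> near \<open>\<tau> = n\<close>.\<close>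

definition X :: "bool \<times> int \<Rightarrow> int \<Rightarrow> vtoda \<Rightarrow> vtoda" where
  "X i k v = modes (\<lambda>F. vact (cur (fst i) F) v) (snd i) k"

lemma trunc_X: "trunc (\<lambda>n k. X (b, n) k v)"
  and vact_cur: "vact (cur b F) v = Lsum (\<lambda>n k. X (b, n) k v) F"
proof -
  have *: "(\<lambda>n k. X (b, n) k v) = modes (\<lambda>F. vact (cur b F) v)" by (simp add: X_def fun_eq_iff)
  show "trunc (\<lambda>n k. X (b, n) k v)" unfolding * by (rule modal_modes[OF modal_vact])
  show "vact (cur b F) v = Lsum (\<lambda>n k. X (b, n) k v) F"
    unfolding * using modal_modes(2)[OF modal_vact] by (rule fun_cong)
qed

lemma X_eqI:
  assumes "trunc d" "\<And>F. vact (cur b F) v = Lsum d F"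
  shows "X (b, n) k v = d n k"
  using modesI[OF assms] by (simp add: X_def)

lemma clinear_X: "clinear (X i k)"
proof (rule clinearI)
  obtain b n where i: "i = (b, n)" by force
  show "X i k (x + y) = X i k x + X i k y" for x y
    unfolding i by (rule X_eqI[where d = "\<lambda>n k. X (b, n) k x + X (b, n) k y"])
      (simp_all add: trunc_add trunc_X Lsum_fun_add clinear_add[OF clinear_vact] flip: vact_cur)
  show "X i k (c *\<^sub>C x) = c *\<^sub>C X i k x" for c x
    unfolding i by (rule X_eqI[where d = "\<lambda>n k. c *\<^sub>C X (b, n) k x"])
      (simp_all add: trunc_comp[OF trunc_X] Lsum_fun_scaleC[OF trunc_X] clinear_scaleC[OF clinear_vact] flip: vact_cur)
qed

lemmas X_lin = clinear_add[OF clinear_X] clinear_scaleC[OF clinear_X] clinear_0[OF clinear_X]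
  clinear_diff[OF clinear_X] clinear_uminus[OF clinear_X] clinear_sum[OF clinear_X]

lemma X_vac: "k \<ge> 0 \<Longrightarrow> X i k v0 = 0"
proof -
  assume k: "k \<ge> 0"
  obtain b n where i: "i = (b, n)" by force
  have "vact (cur b F) v0 = 0" if "F \<in> Kpol" for F
    by (rule vact_ann) (use that in \<open>auto simp: ann_iff cur_def cur_B_def cur_C_def\<close>)
  then have "X (b, n) k v0 = (\<lambda>n k. 0) n k"
    by (intro Lsum_inject_Kpol[OF trunc_X trunc_zero _ k]) (simp flip: vact_cur)
  then show ?thesis by (simp add: i)
qed

text \<open>A current applied to a vector is a linear combination of modes, so words in modes span
  what words in the Lie algebra span.\<close>

lemma X_induct [case_names vac X add scale]:
  assumes "P v0" "\<And>i k v. P v \<Longrightarrow> P (X i k v)"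
    "\<And>v w. P v \<Longrightarrow> P w \<Longrightarrow> P (v + w)" "\<And>c v. P v \<Longrightarrow> P (c *\<^sub>C v)"
  shows "P v"
proof (induction v rule: vtoda_induct)
  case (act x v)
  have S: "csubspace {v. P v}"
    using assms(3,4) assms(4)[OF assms(1), of 0] by (auto simp: cvec.subspace_def)
  have "P (vact (cur b F) v)" for b F
    using Lsum_in_subspace[OF S, of "\<lambda>n k. X (b, n) k v"] assms(2)[OF act] by (simp add: vact_cur)
  then show ?case
    by (subst ltoda_split[of x]) (simp add: vact_add_left assms(3))
qed (use assms in auto)

subsection \<open>Commutators of modes\<close>

text \<open>The two terms of \<open>lam\<close> come from \<open>1 - T\<inverse>\<close>: the expansion of \<open>shift (-1) F\<close> at \<open>m\<close> is that
  of \<open>F\<close> at \<open>m - 1\<close>.\<close>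

definition lam :: "bool \<times> int \<Rightarrow> bool \<times> int \<Rightarrow> complex" where
  "lam i j = (if fst i \<and> \<not> fst j then of_bool (snd i = snd j - 1) - of_bool (snd i = snd j)
    else if \<not> fst i \<and> fst j then of_bool (snd i = snd j) - of_bool (snd j = snd i - 1) else 0)"

text \<open>The bracket of \<open>B\<close> and \<open>C\<close> is a \<open>C\<close> current at
  the point of the \<open>C\<close> factor, whichever comes first.\<close>

definition tgt :: "bool \<times> int \<Rightarrow> bool \<times> int \<Rightarrow> bool \<times> int" where
  "tgt i j = (if fst i then j else i)"

lemma lam_antisym: "lam j i = - lam i j"
  by (auto simp: lam_def)

text \<open>For fixed \<open>m\<close> and \<open>l\<close> the transposed multiplication is itself
  a distribution in \<open>H\<close>, supported at the point \<open>m\<close>. This makes the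
  bracket of two currents modal in each of its two arguments.\<close>

lemma mode_mult_Lsum:
  assumes "trunc d"
  shows "mode_mult H d m l = Lsum (\<lambda>n k. if n = m then d m (k + l) else 0) H"
    and "trunc (\<lambda>n k. if n = m then d m (k + l) else 0)"
proof -
  show t: "trunc (\<lambda>n k. if n = m then d m (k + l) else 0)"
    unfolding trunc_def
  proof (rule finite_subset)
    let ?A = "(\<lambda>(n, k). (n, k - l)) ` {(n, k). k \<ge> 0 \<and> d n k \<noteq> 0} \<union> {m} \<times> {0..-l}"
    show "{(n, k). 0 \<le> k \<and> (if n = m then d m (k + l) else 0) \<noteq> 0} \<subseteq> ?A"
    proof (rule subrelI)
      fix n k assume "(n, k) \<in> {(n, k). 0 \<le> k \<and> (if n = m then d m (k + l) else 0) \<noteq> 0}"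
      then have a: "0 \<le> k" "(if n = m then d m (k + l) else 0) \<noteq> 0" by auto
      show "(n, k) \<in> ?A"
      proof (cases "k + l \<ge> 0")
        case True
        then have "(n, k) = (\<lambda>(n, k). (n, k - l)) (n, k + l)"
          "(n, k + l) \<in> {(n, k). k \<ge> 0 \<and> d n k \<noteq> 0}" using a by (auto split: if_splits)
        then show ?thesis by (intro UnI1 image_eqI)
      next
        case False
        then show ?thesis using a by (auto split: if_splits)
      qed
    qed
    show "finite ?A" using assms by (simp add: trunc_def)
  qed
  have fin: "finite {k. cc H m k *\<^sub>C d m (l + k) \<noteq> 0}" by (rule finite_mode_mult[OF assms])
  have "Lsum (\<lambda>n k. if n = m then d m (k + l) else 0) H
      = (\<Sum>(n, k)\<in>{m} \<times> {k. cc H m k *\<^sub>C d m (l + k) \<noteq> 0}. cc H n k *\<^sub>C (if n = m then d m (k + l) else 0))"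
    by (rule Lsum_superset) (use fin in \<open>auto simp: add.commute split: if_splits\<close>)
  also have "\<dots> = (\<Sum>k | cc H m k *\<^sub>C d m (l + k) \<noteq> 0. cc H m k *\<^sub>C d m (l + k))"
    by (simp add: sum.cartesian_product[symmetric] add.commute)
  also have "\<dots> = mode_mult H d m l"
    by (simp only: mode_mult_def Sum_any.expand_set)
  finally show "mode_mult H d m l = Lsum (\<lambda>n k. if n = m then d m (k + l) else 0) H" by simp
qed

lemma Lsum_lie:
  assumes "trunc d"
  defines "e \<equiv> \<lambda>m l n k. lam (True, n) (False, m) *\<^sub>C d m (k + l)"
  shows "trunc (e m l)" "trunc (\<lambda>m l. Lsum (e m l) F)"
    "Lsum d (- (hact Delta_bar F * G)) = Lsum (\<lambda>m l. Lsum (e m l) F) G"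
proof -
  let ?r = "\<lambda>m l n k. if n = m then d m (k + l) else 0"
  have e: "e m l n k = ?r m l (n + 1) k - ?r m l n k" for m l n k
    by (auto simp: e_def lam_def scaleC_one cvec.scale_minus_left)
  have t: "trunc (?r m l)" for m l by (rule mode_mult_Lsum(2)[OF assms(1)])
  have t': "trunc (\<lambda>n k. ?r m l (n + 1) k)" for m l using trunc_shift[OF t[of m l], where a = "-1"] by simp
  show te: "trunc (e m l)" for m l using trunc_diff[OF t' t, of m l m l] by (simp add: e[abs_def])
  have E: "(\<lambda>m l. Lsum (e m l) F) = mode_mult (shift (-1) F - F) d"
  proof (intro ext)
    fix m l
    have "Lsum (e m l) F = Lsum (\<lambda>n k. ?r m l (n + 1) k) F - Lsum (?r m l) F"
      using Lsum_fun_diff[OF t' t, of m l m l F] by (simp add: e[abs_def])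
    also have "Lsum (\<lambda>n k. ?r m l (n + 1) k) F = Lsum (?r m l) (shift (-1) F)"
      by (simp add: Lsum_shift)
    also have "\<dots> - Lsum (?r m l) F = mode_mult (shift (-1) F - F) d m l"
      by (simp only: mode_mult_Lsum(1)[OF assms(1)] Lsum_diff[OF t])
    finally show "Lsum (e m l) F = mode_mult (shift (-1) F - F) d m l" .
  qed
  show "trunc (\<lambda>m l. Lsum (e m l) F)" unfolding E by (rule trunc_mode_mult[OF assms(1)])
  have "- (hact Delta_bar F * G) = (shift (-1) F - F) * G"
    by (simp add: hact_Delta_bar algebra_simps)
  then show "Lsum d (- (hact Delta_bar F * G)) = Lsum (\<lambda>m l. Lsum (e m l) F) G"
    by (simp only: E Lsum_mult[OF assms(1)])
qed

text \<open>Uniqueness of modes is used twice: for the argument \<open>G\<close> with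
  \<open>F\<close> fixed, then for \<open>F\<close>.\<close>

lemma X_comm_transfer:
  assumes "\<And>F G. vact (cur b F) (vact (cur b' G) v) - vact (cur b' G) (vact (cur b F) v)
      = Lsum (\<lambda>m l. Lsum (e m l) F) G"
    and t1: "\<And>F. trunc (\<lambda>m l. Lsum (e m l) F)" and t2: "\<And>m l. trunc (e m l)"
  shows "X (b, n) k (X (b', m) l v) - X (b', m) l (X (b, n) k v) = e m l n k"
proof -
  have "vact (cur b F) (X (b', m) l v) - X (b', m) l (vact (cur b F) v) = Lsum (e m l) F" for m l F
  proof -
    have tr: "trunc (\<lambda>m l. vact (cur b F) (X (b', m) l v))"
      by (rule trunc_comp[OF trunc_X]) (rule clinear_0[OF clinear_vact])
    have "(\<lambda>m l. vact (cur b F) (X (b', m) l v) - X (b', m) l (vact (cur b F) v)) = (\<lambda>m l. Lsum (e m l) F)"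
    proof (rule Lsum_inject[OF trunc_diff[OF tr trunc_X] t1])
      fix G
      show "Lsum (\<lambda>m l. vact (cur b F) (X (b', m) l v) - X (b', m) l (vact (cur b F) v)) G
          = Lsum (\<lambda>m l. Lsum (e m l) F) G"
        unfolding Lsum_fun_diff[OF tr trunc_X] Lsum_comp[OF clinear_vact trunc_X, symmetric]
        by (simp only: vact_cur[symmetric] assms(1))
    qed
    then show ?thesis by (metis (no_types, lifting))
  qed
  note 1 = this
  have tr: "trunc (\<lambda>n k. X (b', m) l (X (b, n) k v))"
    by (rule trunc_comp[OF trunc_X]) (rule clinear_0[OF clinear_X])
  have "(\<lambda>n k. X (b, n) k (X (b', m) l v) - X (b', m) l (X (b, n) k v)) = e m l"
  proof (rule Lsum_inject[OF trunc_diff[OF trunc_X tr] t2])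
    fix F
    show "Lsum (\<lambda>n k. X (b, n) k (X (b', m) l v) - X (b', m) l (X (b, n) k v)) F = Lsum (e m l) F"
      unfolding Lsum_fun_diff[OF trunc_X tr] Lsum_comp[OF clinear_X trunc_X, symmetric]
      by (simp only: vact_cur[symmetric] 1)
  qed
  then show ?thesis by (metis (no_types, lifting))
qed

lemma lie_cur_same: "lie (cur b F) (cur b G) = 0"
  by (simp add: cur_def lie_cur)

lemma X_comm: "X i k (X j l v) - X j l (X i k v) = lam i j *\<^sub>C X (tgt i j) (k + l) v"
proof -
  have BC: "X (True, n) k (X (False, m) l v) - X (False, m) l (X (True, n) k v)
      = lam (True, n) (False, m) *\<^sub>C X (False, m) (k + l) v" for n k m l
  proof (rule X_comm_transfer[where e = "\<lambda>m l n k. lam (True, n) (False, m) *\<^sub>C X (False, m) (k + l) v"])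
    show "vact (cur True F) (vact (cur False G) v) - vact (cur False G) (vact (cur True F) v)
       = Lsum (\<lambda>m l. Lsum (\<lambda>n k. lam (True, n) (False, m) *\<^sub>C X (False, m) (k + l) v) F) G" for F G
    proof -
      have "lie (cur True F) (cur False G) = cur False (- (hact Delta_bar F * G))"
        by (simp add: cur_def lie_cur) (simp add: cur_C_def uminus_ltoda_def)
      then have "vact (cur True F) (vact (cur False G) v) - vact (cur False G) (vact (cur True F) v)
          = vact (cur False (- (hact Delta_bar F * G))) v" by (metis vact_lie)
      then show ?thesis by (simp only: vact_cur[of False "- (hact Delta_bar F * G)"] Lsum_lie(3)[OF trunc_X])
    qed
  qed (rule Lsum_lie[OF trunc_X])+
  have same: "X (b, n) k (X (b, m) l v) - X (b, m) l (X (b, n) k v) = 0" for b n k m l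
  proof (rule X_comm_transfer[where e = "\<lambda>m l n k. 0"])
    show "vact (cur b F) (vact (cur b G) v) - vact (cur b G) (vact (cur b F) v) = Lsum (\<lambda>m l. Lsum (\<lambda>n k. 0) F) G" for F G
      using vact_lie[of "cur b F" "cur b G" v] vact_scale_left[of 0 0 v] by (simp add: lie_cur_same)
  qed simp_all
  obtain b n b' m where ij: "i = (b, n)" "j = (b', m)" by (cases i, cases j) auto
  consider "b = b'" | "b" "\<not> b'" | "\<not> b" "b'" by blast
  then show ?thesis
  proof cases
    case 1
    then have "lam i j = 0" by (simp add: ij lam_def)
    then show ?thesis using 1 same by (simp add: ij)
  next
    case 2
    then show ?thesis using BC[of n k m l] by (simp add: ij tgt_def)
  next
    case 3
    have "X i k (X j l v) - X j l (X i k v) = - (X j l (X i k v) - X i k (X j l v))" by simp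
    also have "\<dots> = - (lam j i *\<^sub>C X i (l + k) v)" using BC[of m l n k] 3 by (simp add: ij)
    also have "\<dots> = lam i j *\<^sub>C X i (k + l) v"
      by (simp only: lam_antisym[of j i] cvec.scale_minus_left minus_minus add.commute[of l k])
    finally show ?thesis using 3 by (simp add: ij tgt_def)
  qed
qed

subsection \<open>Intertwiners defined by modes\<close>

text \<open>The Lie algebra acts only on the vectors of \<open>S\<close> on which the modes are truncated; these form a
  subspace that is stable under the modes and contains \<open>w0\<close>.\<close>

lemma vtoda_modes_universal:
  fixes x :: "bool \<times> int \<Rightarrow> int \<Rightarrow> 'w \<Rightarrow> 'w::complex_vector"
  assumes S: "csubspace S" and xS: "\<And>i k s. s \<in> S \<Longrightarrow> x i k s \<in> S" and lin: "\<And>i k. clin_on S (x i k)"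
    and comm: "\<And>i j k l s. s \<in> S \<Longrightarrow> x i k (x j l s) - x j l (x i k s) = lam i j *\<^sub>C x (tgt i j) (k + l) s"
    and w0: "w0 \<in> S" and vac: "\<And>i k. k \<ge> 0 \<Longrightarrow> x i k w0 = 0"
  obtains \<Phi> where "clinear \<Phi>" "\<Phi> v0 = w0" "\<And>i k v. \<Phi> (X i k v) = x i k (\<Phi> v)" "\<And>v. \<Phi> v \<in> S"
proof -
  define T where "T = {s \<in> S. \<forall>b. trunc (\<lambda>n k. x (b, n) k s)}"
  note xlin = lin[unfolded clin_on_def]
  have tT: "trunc (\<lambda>n k. x (b, n) k s)" if "s \<in> T" for b s using that by (simp add: T_def)
  have TS: "s \<in> S" if "s \<in> T" for s using that by (simp add: T_def)
  have T: "csubspace T"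
    unfolding cvec.subspace_def
  proof (intro conjI ballI allI)
    show "0 \<in> T" using cvec.subspace_0[OF S] by (simp add: T_def clin_on_0[OF lin S])
    show "s + t \<in> T" if "s \<in> T" "t \<in> T" for s t
      using that cvec.subspace_add[OF S] xlin trunc_add by (fastforce simp: T_def)
    show "c *\<^sub>C s \<in> T" if "s \<in> T" for c s
    proof -
      have "trunc (\<lambda>n k. c *\<^sub>C x (b, n) k s)" for b
        by (rule trunc_comp[OF tT[OF that]]) simp
      then show ?thesis using that cvec.subspace_scale[OF S] xlin by (simp add: T_def)
    qed
  qed
  have linT: "clin_on T (x i k)" for i k using xlin TS by (simp add: clin_on_def)
  have xT: "x i k s \<in> T" if s: "s \<in> T" for i k s
    unfolding T_def mem_Collect_eq
  proof (intro conjI allI)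
    show "x i k s \<in> S" using s TS xS by blast
    fix b
    have "x (b, m) l (x i k s) = x i k (x (b, m) l s) + lam (b, m) i *\<^sub>C x (tgt (b, m) i) (l + k) s" for m l
      using comm[OF TS[OF s], of "(b, m)" l i k] by (simp add: algebra_simps)
    moreover have "trunc (\<lambda>m l. x i k (x (b, m) l s))"
      by (rule trunc_comp[OF tT[OF s]]) (rule clin_on_0[OF lin S])
    moreover have "trunc (\<lambda>m l. lam (b, m) i *\<^sub>C x (tgt (b, m) i) (l + k) s)"
    proof -
      obtain c n where i: "i = (c, n)" by force
      define A where "A = {(n, k). k \<ge> 0 \<and> x (True, n) k s \<noteq> 0} \<union> {(n, k). k \<ge> 0 \<and> x (False, n) k s \<noteq> 0}"
      have fA: "finite A" using tT[OF s] by (simp add: A_def trunc_def)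
      \<comment> \<open>\<open>lam\<close> couples only equal or neighbouring points, so
        \<open>m\<close> is confined to three values; this keeps a truncated vector truncated under
        a further mode.\<close>
      have "{(m, l). 0 \<le> l \<and> lam (b, m) i *\<^sub>C x (tgt (b, m) i) (l + k) s \<noteq> 0}
        \<subseteq> {n - 1..n + 1} \<times> ({0..-k} \<union> (\<lambda>a. snd a - k) ` A)"
      proof clarify
        fix m l assume a: "0 \<le> l" "lam (b, m) i *\<^sub>C x (tgt (b, m) i) (l + k) s \<noteq> 0"
        then have nz: "lam (b, m) i \<noteq> 0" "x (tgt (b, m) i) (l + k) s \<noteq> 0" by auto
        then have "m \<in> {n - 1..n + 1}" by (auto simp: lam_def i of_bool_def split: if_splits)
        moreover have "l \<in> {0..-k} \<union> (\<lambda>a. snd a - k) ` A"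
        proof (cases "l + k \<ge> 0")
          case True
          then have "(snd (tgt (b, m) i), l + k) \<in> A"
            using nz(2) by (cases "tgt (b, m) i"; cases "fst (tgt (b, m) i)") (auto simp: A_def)
          then show ?thesis by force
        next
          case False
          then show ?thesis using a by auto
        qed
        ultimately show "m \<in> {n - 1..n + 1} \<and> l \<in> {0..-k} \<union> (\<lambda>a. snd a - k) ` A" by blast
      qed
      then show ?thesis unfolding trunc_def by (rule finite_subset) (use fA in simp)
    qed
    ultimately show "trunc (\<lambda>m l. x (b, m) l (x i k s))" by (simp add: trunc_add)
  qed
  define R where "R b F s = Lsum (\<lambda>n k. x (b, n) k s) F" for b F s
  have RT: "R b F s \<in> T" if "s \<in> T" for b F s
    unfolding R_def by (rule Lsum_in_subspace[OF T]) (rule xT[OF that])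
  have Rlin: "clin_on T (R b F)" for b F
    unfolding clin_on_def
  proof (intro conjI ballI allI)
    fix s t assume s: "s \<in> T" and t: "t \<in> T"
    have "(\<lambda>n k. x (b, n) k (s + t)) = (\<lambda>n k. x (b, n) k s + x (b, n) k t)"
      using xlin TS s t by (simp add: fun_eq_iff)
    then show "R b F (s + t) = R b F s + R b F t"
      by (simp add: R_def Lsum_fun_add tT s t)
  next
    fix c s assume s: "s \<in> T"
    have "(\<lambda>n k. x (b, n) k (c *\<^sub>C s)) = (\<lambda>n k. c *\<^sub>C x (b, n) k s)"
      using xlin TS s by (simp add: fun_eq_iff)
    then show "R b F (c *\<^sub>C s) = c *\<^sub>C R b F s"
      by (simp add: R_def Lsum_fun_scaleC tT s)
  qed
  have Radd: "R b (F + G) s = R b F s + R b G s" and Rscale: "R b (c *\<^sub>C F) s = c *\<^sub>C R b F s"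
    and Rdiff: "R b (F - G) s = R b F s - R b G s" and Rminus: "R b (- F) s = - R b F s"
    if "s \<in> T" for b F G c s
    unfolding R_def using tT[OF that] by (simp_all add: Lsum_add Lsum_scaleC Lsum_diff Lsum_uminus)
  have Rcomm: "R b F (R b' G s) - R b' G (R b F s)
      = Lsum (\<lambda>m l. Lsum (\<lambda>n k. lam (b, n) (b', m) *\<^sub>C x (tgt (b, n) (b', m)) (k + l) s) F) G"
    if s: "s \<in> T" for b b' F G s
  proof -
    have t1: "trunc (\<lambda>m l. R b F (x (b', m) l s))"
      by (rule trunc_comp[OF tT[OF s]]) (rule clin_on_0[OF Rlin T])
    have "R b F (R b' G s) = Lsum (\<lambda>m l. R b F (x (b', m) l s)) G"
      unfolding R_def[of b' G] by (rule Lsum_comp_on[OF T Rlin tT[OF s] xT[OF s]])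
    moreover have "R b' G (R b F s) = Lsum (\<lambda>m l. x (b', m) l (R b F s)) G"
      by (simp add: R_def)
    ultimately have "R b F (R b' G s) - R b' G (R b F s)
        = Lsum (\<lambda>m l. R b F (x (b', m) l s) - x (b', m) l (R b F s)) G"
      by (simp only: Lsum_fun_diff[OF t1 tT[OF RT[OF s]]])
    moreover have "R b F (x (b', m) l s) - x (b', m) l (R b F s)
        = Lsum (\<lambda>n k. lam (b, n) (b', m) *\<^sub>C x (tgt (b, n) (b', m)) (k + l) s) F" for m l
    proof -
      have t2: "trunc (\<lambda>n k. x (b', m) l (x (b, n) k s))"
        by (rule trunc_comp[OF tT[OF s]]) (rule clin_on_0[OF lin S])
      have "x (b', m) l (R b F s) = Lsum (\<lambda>n k. x (b', m) l (x (b, n) k s)) F"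
        unfolding R_def by (rule Lsum_comp_on[OF T linT tT[OF s] xT[OF s]])
      then have "R b F (x (b', m) l s) - x (b', m) l (R b F s)
          = Lsum (\<lambda>n k. x (b, n) k (x (b', m) l s) - x (b', m) l (x (b, n) k s)) F"
        by (simp only: R_def[of b F "x (b', m) l s"] Lsum_fun_diff[OF tT[OF xT[OF s]] t2])
      then show ?thesis by (simp only: comm[OF TS[OF s]])
    qed
    ultimately show ?thesis by simp
  qed
  have RBC: "R True F (R False G s) - R False G (R True F s) = R False (- (hact Delta_bar F * G)) s"
    if s: "s \<in> T" for F G s
    unfolding Rcomm[OF s] using Lsum_lie(3)[OF tT[OF s, of False], of F G] by (simp add: tgt_def R_def)
  have Rsame: "R b F (R b G s) = R b G (R b F s)" if s: "s \<in> T" for b F G s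
    using Rcomm[OF s, of b F b G] by (simp add: lam_def)
  define \<rho> where "\<rho> y s = R True (Bpart y) s + R False (Cpart y) s" for y s
  have w0T: "w0 \<in> T"
    unfolding T_def using w0 vac by (auto simp: trunc_def not_le[symmetric] intro: finite_subset[of _ "{}"])
  obtain \<Phi> where \<Phi>: "clinear \<Phi>" "\<Phi> v0 = w0" "\<And>y v. \<Phi> (vact y v) = \<rho> y (\<Phi> v)" "\<And>v. \<Phi> v \<in> T"
  proof (rule vtoda_universal[of T \<rho> w0])
    show "\<rho> y s \<in> T" if "s \<in> T" for y s
      unfolding \<rho>_def by (intro cvec.subspace_add[OF T] RT that)
    show "clin_on T (\<rho> y)" for y
      using Rlin unfolding clin_on_def \<rho>_def by (simp add: scaleC_add_right)
    show "\<rho> (y + z) s = \<rho> y s + \<rho> z s" if "s \<in> T" for y z s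
      by (simp add: \<rho>_def plus_ltoda_def Radd that)
    show "\<rho> (c *\<^sub>C y) s = c *\<^sub>C \<rho> y s" if "s \<in> T" for c y s
      by (simp add: \<rho>_def scaleC_ltoda_def Rscale that scaleC_add_right)
    show "\<rho> (lie y z) s = \<rho> y (\<rho> z s) - \<rho> z (\<rho> y s)" if s: "s \<in> T" for y z s
    proof -
      have R0: "R b 0 s = 0" for b by (simp add: R_def)
      have dist: "R b F (s + t) = R b F s + R b F t" if "s \<in> T" "t \<in> T" for b F s t
        using Rlin that unfolding clin_on_def by blast
      have "\<rho> (lie y z) s = R False (- (hact Delta_bar (Bpart y) * Cpart z)) s
          - R False (- (hact Delta_bar (Bpart z) * Cpart y)) s"
        using Rdiff[OF s] Rminus[OF s] R0 by (simp add: \<rho>_def lie_ltoda_def cur_C_def)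
      also have "\<dots> = \<rho> y (\<rho> z s) - \<rho> z (\<rho> y s)"
        unfolding RBC[OF s, symmetric]
        using Rsame[OF s, of True "Bpart y" "Bpart z"] Rsame[OF s, of False "Cpart y" "Cpart z"]
        by (simp add: \<rho>_def dist RT s)
      finally show ?thesis .
    qed
    show "\<rho> y w0 = 0" if "y \<in> ann" for y
    proof -
      have "R b F w0 = 0" if "F \<in> Kpol" for b F
      proof -
        have "Lsum (\<lambda>n k. x (b, n) k w0) (of_pol p) = 0" for p
          by (rule Lsum_of_pol) (rule vac)
        with that show ?thesis by (auto simp: R_def)
      qed
      then show ?thesis using that by (simp add: \<rho>_def ann_iff)
    qed
  qed (use T w0T in auto)
  have "\<Phi> (X i k v) = x i k (\<Phi> v)" for i k v
  proof -
    obtain b n where i: "i = (b, n)" by force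
    have t: "trunc (\<lambda>n k. \<Phi> (X (b, n) k v))" by (rule trunc_comp[OF trunc_X]) (rule clinear_0[OF \<Phi>(1)])
    have "(\<lambda>n k. \<Phi> (X (b, n) k v)) = (\<lambda>n k. x (b, n) k (\<Phi> v))"
    proof (rule Lsum_inject[OF t tT[OF \<Phi>(4)]])
      fix F
      have "Lsum (\<lambda>n k. \<Phi> (X (b, n) k v)) F = \<rho> (cur b F) (\<Phi> v)"
        unfolding Lsum_comp[OF \<Phi>(1) trunc_X, symmetric] vact_cur[symmetric] by (rule \<Phi>(3))
      also have "\<dots> = Lsum (\<lambda>n k. x (b, n) k (\<Phi> v)) F"
        by (simp add: \<rho>_def cur_def cur_B_def cur_C_def R_def)
      finally show "Lsum (\<lambda>n k. \<Phi> (X (b, n) k v)) F = Lsum (\<lambda>n k. x (b, n) k (\<Phi> v)) F" .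
    qed
    then show ?thesis unfolding i by (metis (no_types, lifting))
  qed
  with \<Phi> TS that show ?thesis by blast
qed

section \<open>Finitely supported sums\<close>

definition ev0 :: "(nat \<Rightarrow> 'v::zero) \<Rightarrow> bool" where
  "ev0 g \<longleftrightarrow> (\<exists>N. \<forall>j\<ge>N. g j = 0)"

definition ssum :: "(nat \<Rightarrow> 'v::comm_monoid_add) \<Rightarrow> 'v" where
  "ssum g = Sum_any g"

lemma ssum_lt: "(\<And>j. j \<ge> N \<Longrightarrow> g j = 0) \<Longrightarrow> ssum g = (\<Sum>j<N. g j)"
  unfolding ssum_def by (rule Sum_any.expand_superset) (auto simp: not_less[symmetric] intro: ccontr)

lemma ssum_le: "(\<And>j. j > N \<Longrightarrow> g j = 0) \<Longrightarrow> ssum g = (\<Sum>j\<le>N. g j)"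
  using ssum_lt[of "Suc N" g] by (simp add: lessThan_Suc_atMost)

lemma ssum_cong: "(\<And>j. g j = h j) \<Longrightarrow> ssum g = ssum h"
  by (simp add: ssum_def)

lemma ssum_0 [simp]: "ssum (\<lambda>j. 0) = 0"
  by (simp add: ssum_def)

lemma ev0_mono: "ev0 g \<Longrightarrow> (\<And>j. g j = 0 \<Longrightarrow> h j = 0) \<Longrightarrow> ev0 h"
  unfolding ev0_def by blast

lemma ev0_combine:
  "ev0 g \<Longrightarrow> ev0 h \<Longrightarrow> (\<And>j. g j = 0 \<Longrightarrow> h j = 0 \<Longrightarrow> f j = 0) \<Longrightarrow> ev0 f"
  unfolding ev0_def by (metis max.bounded_iff)

lemma ssum_combine:
  assumes "ev0 g" "ev0 h" "\<And>x y. F (x + y) = F x + F y" "\<And>x y. G (x + y) = G x + G y"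
    "F 0 = 0" "G 0 = 0"
  shows "ssum (\<lambda>j. F (g j) + G (h j)) = F (ssum g) + G (ssum h)"
proof -
  obtain N1 N2 where "\<And>j. j \<ge> N1 \<Longrightarrow> g j = 0" "\<And>j. j \<ge> N2 \<Longrightarrow> h j = 0"
    using assms(1,2) by (auto simp: ev0_def)
  then have N: "\<And>j. j \<ge> max N1 N2 \<Longrightarrow> g j = 0" "\<And>j. j \<ge> max N1 N2 \<Longrightarrow> h j = 0" by auto
  have "F (sum g A) = (\<Sum>j\<in>A. F (g j))" "G (sum h A) = (\<Sum>j\<in>A. G (h j))" for A
    by (induction A rule: infinite_finite_induct) (simp_all add: assms(3-6))
  moreover have "ssum (\<lambda>j. F (g j) + G (h j)) = (\<Sum>j<max N1 N2. F (g j) + G (h j))"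
    by (rule ssum_lt) (simp only: N assms(5,6) add_0_left)
  moreover have "ssum g = (\<Sum>j<max N1 N2. g j)" "ssum h = (\<Sum>j<max N1 N2. h j)"
    by (rule ssum_lt, erule N)+
  ultimately show ?thesis by (simp add: sum.distrib)
qed

lemma ssum_add: "ev0 g \<Longrightarrow> ev0 h \<Longrightarrow> ssum (\<lambda>j. g j + h j) = ssum g + ssum (h :: nat \<Rightarrow> 'v::complex_vector)"
  using ssum_combine[of g h "\<lambda>x. x" "\<lambda>x. x"] by simp

lemma ssum_diff: "ev0 g \<Longrightarrow> ev0 h \<Longrightarrow> ssum (\<lambda>j. g j - h j) = ssum g - ssum (h :: nat \<Rightarrow> 'v::complex_vector)"
  using ssum_combine[of g h "\<lambda>x. x" "\<lambda>x. - x"] by simp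

lemma ssum_comp: "ev0 g \<Longrightarrow> clinear L \<Longrightarrow> L (ssum g) = ssum (\<lambda>j. L (g j))"
  using ssum_combine[of g g L "\<lambda>x. 0"] by (simp add: clinear_add clinear_0)

lemma ssum_scaleC: "ev0 g \<Longrightarrow> ssum (\<lambda>j. c *\<^sub>C g j) = c *\<^sub>C ssum (g :: nat \<Rightarrow> 'v::complex_vector)"
  by (rule ssum_comp[symmetric, OF _ clinear_scaleC_fun])

lemma ssum_uminus: "ev0 g \<Longrightarrow> ssum (\<lambda>j. - g j) = - ssum (g :: nat \<Rightarrow> 'v::complex_vector)"
  by (rule ssum_comp[symmetric, OF _ clinear_uminus_fun])

lemma ssum_diff_add: "ev0 g \<Longrightarrow> ev0 h \<Longrightarrow> ev0 u \<Longrightarrow>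
    ssum (\<lambda>j. g j - h j + u j) = ssum g - ssum h + ssum (u :: nat \<Rightarrow> 'v::complex_vector)"
proof -
  assume e: "ev0 g" "ev0 h" "ev0 u"
  have "ev0 (\<lambda>j. g j - h j)" by (rule ev0_combine[OF e(1,2)]) simp
  then show ?thesis by (simp add: ssum_add ssum_diff e)
qed

lemma ev0_Suc: "ev0 g \<Longrightarrow> ev0 (\<lambda>j. g (Suc j))"
  unfolding ev0_def by (meson le_Suc_eq)

lemma ssum_Suc: "ev0 g \<Longrightarrow> ssum g = g 0 + ssum (\<lambda>j. g (Suc j))"
proof -
  assume "ev0 g"
  then obtain N where N: "\<And>j. j \<ge> N \<Longrightarrow> g j = 0" by (auto simp: ev0_def)
  have "ssum g = (\<Sum>j<Suc N. g j)" by (rule ssum_lt) (use N in auto)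
  also have "\<dots> = g 0 + (\<Sum>j<N. g (Suc j))" by (rule sum.lessThan_Suc_shift)
  also have "(\<Sum>j<N. g (Suc j)) = ssum (\<lambda>j. g (Suc j))" by (rule ssum_lt[symmetric]) (use N in auto)
  finally show ?thesis .
qed

definition ev0_2 :: "(nat \<Rightarrow> nat \<Rightarrow> 'v::zero) \<Rightarrow> bool" where
  "ev0_2 g \<longleftrightarrow> (\<exists>N. \<forall>i j. i \<ge> N \<or> j \<ge> N \<longrightarrow> g i j = 0)"

lemma ev0_2_mono: "ev0_2 g \<Longrightarrow> (\<And>i j. g i j = 0 \<Longrightarrow> h i j = 0) \<Longrightarrow> ev0_2 h"
  unfolding ev0_2_def by blast

lemma ev0_2_combine:
  "ev0_2 g \<Longrightarrow> ev0_2 h \<Longrightarrow> (\<And>i j. g i j = 0 \<Longrightarrow> h i j = 0 \<Longrightarrow> f i j = 0) \<Longrightarrow> ev0_2 f"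
proof -
  assume "ev0_2 g" "ev0_2 h" and f: "\<And>i j. g i j = 0 \<Longrightarrow> h i j = 0 \<Longrightarrow> f i j = 0"
  then obtain N1 N2 where N: "\<And>i j. i \<ge> N1 \<or> j \<ge> N1 \<Longrightarrow> g i j = 0" "\<And>i j. i \<ge> N2 \<or> j \<ge> N2 \<Longrightarrow> h i j = 0"
    unfolding ev0_2_def by metis
  have "f i j = 0" if "i \<ge> max N1 N2 \<or> j \<ge> max N1 N2" for i j
    by (rule f; rule N) (use that in auto)
  then show ?thesis unfolding ev0_2_def by blast
qed

lemma ev0_2_swap: "ev0_2 g \<Longrightarrow> ev0_2 (\<lambda>i j. g j i)"
  unfolding ev0_2_def by metis

text \<open>Only finitely many outer indices contribute, so the bounds for the inner sums can be
  made uniform.\<close>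

lemma ev0_2_iterate:
  assumes "ev0 g" "\<And>i. ev0 (h i)" "\<And>i j. g i = 0 \<Longrightarrow> h i j = 0"
  shows "ev0_2 h"
proof -
  obtain N where N: "\<And>i. i \<ge> N \<Longrightarrow> g i = 0" using assms(1) by (auto simp: ev0_def)
  obtain M where M: "\<And>i j. j \<ge> M i \<Longrightarrow> h i j = 0"
    using assms(2) unfolding ev0_def by metis
  define K where "K = Max (insert N (M ` {..<N}))"
  have K: "N \<le> K" "\<And>i. i < N \<Longrightarrow> M i \<le> K" unfolding K_def by (auto intro!: Max_ge)
  have "h i j = 0" if "i \<ge> K \<or> j \<ge> K" for i j
  proof (cases "i < N")
    case True
    with that K show ?thesis using M[of i j] by force
  next
    case False
    then show ?thesis using N assms(3) by simp
  qed
  then show ?thesis unfolding ev0_2_def by blast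
qed

lemma ev0_2_inner: "ev0_2 g \<Longrightarrow> ev0 (g i)"
  unfolding ev0_2_def ev0_def by blast

lemma ev0_2_outer: "ev0_2 g \<Longrightarrow> ev0 (\<lambda>i. ssum (g i))"
proof -
  assume "ev0_2 g"
  then obtain N where N: "\<And>i j. i \<ge> N \<or> j \<ge> N \<Longrightarrow> g i j = 0" unfolding ev0_2_def by metis
  have "ssum (g i) = 0" if "i \<ge> N" for i using N that by (simp add: ssum_def)
  then show ?thesis unfolding ev0_def by blast
qed

lemma ssum_ssum_diff:
  assumes "ev0_2 g" "ev0_2 (h :: nat \<Rightarrow> nat \<Rightarrow> 'v::complex_vector)"
  shows "ssum (\<lambda>i. ssum (g i)) - ssum (\<lambda>i. ssum (h i)) = ssum (\<lambda>i. ssum (\<lambda>j. g i j - h i j))"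
proof -
  have "ssum (\<lambda>j. g i j - h i j) = ssum (g i) - ssum (h i)" for i
    by (rule ssum_diff[OF ev0_2_inner[OF assms(1)] ev0_2_inner[OF assms(2)]])
  then show ?thesis by (simp add: ssum_diff[OF ev0_2_outer[OF assms(1)] ev0_2_outer[OF assms(2)]])
qed

lemma ssum_ssum_add:
  assumes "ev0_2 g" "ev0_2 (h :: nat \<Rightarrow> nat \<Rightarrow> 'v::complex_vector)"
  shows "ssum (\<lambda>i. ssum (g i)) + ssum (\<lambda>i. ssum (h i)) = ssum (\<lambda>i. ssum (\<lambda>j. g i j + h i j))"
proof -
  have "ssum (\<lambda>j. g i j + h i j) = ssum (g i) + ssum (h i)" for i
    by (rule ssum_add[OF ev0_2_inner[OF assms(1)] ev0_2_inner[OF assms(2)]])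
  then show ?thesis by (simp add: ssum_add[OF ev0_2_outer[OF assms(1)] ev0_2_outer[OF assms(2)]])
qed

lemma ssum_ssum_lt:
  assumes "\<And>i j. i \<ge> N \<or> j \<ge> N \<Longrightarrow> g i j = 0"
  shows "ssum (\<lambda>i. ssum (g i)) = (\<Sum>i<N. \<Sum>j<N. g i j)"
proof -
  have "ssum (g i) = (\<Sum>j<N. g i j)" for i by (rule ssum_lt) (use assms in auto)
  moreover have "ssum (\<lambda>i. \<Sum>j<N. g i j) = (\<Sum>i<N. \<Sum>j<N. g i j)"
    by (rule ssum_lt) (use assms in auto)
  ultimately show ?thesis by simp
qed

lemma ssum_swap: "ev0_2 g \<Longrightarrow> ssum (\<lambda>i. ssum (\<lambda>j. g i j)) = ssum (\<lambda>j. ssum (\<lambda>i. g i j))"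
proof -
  assume "ev0_2 g"
  then obtain N where N: "\<And>i j. i \<ge> N \<or> j \<ge> N \<Longrightarrow> g i j = 0" unfolding ev0_2_def by metis
  have "ssum (\<lambda>j. ssum (\<lambda>i. g i j)) = (\<Sum>j<N. \<Sum>i<N. g i j)"
    by (rule ssum_ssum_lt) (rule N, blast)
  then show ?thesis
    using ssum_ssum_lt[of N g, OF N] sum.swap[of g "{..<N}" "{..<N}"] by simp
qed

lemma ssum_diagonal: "ev0_2 g \<Longrightarrow> ssum (\<lambda>i. ssum (\<lambda>j. g i j)) = ssum (\<lambda>p. \<Sum>i\<le>p. g i (p - i))"
proof -
  assume "ev0_2 g"
  then obtain N where N: "\<And>i j. i \<ge> N \<or> j \<ge> N \<Longrightarrow> g i j = 0" unfolding ev0_2_def by metis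
  have "ssum (\<lambda>p. \<Sum>i\<le>p. g i (p - i)) = (\<Sum>p<2 * N. \<Sum>i\<le>p. g i (p - i))"
  proof (rule ssum_lt, rule sum.neutral, rule ballI)
    fix p i assume "2 * N \<le> p" "i \<in> {..p}"
    then have "i \<ge> N \<or> p - i \<ge> N" by auto
    then show "g i (p - i) = 0" by (rule N)
  qed
  also have "\<dots> = (\<Sum>(p, i)\<in>(SIGMA p:{..<2 * N}. {..p}). g i (p - i))"
    by (rule sum.Sigma) auto
  also have "\<dots> = (\<Sum>(i, j)\<in>{(i, j). i + j < 2 * N}. g i j)"
    by (rule sum.reindex_bij_witness[of _ "\<lambda>(i, j). (i + j, i)" "\<lambda>(p, i). (i, p - i)"]) auto
  also have "\<dots> = (\<Sum>(i, j)\<in>{..<N} \<times> {..<N}. g i j)"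
  proof (rule sum.mono_neutral_right)
    show "finite {(i, j). i + j < 2 * N}"
      by (rule finite_subset[of _ "{..<2 * N} \<times> {..<2 * N}"]) auto
  qed (auto intro!: N)
  also have "\<dots> = ssum (\<lambda>i. ssum (g i))"
    by (simp add: ssum_ssum_lt[OF N] sum.cartesian_product)
  finally show ?thesis by simp
qed

section \<open>Symmetries of the induced module\<close>

instantiation "fun" :: (type, complex_vector) complex_vector
begin
definition scaleC_fun :: "complex \<Rightarrow> ('a \<Rightarrow> 'b) \<Rightarrow> 'a \<Rightarrow> 'b" where
  "scaleC_fun c f = (\<lambda>x. c *\<^sub>C f x)"
instance
  by standard (simp_all add: scaleC_fun_def fun_eq_iff scaleC_add_left scaleC_add_right
      scaleC_scaleC scaleC_one)
end

lemma clin_on_UNIV: "clin_on UNIV L = clinear L"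
  by (simp add: clin_on_def clinear_iff)

definition sh :: "int \<Rightarrow> bool \<times> int \<Rightarrow> bool \<times> int" where
  "sh a i = (fst i, snd i + a)"

lemma lam_sh: "lam (sh a i) (sh a j) = lam i j" and tgt_sh: "tgt (sh a i) (sh a j) = sh a (tgt i j)"
  by (auto simp: lam_def tgt_def sh_def)

definition T :: "int \<Rightarrow> vtoda \<Rightarrow> vtoda" where
  "T a = (SOME \<Phi>. clinear \<Phi> \<and> \<Phi> v0 = v0 \<and> (\<forall>i k v. \<Phi> (X i k v) = X (sh a i) k (\<Phi> v)))"

lemma T_props: "clinear (T a) \<and> T a v0 = v0 \<and> (\<forall>i k v. T a (X i k v) = X (sh a i) k (T a v))"
proof -
  obtain \<Phi> where "clinear \<Phi>" "\<Phi> v0 = v0" "\<And>i k v. \<Phi> (X i k v) = X (sh a i) k (\<Phi> v)"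
  proof (rule vtoda_modes_universal[of UNIV "\<lambda>i. X (sh a i)" v0])
    show "X (sh a i) k (X (sh a j) l s) - X (sh a j) l (X (sh a i) k s)
        = lam i j *\<^sub>C X (sh a (tgt i j)) (k + l) s" for i j k l s
      using X_comm[of "sh a i" k "sh a j" l s] by (simp add: lam_sh tgt_sh)
  qed (auto simp: clin_on_UNIV clinear_X X_vac)
  then have "\<exists>\<Phi>. clinear \<Phi> \<and> \<Phi> v0 = v0 \<and> (\<forall>i k v. \<Phi> (X i k v) = X (sh a i) k (\<Phi> v))"
    by blast
  from someI_ex[OF this] show ?thesis unfolding T_def .
qed

lemma clinear_T: "clinear (T a)" and T_v0 [simp]: "T a v0 = v0" and T_X: "T a (X i k v) = X (sh a i) k (T a v)"
  using T_props by blast+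

lemmas T_lin = clinear_add[OF clinear_T] clinear_scaleC[OF clinear_T] clinear_0[OF clinear_T]
  clinear_diff[OF clinear_T] clinear_uminus[OF clinear_T] clinear_sum[OF clinear_T]

lemma T_T: "T a (T b v) = T (a + b) v"
  by (induction v rule: X_induct) (simp_all add: T_X T_lin sh_def add_ac)

lemma T_0 [simp]: "T 0 v = v"
  by (induction v rule: X_induct) (simp_all add: T_X T_lin sh_def)

definition der :: "vtoda \<Rightarrow> vtoda" where
  "der = (SOME d. clinear d \<and> d v0 = 0 \<and>
    (\<forall>i k v. d (X i k v) = X i k (d v) - of_int k *\<^sub>C X i (k - 1) v))"

text \<open>A derivation is the second component of a homomorphism into the dual numbers; here the
  module of dual numbers is the space of functions on the booleans.\<close>

lemma der_props: "clinear der \<and> der v0 = 0 \<and>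
    (\<forall>i k v. der (X i k v) = X i k (der v) - of_int k *\<^sub>C X i (k - 1) v)"
proof -
  define x :: "bool \<times> int \<Rightarrow> int \<Rightarrow> (bool \<Rightarrow> vtoda) \<Rightarrow> bool \<Rightarrow> vtoda" where
    "x i k s = (\<lambda>b. if b then X i k (s True) else X i k (s False) - of_int k *\<^sub>C X i (k - 1) (s True))" for i k s
  obtain \<Phi> where \<Phi>: "clinear \<Phi>" "\<Phi> v0 = (\<lambda>b. if b then v0 else 0)"
    "\<And>i k v. \<Phi> (X i k v) = x i k (\<Phi> v)" "\<And>v. \<Phi> v \<in> UNIV"
  proof (rule vtoda_modes_universal[of UNIV x "\<lambda>b. if b then v0 else 0"])
    show "clin_on UNIV (x i k)" for i k
      unfolding clin_on_UNIV
      by (rule clinearI) (auto simp: x_def fun_eq_iff X_lin scaleC_fun_def scaleC_add_right algebra_simps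
          cvec.scale_right_diff_distrib scaleC_scaleC mult.commute)
    show "x i k (x j l s) - x j l (x i k s) = lam i j *\<^sub>C x (tgt i j) (k + l) s" for i j k l s
    proof
      fix b
      show "(x i k (x j l s) - x j l (x i k s)) b = (lam i j *\<^sub>C x (tgt i j) (k + l) s) b"
      proof (cases b)
        case True
        then show ?thesis by (simp add: x_def X_comm scaleC_fun_def)
      next
        case False
        let ?s = "s True" and ?t = "s False"
        have c: "X i k (X j l v) = X j l (X i k v) + lam i j *\<^sub>C X (tgt i j) (k + l) v" for k l v
          using X_comm[of i k j l v] by (simp add: algebra_simps)
        show ?thesis
          using False c[of k l ?t] c[of k "l - 1" ?s] c[of "k - 1" l ?s]
          by (simp add: x_def scaleC_fun_def X_lin cvec.scale_right_diff_distrib scaleC_add_right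
              scaleC_add_left scaleC_scaleC algebra_simps)
      qed
    qed
    \<comment> \<open>The extra term \<open>- k X_{k-1} v0\<close> vanishes: its factor is 0 for
      \<open>k = 0\<close>, and for \<open>k > 0\<close> the lowered mode still annihilates
      \<open>v0\<close>.\<close>
    show "x i k (\<lambda>b. if b then v0 else 0) = 0" if "k \<ge> 0" for i k
    proof (cases "k = 0")
      case True
      then show ?thesis by (simp add: x_def fun_eq_iff X_lin X_vac)
    next
      case False
      then show ?thesis using that by (simp add: x_def fun_eq_iff X_lin X_vac)
    qed
  qed (auto)
  have 1: "\<Phi> v True = v" for v
    by (induction v rule: X_induct)
      (simp_all add: \<Phi>(2,3) clinear_add[OF \<Phi>(1)] clinear_scaleC[OF \<Phi>(1)] x_def scaleC_fun_def)
  have "\<exists>d. clinear d \<and> d v0 = 0 \<and> (\<forall>i k v. d (X i k v) = X i k (d v) - of_int k *\<^sub>C X i (k - 1) v)"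
  proof (intro exI[of _ "\<lambda>v. \<Phi> v False"] conjI allI)
    show "clinear (\<lambda>v. \<Phi> v False)"
      by (rule clinearI) (simp_all add: clinear_add[OF \<Phi>(1)] clinear_scaleC[OF \<Phi>(1)] scaleC_fun_def)
  qed (simp_all add: \<Phi>(2,3) 1 x_def)
  from someI_ex[OF this] show ?thesis unfolding der_def .
qed

lemma clinear_der: "clinear der" and der_v0 [simp]: "der v0 = 0"
  and der_X: "der (X i k v) = X i k (der v) - of_int k *\<^sub>C X i (k - 1) v"
  using der_props by blast+

lemmas der_lin = clinear_add[OF clinear_der] clinear_scaleC[OF clinear_der] clinear_0[OF clinear_der]
  clinear_diff[OF clinear_der] clinear_uminus[OF clinear_der] clinear_sum[OF clinear_der]

lemma der_T: "der (T a v) = T a (der v)"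
  by (induction v rule: X_induct) (simp_all add: T_X T_lin der_X der_lin)

section \<open>Divided powers of the derivation and translation covariance\<close>

definition dp :: "nat \<Rightarrow> vtoda \<Rightarrow> vtoda" where
  "dp i v = (1 / fact i) *\<^sub>C (der ^^ i) v"

lemma dp_0 [simp]: "dp 0 v = v"
  by (simp add: dp_def scaleC_one)

lemma der_dp: "der (dp i v) = of_nat (Suc i) *\<^sub>C dp (Suc i) v"
  by (simp add: dp_def der_lin scaleC_scaleC field_simps del: of_nat_Suc)

lemma clinear_funpow_der: "clinear (der ^^ i)"
  by (induction i) (auto intro!: clinearI simp: der_lin clinear_add clinear_scaleC)

lemma clinear_dp: "clinear (dp i)"
  by (rule clinearI)
    (simp_all add: dp_def clinear_add[OF clinear_funpow_der] clinear_scaleC[OF clinear_funpow_der]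
      scaleC_add_right scaleC_scaleC mult.commute)

lemmas dp_lin = clinear_add[OF clinear_dp] clinear_scaleC[OF clinear_dp] clinear_0[OF clinear_dp]
  clinear_diff[OF clinear_dp] clinear_uminus[OF clinear_dp] clinear_sum[OF clinear_dp]

lemma dp_dp: "dp i (dp j v) = of_nat ((i + j) choose i) *\<^sub>C dp (i + j) v"
proof -
  have "dp i (dp j v) = (1 / fact i * (1 / fact j)) *\<^sub>C (der ^^ (i + j)) v"
    by (simp add: dp_def clinear_scaleC[OF clinear_funpow_der] scaleC_scaleC funpow_add)
  also have "\<dots> = of_nat ((i + j) choose i) *\<^sub>C dp (i + j) v"
    by (simp add: dp_def scaleC_scaleC binomial_fact field_simps)
  finally show ?thesis .
qed

lemma dp_der: "dp i (der v) = of_nat (Suc i) *\<^sub>C dp (Suc i) v"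
proof -
  have "dp i (der v) = dp i (dp 1 v)" using der_dp[of 0 v] by (simp add: scaleC_one)
  then show ?thesis by (simp add: dp_dp)
qed

lemma dp_Suc: "dp (Suc i) v = (1 / of_nat (Suc i)) *\<^sub>C der (dp i v)"
  by (simp add: der_dp scaleC_scaleC scaleC_one del: of_nat_Suc)

lemma dp_v0: "i > 0 \<Longrightarrow> dp i v0 = 0"
  by (cases i) (simp_all add: dp_def clinear_0[OF clinear_funpow_der] funpow_swap1[symmetric] funpow_Suc_right del: funpow.simps)

lemma dp_T: "dp i (T a v) = T a (dp i v)"
  by (induction i) (simp_all add: dp_Suc der_T T_lin)

abbreviation gb :: "int \<Rightarrow> nat \<Rightarrow> complex" where
  "gb n j \<equiv> of_int n gchoose j"

lemma gb_absorb: "of_nat (Suc j) * gb n (Suc j) = of_int n * gb (n - 1) j"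
  using gbinomial_absorption[of j "of_int n :: complex"] by simp

lemma gb_absorb': "of_nat (Suc j) * gb n (Suc j) = (of_int n - of_nat j) * gb n j"
  using gbinomial_absorb_comp[of "of_int n :: complex" j] gb_absorb[of j n] by simp

lemma gb_nonneg_0: "0 \<le> n \<Longrightarrow> n < int j \<Longrightarrow> gb n j = 0"
proof -
  assume "0 \<le> n" "n < int j"
  then obtain m where "n = int m" "m < j" by (metis of_nat_less_iff zero_le_imp_eq_int)
  then show ?thesis using binomial_gbinomial[of m j, where ?'a = complex] by (simp add: binomial_eq_0)
qed

lemma scaleC_cancel_Suc: "of_nat (Suc i) *\<^sub>C x = of_nat (Suc i) *\<^sub>C (y :: 'v::complex_vector) \<Longrightarrow> x = y"
  by (metis cvec.scale_cancel_left of_nat_eq_0_iff nat.distinct(1))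

text \<open>With \<open>A(z) = \<Sum> A_n z^{-n-1}\<close> the hypothesis reads
  \<open>[der, A(z)] = A'(z)\<close>, and the claim is the coefficient of
  \<open>t^i z^{-n-1}\<close> in \<open>A(z) e^{t der} = e^{t der} A(z - t)\<close>. It applies to
  the currents and to \<open>Y0 f\<close> alike.\<close>

lemma covariant_dp:
  assumes A: "\<And>n. clinear (A n)" and dA: "\<And>n v. der (A n v) = A n (der v) - of_int n *\<^sub>C A (n - 1) v"
  shows "A n (dp i v) = (\<Sum>p\<le>i. gb n p *\<^sub>C dp (i - p) (A (n - int p) v))"
proof (induction i arbitrary: n)
  case 0
  then show ?case by (simp add: scaleC_one)
next
  case (Suc i)
  let ?d = "\<lambda>p. dp (Suc i - p) (A (n - int p) v)"
  have "of_nat (Suc i) *\<^sub>C A n (dp (Suc i) v) = A n (der (dp i v))"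
    by (simp only: der_dp clinear_scaleC[OF A])
  also have "\<dots> = der (A n (dp i v)) + of_int n *\<^sub>C A (n - 1) (dp i v)"
    by (simp add: dA)
  also have "der (A n (dp i v)) = (\<Sum>p\<le>i. (gb n p * of_nat (Suc i - p)) *\<^sub>C ?d p)"
    unfolding Suc by (simp add: der_lin der_dp scaleC_scaleC Suc_diff_le del: of_nat_Suc)
  also have "of_int n *\<^sub>C A (n - 1) (dp i v) = (\<Sum>p\<le>i. (of_nat (Suc p) * gb n (Suc p)) *\<^sub>C ?d (Suc p))"
    unfolding Suc gb_absorb by (simp add: cvec.scale_sum_right scaleC_scaleC algebra_simps)
  also have "(\<Sum>p\<le>i. (gb n p * of_nat (Suc i - p)) *\<^sub>C ?d p) + (\<Sum>p\<le>i. (of_nat (Suc p) * gb n (Suc p)) *\<^sub>C ?d (Suc p))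
     = (\<Sum>p\<le>Suc i. (gb n p * of_nat (Suc i - p)) *\<^sub>C ?d p) + (\<Sum>p\<le>Suc i. (of_nat p * gb n p) *\<^sub>C ?d p)"
  proof -
    have "(\<Sum>p\<le>Suc i. (of_nat p * gb n p) *\<^sub>C ?d p) = (\<Sum>p\<le>i. (of_nat (Suc p) * gb n (Suc p)) *\<^sub>C ?d (Suc p))"
      by (subst sum.atMost_Suc_shift) (simp del: of_nat_Suc)
    moreover have "(\<Sum>p\<le>Suc i. (gb n p * of_nat (Suc i - p)) *\<^sub>C ?d p) = (\<Sum>p\<le>i. (gb n p * of_nat (Suc i - p)) *\<^sub>C ?d p)"
      by simp
    ultimately show ?thesis by (simp only:)
  qed
  also have "\<dots> = (\<Sum>p\<le>Suc i. of_nat (Suc i) *\<^sub>C gb n p *\<^sub>C ?d p)"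
    unfolding sum.distrib[symmetric] scaleC_add_left[symmetric] scaleC_scaleC
    by (intro sum.cong refl) (simp add: of_nat_diff algebra_simps)
  finally have "of_nat (Suc i) *\<^sub>C A n (dp (Suc i) v) = of_nat (Suc i) *\<^sub>C (\<Sum>p\<le>Suc i. gb n p *\<^sub>C ?d p)"
    by (simp only: cvec.scale_sum_right)
  then show ?case by (rule scaleC_cancel_Suc)
qed

text \<open>The companion \<open>e^{t der} A(z) = A(z + t) e^{t der}\<close>, with all derivatives
  moved to the right.\<close>

lemma dp_covariant:
  assumes A: "\<And>n. clinear (A n)" and dA: "\<And>n v. der (A n v) = A n (der v) - of_int n *\<^sub>C A (n - 1) v"
  shows "dp i (A n v) = (\<Sum>p\<le>i. ((-1) ^ p * gb n p) *\<^sub>C A (n - int p) (dp (i - p) v))"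
proof (induction i)
  case 0
  then show ?case by (simp add: scaleC_one)
next
  case (Suc i)
  let ?d = "\<lambda>p. A (n - int p) (dp (Suc i - p) v)"
  have "of_nat (Suc i) *\<^sub>C dp (Suc i) (A n v) = der (dp i (A n v))"
    by (simp only: der_dp)
  also have "\<dots> = (\<Sum>p\<le>i. ((-1) ^ p * gb n p) *\<^sub>C der (A (n - int p) (dp (i - p) v)))"
    unfolding Suc by (simp add: der_lin)
  also have "\<dots> = (\<Sum>p\<le>i. ((-1) ^ p * gb n p * of_nat (Suc i - p)) *\<^sub>C ?d p
        + ((-1) ^ Suc p * (of_nat (Suc p) * gb n (Suc p))) *\<^sub>C ?d (Suc p))"
  proof (rule sum.cong[OF refl])
    fix p assume "p \<in> {..i}"
    then have "der (A (n - int p) (dp (i - p) v)) = of_nat (Suc i - p) *\<^sub>C ?d p - (of_int n - of_nat p) *\<^sub>C ?d (Suc p)"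
      by (simp add: dA der_dp clinear_scaleC[OF A] Suc_diff_le del: of_nat_Suc) (simp add: algebra_simps)
    then show "((-1) ^ p * gb n p) *\<^sub>C der (A (n - int p) (dp (i - p) v))
      = ((-1) ^ p * gb n p * of_nat (Suc i - p)) *\<^sub>C ?d p
        + ((-1) ^ Suc p * (of_nat (Suc p) * gb n (Suc p))) *\<^sub>C ?d (Suc p)"
      unfolding gb_absorb'
      by (simp add: cvec.scale_right_diff_distrib scaleC_scaleC mult_ac cvec.scale_minus_left)
  qed
  also have "\<dots> = (\<Sum>p\<le>i. ((-1) ^ p * gb n p * of_nat (Suc i - p)) *\<^sub>C ?d p)
     + (\<Sum>p\<le>i. ((-1) ^ Suc p * (of_nat (Suc p) * gb n (Suc p))) *\<^sub>C ?d (Suc p))"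
    by (rule sum.distrib)
  also have "\<dots> = (\<Sum>p\<le>Suc i. ((-1) ^ p * gb n p * of_nat (Suc i - p)) *\<^sub>C ?d p)
     + (\<Sum>p\<le>Suc i. ((-1) ^ p * (of_nat p * gb n p)) *\<^sub>C ?d p)"
  proof -
    have "(\<Sum>p\<le>Suc i. ((-1) ^ p * (of_nat p * gb n p)) *\<^sub>C ?d p)
       = (\<Sum>p\<le>i. ((-1) ^ Suc p * (of_nat (Suc p) * gb n (Suc p))) *\<^sub>C ?d (Suc p))"
      by (subst sum.atMost_Suc_shift) (simp del: of_nat_Suc power_Suc)
    moreover have "(\<Sum>p\<le>Suc i. ((-1) ^ p * gb n p * of_nat (Suc i - p)) *\<^sub>C ?d p)
       = (\<Sum>p\<le>i. ((-1) ^ p * gb n p * of_nat (Suc i - p)) *\<^sub>C ?d p)"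
      by simp
    ultimately show ?thesis by (simp only:)
  qed
  also have "\<dots> = (\<Sum>p\<le>Suc i. of_nat (Suc i) *\<^sub>C ((-1) ^ p * gb n p) *\<^sub>C ?d p)"
    unfolding sum.distrib[symmetric] scaleC_add_left[symmetric] scaleC_scaleC
    by (intro sum.cong refl) (simp add: of_nat_diff algebra_simps)
  finally have "of_nat (Suc i) *\<^sub>C dp (Suc i) (A n v) = of_nat (Suc i) *\<^sub>C (\<Sum>p\<le>Suc i. ((-1) ^ p * gb n p) *\<^sub>C ?d p)"
    by (simp only: cvec.scale_sum_right)
  then show ?case by (rule scaleC_cancel_Suc)
qed

section \<open>The vertex operators at one point\<close>

lemma X_ev0_int: "\<exists>N. \<forall>k\<ge>int N. X a k v = 0"
proof -
  obtain b n where a: "a = (b, n)" by force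
  let ?B = "{(n, k). 0 \<le> k \<and> X (b, n) k v \<noteq> 0}"
  have fin: "finite ?B" using trunc_X[of b v] by (simp add: trunc_def)
  define N where "N = nat (Max (insert 0 (snd ` ?B)) + 1)"
  have "X a k v = 0" if "k \<ge> int N" for k
  proof (rule ccontr)
    assume "X a k v \<noteq> 0"
    then have "(n, k) \<in> ?B" using that by (simp add: a)
    then have "k \<le> Max (insert 0 (snd ` ?B))" using fin by (intro Max_ge) (auto simp: image_iff)
    moreover have "0 \<le> Max (insert 0 (snd ` ?B))" using fin by (intro Max_ge) auto
    ultimately show False using that unfolding N_def by linarith
  qed
  then show ?thesis by blast
qed

lemma X_ev0: "ev0 (\<lambda>j. X a (int j + k) v)"
proof -
  obtain N where N: "\<And>k. k \<ge> int N \<Longrightarrow> X a k v = 0" using X_ev0_int by blast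
  have "X a (int j + k) v = 0" if "j \<ge> N + nat (- k)" for j
    by (rule N) (use that in linarith)
  then show ?thesis unfolding ev0_def by blast
qed

lemma X_ev0': "ev0 (\<lambda>j. X a (int j) v)"
  using X_ev0[of a 0 v] by simp

lemma X_X_ev0: "ev0_2 (\<lambda>i j. X b (int j) (X a (int i) v))"
  by (rule ev0_2_iterate[OF X_ev0'[of a v]]) (auto simp: X_ev0' X_lin)

lemma ev0_scaleC: "ev0 g \<Longrightarrow> ev0 (\<lambda>j. c j *\<^sub>C (g j :: 'v::complex_vector))"
  by (erule ev0_mono) simp

text \<open>Linearity in the state makes the sum in \<open>Yact\<close> finite:
  \<open>X a (int j) f\<close> vanishes for large \<open>j\<close>, and so does its image.\<close>

definition Yspace :: "(vtoda \<Rightarrow> int \<Rightarrow> vtoda) set" where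
  "Yspace = {\<Psi>. \<forall>k. clinear (\<lambda>f. \<Psi> f k)}"

text \<open>The commutator formula, read as an action of the modes on the space of all candidates for
  \<open>\<lambda>f k. Y f k g\<close>.\<close>

definition Yact :: "bool \<times> int \<Rightarrow> int \<Rightarrow> (vtoda \<Rightarrow> int \<Rightarrow> vtoda) \<Rightarrow> vtoda \<Rightarrow> int \<Rightarrow> vtoda" where
  "Yact a l \<Psi> f k = X a l (\<Psi> f k) - ssum (\<lambda>j. gb l j *\<^sub>C \<Psi> (X a (int j) f) (k + l - int j))"

text \<open>The coefficients of \<open>e^{z der} f\<close>, where degree \<open>k\<close> stands for
  the power \<open>z^{-k-1}\<close>.\<close>

definition Yvac :: "vtoda \<Rightarrow> int \<Rightarrow> vtoda" where
  "Yvac f k = (if k < 0 then dp (nat (- k - 1)) f else 0)"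

lemma Yspace_clinear: "\<Psi> \<in> Yspace \<Longrightarrow> clinear (\<lambda>f. \<Psi> f k)"
  by (simp add: Yspace_def)

lemma Yspace_0: "\<Psi> \<in> Yspace \<Longrightarrow> \<Psi> 0 k = 0"
  using clinear_0[OF Yspace_clinear] .

lemma Yspace_ev0: "\<Psi> \<in> Yspace \<Longrightarrow> ev0 (\<lambda>j. \<Psi> (X a (int j) f) (h j))"
  by (rule ev0_mono[OF X_ev0'[of a f]]) (simp add: Yspace_0)

lemma csubspace_Yspace: "csubspace Yspace"
  by (auto simp: cvec.subspace_def Yspace_def scaleC_fun_def clinear_iff scaleC_add_right scaleC_scaleC
      mult.commute)

lemma Yact_space: "\<Psi> \<in> Yspace \<Longrightarrow> Yact a l \<Psi> \<in> Yspace"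
proof -
  assume \<Psi>: "\<Psi> \<in> Yspace"
  note lin = clinear_add[OF Yspace_clinear[OF \<Psi>]] clinear_scaleC[OF Yspace_clinear[OF \<Psi>]]
  have ev: "ev0 (\<lambda>j. c j *\<^sub>C \<Psi> (X a (int j) f) (h j))" for c a f h
    by (rule ev0_scaleC[OF Yspace_ev0[OF \<Psi>]])
  show ?thesis
    unfolding Yspace_def
  proof (rule CollectI, rule allI, rule clinearI)
    show "Yact a l \<Psi> (f + g) k = Yact a l \<Psi> f k + Yact a l \<Psi> g k" for f g k
      by (simp add: Yact_def X_lin lin scaleC_add_right ssum_add[OF ev ev])
    show "Yact a l \<Psi> (c *\<^sub>C f) k = c *\<^sub>C Yact a l \<Psi> f k" for c f k
      using ssum_scaleC[OF ev[where c = "gb l" and a = a and f = f and h = "\<lambda>j. k + l - int j"], of c]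
      by (simp add: Yact_def X_lin lin cvec.scale_right_diff_distrib scaleC_scaleC mult.commute)
  qed
qed

lemma clin_on_Yact: "clin_on Yspace (Yact a l)"
  unfolding clin_on_def
proof (intro conjI ballI allI ext)
  fix \<Psi> \<Psi>' f k c assume \<Psi>: "\<Psi> \<in> Yspace" and \<Psi>': "\<Psi>' \<in> Yspace"
  note ev = ev0_scaleC[OF Yspace_ev0[OF \<Psi>]] and ev' = ev0_scaleC[OF Yspace_ev0[OF \<Psi>']]
  show "Yact a l (\<Psi> + \<Psi>') f k = (Yact a l \<Psi> + Yact a l \<Psi>') f k"
    by (simp add: Yact_def X_lin scaleC_add_right ssum_add[OF ev ev'])
next
  fix \<Psi> f k c assume \<Psi>: "\<Psi> \<in> Yspace"
  have ev: "ev0 (\<lambda>j. c j *\<^sub>C \<Psi> (X a (int j) f) (h j))" for c a f h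
    by (rule ev0_scaleC[OF Yspace_ev0[OF \<Psi>]])
  show "Yact a l (c *\<^sub>C \<Psi>) f k = (c *\<^sub>C Yact a l \<Psi>) f k"
    using ssum_scaleC[OF ev[where c = "gb l" and a = a and f = f and h = "\<lambda>j. k + l - int j"], of c]
    by (simp add: Yact_def X_lin scaleC_fun_def cvec.scale_right_diff_distrib scaleC_scaleC mult.commute)
qed

lemma gb_Vandermonde: "(\<Sum>i\<le>p. gb m i * gb l (p - i)) = gb (m + l) p"
  using gbinomial_Vandermonde[of "of_int m :: complex" "of_int l" p] by (simp add: atLeast0AtMost)

text \<open>The terms with one mode outside and one on the state cancel. The outer modes contribute
  their bracket. The double sums differ by the bracket of the modes acting on the state, and the
  coefficients with \<open>i + j = p\<close> add up to one binomial coefficient by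
  Vandermonde.\<close>

lemma Yact_comm:
  assumes \<Psi>: "\<Psi> \<in> Yspace"
  shows "Yact a m (Yact b l \<Psi>) - Yact b l (Yact a m \<Psi>) = lam a b *\<^sub>C Yact (tgt a b) (m + l) \<Psi>"
proof (intro ext)
  fix f k
  have ev: "ev0 (\<lambda>j. c j *\<^sub>C \<Psi> (X a (int j) f) (h j))" for c a f h
    by (rule ev0_scaleC[OF Yspace_ev0[OF \<Psi>]])
  define D where "D a b m l = ssum (\<lambda>j. ssum (\<lambda>i. (gb m j * gb l i) *\<^sub>C \<Psi> (X b (int i) (X a (int j) f)) (k + m + l - int j - int i)))"
    for a b m l
  have D2: "ev0_2 (\<lambda>j i. (gb m j * gb l i) *\<^sub>C \<Psi> (X b (int i) (X a (int j) f)) (k + m + l - int j - int i))" for a b m l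
    by (rule ev0_2_mono[OF X_X_ev0[of b a f]]) (simp add: Yspace_0[OF \<Psi>])
  have YY: "Yact a m (Yact b l \<Psi>) f k = X a m (X b l (\<Psi> f k))
      - ssum (\<lambda>i. gb l i *\<^sub>C X a m (\<Psi> (X b (int i) f) (k + l - int i)))
      - ssum (\<lambda>j. gb m j *\<^sub>C X b l (\<Psi> (X a (int j) f) (k + m - int j))) + D a b m l" for a b m l
  proof -
    have "Yact a m (Yact b l \<Psi>) f k = X a m (X b l (\<Psi> f k) - ssum (\<lambda>i. gb l i *\<^sub>C \<Psi> (X b (int i) f) (k + l - int i)))
      - ssum (\<lambda>j. gb m j *\<^sub>C (X b l (\<Psi> (X a (int j) f) (k + m - int j))
          - ssum (\<lambda>i. gb l i *\<^sub>C \<Psi> (X b (int i) (X a (int j) f)) (k + m - int j + l - int i))))"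
      by (simp only: Yact_def)
    also have "X a m (X b l (\<Psi> f k) - ssum (\<lambda>i. gb l i *\<^sub>C \<Psi> (X b (int i) f) (k + l - int i)))
       = X a m (X b l (\<Psi> f k)) - ssum (\<lambda>i. gb l i *\<^sub>C X a m (\<Psi> (X b (int i) f) (k + l - int i)))"
      by (simp add: X_lin ssum_comp[OF ev clinear_X])
    also have "ssum (\<lambda>j. gb m j *\<^sub>C (X b l (\<Psi> (X a (int j) f) (k + m - int j))
          - ssum (\<lambda>i. gb l i *\<^sub>C \<Psi> (X b (int i) (X a (int j) f)) (k + m - int j + l - int i))))
       = ssum (\<lambda>j. gb m j *\<^sub>C X b l (\<Psi> (X a (int j) f) (k + m - int j))) - D a b m l"
    proof -
      have e: "gb m j *\<^sub>C ssum (\<lambda>i. gb l i *\<^sub>C \<Psi> (X b (int i) (X a (int j) f)) (k + m - int j + l - int i))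
         = ssum (\<lambda>i. (gb m j * gb l i) *\<^sub>C \<Psi> (X b (int i) (X a (int j) f)) (k + m + l - int j - int i))" for j
        by (subst ssum_scaleC[OF ev, symmetric]) (simp add: scaleC_scaleC algebra_simps)
      have 1: "ev0 (\<lambda>j. gb m j *\<^sub>C X b l (\<Psi> (X a (int j) f) (k + m - int j)))"
        by (rule ev0_mono[OF X_ev0'[of a f]]) (simp add: Yspace_0[OF \<Psi>] X_lin)
      show ?thesis
        unfolding cvec.scale_right_diff_distrib e D_def by (rule ssum_diff[OF 1 ev0_2_outer[OF D2]])
    qed
    finally show ?thesis by simp
  qed
  have Dsw: "D b a l m = ssum (\<lambda>j. ssum (\<lambda>i. (gb m j * gb l i) *\<^sub>C \<Psi> (X a (int j) (X b (int i) f)) (k + m + l - int j - int i)))"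
    unfolding D_def by (subst ssum_swap[OF D2]) (simp add: mult.commute algebra_simps)
  have D2': "ev0_2 (\<lambda>j i. (gb m j * gb l i) *\<^sub>C \<Psi> (X a (int j) (X b (int i) f)) (k + m + l - int j - int i))"
    by (rule ev0_2_mono[OF ev0_2_swap[OF X_X_ev0[of a b f]]]) (simp add: Yspace_0[OF \<Psi>])
  have c: "\<Psi> (X a (int j) (X b (int i) f)) h = \<Psi> (X b (int i) (X a (int j) f)) h + lam a b *\<^sub>C \<Psi> (X (tgt a b) (int (j + i)) f) h" for i j h
  proof -
    have "X a (int j) (X b (int i) f) = X b (int i) (X a (int j) f) + lam a b *\<^sub>C X (tgt a b) (int (j + i)) f"
      using X_comm[of a "int j" b "int i" f] by (simp add: algebra_simps)
    then show ?thesis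
      by (simp add: clinear_add[OF Yspace_clinear[OF \<Psi>]] clinear_scaleC[OF Yspace_clinear[OF \<Psi>]])
  qed
  let ?c = "\<lambda>j i. (gb m j * gb l i) *\<^sub>C lam a b *\<^sub>C \<Psi> (X (tgt a b) (int (j + i)) f) (k + m + l - int j - int i)"
  have e: "?c j i = (gb m j * gb l i) *\<^sub>C \<Psi> (X a (int j) (X b (int i) f)) (k + m + l - int j - int i)
     - (gb m j * gb l i) *\<^sub>C \<Psi> (X b (int i) (X a (int j) f)) (k + m + l - int j - int i)" for i j
    by (simp only: c scaleC_add_right add_diff_cancel_left')
  have D2'': "ev0_2 ?c"
    by (rule ev0_2_combine[OF D2[of m l b a] D2']) (simp only: e diff_self)
  have "D b a l m - D a b m l = ssum (\<lambda>j. ssum (\<lambda>i. ?c j i))"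
    unfolding e Dsw unfolding D_def[of a b m l] by (rule ssum_ssum_diff[OF D2' D2])
  also have "\<dots> = ssum (\<lambda>p. \<Sum>j\<le>p. ?c j (p - j))" by (rule ssum_diagonal[OF D2''])
  also have "(\<lambda>p. \<Sum>j\<le>p. ?c j (p - j))
     = (\<lambda>p. lam a b *\<^sub>C gb (m + l) p *\<^sub>C \<Psi> (X (tgt a b) (int p) f) (k + (m + l) - int p))"
  proof
    fix p
    have "(\<Sum>j\<le>p. ?c j (p - j)) = (\<Sum>j\<le>p. (gb m j * gb l (p - j)) *\<^sub>C lam a b *\<^sub>C \<Psi> (X (tgt a b) (int p) f) (k + (m + l) - int p))"
      by (rule sum.cong) (auto simp: of_nat_diff algebra_simps)
    also have "\<dots> = gb (m + l) p *\<^sub>C lam a b *\<^sub>C \<Psi> (X (tgt a b) (int p) f) (k + (m + l) - int p)"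
      by (simp only: cvec.scale_sum_left[symmetric] gb_Vandermonde)
    finally show "(\<Sum>j\<le>p. ?c j (p - j)) = lam a b *\<^sub>C gb (m + l) p *\<^sub>C \<Psi> (X (tgt a b) (int p) f) (k + (m + l) - int p)"
      by (simp add: scaleC_scaleC mult.commute)
  qed
  also have "ssum (\<lambda>p. lam a b *\<^sub>C gb (m + l) p *\<^sub>C \<Psi> (X (tgt a b) (int p) f) (k + (m + l) - int p))
     = lam a b *\<^sub>C ssum (\<lambda>p. gb (m + l) p *\<^sub>C \<Psi> (X (tgt a b) (int p) f) (k + (m + l) - int p))"
    by (rule ssum_scaleC[OF ev])
  finally have D: "D b a l m - D a b m l
     = lam a b *\<^sub>C ssum (\<lambda>p. gb (m + l) p *\<^sub>C \<Psi> (X (tgt a b) (int p) f) (k + (m + l) - int p))" .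
  have "(Yact a m (Yact b l \<Psi>) - Yact b l (Yact a m \<Psi>)) f k
     = X a m (X b l (\<Psi> f k)) - X b l (X a m (\<Psi> f k)) - (D b a l m - D a b m l)"
    by (simp add: YY)
  also have "\<dots> = (lam a b *\<^sub>C Yact (tgt a b) (m + l) \<Psi>) f k"
    unfolding D X_comm by (simp add: scaleC_fun_def Yact_def cvec.scale_right_diff_distrib)
  finally show "(Yact a m (Yact b l \<Psi>) - Yact b l (Yact a m \<Psi>)) f k = (lam a b *\<^sub>C Yact (tgt a b) (m + l) \<Psi>) f k" .
qed

lemma Yvac_space: "Yvac \<in> Yspace"
  by (auto simp: Yspace_def Yvac_def intro!: clinearI simp: dp_lin)

text \<open>For \<open>l \<ge> 0\<close> this says that the two expansions of \<open>(z + t)^l\<close> agree.\<close>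

lemma covariant_Yvac:
  assumes A: "\<And>n. clinear (A n)" and dA: "\<And>n v. der (A n v) = A n (der v) - of_int n *\<^sub>C A (n - 1) v"
    and l: "l \<ge> 0"
  shows "A l (Yvac f k) = ssum (\<lambda>j. gb l j *\<^sub>C Yvac (A (int j) f) (k + l - int j))"
proof -
  have s: "ssum (\<lambda>j. gb l j *\<^sub>C Yvac (A (int j) f) (k + l - int j))
    = (\<Sum>j\<le>nat l. gb l j *\<^sub>C Yvac (A (int j) f) (k + l - int j))"
    by (rule ssum_le) (use l in \<open>simp add: gb_nonneg_0\<close>)
  show ?thesis
  proof (cases "k \<ge> 0")
    case True
    then have "(\<Sum>j\<le>nat l. gb l j *\<^sub>C Yvac (A (int j) f) (k + l - int j)) = 0"
      using l by (intro sum.neutral) (auto simp: Yvac_def)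
    then show ?thesis using True by (simp add: s) (simp add: Yvac_def clinear_0[OF A])
  next
    case False
    define i where "i = nat (- k - 1)"
    have k: "k = - int i - 1" using False by (simp add: i_def)
    have "A l (Yvac f k) = (\<Sum>p\<le>i. gb l p *\<^sub>C dp (i - p) (A (l - int p) f))"
      using covariant_dp[of A, OF A dA, of l i f] by (simp add: Yvac_def k)
    also have "\<dots> = (\<Sum>p\<le>nat l. gb l p *\<^sub>C Yvac (A (l - int p) f) (k + int p))"
    proof -
      \<comment> \<open>The binomial coefficient vanishes beyond \<open>l\<close> and
        \<open>Yvac\<close> beyond \<open>i\<close>, so the two ranges may be exchanged.\<close>
      have "(\<Sum>p\<le>i. gb l p *\<^sub>C dp (i - p) (A (l - int p) f)) = (\<Sum>p\<in>{..i} \<inter> {..nat l}. gb l p *\<^sub>C Yvac (A (l - int p) f) (k + int p))"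
        by (rule sum.mono_neutral_cong_right) (use l in \<open>auto simp: gb_nonneg_0 Yvac_def k nat_diff_distrib' not_le intro!: arg_cong2[where f = "(*\<^sub>C)"] arg_cong2[where f = dp]\<close>)
      also have "\<dots> = (\<Sum>p\<le>nat l. gb l p *\<^sub>C Yvac (A (l - int p) f) (k + int p))"
        by (rule sum.mono_neutral_left) (auto simp: Yvac_def k)
      finally show ?thesis .
    qed
    also have "\<dots> = (\<Sum>j\<le>nat l. gb l (nat l - j) *\<^sub>C Yvac (A (int j) f) (k + l - int j))"
      by (rule sum.reindex_bij_witness[of _ "\<lambda>j. nat l - j" "\<lambda>j. nat l - j"])
        (use l in \<open>auto simp: of_nat_diff algebra_simps\<close>)
    also have "\<dots> = (\<Sum>j\<le>nat l. gb l j *\<^sub>C Yvac (A (int j) f) (k + l - int j))"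
    proof (rule sum.cong[OF refl])
      fix j assume j: "j \<in> {..nat l}"
      have "gb l i = of_nat (nat l choose i)" for i
        using l binomial_gbinomial[of "nat l" i, where ?'a = complex] by simp
      then have "gb l (nat l - j) = gb l j" using j binomial_symmetric[of j "nat l"] by simp
      then show "gb l (nat l - j) *\<^sub>C Yvac (A (int j) f) (k + l - int j) = gb l j *\<^sub>C Yvac (A (int j) f) (k + l - int j)"
        by simp
    qed
    finally show ?thesis by (simp add: s)
  qed
qed

lemma Yact_Yvac: "l \<ge> 0 \<Longrightarrow> Yact a l Yvac = 0"
  using covariant_Yvac[of "X a", OF clinear_X der_X] by (simp add: Yact_def fun_eq_iff)

section \<open>The operators \<open>Y0\<close> and their translation covariance\<close>

definition Y0 :: "vtoda \<Rightarrow> int \<Rightarrow> vtoda \<Rightarrow> vtoda" where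
  "Y0 f k g = (SOME \<Phi>. clinear \<Phi> \<and> \<Phi> v0 = Yvac \<and> (\<forall>a l g. \<Phi> (X a l g) = Yact a l (\<Phi> g)) \<and> range \<Phi> \<subseteq> Yspace) g f k"

lemma Y0_props: "\<exists>\<Phi>. clinear \<Phi> \<and> \<Phi> v0 = Yvac \<and> (\<forall>a l g. \<Phi> (X a l g) = Yact a l (\<Phi> g)) \<and> range \<Phi> \<subseteq> Yspace
    \<and> (\<forall>f k g. Y0 f k g = \<Phi> g f k)"
proof -
  let ?P = "\<lambda>\<Phi>. clinear \<Phi> \<and> \<Phi> v0 = Yvac \<and> (\<forall>a l g. \<Phi> (X a l g) = Yact a l (\<Phi> g)) \<and> range \<Phi> \<subseteq> Yspace"
  obtain \<Phi> where "clinear \<Phi>" "\<Phi> v0 = Yvac" "\<And>a l g. \<Phi> (X a l g) = Yact a l (\<Phi> g)" "\<And>g. \<Phi> g \<in> Yspace"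
    by (rule vtoda_modes_universal[of Yspace Yact Yvac])
      (auto simp: csubspace_Yspace Yact_space clin_on_Yact Yact_comm Yvac_space Yact_Yvac)
  then have "\<exists>\<Phi>. ?P \<Phi>" by blast
  then have "?P (SOME \<Phi>. ?P \<Phi>)" by (rule someI_ex)
  then show ?thesis by (intro exI[of _ "SOME \<Phi>. ?P \<Phi>"]) (simp add: Y0_def)
qed

lemma clinear_Y0: "clinear (Y0 f k)" and clinear_Y0_state: "clinear (\<lambda>f. Y0 f k g)"
  and Y0_v0: "Y0 f k v0 = Yvac f k"
  and Y0_X: "Y0 f k (X a l g) = X a l (Y0 f k g) - ssum (\<lambda>j. gb l j *\<^sub>C Y0 (X a (int j) f) (k + l - int j) g)"
proof -
  obtain \<Phi> where \<Phi>: "clinear \<Phi>" "\<Phi> v0 = Yvac" "\<And>a l g. \<Phi> (X a l g) = Yact a l (\<Phi> g)"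
    "range \<Phi> \<subseteq> Yspace" "\<And>f k g. Y0 f k g = \<Phi> g f k"
    using Y0_props by blast
  show "clinear (Y0 f k)"
    by (rule clinearI) (simp_all add: \<Phi>(5) clinear_add[OF \<Phi>(1)] clinear_scaleC[OF \<Phi>(1)] scaleC_fun_def)
  show "clinear (\<lambda>f. Y0 f k g)" using \<Phi>(4) unfolding \<Phi>(5) by (auto simp: Yspace_def)
  show "Y0 f k v0 = Yvac f k" by (simp add: \<Phi>(2,5))
  show "Y0 f k (X a l g) = X a l (Y0 f k g) - ssum (\<lambda>j. gb l j *\<^sub>C Y0 (X a (int j) f) (k + l - int j) g)"
    by (simp add: \<Phi>(3,5) Yact_def)
qed

lemmas Y0_lin = clinear_add[OF clinear_Y0] clinear_scaleC[OF clinear_Y0] clinear_0[OF clinear_Y0]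
  clinear_diff[OF clinear_Y0] clinear_uminus[OF clinear_Y0] clinear_sum[OF clinear_Y0]
lemmas Y0_state_lin = clinear_add[OF clinear_Y0_state] clinear_scaleC[OF clinear_Y0_state]
  clinear_0[OF clinear_Y0_state] clinear_diff[OF clinear_Y0_state] clinear_uminus[OF clinear_Y0_state]
  clinear_sum[OF clinear_Y0_state]

lemma X_Y0: "X a l (Y0 f k g) = Y0 f k (X a l g) + ssum (\<lambda>j. gb l j *\<^sub>C Y0 (X a (int j) f) (k + l - int j) g)"
  by (simp add: Y0_X)

lemma Y0_state_ev0: "ev0 (\<lambda>j. c j *\<^sub>C Y0 (X a (int j) f) (h j) g)"
  by (rule ev0_mono[OF X_ev0'[of a f]]) (simp add: Y0_state_lin)

text \<open>The induction is for all \<open>f\<close>: the recursion for \<open>X a l g\<close>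
  involves finitely many other states \<open>X a (int j) f\<close>, each with its own bound.\<close>

lemma Y0_ev0_int: "\<exists>N. \<forall>k\<ge>int N. Y0 f k g = 0"
proof (induction g arbitrary: f rule: X_induct)
  case vac
  then show ?case by (auto simp: Y0_v0 Yvac_def intro!: exI[of _ 0])
next
  case (X a l g)
  obtain N0 where N0: "\<And>j. j \<ge> N0 \<Longrightarrow> X a (int j) f = 0" using X_ev0'[of a f] by (auto simp: ev0_def)
  obtain M where M: "\<And>f k. k \<ge> int (M f) \<Longrightarrow> Y0 f k g = 0" using X by metis
  define K where "K = Max (insert (M f) ((\<lambda>j. M (X a (int j) f)) ` {..<N0}))"
  have K: "M f \<le> K" "\<And>j. j < N0 \<Longrightarrow> M (X a (int j) f) \<le> K" unfolding K_def by (auto intro!: Max_ge)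
  have "Y0 f k (X a l g) = 0" if k: "k \<ge> int (K + N0 + nat (- l))" for k
  proof -
    have "Y0 f k g = 0" by (rule M) (use K(1) k in linarith)
    moreover have "Y0 (X a (int j) f) (k + l - int j) g = 0" for j
    proof (cases "j < N0")
      case True
      then show ?thesis using K(2)[OF True] k by (intro M) linarith
    next
      case False
      then show ?thesis by (simp add: N0 Y0_state_lin)
    qed
    ultimately show ?thesis by (simp add: Y0_X X_lin)
  qed
  then show ?case by blast
next
  case (add g h)
  obtain N M where "\<And>k. k \<ge> int N \<Longrightarrow> Y0 f k g = 0" "\<And>k. k \<ge> int M \<Longrightarrow> Y0 f k h = 0"
    using add[of f] by blast
  then have "Y0 f k (g + h) = 0" if "k \<ge> int (max N M)" for k using that by (simp add: Y0_lin)
  then show ?case by blast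
next
  case (scale c g)
  then show ?case by (metis Y0_lin(2) cvec.scale_zero_right)
qed

lemma Y0_ev0: "ev0 (\<lambda>j. Y0 f (int j + k) g)"
proof -
  obtain N where N: "\<And>k. k \<ge> int N \<Longrightarrow> Y0 f k g = 0" using Y0_ev0_int by blast
  have "Y0 f (int j + k) g = 0" if "j \<ge> N + nat (- k)" for j
    by (rule N) (use that in linarith)
  then show ?thesis unfolding ev0_def by blast
qed

lemma T_Y0: "T a (Y0 f k g) = Y0 (T a f) k (T a g)"
proof (induction g arbitrary: f k rule: X_induct)
  case vac
  then show ?case by (simp add: Y0_v0 Yvac_def dp_T T_lin)
next
  case (X b l g)
  have "T a (ssum (\<lambda>j. gb l j *\<^sub>C Y0 (X b (int j) f) (k + l - int j) g))
     = ssum (\<lambda>j. gb l j *\<^sub>C T a (Y0 (X b (int j) f) (k + l - int j) g))"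
    by (simp add: ssum_comp[OF Y0_state_ev0 clinear_T] T_lin)
  then show ?case by (simp add: Y0_X T_lin T_X X)
qed (simp_all add: Y0_lin T_lin)

text \<open>The two absorption identities for \<open>j (l choose j)\<close> under a summation sign;
  the first serves \<open>Y0_der\<close>, the second \<open>der_Y0\<close>.\<close>

lemma ssum_absorb:
  assumes ev: "\<And>c. ev0 (\<lambda>j. c j *\<^sub>C (h j :: 'v::complex_vector))"
  shows "ssum (\<lambda>j. (of_nat j * gb l j) *\<^sub>C h j) = ssum (\<lambda>j. ((of_int l - of_nat j) * gb l j) *\<^sub>C h (Suc j))"
    and "ssum (\<lambda>j. (of_nat j * gb l j) *\<^sub>C h j) = of_int l *\<^sub>C ssum (\<lambda>j. gb (l - 1) j *\<^sub>C h (Suc j))"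
proof -
  have *: "ssum (\<lambda>j. (of_nat j * gb l j) *\<^sub>C h j) = ssum (\<lambda>j. (of_nat (Suc j) * gb l (Suc j)) *\<^sub>C h (Suc j))"
    by (subst ssum_Suc[OF ev]) simp
  show "ssum (\<lambda>j. (of_nat j * gb l j) *\<^sub>C h j) = ssum (\<lambda>j. ((of_int l - of_nat j) * gb l j) *\<^sub>C h (Suc j))"
    by (simp only: * gb_absorb')
  have "ev0 (\<lambda>j. gb (l - 1) j *\<^sub>C h (Suc j))"
    using ev0_Suc[OF ev[of "\<lambda>j. gb (l - 1) (j - 1)"]] by simp
  then have "ssum (\<lambda>j. of_int l *\<^sub>C gb (l - 1) j *\<^sub>C h (Suc j)) = of_int l *\<^sub>C ssum (\<lambda>j. gb (l - 1) j *\<^sub>C h (Suc j))"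
    by (rule ssum_scaleC)
  then show "ssum (\<lambda>j. (of_nat j * gb l j) *\<^sub>C h j) = of_int l *\<^sub>C ssum (\<lambda>j. gb (l - 1) j *\<^sub>C h (Suc j))"
    by (simp only: * gb_absorb scaleC_scaleC)
qed

lemma X_der: "X a l (der v) = der (X a l v) + of_int l *\<^sub>C X a (l - 1) v"
  by (simp add: der_X)

text \<open>Coefficient form of \<open>Y(der f, z) = d/dz Y(f, z)\<close>. In the induction
  \<open>X a (int j)\<close> and \<open>der\<close> fail to commute by a multiple \<open>j\<close>
  of \<open>X a (int j - 1)\<close>. After absorption this contributes the factor
  \<open>l - j\<close>, which combines with \<open>- (k + l - j)\<close> to the constant
  \<open>- k\<close>.\<close>

lemma Y0_der: "Y0 (der f) k g = - (of_int k *\<^sub>C Y0 f (k - 1) g)"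
proof (induction g arbitrary: f k rule: X_induct)
  case vac
  show ?case
  proof (cases "k < 0")
    case True
    then have "nat (- (k - 1) - 1) = Suc (nat (- k - 1))" "(of_nat (Suc (nat (- k - 1))) :: complex) = - of_int k"
      by auto
    then show ?thesis using True by (simp add: Y0_v0 Yvac_def dp_der cvec.scale_minus_left del: of_nat_Suc)
  next
    case False
    then show ?thesis by (cases "k = 0") (simp_all add: Y0_v0 Yvac_def)
  qed
next
  case (X a l g)
  let ?h = "\<lambda>j. Y0 (X a (int j - 1) f) (k + l - int j) g"
  have ev1: "ev0 (\<lambda>j. c j *\<^sub>C ?h j)" for c
    by (rule ev0_mono[OF X_ev0[of a "-1" f]]) (simp add: Y0_state_lin)
  have "ssum (\<lambda>j. gb l j *\<^sub>C Y0 (X a (int j) (der f)) (k + l - int j) g)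
     = ssum (\<lambda>j. (- (of_int (k + l) - of_nat j) * gb l j) *\<^sub>C Y0 (X a (int j) f) (k + l - int j - 1) g
         + (of_nat j * gb l j) *\<^sub>C ?h j)"
    by (rule ssum_cong) (simp add: X_der Y0_state_lin X scaleC_add_right scaleC_scaleC cvec.scale_minus_right
        cvec.scale_minus_left[symmetric] algebra_simps del: cvec.scale_minus_left)
  also have "\<dots> = ssum (\<lambda>j. (- (of_int (k + l) - of_nat j) * gb l j) *\<^sub>C Y0 (X a (int j) f) (k + l - int j - 1) g)
     + ssum (\<lambda>j. (of_nat j * gb l j) *\<^sub>C ?h j)"
    by (rule ssum_add[OF Y0_state_ev0 ev1])
  also have "ssum (\<lambda>j. (of_nat j * gb l j) *\<^sub>C ?h j)
     = ssum (\<lambda>j. ((of_int l - of_nat j) * gb l j) *\<^sub>C Y0 (X a (int j) f) (k + l - int j - 1) g)"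
    by (simp add: ssum_absorb(1)[OF ev1] diff_diff_eq add.commute)
  also have "ssum (\<lambda>j. (- (of_int (k + l) - of_nat j) * gb l j) *\<^sub>C Y0 (X a (int j) f) (k + l - int j - 1) g) + \<dots>
     = ssum (\<lambda>j. (- of_int k) *\<^sub>C gb l j *\<^sub>C Y0 (X a (int j) f) (k + l - int j - 1) g)"
  proof -
    have "- (of_int (k + l) - of_nat j) * gb l j + (of_int l - of_nat j) * gb l j = - of_int k * gb l j" for j
      by (simp add: algebra_simps)
    then show ?thesis
      by (subst ssum_add[OF Y0_state_ev0 Y0_state_ev0, symmetric])
        (simp only: scaleC_add_left[symmetric] scaleC_scaleC)
  qed
  also have "\<dots> = (- of_int k) *\<^sub>C ssum (\<lambda>j. gb l j *\<^sub>C Y0 (X a (int j) f) (k - 1 + l - int j) g)"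
    by (subst ssum_scaleC[OF Y0_state_ev0]) (simp add: algebra_simps)
  finally show ?case
    by (simp add: Y0_X X X_lin cvec.scale_right_diff_distrib cvec.scale_minus_left)
qed (simp_all add: Y0_lin scaleC_add_right scaleC_scaleC cvec.scale_minus_right mult.commute)

lemma der_Y0: "der (Y0 f k g) = Y0 (der f) k g + Y0 f k (der g)"
proof (induction g arbitrary: f k rule: X_induct)
  case vac
  then show ?case by (simp add: Y0_v0 Yvac_def der_dp dp_der Y0_lin der_lin)
next
  case (X a l g)
  let ?h = "\<lambda>j. Y0 (X a (int j - 1) f) (k + l - int j) g"
  have ev1: "ev0 (\<lambda>j. c j *\<^sub>C ?h j)" for c
    by (rule ev0_mono[OF X_ev0[of a "-1" f]]) (simp add: Y0_state_lin)
  have "der (ssum (\<lambda>j. gb l j *\<^sub>C Y0 (X a (int j) f) (k + l - int j) g))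
    = ssum (\<lambda>j. gb l j *\<^sub>C Y0 (X a (int j) (der f)) (k + l - int j) g - (of_nat j * gb l j) *\<^sub>C ?h j
        + gb l j *\<^sub>C Y0 (X a (int j) f) (k + l - int j) (der g))"
    by (subst ssum_comp[OF Y0_state_ev0 clinear_der], rule ssum_cong)
      (simp add: der_lin X der_X Y0_state_lin scaleC_add_right cvec.scale_right_diff_distrib scaleC_scaleC mult.commute)
  also have "\<dots> = ssum (\<lambda>j. gb l j *\<^sub>C Y0 (X a (int j) (der f)) (k + l - int j) g)
      - ssum (\<lambda>j. (of_nat j * gb l j) *\<^sub>C ?h j)
      + ssum (\<lambda>j. gb l j *\<^sub>C Y0 (X a (int j) f) (k + l - int j) (der g))"
    by (rule ssum_diff_add[OF Y0_state_ev0 ev1 Y0_state_ev0])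
  also have "ssum (\<lambda>j. (of_nat j * gb l j) *\<^sub>C ?h j)
      = of_int l *\<^sub>C ssum (\<lambda>j. gb (l - 1) j *\<^sub>C Y0 (X a (int j) f) (k + (l - 1) - int j) g)"
    by (simp add: ssum_absorb(2)[OF ev1] algebra_simps)
  finally show ?case
    by (simp add: Y0_X X X_lin der_X der_lin Y0_lin cvec.scale_right_diff_distrib algebra_simps)
qed (simp_all add: Y0_lin der_lin scaleC_add_right)

lemma der_Y0': "der (Y0 f k g) = Y0 f k (der g) - of_int k *\<^sub>C Y0 f (k - 1) g"
  by (simp add: der_Y0 Y0_der)

section \<open>Borcherds identities\<close>

definition sg :: "int \<Rightarrow> complex" where
  "sg k = (if even k then 1 else -1)"

lemma sg_add: "sg (a + b) = sg a * sg b"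
  and sg_diff: "sg (a - b) = sg a * sg b"
  and sg_minus [simp]: "sg (- a) = sg a"
  and sg_sq [simp]: "sg a * sg a = 1"
  and sg_sq' [simp]: "sg a * (sg a * c) = c"
  and sg_0 [simp]: "sg 0 = 1"
  and sg_1 [simp]: "sg 1 = -1"
  and sg_of_nat: "sg (int j) = (-1) ^ j"
  by (auto simp: sg_def)

lemma Y0_v0_state: "Y0 v0 k g = (if k = -1 then g else 0)"
proof (induction g arbitrary: k rule: X_induct)
  case vac
  then show ?case by (auto simp: Y0_v0 Yvac_def dp_v0)
next
  case (X a l g)
  then show ?case by (simp add: Y0_X X_vac Y0_state_lin X_lin)
qed (simp_all add: Y0_lin)

text \<open>The vertex operator of \<open>X a (-1) v0\<close> obeys the recursion of the current
  because \<open>X b (int j)\<close> sends that state to zero except for \<open>j = 0\<close>, where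
  it yields the bracket.\<close>

lemma Y0_generator: "Y0 (X a (-1) v0) k g = X a k g"
proof (induction g arbitrary: a k rule: X_induct)
  case vac
  show ?case
  proof (cases "k < 0")
    case True
    define i where "i = nat (- k - 1)"
    have k: "k = - int i - 1" using True by (simp add: i_def)
    have "dp i (X a (-1) v0) = (\<Sum>p\<le>i. ((-1) ^ p * gb (-1) p) *\<^sub>C X a (-1 - int p) (dp (i - p) v0))"
      by (rule dp_covariant[of "X a", OF clinear_X der_X])
    \<comment> \<open>Positive divided powers kill \<open>v0\<close>, so only \<open>p = i\<close>
      remains.\<close>
    also have "\<dots> = (\<Sum>p\<in>{i}. ((-1) ^ p * gb (-1) p) *\<^sub>C X a (-1 - int p) (dp (i - p) v0))"
      by (rule sum.mono_neutral_right) (auto simp: dp_v0 X_lin)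
    also have "\<dots> = X a k v0"
    proof -
      have "gb (-1) i = (-1) ^ i"
        using gbinomial_minus[of "1::complex" i] by (simp add: gbinomial_of_nat_symmetric binomial_gbinomial[symmetric, of i i, where ?'a = complex])
      moreover have "-1 - int i = k" by (simp add: k)
      ultimately show ?thesis by (simp add: scaleC_one flip: power_add mult_2)
    qed
    finally show ?thesis by (simp add: Y0_v0 Yvac_def k)
  next
    case False
    then show ?thesis by (simp add: Y0_v0 Yvac_def X_vac)
  qed
next
  case (X b l g)
  have "X b (int j) (X a (-1) v0) = (if j = 0 then lam b a *\<^sub>C X (tgt b a) (-1) v0 else 0)" for j
    using X_comm[of b "int j" a "-1" v0] by (simp add: X_vac X_lin)
  then have "ssum (\<lambda>j. gb l j *\<^sub>C Y0 (X b (int j) (X a (-1) v0)) (k + l - int j) g)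
     = (\<Sum>j\<le>0. gb l j *\<^sub>C Y0 (X b (int j) (X a (-1) v0)) (k + l - int j) g)"
    by (intro ssum_le) (simp add: Y0_state_lin)
  also have "\<dots> = lam b a *\<^sub>C X (tgt b a) (l + k) g"
    using \<open>\<And>j. X b (int j) (X a (-1) v0) = _\<close>[of 0]
    by (simp add: Y0_state_lin X scaleC_one add.commute)
  finally show ?case
    using X_comm[of b l a k g] by (simp add: Y0_X X algebra_simps)
qed (simp_all add: Y0_lin X_lin)

lemma ssum_gb_zero: "ssum (\<lambda>j. gb 0 j *\<^sub>C h j) = h 0" "ssum (\<lambda>j. (c j * gb 0 j) *\<^sub>C h j) = c 0 *\<^sub>C h 0"
  for h :: "nat \<Rightarrow> 'v::complex_vector"
proof -
  have z: "gb 0 j = (if j = 0 then 1 else 0)" for j using gb_nonneg_0[of 0 j] by simp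
  have "ssum (\<lambda>j. (c j * gb 0 j) *\<^sub>C h j) = (\<Sum>j\<le>0. (c j * gb 0 j) *\<^sub>C h j)" for c
    unfolding z by (rule ssum_le) simp
  then show "ssum (\<lambda>j. (c j * gb 0 j) *\<^sub>C h j) = c 0 *\<^sub>C h 0" for c by simp
  from this[of "\<lambda>_. 1"] show "ssum (\<lambda>j. gb 0 j *\<^sub>C h j) = h 0" by (simp add: scaleC_one)
qed

text \<open>\<open>FJ\<close> and \<open>RW\<close> are the two sides of the Borcherds identity for the current \<open>a(z)\<close> and \<open>Y0(f, w)\<close>,
  tested against \<open>z^k w^l (z - w)^n\<close>; \<open>FA\<close> and \<open>FB\<close> expand \<open>(z - w)^n\<close> for the two orders of the product.\<close>

definition FA :: "int \<Rightarrow> bool \<times> int \<Rightarrow> vtoda \<Rightarrow> int \<Rightarrow> int \<Rightarrow> vtoda \<Rightarrow> vtoda" where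
  "FA n a f k l g = ssum (\<lambda>j. (sg (int j) * gb n j) *\<^sub>C X a (n - int j + k) (Y0 f (l + int j) g))"

definition FB :: "int \<Rightarrow> bool \<times> int \<Rightarrow> vtoda \<Rightarrow> int \<Rightarrow> int \<Rightarrow> vtoda \<Rightarrow> vtoda" where
  "FB n a f k l g = ssum (\<lambda>j. (sg (int j) * gb n j) *\<^sub>C Y0 f (n - int j + l) (X a (int j + k) g))"

definition FJ :: "int \<Rightarrow> bool \<times> int \<Rightarrow> vtoda \<Rightarrow> int \<Rightarrow> int \<Rightarrow> vtoda \<Rightarrow> vtoda" where
  "FJ n a f k l g = FA n a f k l g - sg n *\<^sub>C FB n a f k l g"

definition RW :: "int \<Rightarrow> bool \<times> int \<Rightarrow> vtoda \<Rightarrow> int \<Rightarrow> int \<Rightarrow> vtoda \<Rightarrow> vtoda" where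
  "RW n a f k l g = ssum (\<lambda>j. gb k j *\<^sub>C Y0 (X a (n + int j) f) (k + l - int j) g)"

lemma FA_ev0: "ev0 (\<lambda>j. c j *\<^sub>C X a (h j) (Y0 f (l + int j) g))"
  by (rule ev0_mono[OF Y0_ev0[of f l g]]) (simp add: X_lin add.commute)

lemma FB_ev0: "ev0 (\<lambda>j. c j *\<^sub>C Y0 f (h j) (X a (int j + k) g))"
  by (rule ev0_mono[OF X_ev0[of a k g]]) (simp add: Y0_lin)

lemma RW_ev0: "ev0 (\<lambda>j. c j *\<^sub>C Y0 (X a (n + int j) f) (h j) g)"
  by (rule ev0_mono[OF X_ev0[of a n f]]) (simp add: Y0_state_lin add.commute)

lemma gb_Pascal: "gb (n + 1) (Suc j) = gb n (Suc j) + gb n j"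
  using gbinomial_Suc_Suc[of "of_int n :: complex" j] by simp

lemma ssum_Pascal:
  assumes ev: "\<And>c. ev0 (\<lambda>j. c j *\<^sub>C (h j :: 'v::complex_vector))"
  shows "ssum (\<lambda>j. gb (n + 1) j *\<^sub>C h j) = ssum (\<lambda>j. gb n j *\<^sub>C h j) + ssum (\<lambda>j. gb n j *\<^sub>C h (Suc j))"
proof -
  have ev': "ev0 (\<lambda>j. c j *\<^sub>C h (Suc j))" for c
    using ev0_Suc[OF ev[of "\<lambda>j. c (j - 1)"]] by simp
  show ?thesis
    by (simp only: ssum_Suc[OF ev] gb_Pascal scaleC_add_left ssum_add[OF ev' ev'])
      (simp add: add_ac)
qed

lemma FA_rec: "FA (n + 1) a f k l g = FA n a f (k + 1) l g - FA n a f k (l + 1) g"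
proof -
  let ?h = "\<lambda>j. sg (int j) *\<^sub>C X a (n + 1 - int j + k) (Y0 f (l + int j) g)"
  have ev: "ev0 (\<lambda>j. c j *\<^sub>C ?h j)" for c
    unfolding scaleC_scaleC by (rule FA_ev0)
  have "FA (n + 1) a f k l g = ssum (\<lambda>j. gb (n + 1) j *\<^sub>C ?h j)"
    unfolding FA_def by (simp add: scaleC_scaleC mult.commute)
  also have "\<dots> = ssum (\<lambda>j. gb n j *\<^sub>C ?h j) + ssum (\<lambda>j. gb n j *\<^sub>C ?h (Suc j))"
    by (rule ssum_Pascal[OF ev])
  also have "ssum (\<lambda>j. gb n j *\<^sub>C ?h j) = FA n a f (k + 1) l g"
    unfolding FA_def by (simp add: scaleC_scaleC mult.commute algebra_simps)
  also have "ssum (\<lambda>j. gb n j *\<^sub>C ?h (Suc j)) = ssum (\<lambda>j. - ((sg (int j) * gb n j) *\<^sub>C X a (n - int j + k) (Y0 f (l + 1 + int j) g)))"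
    by (rule ssum_cong) (simp add: scaleC_scaleC sg_add algebra_simps cvec.scale_minus_left)
  also have "\<dots> = - FA n a f k (l + 1) g"
    unfolding FA_def by (rule ssum_uminus[OF FA_ev0])
  finally show ?thesis by simp
qed

lemma FB_rec: "FB (n + 1) a f k l g = FB n a f k (l + 1) g - FB n a f (k + 1) l g"
proof -
  let ?h = "\<lambda>j. sg (int j) *\<^sub>C Y0 f (n + 1 - int j + l) (X a (int j + k) g)"
  have ev: "ev0 (\<lambda>j. c j *\<^sub>C ?h j)" for c
    unfolding scaleC_scaleC by (rule FB_ev0)
  have "FB (n + 1) a f k l g = ssum (\<lambda>j. gb (n + 1) j *\<^sub>C ?h j)"
    unfolding FB_def by (simp add: scaleC_scaleC mult.commute)
  also have "\<dots> = ssum (\<lambda>j. gb n j *\<^sub>C ?h j) + ssum (\<lambda>j. gb n j *\<^sub>C ?h (Suc j))"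
    by (rule ssum_Pascal[OF ev])
  also have "ssum (\<lambda>j. gb n j *\<^sub>C ?h j) = FB n a f k (l + 1) g"
    unfolding FB_def by (simp add: scaleC_scaleC mult.commute algebra_simps)
  also have "ssum (\<lambda>j. gb n j *\<^sub>C ?h (Suc j)) = ssum (\<lambda>j. - ((sg (int j) * gb n j) *\<^sub>C Y0 f (n - int j + l) (X a (int j + (k + 1)) g)))"
    by (rule ssum_cong) (simp add: scaleC_scaleC sg_add algebra_simps cvec.scale_minus_left)
  also have "\<dots> = - FB n a f (k + 1) l g"
    unfolding FB_def by (rule ssum_uminus[OF FB_ev0])
  finally show ?thesis by simp
qed

lemma FJ_rec: "FJ (n + 1) a f k l g = FJ n a f (k + 1) l g - FJ n a f k (l + 1) g"
  by (simp add: FJ_def FA_rec FB_rec sg_add cvec.scale_right_diff_distrib cvec.scale_minus_left)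

lemma RW_rec: "RW (n + 1) a f k l g = RW n a f (k + 1) l g - RW n a f k (l + 1) g"
proof -
  let ?h = "\<lambda>j. Y0 (X a (n + int j) f) (k + 1 + l - int j) g"
  have "RW n a f (k + 1) l g = ssum (\<lambda>j. gb k j *\<^sub>C ?h j) + ssum (\<lambda>j. gb k j *\<^sub>C ?h (Suc j))"
    unfolding RW_def by (rule ssum_Pascal[OF RW_ev0])
  also have "ssum (\<lambda>j. gb k j *\<^sub>C ?h j) = RW n a f k (l + 1) g"
    unfolding RW_def by (simp add: algebra_simps)
  also have "ssum (\<lambda>j. gb k j *\<^sub>C ?h (Suc j)) = RW (n + 1) a f k l g"
    unfolding RW_def by (simp add: algebra_simps)
  finally show ?thesis by simp
qed

lemma RW_0: "RW n a f 0 l g = Y0 (X a n f) l g"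
  unfolding RW_def ssum_gb_zero by simp

lemma FJ_0: "FJ 0 a f k l g = RW 0 a f k l g"
proof -
  have "FA 0 a f k l g = X a k (Y0 f l g)"
    unfolding FA_def ssum_gb_zero by (simp add: scaleC_one)
  moreover have "FB 0 a f k l g = Y0 f l (X a k g)"
    unfolding FB_def ssum_gb_zero by (simp add: scaleC_one)
  ultimately show ?thesis
    by (simp add: FJ_def RW_def X_Y0 scaleC_one add.commute)
qed

text \<open>Pascal's rule reduces the identity to the cases \<open>n = 0\<close> and \<open>k = 0\<close>.\<close>

lemma FJ_eq_RW_if:
  assumes "\<And>n a f l. FJ n a f 0 l g = Y0 (X a n f) l g"
  shows "FJ n a f k l g = RW n a f k l g"
proof (induction n arbitrary: k l rule: int_induct[where k = 0])
  case base
  show ?case by (rule FJ_0)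
next
  case (step1 i)
  then show ?case by (simp add: FJ_rec RW_rec)
next
  case (step2 i)
  have r: "FJ i a f k l g = FJ (i - 1) a f (k + 1) l g - FJ (i - 1) a f k (l + 1) g"
    "RW i a f k l g = RW (i - 1) a f (k + 1) l g - RW (i - 1) a f k (l + 1) g" for k l
    using FJ_rec[of "i - 1"] RW_rec[of "i - 1"] by simp_all
  \<comment> \<open>Downwards in \<open>n\<close> the recursion relates only neighbouring
    \<open>k\<close>. So \<open>k = 0\<close> is taken from the hypothesis, and the inner induction
    runs in both directions from there.\<close>
  show ?case
  proof (induction k arbitrary: l rule: int_induct[where k = 0])
    case base
    show ?case by (simp add: assms RW_0)
  next
    case (step1 k)
    then show ?case using r[of k l] step2(2)[of k l] by simp
  next
    case (step2 k)
    then show ?case using r[of "k - 1" "l - 1"] \<open>\<And>k l. FJ i a f k l g = RW i a f k l g\<close>[of "k - 1" "l - 1"] by simp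
  qed
qed

text \<open>Moving \<open>X b m\<close> to the left past \<open>Y0\<close> changes the state; moving
  it past \<open>X a\<close> replaces the current and raises \<open>k\<close> by \<open>m\<close>.
  The opposite order of the product obeys a recursion of the same shape, which therefore passes to
  the difference \<open>FJ\<close>.\<close>

lemma FA_X: "FA n a f k l (X b m g) = X b m (FA n a f k l g) - lam b a *\<^sub>C FA n (tgt b a) f (k + m) l g
    - ssum (\<lambda>i. gb m i *\<^sub>C FA n a (X b (int i) f) k (l + m - int i) g)"
proof -
  let ?c = "\<lambda>j. sg (int j) * gb n j"
  let ?D = "\<lambda>j i. (?c j * gb m i) *\<^sub>C X a (n - int j + k) (Y0 (X b (int i) f) (l + int j + m - int i) g)"
  have D: "ev0_2 (\<lambda>i j. ?D j i)"
  proof (rule ev0_2_iterate[OF X_ev0'[of b f]])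
    fix i
    show "ev0 (\<lambda>j. ?D j i)"
      using FA_ev0[of "\<lambda>j. ?c j * gb m i" a "\<lambda>j. n - int j + k" "X b (int i) f" "l + m - int i" g]
      by (simp add: algebra_simps)
  qed (simp add: Y0_state_lin X_lin)
  have p: "?c j *\<^sub>C X a (n - int j + k) (Y0 f (l + int j) (X b m g))
    = ?c j *\<^sub>C X b m (X a (n - int j + k) (Y0 f (l + int j) g))
      - (?c j * lam b a) *\<^sub>C X (tgt b a) (n - int j + (k + m)) (Y0 f (l + int j) g)
      - ssum (\<lambda>i. ?D j i)" for j
  proof -
    have "X a (n - int j + k) (X b m (Y0 f (l + int j) g)) = X b m (X a (n - int j + k) (Y0 f (l + int j) g))
       - lam b a *\<^sub>C X (tgt b a) (n - int j + (k + m)) (Y0 f (l + int j) g)"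
      using X_comm[of b m a "n - int j + k" "Y0 f (l + int j) g"] by (simp add: algebra_simps)
    moreover have "?c j *\<^sub>C X a (n - int j + k) (ssum (\<lambda>i. gb m i *\<^sub>C Y0 (X b (int i) f) (l + int j + m - int i) g)) = ssum (\<lambda>i. ?D j i)"
    proof -
      have "clinear (\<lambda>v. ?c j *\<^sub>C X a (n - int j + k) v)"
        by (rule clinearI) (simp_all add: X_lin scaleC_add_right scaleC_scaleC mult.commute)
      from ssum_comp[OF Y0_state_ev0 this] show ?thesis by (simp add: X_lin scaleC_scaleC)
    qed
    ultimately show ?thesis
      by (simp add: Y0_X X_lin cvec.scale_right_diff_distrib scaleC_scaleC)
  qed
  have 1: "ev0 (\<lambda>j. ?c j *\<^sub>C X b m (X a (n - int j + k) (Y0 f (l + int j) g)))"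
    by (rule ev0_mono[OF Y0_ev0[of f l g]]) (simp add: X_lin add.commute)
  have 2: "ev0 (\<lambda>j. (?c j * lam b a) *\<^sub>C X (tgt b a) (n - int j + (k + m)) (Y0 f (l + int j) g))"
    by (rule FA_ev0)
  have 12: "ev0 (\<lambda>j. ?c j *\<^sub>C X b m (X a (n - int j + k) (Y0 f (l + int j) g))
     - (?c j * lam b a) *\<^sub>C X (tgt b a) (n - int j + (k + m)) (Y0 f (l + int j) g))"
    by (rule ev0_combine[OF 1 2]) (simp only: diff_self)
  have "FA n a f k l (X b m g)
    = ssum (\<lambda>j. ?c j *\<^sub>C X b m (X a (n - int j + k) (Y0 f (l + int j) g)))
      - ssum (\<lambda>j. (?c j * lam b a) *\<^sub>C X (tgt b a) (n - int j + (k + m)) (Y0 f (l + int j) g))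
      - ssum (\<lambda>j. ssum (\<lambda>i. ?D j i))"
    unfolding FA_def p ssum_diff[OF 12 ev0_2_outer[OF ev0_2_swap[OF D]]] ssum_diff[OF 1 2] ..
  also have "ssum (\<lambda>j. ?c j *\<^sub>C X b m (X a (n - int j + k) (Y0 f (l + int j) g))) = X b m (FA n a f k l g)"
    unfolding FA_def by (simp add: ssum_comp[OF FA_ev0 clinear_X] X_lin)
  also have "ssum (\<lambda>j. (?c j * lam b a) *\<^sub>C X (tgt b a) (n - int j + (k + m)) (Y0 f (l + int j) g))
     = lam b a *\<^sub>C FA n (tgt b a) f (k + m) l g"
    unfolding FA_def by (subst ssum_scaleC[OF FA_ev0, symmetric]) (simp add: scaleC_scaleC mult_ac)
  also have "ssum (\<lambda>j. ssum (\<lambda>i. ?D j i)) = ssum (\<lambda>i. ssum (\<lambda>j. ?D j i))"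
    by (rule ssum_swap[OF ev0_2_swap[OF D]])
  also have "\<dots> = ssum (\<lambda>i. gb m i *\<^sub>C FA n a (X b (int i) f) k (l + m - int i) g)"
    unfolding FA_def
    by (rule ssum_cong, subst ssum_scaleC[OF FA_ev0, symmetric], rule ssum_cong)
      (simp add: scaleC_scaleC mult_ac algebra_simps)
  finally show ?thesis .
qed

lemma FB_X: "FB n a f k l (X b m g) = X b m (FB n a f k l g) - lam b a *\<^sub>C FB n (tgt b a) f (k + m) l g
    - ssum (\<lambda>i. gb m i *\<^sub>C FB n a (X b (int i) f) k (l + m - int i) g)"
proof -
  let ?c = "\<lambda>j. sg (int j) * gb n j"
  let ?D = "\<lambda>j i. (?c j * gb m i) *\<^sub>C Y0 (X b (int i) f) (n - int j + l + m - int i) (X a (int j + k) g)"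
  have D: "ev0_2 (\<lambda>i j. ?D j i)"
    by (rule ev0_2_iterate[OF X_ev0'[of b f] FB_ev0]) (simp add: Y0_state_lin)
  have p: "?c j *\<^sub>C Y0 f (n - int j + l) (X a (int j + k) (X b m g))
    = ?c j *\<^sub>C X b m (Y0 f (n - int j + l) (X a (int j + k) g))
      - (?c j * lam b a) *\<^sub>C Y0 f (n - int j + l) (X (tgt b a) (int j + (k + m)) g)
      - ssum (\<lambda>i. ?D j i)" for j
  proof -
    have "X a (int j + k) (X b m g) = X b m (X a (int j + k) g) - lam b a *\<^sub>C X (tgt b a) (int j + (k + m)) g"
      using X_comm[of b m a "int j + k" g] by (simp add: algebra_simps)
    moreover have "?c j *\<^sub>C ssum (\<lambda>i. gb m i *\<^sub>C Y0 (X b (int i) f) (n - int j + l + m - int i) (X a (int j + k) g)) = ssum (\<lambda>i. ?D j i)"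
      by (subst ssum_scaleC[OF Y0_state_ev0, symmetric]) (simp add: scaleC_scaleC)
    ultimately show ?thesis
      by (simp add: Y0_X Y0_lin cvec.scale_right_diff_distrib scaleC_scaleC)
  qed
  have 1: "ev0 (\<lambda>j. ?c j *\<^sub>C X b m (Y0 f (n - int j + l) (X a (int j + k) g)))"
    by (rule ev0_mono[OF X_ev0[of a k g]]) (simp add: X_lin Y0_lin)
  have 2: "ev0 (\<lambda>j. (?c j * lam b a) *\<^sub>C Y0 f (n - int j + l) (X (tgt b a) (int j + (k + m)) g))"
    by (rule FB_ev0)
  have 12: "ev0 (\<lambda>j. ?c j *\<^sub>C X b m (Y0 f (n - int j + l) (X a (int j + k) g))
     - (?c j * lam b a) *\<^sub>C Y0 f (n - int j + l) (X (tgt b a) (int j + (k + m)) g))"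
    by (rule ev0_combine[OF 1 2]) (simp only: diff_self)
  have "FB n a f k l (X b m g)
    = ssum (\<lambda>j. ?c j *\<^sub>C X b m (Y0 f (n - int j + l) (X a (int j + k) g)))
      - ssum (\<lambda>j. (?c j * lam b a) *\<^sub>C Y0 f (n - int j + l) (X (tgt b a) (int j + (k + m)) g))
      - ssum (\<lambda>j. ssum (\<lambda>i. ?D j i))"
    unfolding FB_def p ssum_diff[OF 12 ev0_2_outer[OF ev0_2_swap[OF D]]] ssum_diff[OF 1 2] ..
  also have "ssum (\<lambda>j. ?c j *\<^sub>C X b m (Y0 f (n - int j + l) (X a (int j + k) g))) = X b m (FB n a f k l g)"
    unfolding FB_def by (simp add: ssum_comp[OF FB_ev0 clinear_X] X_lin)
  also have "ssum (\<lambda>j. (?c j * lam b a) *\<^sub>C Y0 f (n - int j + l) (X (tgt b a) (int j + (k + m)) g))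
     = lam b a *\<^sub>C FB n (tgt b a) f (k + m) l g"
    unfolding FB_def by (subst ssum_scaleC[OF FB_ev0, symmetric]) (simp add: scaleC_scaleC mult_ac)
  also have "ssum (\<lambda>j. ssum (\<lambda>i. ?D j i)) = ssum (\<lambda>i. ssum (\<lambda>j. ?D j i))"
    by (rule ssum_swap[OF ev0_2_swap[OF D]])
  also have "\<dots> = ssum (\<lambda>i. gb m i *\<^sub>C FB n a (X b (int i) f) k (l + m - int i) g)"
    unfolding FB_def
    by (rule ssum_cong, subst ssum_scaleC[OF FB_ev0, symmetric], rule ssum_cong)
      (simp add: scaleC_scaleC mult_ac algebra_simps)
  finally show ?thesis .
qed

lemma FA_state_0: "FA n a 0 k l g = 0" and FB_state_0: "FB n a 0 k l g = 0"
  by (simp_all add: FA_def FB_def Y0_state_lin X_lin)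

lemma FJ_X: "FJ n a f k l (X b m g) = X b m (FJ n a f k l g) - lam b a *\<^sub>C FJ n (tgt b a) f (k + m) l g
    - ssum (\<lambda>i. gb m i *\<^sub>C FJ n a (X b (int i) f) k (l + m - int i) g)"
proof -
  have 1: "ev0 (\<lambda>i. gb m i *\<^sub>C FA n a (X b (int i) f) k (l + m - int i) g)"
    by (rule ev0_mono[OF X_ev0'[of b f]]) (simp add: FA_state_0)
  have 2: "ev0 (\<lambda>i. gb m i *\<^sub>C FB n a (X b (int i) f) k (l + m - int i) g)"
    by (rule ev0_mono[OF X_ev0'[of b f]]) (simp add: FB_state_0)
  have 3: "ev0 (\<lambda>i. sg n *\<^sub>C gb m i *\<^sub>C FB n a (X b (int i) f) k (l + m - int i) g)"
    by (rule ev0_mono[OF 2]) simp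
  have "ssum (\<lambda>i. gb m i *\<^sub>C FJ n a (X b (int i) f) k (l + m - int i) g)
     = ssum (\<lambda>i. gb m i *\<^sub>C FA n a (X b (int i) f) k (l + m - int i) g)
       - sg n *\<^sub>C ssum (\<lambda>i. gb m i *\<^sub>C FB n a (X b (int i) f) k (l + m - int i) g)"
    unfolding ssum_scaleC[OF 2, symmetric] ssum_diff[OF 1 3, symmetric]
    by (rule ssum_cong) (simp add: FJ_def cvec.scale_right_diff_distrib scaleC_scaleC mult.commute)
  then show ?thesis
    by (simp add: FJ_def FA_X FB_X X_lin cvec.scale_right_diff_distrib scaleC_scaleC mult.commute)
qed

lemma FA_lin: "FA n a f k l (g + h) = FA n a f k l g + FA n a f k l h" "FA n a f k l (c *\<^sub>C g) = c *\<^sub>C FA n a f k l g"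
proof -
  show "FA n a f k l (g + h) = FA n a f k l g + FA n a f k l h"
    unfolding FA_def by (simp add: Y0_lin X_lin scaleC_add_right ssum_add[OF FA_ev0 FA_ev0])
  show "FA n a f k l (c *\<^sub>C g) = c *\<^sub>C FA n a f k l g"
    unfolding FA_def by (subst ssum_scaleC[OF FA_ev0, symmetric]) (simp add: Y0_lin X_lin scaleC_scaleC mult.commute)
qed

lemma FB_lin: "FB n a f k l (g + h) = FB n a f k l g + FB n a f k l h" "FB n a f k l (c *\<^sub>C g) = c *\<^sub>C FB n a f k l g"
proof -
  show "FB n a f k l (g + h) = FB n a f k l g + FB n a f k l h"
    unfolding FB_def by (simp add: Y0_lin X_lin scaleC_add_right ssum_add[OF FB_ev0 FB_ev0])
  show "FB n a f k l (c *\<^sub>C g) = c *\<^sub>C FB n a f k l g"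
    unfolding FB_def by (subst ssum_scaleC[OF FB_ev0, symmetric]) (simp add: Y0_lin X_lin scaleC_scaleC mult.commute)
qed

text \<open>On \<open>v0\<close> only the order with \<open>Y0\<close> applied first survives, and
  there the claim is translation covariance. For \<open>X b m g\<close> the recursion
  \<open>FJ_X\<close> involves the identity with \<open>k = m\<close>, although the claim has
  \<open>k = 0\<close>; \<open>FJ_eq_RW_if\<close> supplies it from the induction hypothesis for
  \<open>g\<close>.\<close>

theorem iterate_formula: "Y0 (X a n f) l g = FJ n a f 0 l g"
proof (induction g arbitrary: n a f l rule: X_induct)
  case vac
  have B: "FB n a f 0 l v0 = 0" by (simp add: FB_def X_vac Y0_lin)
  have "FA n a f 0 l v0 = Yvac (X a n f) l"
  proof (cases "l < 0")
    case True
    define i where "i = nat (- l - 1)"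
    have l: "l = - int i - 1" using True by (simp add: i_def)
    have "FA n a f 0 l v0 = (\<Sum>j\<le>i. (sg (int j) * gb n j) *\<^sub>C X a (n - int j) (Yvac f (l + int j)))"
      unfolding FA_def Y0_v0 by (subst ssum_le[of i]) (auto simp: Yvac_def l X_lin)
    also have "\<dots> = (\<Sum>j\<le>i. ((-1) ^ j * gb n j) *\<^sub>C X a (n - int j) (dp (i - j) f))"
      by (rule sum.cong) (auto simp: Yvac_def l sg_of_nat nat_diff_distrib' intro!: arg_cong2[where f = dp] arg_cong[where f = "X a _"] arg_cong[where f = "(*\<^sub>C) _"])
    also have "\<dots> = dp i (X a n f)"
      by (rule dp_covariant[of "X a", OF clinear_X der_X, symmetric])
    finally show ?thesis by (simp add: Yvac_def l)
  next
    case False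
    then show ?thesis by (simp add: FA_def Y0_v0 Yvac_def X_lin)
  qed
  then show ?case by (simp add: FJ_def B Y0_v0)
next
  case (X b m g)
  note W = FJ_eq_RW_if[OF X[symmetric]]
  have "FJ n a f 0 l (X b m g) = X b m (Y0 (X a n f) l g) - (lam b a *\<^sub>C RW n (tgt b a) f m l g
     + ssum (\<lambda>i. gb m i *\<^sub>C Y0 (X a n (X b (int i) f)) (l + m - int i) g))"
    by (simp add: FJ_X W RW_0 diff_diff_eq)
  also have "lam b a *\<^sub>C RW n (tgt b a) f m l g + ssum (\<lambda>i. gb m i *\<^sub>C Y0 (X a n (X b (int i) f)) (l + m - int i) g)
     = ssum (\<lambda>i. gb m i *\<^sub>C Y0 (X b (int i) (X a n f)) (l + m - int i) g)"
  proof -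
    have 1: "ev0 (\<lambda>i. gb m i *\<^sub>C Y0 (X a n (X b (int i) f)) (l + m - int i) g)"
      by (rule ev0_mono[OF X_ev0'[of b f]]) (simp add: Y0_state_lin X_lin)
    have 2: "ev0 (\<lambda>i. lam b a *\<^sub>C gb m i *\<^sub>C Y0 (X (tgt b a) (n + int i) f) (m + l - int i) g)"
      by (rule ev0_mono[OF RW_ev0[of "gb m" "tgt b a" n f "\<lambda>i. m + l - int i" g]]) simp
    have "X b (int i) (X a n f) = X a n (X b (int i) f) + lam b a *\<^sub>C X (tgt b a) (n + int i) f" for i
      using X_comm[of b "int i" a n f] by (simp add: algebra_simps)
    then show ?thesis
      unfolding RW_def ssum_scaleC[OF RW_ev0, symmetric] ssum_add[OF 2 1, symmetric]
      by (intro ssum_cong) (simp add: Y0_state_lin scaleC_add_right scaleC_scaleC mult.commute add.commute)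
  qed
  finally show ?case by (simp add: Y0_X)
next
  case (add g h)
  then show ?case by (simp add: FJ_def FA_lin FB_lin Y0_lin scaleC_add_right)
next
  case (scale c g)
  then show ?case by (simp add: FJ_def FA_lin FB_lin Y0_lin cvec.scale_right_diff_distrib scaleC_scaleC mult.commute)
qed

section \<open>Skew-symmetry and the commutator formula\<close>

lemma skew_ev0: "ev0 (\<lambda>i. c i *\<^sub>C dp (h i) (Y0 g (k + int i) f))"
  by (rule ev0_mono[OF Y0_ev0[of g k f]]) (simp add: dp_lin add.commute)

lemma alternating_dp: "(\<Sum>i\<le>s. ((-1) ^ i) *\<^sub>C dp i (dp (s - i) g)) = (if s = 0 then g else 0)"
proof -
  have "(\<Sum>i\<le>s. ((-1) ^ i) *\<^sub>C dp i (dp (s - i) g)) = (\<Sum>i\<le>s. (-1) ^ i * of_nat (s choose i)) *\<^sub>C dp s g"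
    unfolding cvec.scale_sum_left by (rule sum.cong) (auto simp: dp_dp scaleC_scaleC)
  then show ?thesis using choose_alternating_sum[of s, where ?'a = complex]
    by (cases "s = 0") (simp_all add: scaleC_one)
qed

text \<open>Coefficient form of \<open>Y(f, z) g = e^{z der} Y(g, -z) f\<close>. In the induction on
  \<open>f\<close> the commutator formula on the right produces two sums, which become the two
  orders \<open>FA\<close> and \<open>FB\<close> of the iterate formula; in the first of them the
  covariance of \<open>X a\<close> redistributes the divided powers.\<close>

theorem skew: "Y0 f k g = ssum (\<lambda>i. sg (k + int i + 1) *\<^sub>C dp i (Y0 g (k + int i) f))"
proof (induction f arbitrary: k g rule: X_induct)
  case vac
  show ?case
  proof (cases "k < 0")
    case True
    define s where "s = nat (- k - 1)"
    have k: "k = - int s - 1" using True by (simp add: s_def)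
    have "ssum (\<lambda>i. sg (k + int i + 1) *\<^sub>C dp i (Y0 g (k + int i) v0))
       = (\<Sum>i\<le>s. sg (k + int i + 1) *\<^sub>C dp i (Y0 g (k + int i) v0))"
      by (rule ssum_le) (auto simp: Y0_v0 Yvac_def k dp_lin)
    also have "\<dots> = sg (int s) *\<^sub>C (\<Sum>i\<le>s. ((-1) ^ i) *\<^sub>C dp i (dp (s - i) g))"
      unfolding cvec.scale_sum_right
    proof (rule sum.cong[OF refl])
      fix i assume "i \<in> {..s}"
      then have "Y0 g (k + int i) v0 = dp (s - i) g"
        by (auto simp: Y0_v0 Yvac_def k nat_diff_distrib' intro!: arg_cong2[where f = dp])
      moreover have "sg (k + int i + 1) = sg (int s) * (-1) ^ i"
        by (simp add: k sg_add sg_diff sg_of_nat)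
      ultimately show "sg (k + int i + 1) *\<^sub>C dp i (Y0 g (k + int i) v0) = sg (int s) *\<^sub>C ((-1) ^ i) *\<^sub>C dp i (dp (s - i) g)"
        by (simp add: scaleC_scaleC)
    qed
    finally show ?thesis by (auto simp: alternating_dp Y0_v0_state k scaleC_one)
  next
    case False
    then show ?thesis by (simp add: Y0_v0_state Y0_v0 Yvac_def dp_lin)
  qed
next
  case (X a n f)
  let ?A = "\<lambda>i. sg (k + int i + 1) *\<^sub>C dp i (X a n (Y0 g (k + int i) f))"
  let ?B = "\<lambda>i j. (sg (k + int i + 1) * gb n j) *\<^sub>C dp i (Y0 (X a (int j) g) (k + int i + n - int j) f)"
  have evA: "ev0 ?A"
    by (rule ev0_mono[OF Y0_ev0[of g k f]]) (simp add: dp_lin X_lin add.commute)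
  have evB: "ev0_2 (\<lambda>j i. ?B i j)"
  proof (rule ev0_2_iterate[OF X_ev0'[of a g]])
    show "ev0 (\<lambda>i. ?B i j)" for j
      using skew_ev0[of "\<lambda>i. sg (k + int i + 1) * gb n j" "\<lambda>i. i" "X a (int j) g" "k + n - int j" f]
      by (simp add: algebra_simps)
  qed (simp add: Y0_state_lin dp_lin)
  have "ssum (\<lambda>i. sg (k + int i + 1) *\<^sub>C dp i (Y0 g (k + int i) (X a n f))) = ssum (\<lambda>i. ?A i - ssum (?B i))"
  proof (rule ssum_cong)
    fix i
    have "clinear (\<lambda>v. sg (k + int i + 1) *\<^sub>C dp i v)"
      by (rule clinearI) (simp_all add: dp_lin scaleC_add_right scaleC_scaleC mult.commute)
    from ssum_comp[OF Y0_state_ev0 this]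
    show "sg (k + int i + 1) *\<^sub>C dp i (Y0 g (k + int i) (X a n f)) = ?A i - ssum (?B i)"
      by (simp add: Y0_X dp_lin cvec.scale_right_diff_distrib scaleC_scaleC)
  qed
  also have "\<dots> = ssum ?A - ssum (\<lambda>i. ssum (?B i))"
    by (rule ssum_diff[OF evA ev0_2_outer[OF ev0_2_swap[OF evB]]])
  also have "ssum ?A = FA n a f 0 k g"
  proof -
    let ?C = "\<lambda>p q. (sg (int p) * gb n p) *\<^sub>C X a (n - int p) (sg (k + int p + int q + 1) *\<^sub>C dp q (Y0 g (k + int p + int q) f))"
    have evC: "ev0_2 ?C"
    proof -
      obtain N where N: "\<And>k. k \<ge> int N \<Longrightarrow> Y0 g k f = 0" using Y0_ev0_int by blast
      have "?C p q = 0" if "p \<ge> N + nat (- k) \<or> q \<ge> N + nat (- k)" for p q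
      proof -
        have "Y0 g (k + int p + int q) f = 0" by (rule N) (use that in linarith)
        then show ?thesis by (simp add: dp_lin X_lin)
      qed
      then show ?thesis unfolding ev0_2_def by blast
    qed
    have "?A i = (\<Sum>p\<le>i. ?C p (i - p))" for i
      unfolding dp_covariant[of "X a", OF clinear_X der_X] cvec.scale_sum_right
      by (rule sum.cong) (auto simp: X_lin scaleC_scaleC sg_add sg_of_nat of_nat_diff algebra_simps)
    then have "ssum ?A = ssum (\<lambda>i. \<Sum>p\<le>i. ?C p (i - p))" by (rule ssum_cong)
    also have "\<dots> = ssum (\<lambda>p. ssum (?C p))" by (rule ssum_diagonal[OF evC, symmetric])
    also have "\<dots> = ssum (\<lambda>p. (sg (int p) * gb n p) *\<^sub>C X a (n - int p) (Y0 f (k + int p) g))"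
    proof (rule ssum_cong)
      fix p
      have "clinear (\<lambda>v. (sg (int p) * gb n p) *\<^sub>C X a (n - int p) v)"
        by (rule clinearI) (simp_all add: X_lin scaleC_add_right scaleC_scaleC mult.commute)
      from ssum_comp[OF skew_ev0 this]
      show "ssum (?C p) = (sg (int p) * gb n p) *\<^sub>C X a (n - int p) (Y0 f (k + int p) g)"
        unfolding X[of "k + int p" g] by simp
    qed
    finally show ?thesis by (simp add: FA_def)
  qed
  also have "ssum (\<lambda>i. ssum (?B i)) = ssum (\<lambda>j. ssum (\<lambda>i. ?B i j))"
    by (rule ssum_swap[OF ev0_2_swap[OF evB]])
  also have "\<dots> = ssum (\<lambda>j. sg n *\<^sub>C (sg (int j) * gb n j) *\<^sub>C Y0 f (n - int j + k) (X a (int j) g))"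
  proof (rule ssum_cong)
    fix j
    have "ssum (\<lambda>i. ?B i j) = ssum (\<lambda>i. (sg n * sg (int j) * gb n j) *\<^sub>C
       sg (n - int j + k + int i + 1) *\<^sub>C dp i (Y0 (X a (int j) g) (n - int j + k + int i) f))"
      by (rule ssum_cong) (simp add: scaleC_scaleC sg_add sg_diff algebra_simps)
    also have "\<dots> = (sg n * sg (int j) * gb n j) *\<^sub>C Y0 f (n - int j + k) (X a (int j) g)"
      unfolding X[of "n - int j + k" "X a (int j) g"] by (rule ssum_scaleC[OF skew_ev0])
    finally show "ssum (\<lambda>i. ?B i j) = sg n *\<^sub>C (sg (int j) * gb n j) *\<^sub>C Y0 f (n - int j + k) (X a (int j) g)"
      by (simp add: scaleC_scaleC mult_ac)
  qed
  also have "\<dots> = sg n *\<^sub>C FB n a f 0 k g"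
    using ssum_scaleC[OF FB_ev0, of "sg n" "\<lambda>j. sg (int j) * gb n j" f "\<lambda>j. n - int j + k" a 0 g]
    by (simp add: FB_def)
  finally show ?case by (simp add: iterate_formula FJ_def)
next
  case (add f h)
  then show ?case
    by (simp add: Y0_state_lin Y0_lin dp_lin scaleC_add_right ssum_add[OF skew_ev0 skew_ev0])
next
  case (scale c f)
  have "c *\<^sub>C ssum (\<lambda>i. sg (k + int i + 1) *\<^sub>C dp i (Y0 g (k + int i) f))
     = ssum (\<lambda>i. c *\<^sub>C sg (k + int i + 1) *\<^sub>C dp i (Y0 g (k + int i) f))"
    by (rule ssum_scaleC[OF skew_ev0, symmetric])
  then show ?case
    by (simp add: Y0_state_lin Y0_lin dp_lin scale scaleC_scaleC mult.commute)
qed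

section \<open>From skew-symmetry to the commutator of any two vertex operators\<close>

lemma Y0_dp: "Y0 (dp s f) m g = (sg (int s) * gb m s) *\<^sub>C Y0 f (m - int s) g"
proof (induction s arbitrary: m)
  case 0
  then show ?case by (simp add: scaleC_one)
next
  case (Suc s)
  have "of_nat (Suc s) *\<^sub>C Y0 (dp (Suc s) f) m g = - (of_int m *\<^sub>C Y0 (dp s f) (m - 1) g)"
    by (simp only: Y0_state_lin(2)[symmetric] der_dp[symmetric] Y0_der)
  also have "\<dots> = (- sg (int s) * (of_int m * gb (m - 1) s)) *\<^sub>C Y0 f (m - 1 - int s) g"
    by (simp add: Suc scaleC_scaleC cvec.scale_minus_left mult_ac)
  also have "\<dots> = of_nat (Suc s) *\<^sub>C (sg (int (Suc s)) * gb m (Suc s)) *\<^sub>C Y0 f (m - int (Suc s)) g"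
    unfolding gb_absorb[symmetric] by (simp add: scaleC_scaleC sg_add algebra_simps del: of_nat_Suc) (simp add: algebra_simps sg_add)
  finally show ?case by (rule scaleC_cancel_Suc)
qed

lemma gb_neg: "gb (- int s - 1) j = (-1) ^ j * of_nat ((s + j) choose j)"
proof -
  have "gb (- int s - 1) j = (-1) ^ j * ((of_nat (s + j) :: complex) gchoose j)"
  proof -
    have "of_int (- int s - 1) = - (of_nat s + 1 :: complex)" by simp
    moreover have "(of_nat (s + j) :: complex) = of_nat s + 1 + of_nat j - 1" by simp
    ultimately show ?thesis by (simp only: gbinomial_minus)
  qed
  then show ?thesis by (simp only: binomial_gbinomial)
qed

lemma gb_minus_one: "gb (-1) j = (-1) ^ j" "(-1 :: complex) gchoose j = (-1) ^ j"
  using gb_neg[of 0 j] by simp_all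

lemma Y0_state_ev0': "ev0 (\<lambda>j. c j *\<^sub>C Y0 (Y0 f (int j + p) g) (h j) u)"
  by (rule ev0_mono[OF Y0_ev0[of f p g]]) (simp add: Y0_state_lin)

lemma Yvac_lin: "Yvac 0 k = 0" "Yvac (c *\<^sub>C f) k = c *\<^sub>C Yvac f k"
  by (simp_all add: Yvac_def dp_lin)

lemma sum_lessThan_add: "(\<Sum>q<m + n. t q) = (\<Sum>q<m. t q) + (\<Sum>j<n. t (m + j :: nat) :: 'a::comm_monoid_add)"
  by (induction n) (simp_all add: add_ac)

text \<open>Replacing \<open>f\<close> by a divided power of its derivative reduces \<open>m < 0\<close> to \<open>m = -1\<close>, which is
  skew-symmetry.\<close>

lemma commutator_vac:
  "Y0 f m (Yvac g k) - Y0 g k (Yvac f m) = ssum (\<lambda>j. gb m j *\<^sub>C Yvac (Y0 f (int j) g) (m + k - int j))"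
proof -
  \<comment> \<open>The sum that \<open>skew\<close> gives for \<open>Y0 g k f\<close> is cut where
    \<open>k + q\<close> changes sign: the terms with negative \<open>k + q\<close> form
    \<open>Y0 f (-1) (Yvac g k)\<close>, the others are minus the right hand side.\<close>
  have m1: "Y0 f (-1) (Yvac g k) - Y0 g k f = ssum (\<lambda>j. gb (-1) j *\<^sub>C Yvac (Y0 f (int j) g) (-1 + k - int j))" for f
  proof (cases "k \<ge> 0")
    case True
    obtain N where N: "\<And>k. k \<ge> int N \<Longrightarrow> Y0 f k g = 0" using Y0_ev0_int by blast
    have "ssum (\<lambda>j. gb (-1) j *\<^sub>C Yvac (Y0 f (int j) g) (-1 + k - int j))
       = (\<Sum>j<N + nat k. gb (-1) j *\<^sub>C Yvac (Y0 f (int j) g) (-1 + k - int j))"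
      by (rule ssum_lt) (simp add: N Yvac_lin)
    also have "\<dots> = (\<Sum>j\<in>{nat k..<N + nat k}. gb (-1) j *\<^sub>C Yvac (Y0 f (int j) g) (-1 + k - int j))"
      by (rule sum.mono_neutral_right) (use True in \<open>auto simp: Yvac_def\<close>)
    also have "\<dots> = (\<Sum>q<N. - (sg (k + int q + 1) *\<^sub>C dp q (Y0 f (k + int q) g)))"
    proof (rule sum.reindex_bij_witness[of _ "\<lambda>q. q + nat k" "\<lambda>j. j - nat k"])
      fix j assume "j \<in> {nat k..<N + nat k}"
      then have j: "k + int (j - nat k) = int j" "nat (- (-1 + k - int j) - 1) = j - nat k" "-1 + k - int j < 0"
        using True by auto
      show "- (sg (k + int (j - nat k) + 1) *\<^sub>C dp (j - nat k) (Y0 f (k + int (j - nat k)) g))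
          = gb (-1) j *\<^sub>C Yvac (Y0 f (int j) g) (-1 + k - int j)"
        unfolding j(1) gb_minus_one Yvac_def j(2) if_P[OF j(3)]
        by (simp add: sg_add sg_of_nat cvec.scale_minus_left)
    qed auto
    also have "\<dots> = - ssum (\<lambda>q. sg (k + int q + 1) *\<^sub>C dp q (Y0 f (k + int q) g))"
      by (subst ssum_lt[of N]) (use True in \<open>auto simp: N dp_lin sum_negf\<close>)
    also have "\<dots> = - Y0 g k f" by (simp only: skew[of g k f])
    finally show ?thesis using True by (simp add: Yvac_def Y0_lin)
  next
    case False
    define i where "i = nat (- k - 1)"
    have k: "k = - int i - 1" using False by (simp add: i_def)
    obtain N where N: "\<And>k. k \<ge> int N \<Longrightarrow> Y0 f k g = 0" using Y0_ev0_int by blast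
    let ?t = "\<lambda>q. sg (k + int q + 1) *\<^sub>C dp q (Y0 f (k + int q) g)"
    have "Y0 g k f = (\<Sum>q<Suc i + N. ?t q)"
      unfolding skew[of g k f] by (rule ssum_lt) (simp add: N k dp_lin)
    also have "\<dots> = (\<Sum>q<Suc i. ?t q) + (\<Sum>j<N. ?t (Suc i + j))"
      by (rule sum_lessThan_add)
    also have "(\<Sum>q<Suc i. ?t q) = Y0 f (-1) (Yvac g k)"
    proof -
      have "Y0 f (-1) (Yvac g k) = (\<Sum>p\<le>i. gb (-1) p *\<^sub>C dp (i - p) (Y0 f (-1 - int p) g))"
        using covariant_dp[of "Y0 f", OF clinear_Y0 der_Y0', of "-1" i g] by (simp add: Yvac_def k)
      also have "\<dots> = (\<Sum>q\<le>i. ?t q)"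
      proof (rule sum.reindex_bij_witness[of _ "\<lambda>q. i - q" "\<lambda>p. i - p"])
        fix p assume "p \<in> {..i}"
        then have p: "k + int (i - p) = -1 - int p" by (simp add: k of_nat_diff)
        show "?t (i - p) = gb (-1) p *\<^sub>C dp (i - p) (Y0 f (-1 - int p) g)"
          unfolding p by (simp add: gb_minus_one sg_of_nat)
      qed auto
      finally show ?thesis by (simp add: lessThan_Suc_atMost)
    qed
    also have "(\<Sum>j<N. ?t (Suc i + j)) = - ssum (\<lambda>j. gb (-1) j *\<^sub>C Yvac (Y0 f (int j) g) (-1 + k - int j))"
    proof -
      have "ssum (\<lambda>j. gb (-1) j *\<^sub>C Yvac (Y0 f (int j) g) (-1 + k - int j))
         = (\<Sum>j<N. gb (-1) j *\<^sub>C Yvac (Y0 f (int j) g) (-1 + k - int j))"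
        by (rule ssum_lt) (simp add: N Yvac_lin)
      note eq = this
      show ?thesis unfolding eq sum_negf[symmetric]
      proof (rule sum.cong[OF refl])
        fix j
        have "nat (- (-1 + k - int j) - 1) = Suc i + j" by (simp add: k)
        moreover have "k + int (Suc i + j) = int j" by (simp add: k)
        ultimately show "?t (Suc i + j) = - (gb (-1) j *\<^sub>C Yvac (Y0 f (int j) g) (-1 + k - int j))"
          by (simp add: Yvac_def k gb_minus_one sg_add sg_of_nat cvec.scale_minus_left)
      qed
    qed
    finally show ?thesis by (simp add: algebra_simps)
  qed
  show ?thesis
  proof (cases "m \<ge> 0")
    case True
    then have "Y0 f m (Yvac g k) = ssum (\<lambda>j. gb m j *\<^sub>C Yvac (Y0 f (int j) g) (k + m - int j))"
      by (rule covariant_Yvac[of "Y0 f", OF clinear_Y0 der_Y0'])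
    moreover have "Yvac f m = 0" using True by (simp add: Yvac_def)
    ultimately show ?thesis by (simp add: Y0_lin add.commute)
  next
    case False
    define s where "s = nat (- m - 1)"
    have m: "m = - int s - 1" using False by (simp add: s_def)
    have 1: "Y0 (dp s f) (-1) u = Y0 f m u" for u
    proof -
      have "-1 - int s = m" by (simp add: m)
      then show ?thesis by (simp add: Y0_dp gb_minus_one sg_of_nat scaleC_one flip: power_mult_distrib)
    qed
    have "Y0 f m (Yvac g k) - Y0 g k (Yvac f m) = Y0 (dp s f) (-1) (Yvac g k) - Y0 g k (dp s f)"
      unfolding 1 by (simp add: Yvac_def m)
    also have "\<dots> = ssum (\<lambda>j. gb (-1) j *\<^sub>C Yvac (Y0 (dp s f) (int j) g) (-1 + k - int j))"
      by (rule m1)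
    also have "\<dots> = ssum (\<lambda>j. gb m j *\<^sub>C Yvac (Y0 f (int j) g) (m + k - int j))"
    proof -
      obtain N where N: "\<And>k. k \<ge> int N \<Longrightarrow> Y0 f k g = 0" using Y0_ev0_int by blast
      let ?g = "\<lambda>j. gb (-1) j *\<^sub>C Yvac (Y0 (dp s f) (int j) g) (-1 + k - int j)"
      have "ssum ?g = (\<Sum>j<N + s. ?g j)"
        by (rule ssum_lt) (simp add: Y0_dp N Yvac_lin)
      also have "\<dots> = (\<Sum>j\<in>{s..<N + s}. ?g j)"
      proof (rule sum.mono_neutral_right)
        \<comment> \<open>The terms with \<open>j < s\<close> drop out with their binomial
          coefficient, so the sum can be reindexed by \<open>j = q + s\<close>.\<close>
        have "gb (int i) s = 0" if "i < s" for i by (rule gb_nonneg_0) (use that in auto)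
        then show "\<forall>j\<in>{..<N + s} - {s..<N + s}. ?g j = 0" by (auto simp: Y0_dp Yvac_lin)
      qed auto
      also have "\<dots> = (\<Sum>j<N. gb m j *\<^sub>C Yvac (Y0 f (int j) g) (m + k - int j))"
      proof (rule sum.reindex_bij_witness[of _ "\<lambda>j. j + s" "\<lambda>j. j - s"])
        fix j assume "j \<in> {s..<N + s}"
        then obtain q where j: "j = q + s" "q < N" by (metis add.commute atLeastLessThan_iff le_Suc_ex nat_add_left_cancel_less)
        have "gb (int (q + s)) s = of_nat ((q + s) choose s)" by (simp only: of_int_of_nat_eq binomial_gbinomial)
        moreover have "(q + s) choose s = (s + q) choose q" using binomial_symmetric[of s "q + s"] by (simp add: add.commute)
        ultimately have c: "gb (-1) j * (sg (int s) * gb (int j) s) = gb m q"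
          unfolding m gb_neg gb_minus_one j(1) sg_of_nat by (simp add: power_add flip: power_mult_distrib)
        show "gb m (j - s) *\<^sub>C Yvac (Y0 f (int (j - s)) g) (m + k - int (j - s)) = ?g j"
          using c by (simp add: Y0_dp Yvac_lin scaleC_scaleC j(1) m algebra_simps)
      qed auto
      also have "\<dots> = ssum (\<lambda>j. gb m j *\<^sub>C Yvac (Y0 f (int j) g) (m + k - int j))"
        by (rule ssum_lt[symmetric]) (simp add: N Yvac_lin)
      finally show ?thesis .
    qed
    finally show ?thesis .
  qed
qed

lemma gb_revision: "gb l (p + i) * of_nat ((p + i) choose p) = gb l p * gb (l - int p) i"
  using gbinomial_trinomial_revision[of p "p + i" "of_int l :: complex"]
  by (simp add: binomial_gbinomial)

text \<open>The coefficients of \<open>(1 + s)^m (1 + s + t)^l\<close> expanded in two ways.\<close>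

lemma commutator_resum:
  fixes \<Theta> :: "nat \<Rightarrow> nat \<Rightarrow> 'v::complex_vector"
  assumes fin: "\<And>p q. p \<ge> N \<or> q \<ge> N \<Longrightarrow> \<Theta> p q = 0"
  shows "ssum (\<lambda>j. ssum (\<lambda>i. (gb m j * gb l i) *\<^sub>C (\<Sum>p\<le>i. of_nat (i choose p) *\<^sub>C \<Theta> p (j + i - p))))
    = ssum (\<lambda>p. gb l p *\<^sub>C ssum (\<lambda>q. gb (m + l - int p) q *\<^sub>C \<Theta> p q))"
proof -
  \<comment> \<open>Trinomial revision expands \<open>(1 + s + t)^l\<close> in powers
    \<open>t^p\<close> with coefficients \<open>(1 + s)^{l - p}\<close>; Vandermonde then multiplies
    these by \<open>(1 + s)^m\<close>.\<close>
  let ?t = "\<lambda>j p i. (gb m j * (gb l p * gb (l - int p) i)) *\<^sub>C \<Theta> p (j + i)"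
  have z: "?t j p i = 0" if "j \<ge> N \<or> p \<ge> N \<or> i \<ge> N" for j p i
    using that fin[of p "j + i"] by auto
  have "ssum (\<lambda>i. (gb m j * gb l i) *\<^sub>C (\<Sum>p\<le>i. of_nat (i choose p) *\<^sub>C \<Theta> p (j + i - p)))
     = ssum (\<lambda>p. ssum (\<lambda>i. ?t j p i))" for j
  proof -
    have "ev0_2 (?t j)" unfolding ev0_2_def using z by blast
    then have "ssum (\<lambda>p. ssum (\<lambda>i. ?t j p i)) = ssum (\<lambda>i. \<Sum>p\<le>i. ?t j p (i - p))"
      by (rule ssum_diagonal)
    also have "\<dots> = ssum (\<lambda>i. (gb m j * gb l i) *\<^sub>C (\<Sum>p\<le>i. of_nat (i choose p) *\<^sub>C \<Theta> p (j + i - p)))"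
      unfolding cvec.scale_sum_right
    proof (intro ssum_cong sum.cong refl)
      fix i p :: nat assume "p \<in> {..i}"
      then obtain q where i: "i = p + q" by (metis atMost_iff le_Suc_ex)
      show "?t j p (i - p) = (gb m j * gb l i) *\<^sub>C of_nat (i choose p) *\<^sub>C \<Theta> p (j + i - p)"
        using gb_revision[of l p q] by (simp add: i scaleC_scaleC mult.assoc)
    qed
    finally show ?thesis by simp
  qed
  then have "ssum (\<lambda>j. ssum (\<lambda>i. (gb m j * gb l i) *\<^sub>C (\<Sum>p\<le>i. of_nat (i choose p) *\<^sub>C \<Theta> p (j + i - p))))
     = ssum (\<lambda>j. ssum (\<lambda>p. ssum (\<lambda>i. ?t j p i)))" by (simp only:)
  also have "\<dots> = ssum (\<lambda>p. ssum (\<lambda>j. ssum (\<lambda>i. ?t j p i)))"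
  proof (rule ssum_swap)
    have "ssum (\<lambda>i. ?t j p i) = 0" if "j \<ge> N \<or> p \<ge> N" for j p
    proof -
      have "?t j p = (\<lambda>i. 0)" using z that by blast
      then show ?thesis by simp
    qed
    then show "ev0_2 (\<lambda>j p. ssum (\<lambda>i. ?t j p i))" unfolding ev0_2_def by blast
  qed
  also have "\<dots> = ssum (\<lambda>p. gb l p *\<^sub>C ssum (\<lambda>q. gb (m + l - int p) q *\<^sub>C \<Theta> p q))"
  proof (rule ssum_cong)
    fix p
    have "ev0_2 (\<lambda>j i. ?t j p i)" unfolding ev0_2_def using z by blast
    then have "ssum (\<lambda>j. ssum (\<lambda>i. ?t j p i)) = ssum (\<lambda>q. \<Sum>j\<le>q. ?t j p (q - j))"
      by (rule ssum_diagonal)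
    also have "\<dots> = ssum (\<lambda>q. gb l p *\<^sub>C gb (m + l - int p) q *\<^sub>C \<Theta> p q)"
    proof (rule ssum_cong)
      fix q
      have "(\<Sum>j\<le>q. ?t j p (q - j)) = (\<Sum>j\<le>q. gb m j * gb (l - int p) (q - j)) *\<^sub>C gb l p *\<^sub>C \<Theta> p q"
        unfolding cvec.scale_sum_left by (rule sum.cong) (auto simp: scaleC_scaleC mult_ac)
      also have "\<dots> = gb l p *\<^sub>C gb (m + l - int p) q *\<^sub>C \<Theta> p q"
        unfolding gb_Vandermonde by (simp add: scaleC_scaleC mult.commute add_diff_eq)
      finally show "(\<Sum>j\<le>q. ?t j p (q - j)) = gb l p *\<^sub>C gb (m + l - int p) q *\<^sub>C \<Theta> p q" .
    qed
    also have "\<dots> = gb l p *\<^sub>C ssum (\<lambda>q. gb (m + l - int p) q *\<^sub>C \<Theta> p q)"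
    proof (rule ssum_scaleC)
      show "ev0 (\<lambda>q. gb (m + l - int p) q *\<^sub>C \<Theta> p q)" unfolding ev0_def using fin by (metis cvec.scale_zero_right)
    qed
    finally show "ssum (\<lambda>j. ssum (\<lambda>i. ?t j p i)) = gb l p *\<^sub>C ssum (\<lambda>q. gb (m + l - int p) q *\<^sub>C \<Theta> p q)" .
  qed
  finally show ?thesis .
qed

definition RC :: "vtoda \<Rightarrow> vtoda \<Rightarrow> int \<Rightarrow> int \<Rightarrow> vtoda \<Rightarrow> vtoda" where
  "RC f g m k h = ssum (\<lambda>j. gb m j *\<^sub>C Y0 (Y0 f (int j) g) (m + k - int j) h)"

lemma RC_ev0: "ev0 (\<lambda>j. c j *\<^sub>C Y0 (Y0 f (int j) g) (e j) h)"
  using Y0_state_ev0'[of c f 0 g e h] by simp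

text \<open>The commutator of \<open>Y0 f m\<close> and \<open>Y0 g k\<close> has this recursion
  too. \<open>X b\<close> acting on the state \<open>Y0 f (int j) g\<close> splits into
  \<open>?U\<close>, where it acts on \<open>g\<close>, and \<open>?V\<close>, where it acts on
  \<open>f\<close>. In \<open>?V\<close> the binomial coefficients do not yet have the upper index
  \<open>m + l - p\<close>, which is what \<open>commutator_resum\<close> achieves.\<close>

lemma RC_X: "RC f g m k (X b l h) = X b l (RC f g m k h)
    - ssum (\<lambda>p. gb l p *\<^sub>C RC (X b (int p) f) g (m + l - int p) k h)
    - ssum (\<lambda>p. gb l p *\<^sub>C RC f (X b (int p) g) m (k + l - int p) h)"
proof -
  let ?\<Theta> = "\<lambda>p q. Y0 (Y0 (X b (int p) f) (int q) g) (m + k + l - int p - int q) h"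
  let ?U = "\<lambda>j i. (gb m j * gb l i) *\<^sub>C Y0 (Y0 f (int j) (X b (int i) g)) (m + k + l - int j - int i) h"
  let ?V = "\<lambda>j i. (gb m j * gb l i) *\<^sub>C (\<Sum>p\<le>i. of_nat (i choose p) *\<^sub>C ?\<Theta> p (j + i - p))"
  have "ev0_2 ?\<Theta>"
    by (rule ev0_2_iterate[OF X_ev0'[of b f]])
      (use Y0_state_ev0'[of "\<lambda>_. 1" _ 0 g] in \<open>auto simp: Y0_state_lin scaleC_one\<close>)
  then obtain N where N: "\<And>p q. p \<ge> N \<or> q \<ge> N \<Longrightarrow> ?\<Theta> p q = 0" unfolding ev0_2_def by metis
  have U: "ev0_2 ?U"
  proof -
    have "ev0_2 (\<lambda>i j. ?U j i)"
      by (rule ev0_2_iterate[OF X_ev0'[of b g]]) (auto intro: RC_ev0 simp: Y0_lin Y0_state_lin)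
    then show ?thesis by (rule ev0_2_swap)
  qed
  have V: "ev0_2 ?V"
  proof -
    have "?V j i = 0" if "j \<ge> 2 * N \<or> i \<ge> 2 * N" for j i
    proof -
      have "?\<Theta> p (j + i - p) = 0" if "p \<le> i" for p
        by (rule N) (use \<open>j \<ge> 2 * N \<or> i \<ge> 2 * N\<close> that in linarith)
      then have "(\<Sum>p\<le>i. of_nat (i choose p) *\<^sub>C ?\<Theta> p (j + i - p)) = 0" by (intro sum.neutral) simp
      then show ?thesis by simp
    qed
    then show ?thesis unfolding ev0_2_def by blast
  qed
  have inner: "gb m j *\<^sub>C Y0 (Y0 f (int j) g) (m + k - int j) (X b l h)
      = gb m j *\<^sub>C X b l (Y0 (Y0 f (int j) g) (m + k - int j) h) - ssum (\<lambda>i. ?U j i + ?V j i)" for j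
  proof -
    have "gb m j *\<^sub>C ssum (\<lambda>i. gb l i *\<^sub>C Y0 (X b (int i) (Y0 f (int j) g)) (m + k - int j + l - int i) h)
       = ssum (\<lambda>i. gb m j *\<^sub>C gb l i *\<^sub>C Y0 (X b (int i) (Y0 f (int j) g)) (m + k - int j + l - int i) h)"
      by (rule ssum_scaleC[OF Y0_state_ev0, symmetric])
    also have "\<dots> = ssum (\<lambda>i. ?U j i + ?V j i)"
    proof (rule ssum_cong)
      fix i
      have "X b (int i) (Y0 f (int j) g) = Y0 f (int j) (X b (int i) g)
         + (\<Sum>p\<le>i. of_nat (i choose p) *\<^sub>C Y0 (X b (int p) f) (int (j + i - p)) g)"
      proof -
        have "ssum (\<lambda>p. gb (int i) p *\<^sub>C Y0 (X b (int p) f) (int j + int i - int p) g)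
           = (\<Sum>p\<le>i. gb (int i) p *\<^sub>C Y0 (X b (int p) f) (int j + int i - int p) g)"
        proof (rule ssum_le)
          fix p assume "p > i"
          then have "gb (int i) p = 0" by (intro gb_nonneg_0) auto
          then show "gb (int i) p *\<^sub>C Y0 (X b (int p) f) (int j + int i - int p) g = 0"
            by (simp only: cvec.scale_zero_left)
        qed
        also have "\<dots> = (\<Sum>p\<le>i. of_nat (i choose p) *\<^sub>C Y0 (X b (int p) f) (int (j + i - p)) g)"
          by (rule sum.cong) (auto simp: binomial_gbinomial of_nat_diff)
        finally show ?thesis by (simp add: X_Y0)
      qed
      moreover have "?\<Theta> p (j + i - p) = Y0 (Y0 (X b (int p) f) (int (j + i - p)) g) (m + k - int j + l - int i) h" if "p \<le> i" for p
        using that by (simp add: of_nat_diff algebra_simps)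
      ultimately show "gb m j *\<^sub>C gb l i *\<^sub>C Y0 (X b (int i) (Y0 f (int j) g)) (m + k - int j + l - int i) h = ?U j i + ?V j i"
        by (simp add: Y0_state_lin scaleC_add_right scaleC_scaleC algebra_simps)
    qed
    finally show ?thesis by (simp add: Y0_X cvec.scale_right_diff_distrib)
  qed
  have 1: "ev0 (\<lambda>j. gb m j *\<^sub>C X b l (Y0 (Y0 f (int j) g) (m + k - int j) h))"
    by (rule ev0_mono[OF RC_ev0[of "gb m" f g "\<lambda>j. m + k - int j" h]]) (auto simp: X_lin)
  have UV: "ev0_2 (\<lambda>j i. ?U j i + ?V j i)"
    by (rule ev0_2_combine[OF U V]) (simp only: add_0_right)
  have "RC f g m k (X b l h) = ssum (\<lambda>j. gb m j *\<^sub>C X b l (Y0 (Y0 f (int j) g) (m + k - int j) h))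
     - ssum (\<lambda>j. ssum (\<lambda>i. ?U j i + ?V j i))"
    unfolding RC_def inner by (rule ssum_diff[OF 1 ev0_2_outer[OF UV]])
  also have "ssum (\<lambda>j. gb m j *\<^sub>C X b l (Y0 (Y0 f (int j) g) (m + k - int j) h)) = X b l (RC f g m k h)"
    unfolding RC_def by (simp add: ssum_comp[OF RC_ev0 clinear_X] X_lin)
  also have "ssum (\<lambda>j. ssum (\<lambda>i. ?U j i + ?V j i)) = ssum (\<lambda>j. ssum (?U j)) + ssum (\<lambda>j. ssum (?V j))"
    by (rule ssum_ssum_add[OF U V, symmetric])
  also have "ssum (\<lambda>j. ssum (?U j)) = ssum (\<lambda>i. ssum (\<lambda>j. ?U j i))" by (rule ssum_swap[OF U])
  also have "\<dots> = ssum (\<lambda>p. gb l p *\<^sub>C RC f (X b (int p) g) m (k + l - int p) h)"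
    unfolding RC_def by (rule ssum_cong, subst ssum_scaleC[OF RC_ev0, symmetric])
      (simp add: scaleC_scaleC mult.commute algebra_simps)
  also have "ssum (\<lambda>j. ssum (?V j)) = ssum (\<lambda>p. gb l p *\<^sub>C ssum (\<lambda>q. gb (m + l - int p) q *\<^sub>C ?\<Theta> p q))"
    by (rule commutator_resum[OF N])
  also have "\<dots> = ssum (\<lambda>p. gb l p *\<^sub>C RC (X b (int p) f) g (m + l - int p) k h)"
    unfolding RC_def by (simp add: algebra_simps)
  finally show ?thesis by simp
qed

lemma Y0_Y0_X: "Y0 f m (Y0 g k (X b l h)) = X b l (Y0 f m (Y0 g k h))
    - ssum (\<lambda>p. gb l p *\<^sub>C Y0 (X b (int p) f) (m + l - int p) (Y0 g k h))
    - ssum (\<lambda>p. gb l p *\<^sub>C Y0 f m (Y0 (X b (int p) g) (k + l - int p) h))"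
  by (simp add: Y0_X Y0_lin ssum_comp[OF Y0_state_ev0 clinear_Y0])

text \<open>Both sides change in the same way when \<open>X b l\<close> is put in front of
  \<open>h\<close>, so the claim is carried from \<open>v0\<close> to all vectors.\<close>

theorem commutator: "Y0 f m (Y0 g k h) - Y0 g k (Y0 f m h)
    = ssum (\<lambda>j. gb m j *\<^sub>C Y0 (Y0 f (int j) g) (m + k - int j) h)"
  unfolding RC_def[symmetric]
proof (induction h arbitrary: f g m k rule: X_induct)
  case vac
  then show ?case by (simp add: Y0_v0 commutator_vac RC_def)
next
  case (X b l h)
  have e1: "ev0 (\<lambda>p. gb l p *\<^sub>C Y0 (X b (int p) f) (m + l - int p) (Y0 g k h))"
    by (rule Y0_state_ev0)
  have e2: "ev0 (\<lambda>p. gb l p *\<^sub>C Y0 g k (Y0 (X b (int p) f) (m + l - int p) h))"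
    by (rule ev0_mono[OF X_ev0'[of b f]]) (simp add: Y0_state_lin Y0_lin)
  have e3: "ev0 (\<lambda>p. gb l p *\<^sub>C Y0 f m (Y0 (X b (int p) g) (k + l - int p) h))"
    by (rule ev0_mono[OF X_ev0'[of b g]]) (simp add: Y0_state_lin Y0_lin)
  have e4: "ev0 (\<lambda>p. gb l p *\<^sub>C Y0 (X b (int p) g) (k + l - int p) (Y0 f m h))"
    by (rule Y0_state_ev0)
  have s1: "ssum (\<lambda>p. gb l p *\<^sub>C Y0 (X b (int p) f) (m + l - int p) (Y0 g k h))
      - ssum (\<lambda>p. gb l p *\<^sub>C Y0 g k (Y0 (X b (int p) f) (m + l - int p) h))
     = ssum (\<lambda>p. gb l p *\<^sub>C RC (X b (int p) f) g (m + l - int p) k h)"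
    by (simp only: ssum_diff[OF e1 e2, symmetric] cvec.scale_right_diff_distrib[symmetric] X)
  have s2: "ssum (\<lambda>p. gb l p *\<^sub>C Y0 f m (Y0 (X b (int p) g) (k + l - int p) h))
      - ssum (\<lambda>p. gb l p *\<^sub>C Y0 (X b (int p) g) (k + l - int p) (Y0 f m h))
     = ssum (\<lambda>p. gb l p *\<^sub>C RC f (X b (int p) g) m (k + l - int p) h)"
    by (simp only: ssum_diff[OF e3 e4, symmetric] cvec.scale_right_diff_distrib[symmetric] X)
  have s3: "X b l (Y0 f m (Y0 g k h)) - X b l (Y0 g k (Y0 f m h)) = X b l (RC f g m k h)"
    by (simp only: X_lin(4)[symmetric] X)
  show ?case
    unfolding RC_X Y0_Y0_X s1[symmetric] s2[symmetric] s3[symmetric] by simp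
next
  case (add g' h)
  have "RC f g m k (g' + h) = RC f g m k g' + RC f g m k h"
    by (simp add: RC_def Y0_lin scaleC_add_right ssum_add[OF RC_ev0 RC_ev0])
  then show ?case by (simp add: Y0_lin add[symmetric])
next
  case (scale c h)
  have "RC f g m k (c *\<^sub>C h) = c *\<^sub>C RC f g m k h"
    unfolding RC_def by (subst ssum_scaleC[OF RC_ev0, symmetric]) (simp add: Y0_lin scaleC_scaleC mult.commute)
  then show ?case by (simp add: Y0_lin scale[symmetric] cvec.scale_right_diff_distrib)
qed

section \<open>Residues, the trace and the Hopf action\<close>

lemma has_laurent_expansion_poly: "(\<lambda>z. poly p (a + z)) has_laurent_expansion poly_fls p a"
proof (induction p)
  case 0
  then show ?case by (simp add: poly_fls_hom)
next
  case (pCons c p)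
  have "poly_fls (pCons c p) a = poly_fls [:c:] a + poly_fls [:0, 1:] a * poly_fls p a"
    by (simp flip: poly_fls_hom)
  also have "\<dots> = fls_const c + (fls_X + fls_const a) * poly_fls p a"
    by (simp only: poly_fls_lin poly_fls_const add_0_right)
  finally have e: "poly_fls (pCons c p) a = fls_const c + (fls_X + fls_const a) * poly_fls p a" .
  have "(\<lambda>z. c + (z + a) * poly p (a + z)) has_laurent_expansion fls_const c + (fls_X + fls_const a) * poly_fls p a"
    by (intro laurent_expansion_intros pCons)
  then show ?case unfolding e by (simp add: add.commute)
qed

lemma residueK_eq: "residueK F n = cc F n (-1)"
proof -
  obtain p q where pq: "Rep_ratK F = Fract p q" "q \<in> M" using Rep_ratK[of F] by blast
  have fr: "fract_residue (Fract p q) a = residue (\<lambda>z. poly p z / poly q z) a" if "q \<noteq> 0" for p q :: "complex poly" and a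
    using that by transfer simp
  have "(\<lambda>z. poly p (of_int n + z) / poly q (of_int n + z)) has_laurent_expansion
      (poly_fls p (of_int n) / poly_fls q (of_int n))"
    by (intro laurent_expansion_intros has_laurent_expansion_poly)
  from has_laurent_expansion_residue_0[OF this]
  have "residue (\<lambda>z. poly p z / poly q z) (of_int n) = fls_residue (poly_fls p (of_int n) / poly_fls q (of_int n))"
    by (subst residue_shift_0)
  then show ?thesis
    using M_nz[OF pq(2)] by (simp add: residueK.rep_eq pq(1) fr cc_def laurent.rep_eq fract_fls_Fract)
qed

definition res_modes :: "int \<Rightarrow> int \<Rightarrow> complex" where
  "res_modes n k = (if k = -1 then 1 else 0)"

lemma trunc_res_modes: "trunc res_modes"
  by (auto simp: trunc_def res_modes_def intro: finite_subset[of _ "{}"])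

lemma Tr_eq: "Tr F = Lsum res_modes F"
proof -
  let ?A = "{n. cc F n (-1) \<noteq> 0}"
  have fin: "finite ?A"
    by (rule finite_subset[OF _ finite_imageI[OF finite_cc_neg[of F], of fst]]) force
  have "Lsum res_modes F = (\<Sum>(n, k)\<in>?A \<times> {-1}. cc F n k *\<^sub>C res_modes n k)"
    by (rule Lsum_superset) (use fin in \<open>auto simp: res_modes_def split: if_splits\<close>)
  also have "\<dots> = (\<Sum>n\<in>?A. cc F n (-1))"
    by (simp add: sum.cartesian_product[symmetric] res_modes_def scaleC_complex_def)
  finally show ?thesis by (simp add: Tr_def residueK_eq)
qed

text \<open>Residue duality: the pairing with \<open>F\<close> has as its modes the coefficients of
  \<open>F\<close> in the complementary degree \<open>-1 - k\<close>.\<close>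

lemma Tr_mult: "Tr (F * G) = Lsum (\<lambda>n k. cc F n (-1 - k)) G"
  and trunc_cc: "trunc (\<lambda>n k. cc F n (-1 - k))"
proof -
  have m: "mode_mult F res_modes = (\<lambda>n k. cc F n (-1 - k))"
  proof (intro ext)
    fix n k
    have "mode_mult F res_modes n k = Sum_any (\<lambda>l. if l = -1 - k then cc F n l else 0)"
      unfolding mode_mult_def by (rule Sum_any.cong) (auto simp: res_modes_def scaleC_complex_def)
    then show "mode_mult F res_modes n k = cc F n (-1 - k)" by simp
  qed
  show "Tr (F * G) = Lsum (\<lambda>n k. cc F n (-1 - k)) G"
    by (simp only: Tr_eq Lsum_mult[OF trunc_res_modes] m)
  show "trunc (\<lambda>n k. cc F n (-1 - k))"
    using trunc_mode_mult[OF trunc_res_modes, of F] by (simp only: m)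
qed

lemma Tr_lin: "Tr (F - G) = Tr F - Tr G" "Tr (c *\<^sub>C F) = c * Tr F" "Tr 0 = 0"
  by (simp_all add: Tr_eq Lsum_diff trunc_res_modes Lsum_scaleC scaleC_complex_def)

lemma Tr_inv_lin_power: "k \<ge> 2 \<Longrightarrow> Tr (inv_lin n ^ k) = 0"
proof -
  assume k: "k \<ge> 2"
  then obtain j where j: "k = Suc j" by (cases k) auto
  have "Lsum res_modes (inv_lin (- (- n)) ^ Suc j) = res_modes (- n) (- int (Suc j))"
    by (rule Lsum_inv_lin[OF trunc_res_modes]) (simp add: res_modes_def)
  then show ?thesis using k by (simp add: Tr_eq j res_modes_def)
qed

text \<open>The residues of \<open>F d\<tau>\<close> add up to zero when \<open>F\<close> vanishes to second order at infinity.\<close>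

lemma Tr_inv_lin_mult: "a + b \<ge> 2 \<Longrightarrow> Tr (inv_lin m ^ a * inv_lin n ^ b) = 0"
proof (induction "a + b" arbitrary: a b rule: less_induct)
  case less
  show ?case
  proof (cases "a = 0 \<or> b = 0 \<or> m = n")
    case True
    then show ?thesis using less.prems Tr_inv_lin_power by (auto simp flip: power_add)
  next
    case False
    then obtain a' b' where ab: "a = Suc a'" "b = Suc b'" by (metis not0_implies_Suc)
    have "inv_lin m ^ a * inv_lin n ^ b = (inv_lin m * inv_lin n) * (inv_lin m ^ a' * inv_lin n ^ b')"
      by (simp add: ab mult_ac)
    also have "\<dots> = (1 / of_int (n - m)) *\<^sub>C (inv_lin m ^ a * inv_lin n ^ b' - inv_lin m ^ a' * inv_lin n ^ b)"
    proof -
      have mn: "m \<noteq> n" using False by blast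
      have "(inv_lin m - inv_lin n) * (inv_lin m ^ a' * inv_lin n ^ b')
          = inv_lin m ^ a * inv_lin n ^ b' - inv_lin m ^ a' * inv_lin n ^ b"
        by (subst left_diff_distrib) (simp add: ab mult_ac)
      then show ?thesis by (simp only: inv_lin_diff[OF mn] scaleC_mult_left)
    qed
    finally have e: "Tr (inv_lin m ^ a * inv_lin n ^ b)
        = 1 / of_int (n - m) * (Tr (inv_lin m ^ a * inv_lin n ^ b') - Tr (inv_lin m ^ a' * inv_lin n ^ b))"
      by (simp only: Tr_lin)
    show ?thesis
    proof (cases "a' = 0 \<and> b' = 0")
      case True
      \<comment> \<open>Two simple poles: the difference of the two residues 1 is zero.\<close>
      have "Tr (inv_lin i) = 1" for i
        using Lsum_inv_lin[OF trunc_res_modes, of "- i" 0] by (simp add: Tr_eq res_modes_def)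
      then show ?thesis unfolding e using True ab by simp
    next
      case False
      then have "Tr (inv_lin m ^ a * inv_lin n ^ b') = 0" "Tr (inv_lin m ^ a' * inv_lin n ^ b) = 0"
      proof -
        show "Tr (inv_lin m ^ a * inv_lin n ^ b') = 0" by (rule less.hyps) (use False ab in auto)
        show "Tr (inv_lin m ^ a' * inv_lin n ^ b) = 0" by (rule less.hyps) (use False ab in auto)
      qed
      then show ?thesis unfolding e by simp
    qed
  qed
qed

lemma Tr_Ksing: "F \<in> Ksing \<Longrightarrow> Tr (F * inv_lin n ^ Suc j) = 0"
proof (rule clinear_span_vanish[of "\<lambda>F. Tr (F * inv_lin n ^ Suc j)" "{inv_lin n ^ (k + 1) | n k. True}" F])
  show "clinear (\<lambda>F. Tr (F * inv_lin n ^ Suc j))"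
    by (rule clinearI)
      (simp_all add: Tr_eq distrib_right Lsum_add trunc_res_modes scaleC_mult_left Lsum_scaleC)
  fix r assume "r \<in> {inv_lin n ^ (k + 1) | n k. True}"
  then obtain m k where "r = inv_lin m ^ (k + 1)" by blast
  then show "Tr (r * inv_lin n ^ Suc j) = 0" by (simp only: Tr_inv_lin_mult)
qed (simp add: Ksing_def)

section \<open>The Hopf algebra acting on \<open>1/\<tau>\<close>, and singular coordinates\<close>

lemma derivK_inv_tau_power: "derivK (inv_lin 0 ^ Suc k) = (- of_nat (Suc k)) *\<^sub>C inv_lin 0 ^ Suc (Suc k)"
proof -
  have r: "Rep_ratK (inv_lin 0 ^ k) = Fract 1 ([:0, 1:] ^ k)" for k
    by (induction k) (simp_all add: one_ratK.rep_eq times_ratK.rep_eq inv_lin.rep_eq One_fract_def)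
  have "Rep_ratK (derivK (inv_lin 0 ^ Suc k)) = Fract (- pderiv ([:0, 1:] ^ Suc k)) ([:0, 1:] ^ Suc k * [:0, 1:] ^ Suc k)"
    by (simp add: derivK.rep_eq r fract_deriv_Fract pderiv_1 del: power_Suc)
  also have "pderiv ([:0, 1 :: complex:] ^ Suc k) = smult (of_nat (Suc k)) ([:0, 1:] ^ k)"
    by (simp add: pderiv_power_Suc pderiv_pCons del: power_Suc of_nat_Suc)
  also have "Fract (- smult (of_nat (Suc k)) ([:0, 1:] ^ k)) ([:0, 1 :: complex:] ^ Suc k * [:0, 1:] ^ Suc k)
      = Fract [:- of_nat (Suc k):] 1 * Fract 1 ([:0, 1:] ^ Suc (Suc k))"
  proof -
    have c: "[:- of_nat (Suc k):] * p = - smult (of_nat (Suc k)) p" for p :: "complex poly" by (simp del: of_nat_Suc)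
    show ?thesis
      unfolding mult_fract by (subst eq_fract) (simp_all only: c power_Suc mult_1_left mult_1_right, simp_all add: mult_ac)
  qed
  also have "\<dots> = Rep_ratK ((- of_nat (Suc k)) *\<^sub>C inv_lin 0 ^ Suc (Suc k))"
    by (simp only: scaleC_ratK_def times_ratK.rep_eq of_pol.rep_eq r)
  finally show ?thesis by (simp only: Rep_ratK_inject)
qed

lemma derivK_scaleC: "derivK (c *\<^sub>C F) = c *\<^sub>C derivK F"
proof -
  obtain p q where pq: "Rep_ratK F = Fract p q" "q \<in> M" using Rep_ratK[of F] by blast
  then show ?thesis
    by (simp add: Rep_ratK_inject[symmetric] derivK.rep_eq scaleC_ratK_def times_ratK.rep_eq of_pol.rep_eq
        fract_deriv_Fract M_nz eq_fract pderiv_smult smult_diff_right)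
qed

lemma derivK_funpow: "(derivK ^^ k) (inv_lin 0) = ((-1) ^ k * fact k) *\<^sub>C inv_lin 0 ^ Suc k"
proof (induction k)
  case 0
  then show ?case by (simp add: scaleC_one)
next
  case (Suc k)
  have "(-1) ^ k * fact k * - of_nat (Suc k) = ((-1) ^ Suc k * fact (Suc k) :: complex)" by (simp add: algebra_simps)
  with Suc show ?case
    by (simp only: funpow.simps comp_apply derivK_scaleC derivK_inv_tau_power scaleC_scaleC)
qed

lemma shift_inv_lin: "shift n (inv_lin m ^ k) = inv_lin (m + n) ^ k"
proof (induction k)
  case 0
  have "shift n 1 = 1" using shift_of_pol[of n 1] by (simp add: of_pol_hom pcompose_1)
  then show ?case by simp
next
  case (Suc k)
  have "shift n (inv_lin m) = inv_lin (m + n)"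
    by (simp add: Rep_ratK_inject[symmetric] shift.rep_eq inv_lin.rep_eq fract_subst_Fract pcompose_1
        pcompose_pCons add.commute)
  with Suc show ?case by (simp add: shift_mult)
qed

lemma hact_antipode: "hact (antipode h) F = lin_ext (\<lambda>(n, k). ((-1) ^ k) *\<^sub>C shift (- n) ((derivK ^^ k) F)) h"
proof -
  have "hact (antipode h) F = lin_ext (\<lambda>k. lin_ext (\<lambda>(n, k). shift n ((derivK ^^ k) F))
      ((\<lambda>(n, k). Poly_Mapping.single (- n, k) ((-1) ^ k)) k)) h"
    unfolding hact_def antipode_def by (rule lin_ext_comp[OF clinear_lin_ext])
  then show ?thesis by (simp add: case_prod_unfold)
qed

text \<open>The signs of the antipode and of the derivatives of \<open>1/\<tau>\<close> cancel, so
  \<open>T^n \<partial>^k\<close> corresponds to \<open>k! (\<tau> - n)^{-k-1}\<close>. This is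
  where the factorials below come from.\<close>

lemma hact_antipode_inv_tau: "hact (antipode h) inv_tau = lin_ext (\<lambda>(n, k). fact k *\<^sub>C inv_lin (- n) ^ Suc k) h"
proof -
  have "((-1) ^ k) *\<^sub>C shift (- n) ((derivK ^^ k) inv_tau) = fact k *\<^sub>C inv_lin (- n) ^ Suc k" for n k
    by (simp add: derivK_funpow shift_scaleC shift_inv_lin scaleC_scaleC power_mult_distrib[symmetric] del: power_Suc flip: mult.assoc)
  then show ?thesis by (simp add: hact_antipode)
qed

lemma cc_hact_antipode:
  "cc (hact (antipode h) inv_tau) n (-1 - int k) = Poly_Mapping.lookup h (n, k) * fact k"
proof (induction h rule: poly_mapping_single_induct)
  case zero
  then show ?case by (simp add: hact_antipode_inv_tau)
next
  case (single x v)
  obtain m j where x: "x = (m, j)" by force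
  have "cc (inv_lin (- m) ^ Suc j) n (-1 - int k) = (if m = n \<and> j = k then 1 else 0)"
  proof (cases "m = n")
    case True
    then show ?thesis by (simp add: cc_inv_lin_self del: power_Suc)
  next
    case False
    then show ?thesis using cc_inv_lin_other[of m n "-1 - int k" "Suc j"] by simp
  qed
  then show ?case
    by (simp add: hact_antipode_inv_tau x cc_scaleC lookup_single when_def del: power_Suc)
next
  case (add f g)
  then show ?case by (simp add: hact_antipode_inv_tau lin_ext_add cc_add lookup_add distrib_right)
qed

text \<open>Congruence modulo polynomials prescribes the polar coefficients, and these are the
  coordinates of \<open>h\<close> up to factorials. Since there are finitely many of them, they
  define an element of the Hopf algebra.\<close>

lemma sing_coord_unique: "\<exists>!h. F - hact (antipode h) inv_tau \<in> Kpol"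
proof -
  have iff: "F - hact (antipode h) inv_tau \<in> Kpol
      \<longleftrightarrow> (\<forall>n k. Poly_Mapping.lookup h (n, k) = cc F n (-1 - int k) / fact k)" for h
  proof -
    have "F - hact (antipode h) inv_tau \<in> Kpol \<longleftrightarrow> (\<forall>n k. cc F n (-1 - int k) = Poly_Mapping.lookup h (n, k) * fact k)"
      unfolding Kpol_iff cc_diff
    proof safe
      fix n k assume "\<forall>n k. k < 0 \<longrightarrow> cc F n k - cc (hact (antipode h) inv_tau) n k = 0"
      then have "cc F n (-1 - int k) - cc (hact (antipode h) inv_tau) n (-1 - int k) = 0" by auto
      then show "cc F n (-1 - int k) = Poly_Mapping.lookup h (n, k) * fact k"
        by (simp add: cc_hact_antipode)
    next
      fix n k :: int assume a: "\<forall>n k. cc F n (-1 - int k) = Poly_Mapping.lookup h (n, k) * fact k" and "k < 0"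
      then have k: "k = -1 - int (nat (- k - 1))" by auto
      show "cc F n k - cc (hact (antipode h) inv_tau) n k = 0"
        by (subst (1 2) k) (simp only: a cc_hact_antipode diff_self)
    qed
    moreover have "cc F n (-1 - int k) = Poly_Mapping.lookup h (n, k) * fact k
        \<longleftrightarrow> Poly_Mapping.lookup h (n, k) = cc F n (-1 - int k) / fact k" for n k
      by (auto simp: field_simps)
    ultimately show ?thesis by (simp only:)
  qed
  have fin: "finite {x. (\<lambda>(n, k). cc F n (-1 - int k) / fact k) x \<noteq> 0}"
  proof (rule finite_subset)
    show "{x. (\<lambda>(n, k). cc F n (-1 - int k) / fact k) x \<noteq> 0}
        \<subseteq> (\<lambda>(n, k). (n, nat (- k - 1))) ` {(n, k). k < 0 \<and> cc F n k \<noteq> 0}"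
    proof clarify
      fix n k assume "cc F n (-1 - int k) / fact k \<noteq> 0"
      then have "(n, k) = (\<lambda>(n, k). (n, nat (- k - 1))) (n, -1 - int k)"
        "(n, -1 - int k) \<in> {(n, k). k < 0 \<and> cc F n k \<noteq> 0}" by auto
      then show "(n, k) \<in> (\<lambda>(n, k). (n, nat (- k - 1))) ` {(n, k). k < 0 \<and> cc F n k \<noteq> 0}"
        by (rule image_eqI)
    qed
  qed (use finite_cc_neg in simp)
  show ?thesis
    unfolding iff
  proof (rule ex1I[of _ "Abs_poly_mapping (\<lambda>(n, k). cc F n (-1 - int k) / fact k)"])
    show "\<forall>n k. Poly_Mapping.lookup (Abs_poly_mapping (\<lambda>(n, k). cc F n (-1 - int k) / fact k)) (n, k) = cc F n (-1 - int k) / fact k"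
      using fin by (simp add: Abs_poly_mapping_inverse)
    fix h assume "\<forall>n k. Poly_Mapping.lookup h (n, k) = cc F n (-1 - int k) / fact k"
    then show "h = Abs_poly_mapping (\<lambda>(n, k). cc F n (-1 - int k) / fact k)"
      by (intro poly_mapping_eqI) (use fin in \<open>auto simp: Abs_poly_mapping_inverse\<close>)
  qed
qed

lemma sing_coord_Kpol: "F - hact (antipode (sing_coord F)) inv_tau \<in> Kpol"
  unfolding sing_coord_def by (rule theI'[OF sing_coord_unique])

lemma lookup_sing_coord: "Poly_Mapping.lookup (sing_coord F) (n, k) = cc F n (-1 - int k) / fact k"
proof -
  have "cc F n (-1 - int k) - cc (hact (antipode (sing_coord F)) inv_tau) n (-1 - int k) = 0"
    using sing_coord_Kpol[of F] unfolding Kpol_iff cc_diff by auto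
  then show ?thesis by (simp add: cc_hact_antipode field_simps)
qed

text \<open>Sums over the Hopf basis become mode sums, the form in which \<open>R_op\<close> is
  compared with \<open>Y\<close>.\<close>

lemma lin_ext_sing_coord:
  "lin_ext \<phi> (sing_coord F) = Lsum (\<lambda>n k. if k < 0 then (1 / fact (nat (- k - 1))) *\<^sub>C \<phi> (n, nat (- k - 1)) else 0) F"
proof -
  let ?K = "Poly_Mapping.keys (sing_coord F)"
  let ?i = "\<lambda>(n, k). (n, -1 - int k)"
  let ?d = "\<lambda>n k. if k < 0 then (1 / fact (nat (- k - 1))) *\<^sub>C \<phi> (n, nat (- k - 1)) else 0"
  have "Lsum ?d F = (\<Sum>(n, k)\<in>?i ` ?K. cc F n k *\<^sub>C ?d n k)"
  proof (rule Lsum_superset)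
    show "{(n, k). cc F n k \<noteq> 0 \<and> ?d n k \<noteq> 0} \<subseteq> ?i ` ?K"
    proof clarify
      fix n k assume a: "cc F n k \<noteq> 0" "?d n k \<noteq> 0"
      then have "k < 0" by (auto split: if_splits)
      then have k: "-1 - int (nat (- k - 1)) = k" by auto
      then have "Poly_Mapping.lookup (sing_coord F) (n, nat (- k - 1)) \<noteq> 0"
        unfolding lookup_sing_coord using a by simp
      then have "(n, nat (- k - 1)) \<in> ?K" by (simp add: in_keys_iff)
      then show "(n, k) \<in> ?i ` ?K" using k by (intro image_eqI[of _ _ "(n, nat (- k - 1))"]) auto
    qed
  qed simp
  also have "\<dots> = (\<Sum>x\<in>?K. (\<lambda>(n, k). cc F n k *\<^sub>C ?d n k) (?i x))"
    by (rule sum.reindex_cong[of ?i]) (auto simp: inj_on_def)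
  also have "\<dots> = lin_ext \<phi> (sing_coord F)"
    unfolding lin_ext_def
    by (rule sum.cong) (auto simp: lookup_sing_coord scaleC_scaleC)
  finally show ?thesis by simp
qed

lemma coproduct_single: "coproduct (Poly_Mapping.single (n, k) 1)
   = (\<Sum>i\<le>k. of_nat (k choose i) *\<^sub>C Poly_Mapping.single ((n, i), (n, k - i)) 1)"
proof -
  have p1: "Poly_Mapping.single ((0::int, 1::nat), (0::int, 0::nat)) (1::complex) ^ i = Poly_Mapping.single ((0, i), (0, 0)) 1" for i
    by (induction i) (simp_all add: mult_single zero_prod_def flip: single_one)
  have p2: "Poly_Mapping.single ((0::int, 0::nat), (0::int, 1::nat)) (1::complex) ^ i = Poly_Mapping.single ((0, 0), (0, i)) 1" for i
    by (induction i) (simp_all add: mult_single zero_prod_def flip: single_one)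
  have nat_mult: "of_nat c * f = of_nat c *\<^sub>C f" for c and f :: "((int \<times> nat) \<times> (int \<times> nat)) \<Rightarrow>\<^sub>0 complex"
    by (induction c) (simp_all add: distrib_right scaleC_add_left scaleC_one)
  show ?thesis
    unfolding coproduct_def lin_ext_single case_prod_conv scaleC_one binomial_ring p1 p2 mult.assoc nat_mult
    by (simp add: sum_distrib_left scaleC_mult_left scaleC_mult_right mult_single)
qed

section \<open>The state-field correspondence\<close>

definition Y :: "vtoda \<Rightarrow> ratK \<Rightarrow> vtoda \<Rightarrow> vtoda" where
  "Y f F g = Lsum (\<lambda>n k. Y0 (T n f) k g) F"

text \<open>The mode \<open>X b\<close> at the point \<open>m\<close> meets the state
  \<open>T n f\<close> through \<open>X (c, m - n) (int j) f\<close>, which is nonzero for finitely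
  many \<open>n\<close> and \<open>j\<close>. Each such pair adds the finite support known for
  another state, together with the finitely many \<open>k \<ge> 0\<close> for which
  \<open>k + l - j\<close> is negative.\<close>

lemma trunc_Y: "trunc (\<lambda>n k. Y0 (T n f) k g)"
proof (induction g arbitrary: f rule: X_induct)
  case vac
  then show ?case
    by (auto simp: trunc_def Y0_v0 Yvac_def not_less[symmetric] intro: finite_subset[of _ "{}"])
next
  case (X b l g)
  obtain c m where b: "b = (c, m)" by force
  define P where "P = {(n', j). 0 \<le> j \<and> X (c, n') j f \<noteq> 0}"
  have fP: "finite P" using trunc_X[of c f] by (simp add: trunc_def P_def)
  define A where "A f = {(n, k). 0 \<le> k \<and> Y0 (T n f) k g \<noteq> 0}" for f
  have fA: "finite (A f)" for f using X[of f] by (simp add: trunc_def A_def)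
  define S where "S = (\<lambda>(n', j). {m - n'} \<times> {0..j - l} \<union> (\<lambda>(n, k). (n, k - l + j)) ` A (X (c, n') j f))"
  have fin: "finite (A f \<union> (\<Union>x\<in>P. S x))" using fP fA by (auto simp: S_def)
  have "{(n, k). 0 \<le> k \<and> Y0 (T n f) k (X b l g) \<noteq> 0} \<subseteq> A f \<union> (\<Union>x\<in>P. S x)"
  proof (rule subrelI, rule ccontr)
    fix n k assume nk: "(n, k) \<in> {(n, k). 0 \<le> k \<and> Y0 (T n f) k (X b l g) \<noteq> 0}"
      and not: "(n, k) \<notin> A f \<union> (\<Union>x\<in>P. S x)"
    have k: "0 \<le> k" and nz: "Y0 (T n f) k (X b l g) \<noteq> 0" using nk by auto
    have "Y0 (T n f) k g = 0" using not k by (simp add: A_def)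
    moreover have "Y0 (X b (int j) (T n f)) (k + l - int j) g = 0" for j
    proof (rule ccontr)
      have e: "X b (int j) (T n f) = T n (X (c, m - n) (int j) f)"
        by (simp add: T_X sh_def b)
      assume a: "Y0 (X b (int j) (T n f)) (k + l - int j) g \<noteq> 0"
      then have P: "(m - n, int j) \<in> P" by (auto simp: P_def e T_lin Y0_state_lin)
      have "(n, k) \<in> S (m - n, int j)"
      proof (cases "k + l - int j < 0")
        case True
        then show ?thesis using k by (simp add: S_def)
      next
        case False
        then have "(n, k + l - int j) \<in> A (X (c, m - n) (int j) f)" using a by (simp add: A_def e)
        then show ?thesis unfolding S_def by (auto intro!: image_eqI[of _ _ "(n, k + l - int j)"])
      qed
      with P not show False by blast
    qed
    ultimately show False using nz by (simp add: Y0_X X_lin)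
  qed
  then show ?case unfolding trunc_def by (rule finite_subset[OF _ fin])
next
  case (add g h)
  then show ?case by (simp add: Y0_lin trunc_add)
next
  case (scale c g)
  show ?case using trunc_comp[OF scale[of f], of "\<lambda>v. c *\<^sub>C v"] by (simp add: Y0_lin)
qed

lemma clinear_Y: "clinear (\<lambda>F. Y f F g)" and clinear_Y_op: "clinear (Y f F)" and clinear_Y_state: "clinear (\<lambda>f. Y f F g)"
proof -
  show "clinear (\<lambda>F. Y f F g)" unfolding Y_def by (rule clinear_Lsum[OF trunc_Y])
  show "clinear (Y f F)"
    by (rule clinearI) (simp_all add: Y_def Y0_lin Lsum_fun_add trunc_Y Lsum_fun_scaleC)
  show "clinear (\<lambda>f. Y f F g)"
    by (rule clinearI) (simp_all add: Y_def Y0_state_lin T_lin Lsum_fun_add trunc_Y Lsum_fun_scaleC)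
qed

lemmas Y_lin = clinear_add[OF clinear_Y_op] clinear_scaleC[OF clinear_Y_op] clinear_0[OF clinear_Y_op]
  clinear_diff[OF clinear_Y_op]

lemma Y_v0_Kpol: "G \<in> Kpol \<Longrightarrow> Y f G v0 = 0"
  unfolding Y_def by (auto intro!: Lsum_of_pol simp: Y0_v0 Yvac_def)

lemma Y_inv_lin_v0: "Y f (inv_lin (- n) ^ Suc k) v0 = dp k (T n f)"
  unfolding Y_def by (subst Lsum_inv_lin[OF trunc_Y]) (auto simp: Y0_v0 Yvac_def)

lemma Y_vacuum: "Y v0 F v = Tr F *\<^sub>C v"
proof -
  have "Tr F *\<^sub>C v = Lsum (\<lambda>n k. res_modes n k *\<^sub>C v) F"
    unfolding Tr_eq by (rule Lsum_comp[OF _ trunc_res_modes])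
      (auto intro!: clinearI simp: scaleC_add_left scaleC_scaleC scaleC_complex_def)
  also have "(\<lambda>n k. res_modes n k *\<^sub>C v) = (\<lambda>n k. Y0 (T n v0) k v)"
    by (auto simp: fun_eq_iff res_modes_def Y0_v0_state scaleC_one)
  finally show ?thesis by (simp add: Y_def)
qed

lemma Y_shift: "Y f (shift a F) v = Y (T (- a) f) F v"
  unfolding Y_def Lsum_shift by (simp add: T_T)

section \<open>The Hopf action on states and the two summands of \<open>R_op\<close>\<close>

lemma hV_single: "hV v0 Y (Poly_Mapping.single (n, k) 1) f = fact k *\<^sub>C dp k (T n f)"
proof -
  have "hV v0 Y (Poly_Mapping.single (n, k) 1) f = Y f (fact k *\<^sub>C inv_lin (- n) ^ Suc k) v0"
    by (simp add: hV_def hact_antipode_inv_tau scaleC_one del: power_Suc)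
  also have "\<dots> = fact k *\<^sub>C dp k (T n f)"
    by (simp only: clinear_scaleC[OF clinear_Y] Y_inv_lin_v0)
  finally show ?thesis .
qed

text \<open>Polynomials annihilate \<open>v0\<close>, so the singular part of \<open>F\<close> may
  be replaced by \<open>F\<close> itself and the Hopf coordinates disappear.\<close>

lemma R_dist_eq: "R_dist v0 Y v F = Y v F v0"
proof -
  have "Y v (F - hact (antipode (sing_coord F)) inv_tau) v0 = 0"
    by (rule Y_v0_Kpol[OF sing_coord_Kpol])
  then show ?thesis by (simp add: R_dist_def hV_def clinear_diff[OF clinear_Y])
qed

text \<open>The coproduct contributes \<open>k choose i\<close>, the two actions contribute
  \<open>i!\<close> and \<open>(k - i)!\<close>, and \<open>sing_coord\<close> divides by
  \<open>k!\<close>; what remains are plain divided powers.\<close>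

lemma R_hol_eq:
  assumes D: "clinear D"
  shows "R_hol v0 Y D F = Lsum (\<lambda>n k. if k < 0 then
      (\<Sum>i\<le>nat (- k - 1). dp i (T n (D (inv_lin (- n) ^ Suc (nat (- k - 1) - i))))) else 0) F"
proof -
  let ?\<chi> = "\<lambda>(a, b). hV v0 Y (Poly_Mapping.single a 1) (D (hact (antipode (Poly_Mapping.single b 1)) inv_tau))"
  have \<chi>: "?\<chi> ((n, i), (n, j)) = (fact i * fact j) *\<^sub>C dp i (T n (D (inv_lin (- n) ^ Suc j)))" for n i j
    by (simp add: hV_single hact_antipode_inv_tau scaleC_one clinear_scaleC[OF D] T_lin dp_lin scaleC_scaleC del: power_Suc)
  have cop: "lin_ext ?\<chi> (coproduct (Poly_Mapping.single (n, k) 1))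
      = fact k *\<^sub>C (\<Sum>i\<le>k. dp i (T n (D (inv_lin (- n) ^ Suc (k - i)))))" for n k
  proof -
    have "lin_ext ?\<chi> (coproduct (Poly_Mapping.single (n, k) 1))
       = (\<Sum>i\<le>k. of_nat (k choose i) *\<^sub>C ?\<chi> ((n, i), (n, k - i)))"
      unfolding coproduct_single clinear_sum[OF clinear_lin_ext] lin_ext_scaleC lin_ext_single scaleC_one ..
    also have "\<dots> = fact k *\<^sub>C (\<Sum>i\<le>k. dp i (T n (D (inv_lin (- n) ^ Suc (k - i)))))"
      unfolding \<chi> cvec.scale_sum_right scaleC_scaleC
    proof (rule sum.cong[OF refl])
      fix i assume "i \<in> {..k}"
      then have "of_nat (k choose i) * (fact i * fact (k - i)) = (fact k :: complex)"
      proof -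
        have "fact i * fact (k - i) * (k choose i) = fact k"
          using \<open>i \<in> {..k}\<close> by (intro binomial_fact_lemma) simp
        then have "(of_nat (fact i * fact (k - i) * (k choose i)) :: complex) = of_nat (fact k)" by (simp only:)
        then show ?thesis by (simp only: of_nat_mult of_nat_fact mult_ac)
      qed
      then show "(of_nat (k choose i) * (fact i * fact (k - i))) *\<^sub>C dp i (T n (D (inv_lin (- n) ^ Suc (k - i))))
         = fact k *\<^sub>C dp i (T n (D (inv_lin (- n) ^ Suc (k - i))))" by simp
    qed
    finally show ?thesis .
  qed
  have "R_hol v0 Y D F = lin_ext (\<lambda>x. lin_ext ?\<chi> (coproduct (Poly_Mapping.single x 1))) (sing_coord F)"
  proof -
    have "coproduct (sing_coord F) = lin_ext (\<lambda>x. coproduct (Poly_Mapping.single x 1)) (sing_coord F)"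
      by (simp add: coproduct_def scaleC_one)
    then show ?thesis
      unfolding R_hol_def by (simp only: lin_ext_comp[OF clinear_lin_ext])
  qed
  also have "\<dots> = Lsum (\<lambda>n k. if k < 0 then
      (\<Sum>i\<le>nat (- k - 1). dp i (T n (D (inv_lin (- n) ^ Suc (nat (- k - 1) - i))))) else 0) F"
    unfolding lin_ext_sing_coord cop
    by (intro arg_cong2[where f = Lsum] ext refl) (simp add: scaleC_scaleC scaleC_one)
  finally show ?thesis .
qed

lemma sing_kernel_exists:
  assumes "trunc d"
  shows "\<exists>ks. is_sing_kernel ks (Lsum d)"
proof -
  let ?S = "{(n, k). k \<ge> 0 \<and> d n k \<noteq> 0}"
  have "finite ?S" using assms by (simp add: trunc_def)
  then obtain xs where xs: "set xs = ?S" "distinct xs" using finite_distinct_list by blast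
  \<comment> \<open>By residue duality \<open>(\<tau> - n)^{-k-1}\<close> extracts the coefficient
    of degree \<open>k\<close> at \<open>n\<close> from a polynomial, so it is the partner of the
    mode \<open>d n k\<close>.\<close>
  let ?ks = "map (\<lambda>(n, k). (d n k, inv_lin (- n) ^ (nat k + 1))) xs"
  have "is_sing_kernel ?ks (Lsum d)"
    unfolding is_sing_kernel_def
  proof (intro conjI ballI)
    fix G assume G: "G \<in> Kpol"
    have tr: "Tr (inv_lin (- n) ^ (nat k + 1) * G) = cc G n k" if "k \<ge> 0" for n k
    proof -
      have "Tr (inv_lin (- n) ^ (nat k + 1) * G) = Lsum (\<lambda>m l. cc G m (-1 - l)) (inv_lin (- n) ^ Suc (nat k))"
        by (simp add: Tr_mult[symmetric] mult.commute)
      also have "\<dots> = cc G n (-1 - (- int (Suc (nat k))))"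
        by (rule Lsum_inv_lin[OF trunc_cc]) (use G in \<open>simp add: Kpol_iff\<close>)
      finally show ?thesis using that by simp
    qed
    have "Lsum d G = (\<Sum>(n, k)\<in>?S. cc G n k *\<^sub>C d n k)"
      by (rule Lsum_superset) (use assms G in \<open>auto simp: trunc_def Kpol_iff not_le[symmetric] intro: ccontr\<close>)
    also have "\<dots> = (\<Sum>x\<leftarrow>xs. (\<lambda>(n, k). cc G n k *\<^sub>C d n k) x)"
      by (simp only: sum_list_distinct_conv_sum_set[OF xs(2)] xs(1))
    also have "\<dots> = (\<Sum>(w, F)\<leftarrow>?ks. Tr (F * G) *\<^sub>C w)"
      unfolding map_map comp_def
    proof (rule arg_cong[where f = sum_list], rule map_cong[OF refl])
      fix x assume "x \<in> set xs"
      then obtain n k where x: "x = (n, k)" "k \<ge> 0" using xs(1) by auto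
      show "(case x of (n, k) \<Rightarrow> cc G n k *\<^sub>C d n k) = (case case x of (n, k) \<Rightarrow> (d n k, inv_lin (- n) ^ (nat k + 1)) of
          (w, F) \<Rightarrow> Tr (F * G) *\<^sub>C w)"
        by (simp only: x(1) prod.case tr[OF x(2)])
    qed
    finally show "Lsum d G = (\<Sum>(w, F)\<leftarrow>?ks. Tr (F * G) *\<^sub>C w)" .
  next
    fix x assume "x \<in> set ?ks"
    then show "case x of (w, F) \<Rightarrow> F \<in> Ksing"
      unfolding Ksing_def by (auto simp del: power_Suc intro!: cvec.span_base)
  qed
  then show ?thesis by blast
qed

lemma Y_is_field: "is_field (Y f)"
  unfolding is_field_def
proof (intro conjI allI)
  show "\<exists>ks. is_sing_kernel ks (\<lambda>F. Y f F v)" for v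
    unfolding Y_def by (rule sing_kernel_exists[OF trunc_Y])
qed (simp_all add: clinear_Y clinear_Y_op)

lemma Y_covariance:
  assumes "h \<in> H_T"
  shows "Y f (hact (antipode h) F) v = Y (hV v0 Y h f) F v"
proof -
  have "hact (antipode h) F = lin_ext (\<lambda>(n, k). shift (- n) F) h" for F
    unfolding hact_antipode lin_ext_def
    by (rule sum.cong) (use assms in \<open>auto simp: H_T_def scaleC_one\<close>)
  then have *: "Y f (hact (antipode h) F) v = lin_ext (\<lambda>(n, k). Y (T n f) F v) h" for F v
    by (simp add: lin_ext_comp[OF clinear_Y] case_prod_unfold Y_shift)
  have "Y f (inv_lin (- 0) ^ Suc 0) v0 = f" for f by (simp only: Y_inv_lin_v0) simp
  then have "hV v0 Y h f = lin_ext (\<lambda>(n, k). T n f) h" by (simp add: hV_def *)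
  then have "Y (hV v0 Y h f) F v = lin_ext (\<lambda>(n, k). Y (T n f) F v) h"
    by (simp add: lin_ext_comp[OF clinear_Y_state] case_prod_unfold)
  with * show ?thesis by simp
qed

section \<open>Skew-symmetry over the integers\<close>

lemma cc_reflect: "cc (reflect F) n k = sg k * cc F (- n) k"
proof -
  \<comment> \<open>\<open>neg\<close> substitutes \<open>-z\<close> for \<open>z\<close> in a
    Laurent series. Being multiplicative, it passes from numerator and denominator to the
    quotient.\<close>
  define neg where "neg f = Abs_fls (\<lambda>k. sg k * f $$ k)" for f :: "complex fls"
  have neg: "neg f $$ k = sg k * f $$ k" for f k
    unfolding neg_def by (rule nth_Abs_fls_lower_bound[of "fls_subdegree f"]) simp
  have neg_mult: "neg (f * g) = neg f * neg g" for f g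
  proof (rule fls_eqI)
    fix k
    have "neg (f * g) $$ k = Sum_any (\<lambda>l. sg k * (f $$ l * g $$ (k - l)))"
      unfolding neg fls_mult_nth_Sum_any(2) by (rule Sum_any_right_distrib) (rule fls_mult_nth_Sum_any(1))
    also have "\<dots> = (neg f * neg g) $$ k"
      unfolding fls_mult_nth_Sum_any(2) neg by (rule Sum_any.cong) (simp add: sg_diff mult_ac)
    finally show "neg (f * g) $$ k = (neg f * neg g) $$ k" .
  qed
  have neg_0: "neg f = 0 \<longleftrightarrow> f = 0" for f
  proof -
    have "sg k \<noteq> 0" for k by (simp add: sg_def)
    then show ?thesis by (auto simp: fls_eq_iff neg)
  qed
  have neg_poly: "poly_fls (pcompose p [:0, -1:]) (of_int n) = neg (poly_fls p (of_int (- n)))" for p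
  proof (rule fls_eqI)
    fix k
    have "pcompose (pcompose p [:0, -1:]) [:of_int n, 1:] = pcompose (pcompose p [:- of_int n, 1:]) [:0, -1:]"
      by (simp add: pcompose_assoc[symmetric] pcompose_pCons)
    then show "poly_fls (pcompose p [:0, -1:]) (of_int n) $$ k = neg (poly_fls p (of_int (- n))) $$ k"
      unfolding neg by (cases "k < 0") (auto simp: poly_fls_def coeff_pcompose_linear sg_of_nat[symmetric])
  qed
  obtain p q where pq: "Rep_ratK F = Fract p q" "q \<in> M" using Rep_ratK[of F] by blast
  have q: "q \<noteq> 0" "pcompose q [:0, -1:] \<noteq> 0"
    using M_nz[OF pq(2)] by (auto dest: pcompose_eq_0)
  have "laurent (reflect F) n = neg (poly_fls p (of_int (- n))) / neg (poly_fls q (of_int (- n)))"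
    using q by (simp add: laurent.rep_eq reflect.rep_eq pq(1) fract_subst_Fract fract_fls_Fract neg_poly)
  also have "\<dots> = neg (laurent F (- n))"
  proof -
    have "neg (poly_fls p (of_int (- n))) = neg (laurent F (- n)) * neg (poly_fls q (of_int (- n)))"
      using q by (simp add: laurent.rep_eq pq(1) fract_fls_Fract flip: neg_mult)
    moreover have "neg (poly_fls q (of_int (- n))) \<noteq> 0" using q by (simp add: neg_0)
    ultimately show ?thesis by simp
  qed
  finally show ?thesis by (simp add: cc_def neg)
qed

lemma Lsum_reflect: "Lsum d (reflect F) = Lsum (\<lambda>n k. sg k *\<^sub>C d (- n) k) F"
proof -
  have "Sum_any (\<lambda>(n, k). cc F n k *\<^sub>C sg k *\<^sub>C d (- n) k) = Sum_any (\<lambda>(n, k). cc (reflect F) n k *\<^sub>C d n k)"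
  proof (rule Sum_any.reindex_cong[symmetric])
    show "bij (\<lambda>(n::int, k::int). (- n, k))"
      by (rule bij_betwI[where g = "\<lambda>(n, k). (- n, k)"]) auto
  qed (auto simp: cc_reflect scaleC_scaleC fun_eq_iff mult.commute)
  then show ?thesis by (simp add: Lsum_def)
qed

section \<open>The kernel terms of \<open>R_op\<close> as mode sums\<close>

lemma dpT_ev0:
  assumes "\<exists>N. \<forall>i\<ge>N. u i = 0"
  shows "ev0 (\<lambda>i. dp i (T n (u i)))"
proof -
  obtain N where "\<And>i. i \<ge> N \<Longrightarrow> u i = 0" using assms by blast
  then have "dp i (T n (u i)) = 0" if "i \<ge> N" for i using that by (simp add: T_lin dp_lin)
  then show ?thesis unfolding ev0_def by blast
qed

text \<open>These are the modes of \<open>G \<mapsto> Y w (F * G) v0\<close>, with \<open>i\<close>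
  the power of \<open>z\<close> in \<open>e^{z der}\<close>.\<close>

lemma mode_mult_Yvac:
  "mode_mult F (\<lambda>n k. Y0 (T n w) k v0) n k = ssum (\<lambda>i. dp i (T n (cc F n (-1 - k - int i) *\<^sub>C w)))"
proof -
  obtain N where N: "\<And>l. l < N \<Longrightarrow> cc F n l = 0"
    unfolding cc_def using fls_eq0_below_subdegree by blast
  let ?h = "\<lambda>l. cc F n l *\<^sub>C Y0 (T n w) (k + l) v0"
  have h: "?h l = 0" if "l \<notin> {N..-1 - k}" for l
    using that by (auto simp: Y0_v0 Yvac_def N not_le)
  have "mode_mult F (\<lambda>n k. Y0 (T n w) k v0) n k = (\<Sum>l\<in>{N..-1 - k}. ?h l)"
    unfolding mode_mult_def by (rule Sum_any.expand_superset) (simp, use h in blast)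
  also have "\<dots> = (\<Sum>i<nat (- k - N). dp i (T n (cc F n (-1 - k - int i) *\<^sub>C w)))"
  proof (rule sum.reindex_bij_witness[of _ "\<lambda>i. -1 - k - int i" "\<lambda>l. nat (-1 - k - l)"])
    fix l assume "l \<in> {N..-1 - k}"
    then have l: "-1 - k - int (nat (-1 - k - l)) = l" "k + l < 0" "nat (- (k + l) - 1) = nat (-1 - k - l)" by auto
    show "dp (nat (-1 - k - l)) (T n (cc F n (-1 - k - int (nat (-1 - k - l))) *\<^sub>C w)) = ?h l"
      unfolding l(1) Y0_v0 Yvac_def if_P[OF l(2)] l(3) by (simp add: T_lin dp_lin)
  qed auto
  also have "\<dots> = ssum (\<lambda>i. dp i (T n (cc F n (-1 - k - int i) *\<^sub>C w)))"
    by (rule ssum_lt[symmetric]) (simp add: N T_lin dp_lin)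
  finally show ?thesis .
qed

text \<open>Laurent coefficients at \<open>n\<close> of the vector-valued function
  \<open>\<Sum> w F\<close>. The trace pairing and the first summand of \<open>R_op\<close> depend
  on the list only through them, so the proof does not have to know which kernel is chosen.\<close>

definition ksum :: "(vtoda \<times> ratK) list \<Rightarrow> int \<Rightarrow> int \<Rightarrow> vtoda" where
  "ksum ks n l = (\<Sum>(w, F)\<leftarrow>ks. cc F n l *\<^sub>C w)"

lemma ksum_ev: "\<exists>N. \<forall>l<N. ksum ks n l = 0"
proof (induction ks)
  case (Cons x ks)
  obtain w F where x: "x = (w, F)" by force
  obtain N1 N2 where "\<And>l. l < N1 \<Longrightarrow> ksum ks n l = 0" "\<And>l. l < N2 \<Longrightarrow> cc F n l = 0"
    using Cons unfolding cc_def using fls_eq0_below_subdegree by blast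
  then have "ksum (x # ks) n l = 0" if "l < min N1 N2" for l
    using that by (simp add: ksum_def x)
  then show ?case by blast
qed (simp add: ksum_def)

lemma ksum_ev': "\<exists>N. \<forall>i\<ge>N. ksum ks n (-1 - k - int i) = 0"
proof -
  obtain N where "\<And>l. l < N \<Longrightarrow> ksum ks n l = 0" using ksum_ev by blast
  then have "ksum ks n (-1 - k - int i) = 0" if "i \<ge> nat (- k - N)" for i
    using that by auto
  then show ?thesis by blast
qed

lemma kernel_Tr_sum:
  "(\<Sum>(w, F)\<leftarrow>ks. Tr (F * G) *\<^sub>C w) = Lsum (\<lambda>n k. ksum ks n (-1 - k)) G"
  and trunc_ksum: "trunc (\<lambda>n k. ksum ks n (-1 - k))"
proof (induction ks)
  case Nil
  { case 1 then show ?case by (simp add: ksum_def) next case 2 then show ?case by (simp add: ksum_def) }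
next
  case (Cons x ks)
  obtain w F where x: "x = (w, F)" by force
  have e: "ksum (x # ks) n l = cc F n l *\<^sub>C w + ksum ks n l" for n l by (simp add: ksum_def x)
  have t: "trunc (\<lambda>n k. cc F n (-1 - k) *\<^sub>C w)"
    using trunc_comp[OF trunc_cc[of F], of "\<lambda>c. c *\<^sub>C w"] by simp
  { case 1
    have "Tr (F * G) *\<^sub>C w = Lsum (\<lambda>n k. cc F n (-1 - k) *\<^sub>C w) G"
      unfolding Tr_mult by (rule Lsum_comp[OF _ trunc_cc])
        (auto intro!: clinearI simp: scaleC_add_left scaleC_scaleC scaleC_complex_def)
    then show ?case using Cons by (simp add: x e[unfolded x] Lsum_fun_add[OF t Cons(2)]) }
  { case 2 then show ?case unfolding e by (rule trunc_add[OF t Cons(2)]) }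
qed

lemma kernel_R_sum:
  "(\<Sum>(w, F)\<leftarrow>ks. R_dist v0 Y w (F * G)) = Lsum (\<lambda>n k. ssum (\<lambda>i. dp i (T n (ksum ks n (-1 - k - int i))))) G"
  and trunc_R: "trunc (\<lambda>n k. ssum (\<lambda>i. dp i (T n (ksum ks n (-1 - k - int i)))))"
proof (induction ks)
  case Nil
  { case 1 then show ?case by (simp add: ksum_def T_lin dp_lin) next
    case 2 then show ?case by (simp add: ksum_def T_lin dp_lin) }
next
  case (Cons x ks)
  obtain w F where x: "x = (w, F)" by force
  have e: "ksum (x # ks) n l = cc F n l *\<^sub>C w + ksum ks n l" for n l by (simp add: ksum_def x)
  have ev: "\<exists>N. \<forall>i\<ge>N. cc F n (-1 - k - int i) *\<^sub>C w = 0" for n k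
    using ksum_ev'[of "[(w, F)]" n k] by (simp add: ksum_def)
  have s: "ssum (\<lambda>i. dp i (T n (ksum (x # ks) n (-1 - k - int i))))
      = mode_mult F (\<lambda>n k. Y0 (T n w) k v0) n k + ssum (\<lambda>i. dp i (T n (ksum ks n (-1 - k - int i))))" for n k
    unfolding e mode_mult_Yvac T_lin dp_lin(1)
    using ssum_add[OF dpT_ev0[OF ev] dpT_ev0[OF ksum_ev']] by (simp add: T_lin)
  have t: "trunc (mode_mult F (\<lambda>n k. Y0 (T n w) k v0))" by (rule trunc_mode_mult[OF trunc_Y])
  { case 1
    have "R_dist v0 Y w (F * G) = Lsum (mode_mult F (\<lambda>n k. Y0 (T n w) k v0)) G"
      unfolding R_dist_eq Y_def by (rule Lsum_mult[OF trunc_Y])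
    then show ?case unfolding s by (simp add: x Cons(1) Lsum_fun_add[OF t Cons(2)]) }
  { case 2 then show ?case unfolding s by (rule trunc_add[OF t Cons(2)]) }
qed

text \<open>The part of the kernel that is regular at \<open>n\<close> enters both summands of \<^const>\<open>R_op\<close>, and with
  opposite signs, since the residues of \<open>F (\<tau> - n)^{-j-1}\<close> add up to zero for \<open>F\<close> in \<^const>\<open>Ksing\<close>.\<close>

lemma Y_skew: "Y f G g = R_op v0 Y (Y_S Y g f) G"
proof -
  \<comment> \<open>Reflection exchanges \<open>n\<close> and \<open>- n\<close> and brings in
    \<open>(-1)^k\<close>; with the minus sign of \<open>Y_S\<close> this becomes
    \<open>sg (k + 1)\<close>.\<close>
  define e where "e n k = sg (k + 1) *\<^sub>C Y0 (T (- n) g) k f" for n k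
  define ks where "ks = (SOME ks. is_sing_kernel ks (Y_S Y g f))"
  have te: "trunc e"
  proof -
    have "{(n, k). 0 \<le> k \<and> e n k \<noteq> 0} \<subseteq> (\<lambda>(n, k). (- n, k)) ` {(n, k). 0 \<le> k \<and> Y0 (T n g) k f \<noteq> 0}"
      by (force simp: e_def image_def)
    then show ?thesis using trunc_Y[of g f] unfolding trunc_def by (meson finite_imageI finite_subset)
  qed
  have D: "Y_S Y g f = Lsum e"
  proof
    fix F
    have t: "trunc (\<lambda>n k. sg k *\<^sub>C Y0 (T (- n) g) k f)"
      using trunc_uminus[OF te] by (simp add: e_def sg_add cvec.scale_minus_left)
    have "Y_S Y g f F = - Lsum (\<lambda>n k. sg k *\<^sub>C Y0 (T (- n) g) k f) F"
      by (simp add: Y_S_def Y_def Lsum_reflect)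
    also have "\<dots> = Lsum e F"
      by (simp add: Lsum_fun_uminus[OF t, symmetric] e_def[abs_def] sg_add cvec.scale_minus_left)
    finally show "Y_S Y g f F = Lsum e F" .
  qed
  have ks: "is_sing_kernel ks (Lsum e)"
    unfolding ks_def D by (rule someI_ex[OF sing_kernel_exists[OF te]])
  \<comment> \<open>Polynomials see only nonnegative modes, so this identifies the polar
    coefficients of the chosen kernel. The regular ones remain and have to cancel in the
    end.\<close>
  have E: "ksum ks n (-1 - k) = e n k" if "k \<ge> 0" for n k
  proof -
    have "Lsum e F = Lsum (\<lambda>n k. ksum ks n (-1 - k)) F" if "F \<in> Kpol" for F
      using ks that unfolding is_sing_kernel_def kernel_Tr_sum by blast
    from Lsum_inject_Kpol[OF te trunc_ksum this that] show ?thesis by simp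
  qed
  have H: "Lsum e (inv_lin (- n) ^ Suc j) = e n (- int (Suc j)) - ksum ks n (int j)" for n j
  proof -
    have "(\<Sum>(w, F)\<leftarrow>ks. Tr (F * inv_lin (- n) ^ Suc j) *\<^sub>C w) = 0"
    proof -
      have "\<forall>(w, F)\<in>set ks. F \<in> Ksing" using ks by (simp add: is_sing_kernel_def)
      then show ?thesis by (induction ks) (auto simp: Tr_Ksing simp del: power_Suc)
    qed
    then have "Lsum (\<lambda>n k. ksum ks n (-1 - k)) (inv_lin (- n) ^ Suc j) = 0"
      by (simp only: kernel_Tr_sum)
    then have "Lsum e (inv_lin (- n) ^ Suc j) = Lsum (\<lambda>n k. e n k - ksum ks n (-1 - k)) (inv_lin (- n) ^ Suc j)"
      by (simp only: Lsum_fun_diff[OF te trunc_ksum] diff_0_right)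
    also have "\<dots> = e n (- int (Suc j)) - ksum ks n (-1 - (- int (Suc j)))"
      by (rule Lsum_inv_lin[OF trunc_diff[OF te trunc_ksum]]) (simp add: E)
    finally show ?thesis by simp
  qed
  let ?hol = "\<lambda>n k. if k < 0 then (\<Sum>i\<le>nat (- k - 1). dp i (T n (Lsum e (inv_lin (- n) ^ Suc (nat (- k - 1) - i))))) else 0"
  have th: "trunc ?hol"
    by (auto simp: trunc_def not_less[symmetric] intro: finite_subset[of _ "{}"])
  have "R_op v0 Y (Y_S Y g f) G = Lsum (\<lambda>n k. ssum (\<lambda>i. dp i (T n (ksum ks n (-1 - k - int i)))) + ?hol n k) G"
    unfolding R_op_def ks_def[symmetric] kernel_R_sum unfolding D R_hol_eq[OF clinear_Lsum[OF te]]
    by (rule Lsum_fun_add[OF trunc_R th, symmetric])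
  also have "(\<lambda>n k. ssum (\<lambda>i. dp i (T n (ksum ks n (-1 - k - int i)))) + ?hol n k) = (\<lambda>n k. Y0 (T n f) k g)"
  proof (intro ext)
    fix n k
    have ev: "\<exists>N. \<forall>i\<ge>N. e n (k + int i) = 0"
      using Y0_ev0[of "T (- n) g" k f] unfolding ev0_def e_def by (auto simp: add.commute)
    \<comment> \<open>\<open>T n\<close> carries \<open>Y0 (T (- n) g) k f\<close> to
      \<open>Y0 g k (T n f)\<close>, so skew-symmetry at one point applies to the states
      \<open>T n f\<close> and \<open>g\<close>.\<close>
    have "T n (e n (k + int i)) = sg (k + int i + 1) *\<^sub>C Y0 g (k + int i) (T n f)" for i
      by (simp add: e_def T_lin T_Y0 T_T)
    then have "Y0 (T n f) k g = ssum (\<lambda>i. dp i (T n (e n (k + int i))))"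
      by (simp add: skew[of "T n f" k g] dp_lin)
    also have "\<dots> = ssum (\<lambda>i. dp i (T n (ksum ks n (-1 - k - int i))) + dp i (T n (e n (k + int i) - ksum ks n (-1 - k - int i))))"
      by (simp add: T_lin dp_lin)
    also have "\<dots> = ssum (\<lambda>i. dp i (T n (ksum ks n (-1 - k - int i)))) + ssum (\<lambda>i. dp i (T n (e n (k + int i) - ksum ks n (-1 - k - int i))))"
    proof (rule ssum_add[OF dpT_ev0[OF ksum_ev'] dpT_ev0])
      obtain N1 N2 where "\<And>i. i \<ge> N1 \<Longrightarrow> e n (k + int i) = 0" "\<And>i. i \<ge> N2 \<Longrightarrow> ksum ks n (-1 - k - int i) = 0"
        using ev ksum_ev' by metis
      then have "e n (k + int i) - ksum ks n (-1 - k - int i) = 0" if "i \<ge> max N1 N2" for i using that by simp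
      then show "\<exists>N. \<forall>i\<ge>N. e n (k + int i) - ksum ks n (-1 - k - int i) = 0" by blast
    qed
    also have "ssum (\<lambda>i. dp i (T n (e n (k + int i) - ksum ks n (-1 - k - int i)))) = ?hol n k"
    proof -
      have z: "dp i (T n (e n (k + int i) - ksum ks n (-1 - k - int i))) = 0" if "k + int i \<ge> 0" for i
        using E[OF that, of n] by (simp add: T_lin dp_lin diff_diff_eq)
      show ?thesis
      proof (cases "k < 0")
        case True
        have "ssum (\<lambda>i. dp i (T n (e n (k + int i) - ksum ks n (-1 - k - int i))))
           = (\<Sum>i\<le>nat (- k - 1). dp i (T n (e n (k + int i) - ksum ks n (-1 - k - int i))))"
          by (rule ssum_le, rule z) auto
        also have "\<dots> = (\<Sum>i\<le>nat (- k - 1). dp i (T n (Lsum e (inv_lin (- n) ^ Suc (nat (- k - 1) - i)))))"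
        proof (rule sum.cong[OF refl])
          fix i assume "i \<in> {..nat (- k - 1)}"
          then have "- int (Suc (nat (- k - 1) - i)) = k + int i" "int (nat (- k - 1) - i) = -1 - k - int i"
            using True by auto
          then show "dp i (T n (e n (k + int i) - ksum ks n (-1 - k - int i)))
              = dp i (T n (Lsum e (inv_lin (- n) ^ Suc (nat (- k - 1) - i))))" by (simp only: H)
        qed
        finally show ?thesis using True by simp
      next
        case False
        then show ?thesis by (simp add: z)
      qed
    qed
    finally show "ssum (\<lambda>i. dp i (T n (ksum ks n (-1 - k - int i)))) + ?hol n k = Y0 (T n f) k g" by simp
  qed
  finally show ?thesis unfolding Y_def[of f G g] by simp
qed

section \<open>Mutual rationality\<close>

text \<open>The linear functional on bivariate polynomials with value \<open>\<mu> i j\<close> on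
  monomials. The ranges are those of \<open>apply_bipoly\<close>, so the two unfold to the same sum;
  \<open>bsum_bound\<close> then replaces them by a rectangle, which linearity requires.\<close>

definition bsum :: "(nat \<Rightarrow> nat \<Rightarrow> 'v::complex_vector) \<Rightarrow> complex poly poly \<Rightarrow> 'v" where
  "bsum \<mu> P = (\<Sum>i\<le>degree P. \<Sum>j\<le>degree (coeff P i). coeff (coeff P i) j *\<^sub>C \<mu> i j)"

lemma bsum_bound:
  assumes "degree P \<le> N" "\<And>i. degree (coeff P i) \<le> K"
  shows "bsum \<mu> P = (\<Sum>i\<le>N. \<Sum>j\<le>K. coeff (coeff P i) j *\<^sub>C \<mu> i j)"
proof -
  have "(\<Sum>j\<le>degree (coeff P i). coeff (coeff P i) j *\<^sub>C \<mu> i j) = (\<Sum>j\<le>K. coeff (coeff P i) j *\<^sub>C \<mu> i j)" for i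
    by (rule sum.mono_neutral_left) (use assms(2)[of i] in \<open>auto simp: coeff_eq_0\<close>)
  note i = this
  show ?thesis
    unfolding bsum_def i by (rule sum.mono_neutral_left) (use assms(1) in \<open>auto simp: coeff_eq_0\<close>)
qed

lemma bsum_bound_exists: "\<exists>K. \<forall>i. degree (coeff P i) \<le> K" for P :: "complex poly poly"
proof -
  have "degree (coeff P i) \<le> Max ((\<lambda>i. degree (coeff P i)) ` {..degree P})" for i
  proof (cases "i \<le> degree P")
    case False
    then show ?thesis by (simp add: coeff_eq_0)
  qed (simp add: Max_ge)
  then show ?thesis by blast
qed

lemma bsum_add: "bsum \<mu> (P + Q) = bsum \<mu> P + bsum \<mu> Q"
proof -
  obtain K1 K2 where K: "\<And>i. degree (coeff P i) \<le> K1" "\<And>i. degree (coeff Q i) \<le> K2"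
    using bsum_bound_exists by metis
  let ?N = "max (degree P) (degree Q)" and ?K = "max K1 K2"
  have "degree (coeff (P + Q) i) \<le> ?K" for i
    using K[of i] degree_add_le_max[of "coeff P i" "coeff Q i"] by (simp add: le_max_iff_disj) linarith
  moreover have "degree (P + Q) \<le> ?N" by (rule degree_add_le_max)
  moreover have "degree (coeff P i) \<le> ?K" "degree (coeff Q i) \<le> ?K" for i using K[of i] by auto
  ultimately show ?thesis
    by (simp add: bsum_bound[of _ ?N ?K] sum.distrib scaleC_add_left)
qed

lemma bsum_smult_const: "bsum \<mu> (smult [:c:] P) = c *\<^sub>C bsum \<mu> P"
proof -
  obtain K where K: "\<And>i. degree (coeff P i) \<le> K" using bsum_bound_exists by metis
  have "degree (coeff (smult [:c:] P) i) \<le> K" for i using K[of i] by (simp add: order.trans[OF degree_smult_le])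
  then have "bsum \<mu> (smult [:c:] P) = (\<Sum>i\<le>degree P. \<Sum>j\<le>K. coeff (coeff (smult [:c:] P) i) j *\<^sub>C \<mu> i j)"
    by (intro bsum_bound degree_smult_le)
  then show ?thesis
    by (simp add: bsum_bound[of P "degree P" K, OF order.refl K] cvec.scale_sum_right scaleC_scaleC)
qed

lemma bsum_pCons: "bsum \<mu> (pCons 0 P) = bsum (\<lambda>i. \<mu> (Suc i)) P"
proof -
  obtain K where K: "\<And>i. degree (coeff P i) \<le> K" using bsum_bound_exists by metis
  have "degree (coeff (pCons 0 P) i) \<le> K" for i using K by (cases i) auto
  then have "bsum \<mu> (pCons 0 P) = (\<Sum>i\<le>Suc (degree P). \<Sum>j\<le>K. coeff (coeff (pCons 0 P) i) j *\<^sub>C \<mu> i j)"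
    by (intro bsum_bound degree_pCons_le)
  also have "\<dots> = (\<Sum>i\<le>degree P. \<Sum>j\<le>K. coeff (coeff P i) j *\<^sub>C \<mu> (Suc i) j)"
    by (subst sum.atMost_Suc_shift) simp
  finally show ?thesis by (simp add: bsum_bound[of P "degree P" K, OF order.refl K])
qed

lemma bsum_smult_x: "bsum \<mu> (smult [:0, 1:] P) = bsum (\<lambda>i j. \<mu> i (Suc j)) P"
proof -
  obtain K where K: "\<And>i. degree (coeff P i) \<le> K" using bsum_bound_exists by metis
  have c: "coeff (smult [:0, 1:] P) i = pCons 0 (coeff P i)" for i by simp
  have "degree (coeff (smult [:0, 1:] P) i) \<le> Suc K" for i
    unfolding c using K[of i] degree_pCons_le[of 0 "coeff P i"] by simp
  then have "bsum \<mu> (smult [:0, 1:] P) = (\<Sum>i\<le>degree P. \<Sum>j\<le>Suc K. coeff (coeff (smult [:0, 1:] P) i) j *\<^sub>C \<mu> i j)"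
    by (intro bsum_bound degree_smult_le)
  also have "\<dots> = (\<Sum>i\<le>degree P. \<Sum>j\<le>K. coeff (coeff P i) j *\<^sub>C \<mu> i (Suc j))"
    unfolding c by (rule sum.cong[OF refl], subst sum.atMost_Suc_shift) simp
  finally show ?thesis by (simp add: bsum_bound[of P "degree P" K, OF order.refl K])
qed

lemma apply_bipoly_bsum:
  "apply_bipoly P \<Phi> G G' = bsum (\<lambda>i j. \<Phi> (of_pol (monom 1 i) * G) (of_pol (monom 1 j) * G')) P"
  by (simp add: apply_bipoly_def bsum_def)

lemma bsum_fun_combine:
  "bsum (\<lambda>i j. \<mu> i j - \<nu> i j + c *\<^sub>C \<kappa> i j) P = bsum \<mu> P - bsum \<nu> P + c *\<^sub>C bsum \<kappa> P"
  by (simp add: bsum_def scaleC_add_right cvec.scale_right_diff_distrib sum.distrib sum_subtractf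
      cvec.scale_sum_right scaleC_scaleC mult.commute)

abbreviation tau :: ratK where "tau \<equiv> of_pol [:0, 1:]"

text \<open>\<open>Eop a\<close> and \<open>Emode a\<close> are the multiplication of a distribution by \<open>\<tau>\<^sub>1 - \<tau>\<^sub>2 + a\<close>, and
  \<open>local_order N \<psi>\<close> says that \<open>(z - w)^N\<close> annihilates \<open>\<psi>\<close>.\<close>

definition Eop :: "int \<Rightarrow> (ratK \<Rightarrow> ratK \<Rightarrow> 'v) \<Rightarrow> ratK \<Rightarrow> ratK \<Rightarrow> 'v::complex_vector" where
  "Eop a \<Phi> G G' = \<Phi> (tau * G) G' - \<Phi> G (tau * G') + of_int a *\<^sub>C \<Phi> G G'"

text \<open>\<open>at_difference\<close> is linear and turns multiplication by \<open>\<tau>\<close>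
  into multiplication by \<open>\<tau>_1 - \<tau>_2\<close>; the factor is then transferred to the
  two arguments of \<open>\<Phi>\<close>.\<close>

lemma apply_bipoly_lin:
  "apply_bipoly (at_difference ([:of_int a, 1:] * q)) \<Phi> G G' = apply_bipoly (at_difference q) (Eop a \<Phi>) G G'"
proof -
  have A: "at_difference (smult c q) = smult [:c:] (at_difference q)" for c q
    by (simp add: at_difference_def map_poly_smult pcompose_smult)
  have B: "at_difference (pCons 0 q) = pCons 0 (at_difference q) - smult [:0, 1:] (at_difference q)" for q
  proof -
    have "smult [:0, -1:] P = - smult [:0, 1:] P" for P :: "complex poly poly"
    proof -
      have "[:0, -1:] = - [:0, 1 :: complex:]" by simp
      then show ?thesis by (simp only: smult_minus_left)
    qed
    then show ?thesis by (simp add: at_difference_def map_poly_pCons pcompose_pCons)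
  qed
  have C: "at_difference (p + q) = at_difference p + at_difference q" for p q
  proof -
    have "map_poly (\<lambda>c. [:c:]) (p + q) = map_poly (\<lambda>c. [:c:]) p + map_poly (\<lambda>c. [:c:]) q"
      by (rule poly_eqI) (simp add: coeff_map_poly)
    then show ?thesis by (simp add: at_difference_def pcompose_add)
  qed
  have diff: "bsum \<mu> (P - Q) = bsum \<mu> P - bsum \<mu> Q" for \<mu> :: "nat \<Rightarrow> nat \<Rightarrow> 'a" and P Q
    using bsum_add[of \<mu> "P - Q" Q] by simp
  have m: "of_pol (monom 1 i) * (tau * G) = of_pol (monom 1 (Suc i)) * G" for i G
    by (simp add: monom_Suc flip: of_pol_hom mult.assoc)
  have "[:of_int a, 1:] * q = smult (of_int a) q + pCons 0 q" by simp
  then have d: "at_difference ([:of_int a, 1:] * q) = smult [:of_int a:] (at_difference q)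
      + (pCons 0 (at_difference q) - smult [:0, 1:] (at_difference q))"
    by (simp only: A B C)
  have m': "tau * (of_pol (monom 1 i) * G) = of_pol (monom 1 (Suc i)) * G" for i G
    using m[of i G] by (simp add: mult.left_commute)
  show ?thesis
    unfolding d apply_bipoly_bsum bsum_add diff bsum_smult_const bsum_pCons bsum_smult_x Eop_def m'
      bsum_fun_combine by simp
qed

definition lin_prod :: "int list \<Rightarrow> complex poly" where
  "lin_prod as = foldr (\<lambda>a q. [:of_int a, 1:] * q) as 1"

lemma lin_prod_M: "lin_prod as \<in> M"
  by (induction as) (auto simp: lin_prod_def intro: M.intros simp del: mult_pCons_left)

lemma apply_bipoly_lin_prod: "apply_bipoly (at_difference (lin_prod as)) \<Phi> G G' = fold Eop as \<Phi> G G'"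
proof (induction as arbitrary: \<Phi>)
  case Nil
  have "at_difference 1 = 1"
    by (simp add: at_difference_def one_pCons map_poly_pCons)
  moreover have "of_pol (monom 1 0) = 1" by (simp add: of_pol_hom flip: one_pCons)
  ultimately show ?case by (simp add: lin_prod_def apply_bipoly_def scaleC_one)
next
  case (Cons a as)
  have "lin_prod (a # as) = [:of_int a, 1:] * lin_prod as" by (simp add: lin_prod_def)
  then show ?case by (simp only: apply_bipoly_lin Cons fold_simps)
qed

section \<open>Powers of the difference of the variables acting on modes\<close>

definition Emode :: "int \<Rightarrow> (int \<Rightarrow> int \<Rightarrow> int \<Rightarrow> int \<Rightarrow> 'v) \<Rightarrow> int \<Rightarrow> int \<Rightarrow> int \<Rightarrow> int \<Rightarrow> 'v::complex_vector" where
  "Emode a \<phi> m l n k = of_int (n - m + a) *\<^sub>C \<phi> m l n k + \<phi> m l n (k + 1) - \<phi> m (l + 1) n k"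

text \<open>Truncation is imposed in one variable at a time: for a product of two fields the bound
  on the inner modes depends on the outer mode.\<close>

definition bimodal :: "(int \<Rightarrow> int \<Rightarrow> int \<Rightarrow> int \<Rightarrow> 'v) \<Rightarrow> (ratK \<Rightarrow> ratK \<Rightarrow> 'v::complex_vector) \<Rightarrow> bool" where
  "bimodal \<phi> \<Phi> \<longleftrightarrow> (\<forall>m l. trunc (\<phi> m l)) \<and> (\<forall>G. trunc (\<lambda>m l. Lsum (\<phi> m l) G)) \<and>
     (\<forall>G G'. \<Phi> G G' = Lsum (\<lambda>m l. Lsum (\<phi> m l) G) G')"

lemma mode_mult_tau: "mode_mult tau d n k = of_int n *\<^sub>C d n k + d n (k + 1)"
proof -
  have c: "cc tau n l = (if l = 0 then of_int n else if l = 1 then 1 else 0)" for l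
    by (simp add: cc_def laurent_of_pol poly_fls_lin)
  have "mode_mult tau d n k = (\<Sum>l\<in>{0, 1}. cc tau n l *\<^sub>C d n (k + l))"
    unfolding mode_mult_def by (rule Sum_any.expand_superset) (auto simp: c split: if_splits)
  then show ?thesis by (simp add: c scaleC_one)
qed

lemma bimodal_Eop:
  assumes "bimodal \<phi> \<Phi>"
  shows "bimodal (Emode a \<phi>) (Eop a \<Phi>)"
proof -
  have t1: "trunc (\<phi> m l)" and t2: "trunc (\<lambda>m l. Lsum (\<phi> m l) G)"
    and e: "\<Phi> G G' = Lsum (\<lambda>m l. Lsum (\<phi> m l) G) G'" for m l G G'
    using assms by (auto simp: bimodal_def)
  let ?\<psi> = "\<lambda>G m l. Lsum (\<phi> m l) G"
  have E: "Emode a \<phi> m l = (\<lambda>n k. mode_mult tau (\<phi> m l) n k - (of_int m *\<^sub>C \<phi> m l n k + \<phi> m (l + 1) n k) + of_int a *\<^sub>C \<phi> m l n k)" for m l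
    by (intro ext) (simp add: Emode_def mode_mult_tau scaleC_add_left cvec.scale_left_diff_distrib algebra_simps)
  have ts: "trunc (\<lambda>n k. c *\<^sub>C d n k)" if "trunc d" for c and d :: "int \<Rightarrow> int \<Rightarrow> 'a"
    by (rule trunc_comp[OF that]) simp
  note t3 = trunc_mode_mult[OF t1] and t4 = trunc_add[OF ts[OF t1] t1] and t5 = ts[OF t1]
  have tE: "trunc (Emode a \<phi> m l)" for m l
    unfolding E by (intro trunc_add trunc_diff t3 t4 t5)
  have LE: "Lsum (Emode a \<phi> m l) G = ?\<psi> (tau * G) m l - mode_mult tau (?\<psi> G) m l + of_int a *\<^sub>C ?\<psi> G m l" for m l G
    unfolding E mode_mult_tau[of "?\<psi> G"]
    by (simp only: Lsum_fun_add[OF trunc_diff[OF t3 t4] t5] Lsum_fun_diff[OF t3 t4] Lsum_fun_add[OF ts[OF t1] t1]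
        Lsum_fun_scaleC[OF t1] Lsum_mult[OF t1])
  have tL: "trunc (\<lambda>m l. ?\<psi> (tau * G) m l - mode_mult tau (?\<psi> G) m l + of_int a *\<^sub>C ?\<psi> G m l)" for G
    by (intro trunc_add trunc_diff t2 trunc_mode_mult ts)
  have "Eop a \<Phi> G G' = Lsum (\<lambda>m l. ?\<psi> (tau * G) m l - mode_mult tau (?\<psi> G) m l + of_int a *\<^sub>C ?\<psi> G m l) G'" for G G'
    by (simp only: Eop_def e Lsum_fun_add[OF trunc_diff[OF t2 trunc_mode_mult[OF t2]] ts[OF t2]]
        Lsum_fun_diff[OF t2 trunc_mode_mult[OF t2]] Lsum_fun_scaleC[OF t2] Lsum_mult[OF t2])
  then show ?thesis unfolding bimodal_def LE using tE tL by blast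
qed

lemma bimodal_fold: "bimodal \<phi> \<Phi> \<Longrightarrow> bimodal (fold Emode as \<phi>) (fold Eop as \<Phi>)"
  by (induction as arbitrary: \<phi> \<Phi>) (auto intro: bimodal_Eop)

fun local_order :: "nat \<Rightarrow> (int \<Rightarrow> int \<Rightarrow> 'v::complex_vector) \<Rightarrow> bool" where
  "local_order 0 \<psi> \<longleftrightarrow> (\<forall>l k. \<psi> l k = 0)"
| "local_order (Suc N) \<psi> \<longleftrightarrow> local_order N (\<lambda>l k. \<psi> l (k + 1) - \<psi> (l + 1) k)"

lemma local_order_combine: "local_order N \<psi> \<Longrightarrow> local_order N \<psi>' \<Longrightarrow> local_order N (\<lambda>l k. c *\<^sub>C \<psi> l k + \<psi>' l k)"
proof (induction N arbitrary: \<psi> \<psi>')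
  case (Suc N)
  then have "local_order N (\<lambda>l k. c *\<^sub>C (\<psi> l (k + 1) - \<psi> (l + 1) k) + (\<psi>' l (k + 1) - \<psi>' (l + 1) k))"
    by simp
  then show ?case by (simp add: cvec.scale_right_diff_distrib algebra_simps)
qed simp

lemma local_order_step: "local_order N \<psi> \<Longrightarrow> local_order N (\<lambda>l k. \<psi> l (k + 1) - \<psi> (l + 1) k)"
proof (induction N arbitrary: \<psi>)
  case (Suc N)
  then have "local_order N (\<lambda>l k. \<psi> l (k + 1) - \<psi> (l + 1) k)" by simp
  from Suc.IH[OF this] show ?case by (simp only: local_order.simps)
qed simp

text \<open>At the points \<open>n\<close> and \<open>m\<close> the factor with
  \<open>a = m - n\<close> acts as \<open>z - w\<close> and lowers a positive order by one; any
  other factor is a constant plus \<open>z - w\<close> and preserves the order. So \<open>N\<close>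
  factors of the first kind suffice.\<close>

lemma fold_Emode_vanish:
  assumes "local_order N (\<lambda>l k. \<phi> m l n k)" "count_list as (m - n) \<ge> N"
  shows "fold Emode as \<phi> m l n k = 0"
  using assms
proof (induction as arbitrary: \<phi> N)
  case Nil
  then show ?case by simp
next
  case (Cons a as)
  let ?\<psi> = "\<lambda>l k. \<phi> m l n k"
  have E: "(\<lambda>l k. Emode a \<phi> m l n k) = (\<lambda>l k. of_int (n - m + a) *\<^sub>C ?\<psi> l k + (?\<psi> l (k + 1) - ?\<psi> (l + 1) k))"
    by (simp add: Emode_def fun_eq_iff)
  show ?case
  proof (cases "a = m - n \<and> N > 0")
    case True
    then obtain N' where N': "N = Suc N'" by (cases N) auto
    have "local_order N' (\<lambda>l k. Emode a \<phi> m l n k)"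
      unfolding E using Cons.prems(1) True by (simp add: N')
    then show ?thesis using Cons.IH[of N' "Emode a \<phi>"] Cons.prems(2) True by (simp add: N')
  next
    case False
    have "local_order N (\<lambda>l k. Emode a \<phi> m l n k)"
      unfolding E by (intro local_order_combine local_order_step Cons.prems)
    then show ?thesis using Cons.IH[of N "Emode a \<phi>"] Cons.prems(2) False
      by (cases "a = m - n") auto
  qed
qed

text \<open>\<open>gb k j\<close> is a polynomial of degree \<open>j\<close> in \<open>k\<close>,
  and \<open>z - w\<close> acts as a difference operator, which lowers the degree by Pascal's
  rule.\<close>

lemma local_order_binomial:
  "local_order N (\<lambda>l k. \<Sum>j<N. gb k j *\<^sub>C Z j (k + l - int j))"
proof (induction N arbitrary: Z)
  case (Suc N)
  have "(\<Sum>j<Suc N. gb (k + 1) j *\<^sub>C Z j (k + 1 + l - int j)) - (\<Sum>j<Suc N. gb k j *\<^sub>C Z j (k + (l + 1) - int j))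
      = (\<Sum>j<N. gb k j *\<^sub>C Z (Suc j) (k + l - int j))" for k l
  proof -
    have "(\<Sum>j<Suc N. gb (k + 1) j *\<^sub>C Z j (k + 1 + l - int j)) - (\<Sum>j<Suc N. gb k j *\<^sub>C Z j (k + (l + 1) - int j))
       = (\<Sum>j<Suc N. (gb (k + 1) j - gb k j) *\<^sub>C Z j (k + 1 + l - int j))"
      by (simp only: sum_subtractf[symmetric] cvec.scale_left_diff_distrib add.assoc add.commute[of l 1])
    also have "\<dots> = (\<Sum>j<N. gb k j *\<^sub>C Z (Suc j) (k + l - int j))"
    proof -
      have "gb (k + 1) 0 - gb k 0 = 0" "gb (k + 1) (Suc i) - gb k (Suc i) = gb k i"
        "k + 1 + l - int (Suc i) = k + l - int i" for i
        by (simp_all only: gb_Pascal) simp_all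
      then show ?thesis
        by (subst sum.lessThan_Suc_shift) (simp only: cvec.scale_zero_left add_0_left)
    qed
    finally show ?thesis .
  qed
  then show ?case using Suc[of "\<lambda>j. Z (Suc j)"] by (simp only: local_order.simps)
qed simp

text \<open>Near the points \<open>n\<close> and \<open>m\<close> the commutator is governed by the
  products \<open>Y0 (T (n - m) f) (int j) g\<close>. By \<open>trunc_Y\<close> they vanish except
  for finitely many differences \<open>n - m\<close> and finitely many \<open>j\<close>, so one
  polynomial in \<open>\<tau>_1 - \<tau>_2\<close> serves all pairs of points and all
  vectors.\<close>

lemma Y_mutually_rational: "mutually_rational (Y f) (Y g)"
proof -
  let ?S = "{(s, j). 0 \<le> j \<and> Y0 (T s f) j g \<noteq> 0}"
  have fin: "finite ?S" using trunc_Y[of f g] by (simp add: trunc_def)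
  define N where "N = nat (Max (insert 0 (snd ` ?S)) + 1)"
  have N: "Y0 (T s f) (int j) g = 0" if "j \<ge> N" for s j
  proof (rule ccontr)
    assume "Y0 (T s f) (int j) g \<noteq> 0"
    then have "(s, int j) \<in> ?S" by simp
    then have "int j \<le> Max (insert 0 (snd ` ?S))" using fin by (intro Max_ge) (auto simp: image_iff)
    moreover have "0 \<le> Max (insert 0 (snd ` ?S))" using fin by (intro Max_ge) auto
    ultimately show False using that unfolding N_def by linarith
  qed
  obtain ss where ss: "set ss = fst ` ?S" using finite_list[OF finite_imageI[OF fin, of fst]] by blast
  \<comment> \<open>Each difference \<open>s\<close> that occurs contributes the factor
    \<open>(\<tau> - s)^N\<close>.\<close>
  define as where "as = concat (map (\<lambda>s. replicate N (- s)) ss)"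
  have count: "count_list as (- s) \<ge> N" if "s \<in> set ss" for s
  proof -
    have "count_list (replicate N x) x = N" for x :: int by (induction N) auto
    then show ?thesis using that unfolding as_def by (induction ss) auto
  qed
  show ?thesis
    unfolding mutually_rational_def
  proof (intro bexI[of _ "lin_prod as"] allI)
    fix G G' v
    define \<phi> where "\<phi> m l n k = Y0 (T n f) k (Y0 (T m g) l v) - Y0 (T m g) l (Y0 (T n f) k v)" for m l n k
    have t1: "trunc (\<lambda>n k. Y0 (T m g) l (Y0 (T n f) k v))" for m l
      by (rule trunc_comp[OF trunc_Y]) (simp add: Y0_lin)
    have t2: "trunc (\<lambda>m l. Y f G (Y0 (T m g) l v))" for G
      by (rule trunc_comp[OF trunc_Y]) (simp add: Y_lin)
    have L: "Lsum (\<phi> m l) G = Y f G (Y0 (T m g) l v) - Y0 (T m g) l (Y f G v)" for m l G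
      unfolding Y_def \<phi>_def[abs_def] Lsum_comp[OF clinear_Y0 trunc_Y] by (rule Lsum_fun_diff[OF trunc_Y t1])
    have bi: "bimodal \<phi> (\<lambda>G G'. Y f G (Y g G' v) - Y g G' (Y f G v))"
      unfolding bimodal_def
    proof (intro conjI allI)
      show "trunc (\<phi> m l)" for m l unfolding \<phi>_def[abs_def] by (rule trunc_diff[OF trunc_Y t1])
      show "trunc (\<lambda>m l. Lsum (\<phi> m l) G)" for G unfolding L by (rule trunc_diff[OF t2 trunc_Y])
      show "Y f G (Y g G' v) - Y g G' (Y f G v) = Lsum (\<lambda>m l. Lsum (\<phi> m l) G) G'" for G G'
      proof -
        have "Y f G (Y g G' v) = Lsum (\<lambda>m l. Y f G (Y0 (T m g) l v)) G'"
          unfolding Y_def[of g] by (rule Lsum_comp[OF clinear_Y_op trunc_Y])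
        moreover have "Y g G' (Y f G v) = Lsum (\<lambda>m l. Y0 (T m g) l (Y f G v)) G'"
          by (simp add: Y_def[of g])
        ultimately show ?thesis by (simp only: L Lsum_fun_diff[OF t2 trunc_Y])
      qed
    qed
    have zero: "fold Emode as \<phi> m l n k = 0" for m l n k
    proof -
      have \<phi>: "\<phi> m l n k = ssum (\<lambda>j. gb k j *\<^sub>C Y0 (T m (Y0 (T (n - m) f) (int j) g)) (k + l - int j) v)" for l k
        unfolding \<phi>_def commutator by (simp add: T_Y0 T_T)
      show ?thesis
      proof (cases "n - m \<in> set ss")
        case True
        have "(\<lambda>l k. \<phi> m l n k) = (\<lambda>l k. \<Sum>j<N. gb k j *\<^sub>C Y0 (T m (Y0 (T (n - m) f) (int j) g)) (k + l - int j) v)"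
          unfolding \<phi> by (intro ext ssum_lt) (simp add: N T_lin Y0_state_lin)
        then have "local_order N (\<lambda>l k. \<phi> m l n k)"
          using local_order_binomial[of N "\<lambda>j p. Y0 (T m (Y0 (T (n - m) f) (int j) g)) p v"] by simp
        then show ?thesis using count[OF True] by (intro fold_Emode_vanish) auto
      next
        case False
        have "Y0 (T (n - m) f) (int j) g = 0" for j
        proof (rule ccontr)
          assume "Y0 (T (n - m) f) (int j) g \<noteq> 0"
          then have "n - m \<in> fst ` ?S" by (intro image_eqI[of _ _ "(n - m, int j)"]) auto
          then show False using False ss by simp
        qed
        then have "local_order 0 (\<lambda>l k. \<phi> m l n k)" by (simp add: \<phi> T_lin Y0_state_lin)
        then show ?thesis by (rule fold_Emode_vanish) simp
      qed
    qed
    have "fold Eop as (\<lambda>G G'. Y f G (Y g G' v) - Y g G' (Y f G v)) G G'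
        = Lsum (\<lambda>m l. Lsum (fold Emode as \<phi> m l) G) G'"
      using bimodal_fold[OF bi, of as] unfolding bimodal_def by blast
    also have "\<dots> = 0" by (simp add: zero[abs_def] Lsum_def)
    finally show "apply_bipoly (at_difference (lin_prod as)) (\<lambda>G G'. Y f G (Y g G' v) - Y g G' (Y f G v)) G G' = 0"
      by (simp only: apply_bipoly_lin_prod)
  qed (rule lin_prod_M)
qed

lemma Y_generator: "Y (vact (cur b inv_tau) v0) F = vact (cur b F)"
proof
  fix g
  have "vact (cur b inv_tau) v0 = X (b, 0) (-1) v0"
    using Lsum_inv_lin[OF trunc_X, of b v0 0 0] by (simp add: vact_cur X_vac)
  then have "T n (vact (cur b inv_tau) v0) = X (b, n) (-1) v0" for n
    by (simp add: T_X sh_def)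
  then show "Y (vact (cur b inv_tau) v0) F g = vact (cur b F) g"
    by (simp add: Y_def Y0_generator vact_cur)
qed

theorem mainTheorem4:
  shows "\<exists>Y. HT_vertex_algebra v0 Y \<and>
    (\<forall>F. Y (vact (cur_B inv_tau) v0) F = vact (cur_B F)) \<and>
    (\<forall>F. Y (vact (cur_C inv_tau) v0) F = vact (cur_C F))"
proof (intro exI[of _ Y] conjI allI)
  show "HT_vertex_algebra v0 Y"
  proof (rule HT_vertex_algebra.intro)
    show "Y f inv_tau v0 = f" for f
      using Y_inv_lin_v0[of f 0 0] by simp
  qed (assumption | rule Y_is_field clinear_Y_state Y_vacuum Y_v0_Kpol Y_covariance Y_skew Y_mutually_rational)+
  show "Y (vact (cur_B inv_tau) v0) F = vact (cur_B F)" for F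
    using Y_generator[of True F] by (simp add: cur_def)
  show "Y (vact (cur_C inv_tau) v0) F = vact (cur_C F)" for F
    using Y_generator[of False F] by (simp add: cur_def)
qed

end
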